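(* Let $n\ge 1$. As formal power series in $\mathbf p=(p_1,p_2,\dots)$, the integral $I_{\mathbb{S}p(2n)}(\mathbf p)=\int_{S\in \mathbb{S}p(2n)}e^{\sum_{m\ge1}\frac1m p_m\,\mathrm{tr}\,S^m}\,d_*S$ satisfies $$I_{\mathbb{S}p(2n)}(\mathbf p)=\sum_{\lambda:\ \ell(\lambda)\le n}s_{\lambda\cup\lambda}(\mathbf p)=2^{-n}\sum_{\lambda:\ \ell(\lambda)\le n}\bigl(o_\lambda(\mathbf p)\bigr)^2=2^{-n}\sum_{\lambda:\ \lambda_1\le n}\bigl(sp_\lambda(-\mathbf p)\bigr)^2,$$ where all sums run over partitions $\lambda$ with the indicated restriction.
   Context: Sums over partitions include the empty partition; $\ell(\lambda)$ is the number of nonzero parts; $\lambda\cup\lambda=(\lambda_1,\lambda_1,\lambda_2,\lambda_2,\dots)$. Write $-\mathbf p=(-p_1,-p_2,\dots)$. Schur functions in power-sum variables: $e^{\sum_{m>0}\frac1m p_mz^m}=\sum_{i\ge0}s_{(i)}(\mathbf p)z^i$, $s_{(i)}=0$ for $i<0$, and $s_\lambda(\mathbf p)=\det[s_{(\lambda_i-i+j)}(\mathbf p)]_{i,j}$. Universal orthogonal and symplectic characters: with $\partial_m=\partial/\partial p_m$, $$o_\lambda(\mathbf p)=e^{\Omega_-}\cdot s_\lambda(\mathbf p),\qquad sp_\lambda(\mathbf p)=e^{\Omega_+}\cdot s_\lambda(\mathbf p),\qquad \Omega_\mp=\sum_{m>0}\Bigl(-\frac m2\partial_m^2\mp\partial_{2m}\Bigr)$$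 (upper sign for $\Omega_-$, lower sign for $\Omega_+$). $\mathbb{S}p(2n)$ is the compact symplectic group of $2n\times2n$ matrices with normalized Haar measure $d_*S$. In terms of the eigenvalues $e^{\pm i\theta_1},\dots,e^{\pm i\theta_n}$ of $S$, $$I_{\mathbb{S}p(2n)}(\mathbf p)=\frac{2^{n^2}}{\pi^n}\int_{0\le\theta_1\le\cdots\le\theta_n\le\pi}\prod_{i<j}(\cos\theta_i-\cos\theta_j)^2\prod_{i=1}^n e^{2\sum_{m\ge1}\frac1m p_m\cos m\theta_i}\sin^2\theta_i\,d\theta_i .$$ The integral is understood as a formal power series in $\mathbf p$ by expanding the exponential under the integral sign; the infinite sums are understood coefficientwise. *)

theory Defs
  imports
    "HOL-Analysis.Analysis"
    "HOL-Computational_Algebra.Formal_Power_Series"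
    "HOL-Library.Poly_Mapping"
    "Jordan_Normal_Form.Determinant"
begin

text \<open>
  A monomial is an exponent vector of type \<open>nat \<Rightarrow>\<^sub>0 nat\<close>, whose entry at \<open>m\<close> is the exponent
  of \<open>p\<^sub>m\<close>. Polynomials are finitely supported coefficient functions on monomials, with the
  convolution product of \<^theory>\<open>HOL-Library.Poly_Mapping\<close>; formal power series are arbitrary
  coefficient functions. The variables are \<open>p\<^sub>m\<close> for \<open>m \<ge> 1\<close>; the index \<open>0\<close> is never used, and
  all coefficients at monomials containing it are zero on both sides of the identities.
\<close>

type_synonym monomial = "nat \<Rightarrow>\<^sub>0 nat"
type_synonym ppoly = "monomial \<Rightarrow>\<^sub>0 complex"
type_synonym pseries = "monomial \<Rightarrow> complex"

definition pconst :: "complex \<Rightarrow> ppoly" where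
  "pconst c = Poly_Mapping.single 0 c"

definition pvar :: "nat \<Rightarrow> ppoly" where
  "pvar m = Poly_Mapping.single (Poly_Mapping.single m 1) 1"

text \<open>The truncated subtraction of exponents is harmless: if \<open>p\<^sub>m\<close> does not occur in the monomial
  \<open>\<alpha>\<close>, then the coefficient vanishes.\<close>

definition pderiv_var :: "nat \<Rightarrow> ppoly \<Rightarrow> ppoly" where
  "pderiv_var m f = (\<Sum>\<alpha>\<in>Poly_Mapping.keys f.
     Poly_Mapping.single (\<alpha> - Poly_Mapping.single m 1)
       (of_nat (Poly_Mapping.lookup \<alpha> m) * Poly_Mapping.lookup f \<alpha>))"

definition psubst :: "(nat \<Rightarrow> ppoly) \<Rightarrow> ppoly \<Rightarrow> ppoly" where
  "psubst \<sigma> f = (\<Sum>\<alpha>\<in>Poly_Mapping.keys f.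
     pconst (Poly_Mapping.lookup f \<alpha>) *
       (\<Prod>m\<in>Poly_Mapping.keys \<alpha>. \<sigma> m ^ Poly_Mapping.lookup \<alpha> m))"

definition int_partition :: "nat list \<Rightarrow> bool" where
  "int_partition l \<longleftrightarrow> sorted_wrt (\<ge>) l \<and> 0 \<notin> set l"

definition first_part :: "nat list \<Rightarrow> nat" where
  "first_part l = (case l of [] \<Rightarrow> 0 | x # _ \<Rightarrow> x)"

definition double_parts :: "nat list \<Rightarrow> nat list" where
  "double_parts l = concat (map (\<lambda>x. [x, x]) l)"

text \<open>The exponential of a series \<open>A\<close> in \<open>z\<close> without constant term. The coefficient of \<open>z\<^sup>i\<close> in
  \<open>A\<^sup>k\<close> vanishes for \<open>k > i\<close>, so only the terms with \<open>k \<le> i\<close> of the exponential series contribute.\<close>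

definition exp_zseries :: "ppoly fps \<Rightarrow> ppoly fps" where
  "exp_zseries A = Abs_fps (\<lambda>i. \<Sum>k\<le>i. pconst (1 / fact k) * fps_nth (A ^ k) i)"

definition power_sum_zseries :: "ppoly fps" where
  "power_sum_zseries = Abs_fps (\<lambda>m. if m = 0 then 0 else pconst (1 / of_nat m) * pvar m)"

definition schur_row :: "int \<Rightarrow> ppoly" where
  "schur_row i = (if i < 0 then 0 else fps_nth (exp_zseries power_sum_zseries) (nat i))"

definition schur :: "nat list \<Rightarrow> ppoly" where
  "schur l = Determinant.det (Matrix.mat (length l) (length l)
     (\<lambda>(i, j). schur_row (int (l ! i) - int i + int j)))"

text \<open>\<open>Omega c\<close> is the sum over \<open>m > 0\<close> of \<open>- m/2 \<partial>\<^sub>m\<^sup>2 + c \<partial>\<^sub>2\<^sub>m\<close>, hence \<open>\<Omega>\<^sub>-\<close> for \<open>c = -1\<close> and \<open>\<Omega>\<^sub>+\<close>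
  for \<open>c = 1\<close>. A polynomial involves finitely many variables, and \<open>Omega c\<close> acts locally
  nilpotently, so both uses of \<^const>\<open>Sum_any\<close> are finite sums.\<close>

definition Omega :: "complex \<Rightarrow> ppoly \<Rightarrow> ppoly" where
  "Omega c f = Sum_any (\<lambda>m. if m = 0 then 0
     else pconst (- of_nat m / 2) * pderiv_var m (pderiv_var m f)
          + pconst c * pderiv_var (2 * m) f)"

definition exp_Omega :: "complex \<Rightarrow> ppoly \<Rightarrow> ppoly" where
  "exp_Omega c f = Sum_any (\<lambda>k. pconst (1 / fact k) * (Omega c ^^ k) f)"

definition orth_char :: "nat list \<Rightarrow> ppoly" where
  "orth_char l = exp_Omega (-1) (schur l)"

definition symp_char :: "nat list \<Rightarrow> ppoly" where
  "symp_char l = exp_Omega 1 (schur l)"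

definition coeff_summable :: "('a \<Rightarrow> ppoly) \<Rightarrow> 'a set \<Rightarrow> bool" where
  "coeff_summable f A \<longleftrightarrow> (\<forall>\<alpha>. finite {x \<in> A. Poly_Mapping.lookup (f x) \<alpha> \<noteq> 0})"

definition coeff_sum :: "('a \<Rightarrow> ppoly) \<Rightarrow> 'a set \<Rightarrow> pseries" where
  "coeff_sum f A = (\<lambda>\<alpha>. \<Sum>x\<in>{x \<in> A. Poly_Mapping.lookup (f x) \<alpha> \<noteq> 0}. Poly_Mapping.lookup (f x) \<alpha>)"

definition symp_form :: "complex^('n::finite + 'n)^('n + 'n)" where
  "symp_form = (\<chi> i j. case (i, j) of
       (Inl a, Inr b) \<Rightarrow> if a = b then 1 else 0
     | (Inr a, Inl b) \<Rightarrow> if a = b then -1 else 0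
     | _ \<Rightarrow> 0)"

definition compact_Sp :: "(complex^('n::finite + 'n)^('n + 'n)) set" where
  "compact_Sp = {S. map_matrix cnj (Finite_Cartesian_Product.transpose S) ** S = Finite_Cartesian_Product.mat 1
     \<and> Finite_Cartesian_Product.transpose S ** symp_form ** S = symp_form}"

text \<open>The group is compact, so left invariance together with total mass 1 determines the
  (bi-invariant) Haar measure.\<close>

definition normalized_haar_Sp :: "(complex^('n::finite + 'n)^('n + 'n)) measure \<Rightarrow> bool" where
  "normalized_haar_Sp M \<longleftrightarrow>
     sets M = sets (restrict_space borel compact_Sp) \<and>
     emeasure M (space M) = 1 \<and>
     (\<forall>U\<in>compact_Sp. distr M M (\<lambda>S. U ** S) = M)"

definition matrix_power :: "'a::semiring_1^'k::finite^'k \<Rightarrow> nat \<Rightarrow> 'a^'k^'k" where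
  "matrix_power A m = (((**) A) ^^ m) (Finite_Cartesian_Product.mat 1)"

text \<open>\<open>exp_linear a\<close> is the power series \<open>exp (\<Sum>\<^sub>m a\<^sub>m p\<^sub>m) = \<Prod>\<^sub>m \<Sum>\<^sub>k (a\<^sub>m p\<^sub>m)\<^sup>k / k!\<close>.\<close>

definition exp_linear :: "(nat \<Rightarrow> complex) \<Rightarrow> pseries" where
  "exp_linear a = (\<lambda>\<alpha>. \<Prod>m\<in>Poly_Mapping.keys \<alpha>.
     a m ^ Poly_Mapping.lookup \<alpha> m / fact (Poly_Mapping.lookup \<alpha> m))"

definition I_Sp :: "(complex^('n::finite + 'n)^('n + 'n)) measure \<Rightarrow> pseries" where
  "I_Sp M = (\<lambda>\<alpha>. \<integral>S. exp_linear
     (\<lambda>m. if m = 0 then 0 else Determinants.trace (matrix_power S m) / of_nat m) \<alpha> \<partial>M)"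

end

theory Submission
  imports Defs "Jordan_Normal_Form.Schur_Decomposition"
begin

text \<open>
  Coefficient by coefficient, all sides are matched with the \<open>n \<times> n\<close> determinant of
  \<open>g (i - j) - g (i + j + 2)\<close>, where \<open>g d = \<Sum>\<^sub>l h\<^sub>l h\<^sub>l\<^sub>+\<^sub>d\<close> and the \<open>h\<^sub>l\<close> are the one-row Schur functions.

  For the sums over partitions, the Jacobi--Trudi determinant is written as the image of a
  Laurent polynomial under \<open>z\<^sup>e \<mapsto> \<Prod>\<^sub>i h (k\<^sub>i - e\<^sub>i)\<close>. Then \<open>\<partial>\<^sub>m\<close> is multiplication by a power sum in \<open>z\<close>,
  and the exponential of \<open>\<Omega>\<^sub>-\<close> is multiplication by \<open>\<Prod>\<^sub>i\<^sub>\<le>\<^sub>j (1 - z\<^sub>i z\<^sub>j)\<close>, so \<open>o\<^sub>\<lambda>\<close> is again a determinant and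
  Cauchy--Binet sums the squares. The doubled partitions are summed by a pfaffian minor
  summation. The substitution \<open>p \<mapsto> - p\<close> conjugates partitions and exchanges \<open>\<Omega>\<^sub>+\<close> and \<open>\<Omega>\<^sub>-\<close>, which
  reduces the symplectic sum to the orthogonal one.

  The integral is evaluated without the Weyl integration formula. Left invariance yields the
  Schwinger--Dyson equations for integrals of polynomials \<open>f\<close> in the traces, hence the integral
  kills the image of an operator \<open>C\<close> such that \<open>(C f) \<Delta>\<close> is the Laplacian minus \<open>\<bar>\<rho>\<bar>\<^sup>2\<close> applied to \<open>f \<Delta>\<close>,
  where \<open>f\<close> is expressed in the eigenvalues \<open>z\<close> and \<open>\<Delta>\<close> is the Weyl denominator. Applying
  \<open>1 - C / v\<close> for each nonzero eigenvalue \<open>v\<close> that occurs turns \<open>f\<close> into a constant, namely the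
  coefficient of \<open>z\<^sup>\<rho>\<close> in the alternating Laurent polynomial \<open>f \<Delta>\<close>.
\<close>

subsection \<open>Determinants\<close>

text \<open>With \<open>H(z) = \<Sum>_l h_l z^l\<close> and eigenvalues \<open>z_i, 1/z_i\<close>,
  the integrand is \<open>\<Prod>_i H(z_i) H(1/z_i)\<close>, and \<open>g d\<close> is the
  coefficient of \<open>z^d\<close> in \<open>H(z) H(1/z)\<close>. The common determinant is
  therefore the coefficient of \<open>z^\<rho>\<close>, \<open>\<rho> = (1, ..., n)\<close>, in the
  integrand times \<Delta>. The factor \<open>2^n\<close> appears because two columns of differences
  \<open>h_(a+j) - h_(a-j)\<close> correlate to twice an entry of that determinant. The measure is
  given only by its invariance, so no coordinates are available for integration. What replaces them
  is a minimality property: up to signs and order, \<rho> is the only exponent of norm at most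
  \<open>|\<rho>|\<close> whose alternating sum is nonzero. Once the other norms are removed,
  \<open>f \<Delta> = c \<Delta>\<close>, so \<open>f\<close> is the constant \<open>c\<close>, and
  its integral is \<open>c\<close>. Each \<open>g d\<close> is an infinite series, whereas Schur
  functions are polynomials. Hence every identity is proved for one monomial at a time, modulo
  polynomials of larger weight and with truncated \<open>h_l\<close>; the explicit cutoffs in the
  proof make the finite sums complete at that weight.\<close>

definition dt :: "nat \<Rightarrow> (nat \<Rightarrow> nat \<Rightarrow> 'a::comm_ring_1) \<Rightarrow> 'a" where
  "dt n a = Determinant.det (Matrix.mat n n (\<lambda>(i, j). a i j))"

lemma dt_leibniz:
  "dt n a = (\<Sum>p | p permutes {0..<n}. signof p * (\<Prod>i = 0..<n. a i (p i)))"
proof -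
  have "(\<Prod>i = 0..<n. Matrix.mat n n (\<lambda>(i, j). a i j) $$ (i, p i)) = (\<Prod>i = 0..<n. a i (p i))"
    if "p permutes {0..<n}" for p
    using permutes_in_image[OF that] by (intro prod.cong) auto
  then show ?thesis
    unfolding dt_def by (subst det_def'[of _ n]) (auto intro!: sum.cong)
qed

lemma dt_cong:
  assumes "\<And>i j. i < n \<Longrightarrow> j < n \<Longrightarrow> a i j = b i j"
  shows "dt n a = dt n b"
  unfolding dt_def by (intro arg_cong[of _ _ Determinant.det] eq_matI) (auto simp: assms)

lemma dt_transpose: "dt n (\<lambda>i j. a j i) = dt n a"
proof -
  have "Matrix.mat n n (\<lambda>(i, j). a j i) = transpose_mat (Matrix.mat n n (\<lambda>(i, j). a i j))"
    by (intro eq_matI) auto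
  then show ?thesis unfolding dt_def by (metis det_transpose mat_carrier)
qed

lemma signof_square: "signof p * signof p = (1::'a::comm_ring_1)"
  by (simp add: sign_def)

lemma signof_cases: "signof p = (1::'a::comm_ring_1) \<or> signof p = (-1::'a)"
  by (simp add: sign_def)

lemma dt_permute_rows:
  assumes "p permutes {0..<n}"
  shows "dt n (\<lambda>i j. a (p i) j) = signof p * dt n a"
proof -
  have "Matrix.mat n n (\<lambda>(i, j). a (p i) j)
      = Matrix.mat n n (\<lambda>(i, j). Matrix.mat n n (\<lambda>(i, j). a i j) $$ (p i, j))"
    using permutes_in_image[OF assms] by (intro eq_matI) auto
  then show ?thesis unfolding dt_def using det_permute_rows[OF mat_carrier assms] by simp
qed

lemma dt_mult: "dt n (\<lambda>i j. \<Sum>k<n. a i k * b k j) = dt n a * dt n b"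
proof -
  have "Matrix.mat n n (\<lambda>(i, j). \<Sum>k<n. a i k * b k j)
      = Matrix.mat n n (\<lambda>(i, j). a i j) * Matrix.mat n n (\<lambda>(i, j). b i j)"
    by (intro eq_matI) (auto simp: scalar_prod_def lessThan_atLeast0)
  then show ?thesis unfolding dt_def by (simp add: det_mult[of _ n])
qed

lemma dt_scale_rows: "dt n (\<lambda>i j. c i * a i j) = (\<Prod>i<n. c i) * dt n a"
  unfolding dt_leibniz by (simp add: prod.distrib sum_distrib_left lessThan_atLeast0 mult_ac)

lemma dt_scale_cols: "dt n (\<lambda>i j. c j * a i j) = (\<Prod>i<n. c i) * dt n a"
  using dt_scale_rows[of n c "\<lambda>i j. a j i"] dt_transpose[of n "\<lambda>i j. c j * a i j"] dt_transpose[of n a]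
  by simp

lemma dt_equal_rows:
  assumes "i < n" "k < n" "i \<noteq> k" "\<And>j. j < n \<Longrightarrow> a i j = a k j"
  shows "dt n a = 0"
  unfolding dt_def using assms
  by (intro det_identical_rows[of _ n i k]) (auto intro!: eq_vecI)

lemma dt_lower_triangular:
  assumes "\<And>i j. i < j \<Longrightarrow> j < n \<Longrightarrow> a i j = 0"
  shows "dt n a = (\<Prod>i<n. a i i)"
  unfolding dt_def
  by (subst det_lower_triangular[of n]) (auto simp: assms diag_mat_def interv_sum_list_conv_sum_set_nat
    prod.distinct_set_conv_list[symmetric] lessThan_atLeast0)

lemma dt_upper_triangular:
  assumes "\<And>i j. j < i \<Longrightarrow> i < n \<Longrightarrow> a i j = 0"
  shows "dt n a = (\<Prod>i<n. a i i)"
  using dt_lower_triangular[of n "\<lambda>i j. a j i"] dt_transpose[of n a] assms by simp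

lemma dt_neg_rows: "dt n (\<lambda>i j. - a i j) = (-1) ^ n * dt n a"
  using dt_scale_rows[of n "\<lambda>_. -1" a] by simp

text \<open>Laplace expansion along the last row. A zero part appended to a partition adds such a
  row to its Jacobi-Trudi matrix, which makes the size of the matrix adjustable.\<close>

lemma dt_Suc_last_row:
  assumes "\<And>j. j < n \<Longrightarrow> a n j = 0" "a n n = 1"
  shows "dt (Suc n) a = dt n a"
proof -
  let ?A = "Matrix.mat (Suc n) (Suc n) (\<lambda>(i, j). a i j)"
  have "dt (Suc n) a = (\<Sum>j<Suc n. ?A $$ (n, j) * cofactor ?A n j)"
    unfolding dt_def by (rule laplace_expansion_row[of _ "Suc n"]) auto
  also have "\<dots> = cofactor ?A n n" using assms by simp
  also have "mat_delete ?A n n = Matrix.mat n n (\<lambda>(i, j). a i j)"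
    unfolding mat_delete_def by (intro eq_matI) auto
  then have "cofactor ?A n n = dt n a"
    unfolding cofactor_def dt_def by simp
  finally show ?thesis .
qed

text \<open>The discrete Andreief identity, that is, Cauchy-Binet summed over tuples instead of
  subsets. For each pair of permutations the sum over \<open>k\<close> factorizes; the permutation
  \<open>p\<close> of the rows then costs a second \<open>signof p\<close>, which cancels the
  first.\<close>

lemma sum_PiE_dt_dt:
  assumes "finite K"
  shows "(\<Sum>k\<in>PiE {0..<n} (\<lambda>_. K). dt n (\<lambda>i j. a (k i) j) * dt n (\<lambda>i j. b (k i) j))
       = of_nat (fact n) * dt n (\<lambda>i j. \<Sum>k\<in>K. a k i * b k j)"
proof -
  let ?C = "\<lambda>i j. \<Sum>k\<in>K. a k i * b k j"
  let ?P = "{p. p permutes {0..<n}}"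
  have "(\<Sum>k\<in>PiE {0..<n} (\<lambda>_. K). dt n (\<lambda>i j. a (k i) j) * dt n (\<lambda>i j. b (k i) j))
      = (\<Sum>k\<in>PiE {0..<n} (\<lambda>_. K). \<Sum>p\<in>?P. \<Sum>q\<in>?P. signof p * signof q *
            (\<Prod>i = 0..<n. a (k i) (p i) * b (k i) (q i)))"
    unfolding dt_leibniz sum_product by (simp add: prod.distrib mult_ac)
  also have "\<dots> = (\<Sum>p\<in>?P. \<Sum>k\<in>PiE {0..<n} (\<lambda>_. K). \<Sum>q\<in>?P. signof p * signof q *
            (\<Prod>i = 0..<n. a (k i) (p i) * b (k i) (q i)))"
    by (rule sum.swap)
  also have "\<dots> = (\<Sum>p\<in>?P. \<Sum>q\<in>?P. \<Sum>k\<in>PiE {0..<n} (\<lambda>_. K). signof p * signof q *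
            (\<Prod>i = 0..<n. a (k i) (p i) * b (k i) (q i)))"
    by (intro sum.cong refl sum.swap)
  also have "\<dots> = (\<Sum>p\<in>?P. \<Sum>q\<in>?P. signof p * signof q * (\<Prod>i = 0..<n. ?C (p i) (q i)))"
    using assms by (simp add: sum_distrib_left[symmetric] prod_sum_PiE)
  also have "\<dots> = (\<Sum>p\<in>?P. signof p * dt n (\<lambda>i j. ?C (p i) j))"
    unfolding dt_leibniz by (simp add: sum_distrib_left mult_ac)
  also have "\<dots> = (\<Sum>p\<in>?P. dt n ?C)"
    by (intro sum.cong refl) (simp add: dt_permute_rows[of _ n ?C] mult.assoc[symmetric] signof_square)
  also have "\<dots> = of_nat (fact n) * dt n ?C"
    by (simp add: card_permutations)
  finally show ?thesis .
qed

text \<open>Decreasing, to agree with the order of the parts of a partition. The restriction to the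
  index set makes it an element of the extensional function space \<open>PiE\<close> over which
  tuples are summed.\<close>

definition desc :: "nat set \<Rightarrow> nat \<Rightarrow> nat" where
  "desc A = (\<lambda>i\<in>{0..<card A}. rev (sorted_list_of_set A) ! i)"

lemma desc_bij_betw:
  assumes "finite A"
  shows "bij_betw (desc A) {0..<card A} A"
proof -
  have "bij_betw ((!) (rev (sorted_list_of_set A))) {..<length (rev (sorted_list_of_set A))}
          (set (rev (sorted_list_of_set A)))"
    by (rule bij_betw_nth) simp_all
  then have "bij_betw ((!) (rev (sorted_list_of_set A))) {0..<card A} A"
    using assms by (simp add: lessThan_atLeast0)
  then show ?thesis
    by (rule bij_betw_cong[THEN iffD1, rotated]) (simp add: desc_def)
qed

lemma desc_mono:
  assumes "finite A" "i < j" "j < card A"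
  shows "desc A j < desc A i"
proof -
  have "sorted_wrt (>) (rev (sorted_list_of_set A))"
    unfolding sorted_wrt_rev by (simp add: strict_sorted_list_of_set)
  then show ?thesis using assms sorted_wrt_nth_less[of "(>)" "rev (sorted_list_of_set A)" i j]
    by (simp add: desc_def)
qed

lemma desc_unique:
  fixes k :: "nat \<Rightarrow> nat"
  assumes dec: "\<And>i j. i < j \<Longrightarrow> j < n \<Longrightarrow> k j < k i" and "i < n"
  shows "desc (k ` {0..<n}) i = k i"
proof -
  let ?xs = "map k (rev [0..<n])"
  have inj: "inj_on k {0..<n}"
    by (rule inj_onI) (metis atLeastLessThan_iff dec linorder_neqE_nat order_less_irrefl)
  have "sorted_wrt (<) ?xs"
    unfolding rev_map[symmetric] sorted_wrt_rev sorted_wrt_map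
    by (rule sorted_wrt_mono_rel[of _ "(<)"]) (auto simp: dec)
  then have "sorted_list_of_set (set ?xs) = ?xs"
    by (metis sorted_list_of_set.idem_if_sorted_distinct strict_sorted_iff)
  then have "rev (sorted_list_of_set (k ` {0..<n})) = map k [0..<n]"
    by (simp add: rev_map)
  moreover have "card (k ` {0..<n}) = n" using inj by (simp add: card_image)
  ultimately show ?thesis using assms(2) by (simp add: desc_def)
qed

text \<open>The injective tuples with image \<open>A\<close> are the \<open>desc A \<circ> p\<close>
  for the \<open>fact n\<close> permutations \<open>p\<close>, each obtained once; all other tuples
  contribute zero.\<close>

lemma sum_PiE_symmetric:
  fixes F :: "(nat \<Rightarrow> nat) \<Rightarrow> 'a::comm_ring_1"
  assumes fin: "finite K"
    and inj: "\<And>k. k \<in> PiE {0..<n} (\<lambda>_. K) \<Longrightarrow> \<not> inj_on k {0..<n} \<Longrightarrow> F k = 0"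
    and perm: "\<And>k p. k \<in> PiE {0..<n} (\<lambda>_. K) \<Longrightarrow> p permutes {0..<n} \<Longrightarrow> F (k \<circ> p) = F k"
  shows "(\<Sum>k\<in>PiE {0..<n} (\<lambda>_. K). F k) = of_nat (fact n) * (\<Sum>A | A \<subseteq> K \<and> card A = n. F (desc A))"
proof -
  let ?E = "PiE {0..<n} (\<lambda>_. K)"
  let ?I = "{k \<in> ?E. inj_on k {0..<n}}"
  let ?S = "{A. A \<subseteq> K \<and> card A = n}"
  have finE: "finite ?E" using fin by (intro finite_PiE) auto
  have finS: "finite ?S" using fin by (auto intro: finite_subset[of _ "Pow K"])
  have "(\<Sum>k\<in>?E. F k) = (\<Sum>k\<in>?I. F k)"
    by (rule sum.mono_neutral_right) (use finE inj in auto)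
  also have "\<dots> = (\<Sum>A\<in>?S. \<Sum>k | k \<in> ?I \<and> k ` {0..<n} = A. F k)"
    by (rule sum.group[symmetric]) (use finE finS in \<open>auto simp: card_image\<close>)
  also have "\<dots> = (\<Sum>A\<in>?S. of_nat (fact n) * F (desc A))"
  proof (rule sum.cong[OF refl])
    fix A assume "A \<in> ?S"
    then have A: "A \<subseteq> K" "card A = n" "finite A" using fin finite_subset by auto
    have bd: "bij_betw (desc A) {0..<n} A" using desc_bij_betw[OF A(3)] A(2) by simp
    have dE: "desc A \<in> ?E"
      using bd A by (auto simp: PiE_iff bij_betw_def desc_def extensional_def)
    let ?J = "{k. k \<in> ?I \<and> k ` {0..<n} = A}"
    have J: "bij_betw (\<lambda>p. desc A \<circ> p) {p. p permutes {0..<n}} ?J"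
    proof (rule bij_betwI')
      fix p q assume "p \<in> {p. p permutes {0..<n}}" "q \<in> {p. p permutes {0..<n}}"
      then have pq: "p permutes {0..<n}" "q permutes {0..<n}" by auto
      show "(desc A \<circ> p = desc A \<circ> q) = (p = q)"
      proof
        assume e: "desc A \<circ> p = desc A \<circ> q"
        show "p = q"
        proof
          fix x show "p x = q x"
          proof (cases "x \<in> {0..<n}")
            case True
            then have "p x \<in> {0..<n}" "q x \<in> {0..<n}" using pq permutes_in_image by metis+
            moreover have "desc A (p x) = desc A (q x)" using e by (metis comp_apply)
            ultimately show ?thesis using bd by (metis bij_betw_def inj_onD)
          next
            case False then show ?thesis using pq by (simp add: permutes_def)
          qed
        qed
      qed simp
    next
      fix p assume "p \<in> {p. p permutes {0..<n}}"
      then have p: "p permutes {0..<n}" by auto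
      then have b: "bij_betw (desc A \<circ> p) {0..<n} A"
        using bd bij_betw_trans permutes_imp_bij by blast
      moreover have "(desc A \<circ> p) x = undefined" if "x \<notin> {0..<n}" for x
        using that p A(2) by (simp add: permutes_def desc_def)
      ultimately show "desc A \<circ> p \<in> ?J"
        using A(1) by (auto simp: PiE_iff bij_betw_def extensional_def)
    next
      fix k assume k: "k \<in> ?J"
      then have bk: "bij_betw k {0..<n} A" by (auto simp: bij_betw_def)
      define p where "p = (\<lambda>x. if x \<in> {0..<n} then the_inv_into {0..<n} (desc A) (k x) else x)"
      have "bij_betw (the_inv_into {0..<n} (desc A) \<circ> k) {0..<n} {0..<n}"
        using bk bij_betw_the_inv_into[OF bd] by (rule bij_betw_trans)
      then have "bij_betw p {0..<n} {0..<n}"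
        by (rule bij_betw_cong[THEN iffD1, rotated]) (auto simp: p_def)
      then have "p permutes {0..<n}" by (rule bij_imp_permutes) (auto simp: p_def)
      moreover have "k = desc A \<circ> p"
      proof
        fix x show "k x = (desc A \<circ> p) x"
        proof (cases "x \<in> {0..<n}")
          case True
          then show ?thesis using bd bk
            by (simp add: p_def bij_betw_def f_the_inv_into_f) (metis atLeastLessThan_iff f_the_inv_into_f imageI le0)
        next
          case False then show ?thesis using k A(2) by (auto simp: p_def desc_def PiE_iff extensional_def)
        qed
      qed
      ultimately show "\<exists>p\<in>{p. p permutes {0..<n}}. k = desc A \<circ> p" by blast
    qed
    have "(\<Sum>k\<in>?J. F k) = (\<Sum>p | p permutes {0..<n}. F (desc A \<circ> p))"
      by (rule sum.reindex_bij_betw[OF J, symmetric])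
    also have "\<dots> = (\<Sum>p | p permutes {0..<n}. F (desc A))"
      using perm[OF dE] by (intro sum.cong) auto
    also have "\<dots> = of_nat (fact n) * F (desc A)" by (simp add: card_permutations)
    finally show "(\<Sum>k\<in>?J. F k) = of_nat (fact n) * F (desc A)" .
  qed
  finally show ?thesis by (simp add: sum_distrib_left)
qed

section \<open>Vandermonde products and the Weyl denominator of type C\<close>

definition vand :: "nat \<Rightarrow> (nat \<Rightarrow> 'a::comm_ring_1) \<Rightarrow> 'a" where
  "vand n x = (\<Prod>j<n. \<Prod>i<j. x j - x i)"

text \<open>The matrix of values is the Vandermonde matrix times the upper triangular matrix of
  coefficients.\<close>

lemma dt_poly:
  assumes "\<And>j. j < n \<Longrightarrow> degree (P j) \<le> j"
  shows "dt n (\<lambda>i j. poly (P j) (x i)) = dt n (\<lambda>i j. x i ^ j) * (\<Prod>j<n. coeff (P j) j)"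
proof -
  have "dt n (\<lambda>i j. poly (P j) (x i)) = dt n (\<lambda>i j. \<Sum>k<n. x i ^ k * coeff (P j) k)"
  proof (rule dt_cong)
    fix i j assume "i < n" "j < n"
    then have "(\<Sum>k<n. x i ^ k * coeff (P j) k) = (\<Sum>k\<le>degree (P j). x i ^ k * coeff (P j) k)"
      using assms[of j] by (intro sum.mono_neutral_right) (auto simp: coeff_eq_0)
    then show "poly (P j) (x i) = (\<Sum>k<n. x i ^ k * coeff (P j) k)"
      by (simp add: poly_altdef mult.commute)
  qed
  also have "\<dots> = dt n (\<lambda>i j. x i ^ j) * dt n (\<lambda>k j. coeff (P j) k)" by (rule dt_mult)
  also have "dt n (\<lambda>k j. coeff (P j) k) = (\<Prod>j<n. coeff (P j) j)"
    by (rule dt_upper_triangular) (use assms in \<open>meson coeff_eq_0 le_less_trans less_trans\<close>)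
  finally show ?thesis .
qed

text \<open>The powers are replaced by the Newton basis: \<open>P j\<close> has leading term
  \<open>x^j\<close> and vanishes at \<open>x 0, ..., x (j - 1)\<close>, so that the matrix of
  values becomes triangular. No division is involved.\<close>

lemma dt_vandermonde: "dt n (\<lambda>i j. x i ^ j) = vand n (x :: nat \<Rightarrow> 'a::comm_ring_1)"
proof -
  define P where "P j = (\<Prod>k<j. [:- x k, 1:])" for j
  have P: "degree (P j) \<le> j \<and> coeff (P j) j = 1" for j
  proof (induction j)
    case (Suc j)
    have "P (Suc j) = [:- x j, 1:] * P j" by (simp add: P_def mult.commute)
    moreover have "degree ([:- x j, 1:] * P j) \<le> Suc j"
      using degree_mult_le[of "[:- x j, 1:]" "P j"] Suc by (auto split: if_splits)
    moreover have "coeff ([:- x j, 1:] * P j) (Suc j) = 1"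
      using Suc by (simp add: coeff_eq_0)
    ultimately show ?case by simp
  qed (simp add: P_def)
  have ev: "poly (P j) (x i) = (\<Prod>k<j. x i - x k)" for i j
    by (simp add: P_def poly_prod)
  have "dt n (\<lambda>i j. x i ^ j) = dt n (\<lambda>i j. poly (P j) (x i))"
    using P by (subst dt_poly) auto
  also have "\<dots> = (\<Prod>i<n. poly (P i) (x i))"
    by (rule dt_lower_triangular) (auto simp: ev intro!: prod_zero)
  finally show ?thesis by (simp add: ev vand_def)
qed

text \<open>Chebyshev polynomials of the second kind in the variable \<open>z + 1/z\<close>, i.e.
  the quotients \<open>(z^(j+1) - z^(-j-1)) / (z - 1/z)\<close>.\<close>

fun cheb :: "nat \<Rightarrow> 'a::comm_ring_1 poly" where
  "cheb 0 = 1"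
| "cheb (Suc 0) = [:0, 1:]"
| "cheb (Suc (Suc j)) = [:0, 1:] * cheb (Suc j) - cheb j"

lemma cheb_monic: "degree (cheb j :: 'a::comm_ring_1 poly) \<le> j \<and> coeff (cheb j :: 'a poly) j = 1"
proof (induction j rule: cheb.induct)
  case (3 j)
  have "degree ([:0, 1:] * cheb (Suc j) :: 'a poly) \<le> Suc (Suc j)"
  proof (intro degree_le allI impI)
    fix i assume "Suc (Suc j) < i"
    then show "coeff ([:0, 1:] * cheb (Suc j) :: 'a poly) i = 0"
    proof (cases i)
      case (Suc k)
      then have "coeff (cheb (Suc j) :: 'a poly) k = 0"
        using conjunct1[OF 3(1)] \<open>Suc (Suc j) < i\<close> by (intro coeff_eq_0) linarith
      then show ?thesis by (simp add: Suc)
    qed simp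
  qed
  moreover have "degree (cheb j :: 'a poly) \<le> Suc (Suc j)" using 3 by linarith
  ultimately have "degree (cheb (Suc (Suc j)) :: 'a poly) \<le> Suc (Suc j)"
    unfolding cheb.simps by (rule degree_diff_le)
  moreover have "coeff (cheb j :: 'a poly) (Suc (Suc j)) = 0" using 3 by (intro coeff_eq_0) linarith
  then have "coeff (cheb (Suc (Suc j)) :: 'a poly) (Suc (Suc j)) = 1" using 3 by simp
  ultimately show ?case by blast
qed simp_all

lemma cheb_eval:
  fixes z w :: "'a::comm_ring_1"
  assumes "z * w = 1"
  shows "(z - w) * poly (cheb j) (z + w) = z ^ Suc j - w ^ Suc j"
proof (induction j rule: cheb.induct)
  case 2 then show ?case by (simp add: algebra_simps)
next
  case (3 j)
  have "(z - w) * poly (cheb (Suc (Suc j))) (z + w)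
      = (z + w) * ((z - w) * poly (cheb (Suc j)) (z + w)) - (z - w) * poly (cheb j) (z + w)"
    by (simp add: algebra_simps)
  also have "\<dots> = (z + w) * (z ^ Suc (Suc j) - w ^ Suc (Suc j)) - (z ^ Suc j - w ^ Suc j)"
    using 3 by simp
  also have "\<dots> = z ^ Suc (Suc (Suc j)) - w ^ Suc (Suc (Suc j))
      + (z * w) * z ^ Suc j - (z * w) * w ^ Suc j - (z ^ Suc j - w ^ Suc j)"
    by (simp add: algebra_simps)
  also have "\<dots> = z ^ Suc (Suc (Suc j)) - w ^ Suc (Suc (Suc j))" using assms by simp
  finally show ?case .
qed simp

text \<open>Weyl's denominator formula. After the factor \<open>z i - w i\<close> is taken out of
  each row, the entries are monic polynomials in \<open>z i + w i\<close>.\<close>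

lemma dt_symplectic_denominator:
  fixes z w :: "nat \<Rightarrow> 'a::comm_ring_1"
  assumes "\<And>i. i < n \<Longrightarrow> z i * w i = 1"
  shows "dt n (\<lambda>i j. z i ^ Suc j - w i ^ Suc j) = (\<Prod>i<n. z i - w i) * vand n (\<lambda>i. z i + w i)"
proof -
  have "dt n (\<lambda>i j. z i ^ Suc j - w i ^ Suc j) = dt n (\<lambda>i j. (z i - w i) * poly (cheb j) (z i + w i))"
    by (rule dt_cong) (simp only: cheb_eval[OF assms])
  also have "\<dots> = (\<Prod>i<n. z i - w i) * dt n (\<lambda>i j. poly (cheb j) (z i + w i))"
    by (rule dt_scale_rows)
  also have "dt n (\<lambda>i j. poly (cheb j) (z i + w i)) = vand n (\<lambda>i. z i + w i)"
    by (subst dt_poly) (simp_all add: cheb_monic dt_vandermonde)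
  finally show ?thesis .
qed

text \<open>The identities \<open>w i (1 - z i z i) = w i - z i\<close> and
  \<open>(w j - w i) (1 - z i z j) = (z j + w j) - (z i + w i)\<close> turn the factors of the plain
  alternant in \<open>w\<close>, one by one, into those of the type C denominator.\<close>

lemma dt_mult_prod_pairs:
  fixes z w :: "nat \<Rightarrow> 'a::comm_ring_1"
  assumes zw: "\<And>i. i < n \<Longrightarrow> z i * w i = 1"
  shows "dt n (\<lambda>i j. w i ^ Suc j) * (\<Prod>j<n. \<Prod>i\<le>j. 1 - z i * z j) = dt n (\<lambda>i j. w i ^ Suc j - z i ^ Suc j)"
proof -
  have "dt n (\<lambda>i j. w i ^ Suc j) = (\<Prod>i<n. w i) * vand n w"
    unfolding power_Suc dt_scale_rows dt_vandermonde ..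
  moreover have "(\<Prod>j<n. \<Prod>i\<le>j. 1 - z i * z j) = (\<Prod>j<n. (1 - z j * z j)) * (\<Prod>j<n. \<Prod>i<j. 1 - z i * z j)"
  proof -
    have "(\<Prod>i\<le>j. 1 - z i * z j) = (1 - z j * z j) * (\<Prod>i<j. 1 - z i * z j)" for j
      using prod.lessThan_Suc[of "\<lambda>i. 1 - z i * z j" j] by (simp add: lessThan_Suc_atMost mult.commute)
    then show ?thesis by (simp only: prod.distrib)
  qed
  moreover have "(\<Prod>i<n. w i) * (\<Prod>j<n. (1 - z j * z j)) = (\<Prod>i<n. w i - z i)"
    unfolding prod.distrib[symmetric]
  proof (rule prod.cong[OF refl])
    fix i assume "i \<in> {..<n}"
    have "w i * (1 - z i * z i) = w i - (z i * w i) * z i" by (simp add: algebra_simps)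
    with zw \<open>i \<in> {..<n}\<close> show "w i * (1 - z i * z i) = w i - z i" by simp
  qed
  moreover have "vand n w * (\<Prod>j<n. \<Prod>i<j. 1 - z i * z j) = vand n (\<lambda>i. z i + w i)"
    unfolding vand_def prod.distrib[symmetric]
  proof (intro prod.cong refl)
    fix i j assume "j \<in> {..<n}" "i \<in> {..<j}"
    then have "z i * w i = 1" "z j * w j = 1" using zw by auto
    moreover have "(w j - w i) * (1 - z i * z j) = w j - (z j * w j) * z i - w i + (z i * w i) * z j"
      by (simp add: algebra_simps)
    ultimately show "(w j - w i) * (1 - z i * z j) = z j + w j - (z i + w i)" by simp
  qed
  moreover have "dt n (\<lambda>i j. w i ^ Suc j - z i ^ Suc j) = (\<Prod>i<n. w i - z i) * vand n (\<lambda>i. w i + z i)"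
    by (rule dt_symplectic_denominator) (simp add: zw mult.commute[of "w _"])
  ultimately have "dt n (\<lambda>i j. w i ^ Suc j) = (\<Prod>i<n. w i) * vand n w"
    "(\<Prod>j<n. \<Prod>i\<le>j. 1 - z i * z j) = (\<Prod>j<n. (1 - z j * z j)) * (\<Prod>j<n. \<Prod>i<j. 1 - z i * z j)"
    "dt n (\<lambda>i j. w i ^ Suc j - z i ^ Suc j) = ((\<Prod>i<n. w i) * (\<Prod>j<n. (1 - z j * z j)))
       * (vand n w * (\<Prod>j<n. \<Prod>i<j. 1 - z i * z j))"
    by (simp_all only: add.commute)
  then show ?thesis by (simp only: mult_ac)
qed

definition interleave :: "(nat \<Rightarrow> 'a) \<Rightarrow> (nat \<Rightarrow> 'a) \<Rightarrow> nat \<Rightarrow> 'a" where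
  "interleave z w r = (if even r then z (r div 2) else w (r div 2))"

lemma interleave_simps [simp]:
  "interleave z w (2 * i) = z i" "interleave z w (Suc (2 * i)) = w i"
  by (simp_all add: interleave_def)

lemma sum_double: "(\<Sum>r<2 * n. f r) = (\<Sum>i<n. f (2 * i) + f (Suc (2 * i)))" for f :: "nat \<Rightarrow> 'a::comm_monoid_add"
  by (induction n) (simp_all add: add.assoc)

lemma prod_double: "(\<Prod>r<2 * n. f r) = (\<Prod>i<n. f (2 * i) * f (Suc (2 * i)))" for f :: "nat \<Rightarrow> 'a::comm_monoid_mult"
  by (induction n) (simp_all add: mult.assoc)

text \<open>The four differences between the pairs \<open>z n, w n\<close> and
  \<open>z i, w i\<close> multiply to \<open>(z n + w n - z i - w i)^2\<close>, because both pairs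
  have product one; within a pair the factor \<open>w i - z i\<close> remains.\<close>

lemma vand_interleave:
  fixes z w :: "nat \<Rightarrow> 'a::comm_ring_1"
  assumes zw: "\<And>i. i < n \<Longrightarrow> z i * w i = 1"
  shows "vand (2 * n) (interleave z w) = (\<Prod>i<n. w i - z i) * (vand n (\<lambda>i. z i + w i))\<^sup>2"
  using assms
proof (induction n)
  case (Suc n)
  let ?x = "interleave z w"
  have pairs: "(\<Prod>i<2 * n. z n - ?x i) * (\<Prod>i<2 * n. w n - ?x i) = (\<Prod>i<n. z n + w n - (z i + w i))\<^sup>2"
    unfolding prod_double prod.distrib[symmetric] prod_power_distrib
  proof (rule prod.cong[OF refl])
    fix i assume i: "i \<in> {..<n}"
    then have e: "z i * w i = 1" "z n * w n = 1" using Suc.prems by auto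
    have "(z n - z i) * (z n - w i) = z n * z n - z n * (z i + w i) + z i * w i" by (simp add: algebra_simps)
    also have "\<dots> = z n * (z n + w n - (z i + w i))" using e by (simp add: algebra_simps)
    finally have 1: "(z n - z i) * (z n - w i) = z n * (z n + w n - (z i + w i))" .
    have "(w n - z i) * (w n - w i) = w n * w n - w n * (z i + w i) + z i * w i" by (simp add: algebra_simps)
    also have "\<dots> = w n * (z n + w n - (z i + w i))" using e by (simp add: algebra_simps)
    finally have 2: "(w n - z i) * (w n - w i) = w n * (z n + w n - (z i + w i))" .
    have "(z n - ?x (2 * i)) * (z n - ?x (Suc (2 * i))) * ((w n - ?x (2 * i)) * (w n - ?x (Suc (2 * i))))
       = (z n * w n) * (z n + w n - (z i + w i))\<^sup>2"
      unfolding interleave_simps 1 2 by (simp only: power2_eq_square mult_ac)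
    then show "(z n - ?x (2 * i)) * (z n - ?x (Suc (2 * i))) * ((w n - ?x (2 * i)) * (w n - ?x (Suc (2 * i))))
       = (z n + w n - (z i + w i))\<^sup>2" using e by simp
  qed
  have "vand (2 * Suc n) ?x = vand (2 * n) ?x * (\<Prod>i<2 * n. z n - ?x i) * ((\<Prod>i<2 * n. w n - ?x i) * (w n - z n))"
    by (simp add: vand_def)
  also have "\<dots> = vand (2 * n) ?x * (w n - z n) * ((\<Prod>i<2 * n. z n - ?x i) * (\<Prod>i<2 * n. w n - ?x i))"
    by (simp only: mult_ac)
  also have "\<dots> = (\<Prod>i<Suc n. w i - z i) * (vand (Suc n) (\<lambda>i. z i + w i))\<^sup>2"
    unfolding pairs using Suc by (simp add: vand_def power_mult_distrib mult_ac)
  finally show ?case .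
qed (simp add: vand_def)

text \<open>The squared Weyl denominator as a product of differences of the \<open>2 n\<close>
  eigenvalues. In this form it expands into a pfaffian, and its factors are easy to
  differentiate.\<close>

lemma vand_interleave_symplectic:
  fixes z w :: "nat \<Rightarrow> 'a::comm_ring_1"
  assumes zw: "\<And>i. i < n \<Longrightarrow> z i * w i = 1"
  shows "(\<Prod>i<n. z i - w i) * vand (2 * n) (interleave z w)
       = (-1) ^ n * (dt n (\<lambda>i j. z i ^ Suc j - w i ^ Suc j))\<^sup>2"
proof -
  have "(\<Prod>i<n. w i - z i) = (\<Prod>i<n. (-1) * (z i - w i))" by simp
  also have "\<dots> = (-1) ^ n * (\<Prod>i<n. z i - w i)" by (simp only: prod.distrib) simp
  moreover have "vand (2 * n) (interleave z w) = (\<Prod>i<n. w i - z i) * (vand n (\<lambda>i. z i + w i))\<^sup>2"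
    by (rule vand_interleave) (rule zw)
  moreover have "dt n (\<lambda>i j. z i ^ Suc j - w i ^ Suc j) = (\<Prod>i<n. z i - w i) * vand n (\<lambda>i. z i + w i)"
    by (rule dt_symplectic_denominator) (rule zw)
  ultimately show ?thesis
    by (simp only: power2_eq_square mult_ac)
qed

subsection \<open>Polynomials and evaluation\<close>

abbreviation lkp :: "('a \<Rightarrow>\<^sub>0 'b::zero) \<Rightarrow> 'a \<Rightarrow> 'b" where "lkp \<equiv> Poly_Mapping.lookup"
abbreviation sng :: "'a \<Rightarrow> 'b \<Rightarrow> 'a \<Rightarrow>\<^sub>0 'b::zero" where "sng \<equiv> Poly_Mapping.single"

lemma poly_mapping_monomial_induct [case_names single add]:
  fixes f :: "'a \<Rightarrow>\<^sub>0 'b::comm_monoid_add"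
  assumes single: "\<And>k c. P (sng k c)" and add: "\<And>f g. P f \<Longrightarrow> P g \<Longrightarrow> P (f + g)"
  shows "P f"
proof -
  have "P (\<Sum>k\<in>A. sng k (c k))" if "finite A" for A and c :: "'a \<Rightarrow> 'b"
    using that
  proof induction
    case empty
    show ?case using single[of undefined 0] by simp
  qed (simp add: add single)
  moreover have "f = (\<Sum>k\<in>Poly_Mapping.keys f. sng k (lkp f k))"
    by (rule poly_mapping_eqI)
      (simp add: lookup_sum lookup_single when_def sum.delta' in_keys_iff)
  ultimately show ?thesis by (metis finite_keys)
qed

lemma additive_eqI:
  fixes A B :: "('k \<Rightarrow>\<^sub>0 'c::comm_monoid_add) \<Rightarrow> 'b::plus"
  assumes "\<And>k c. A (sng k c) = B (sng k c)"
    and "\<And>f g. A (f + g) = A f + A g" "\<And>f g. B (f + g) = B f + B g"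
  shows "A f = B f"
  by (induction f rule: poly_mapping_monomial_induct) (simp_all add: assms)

definition cst :: "complex \<Rightarrow> 'k::zero \<Rightarrow>\<^sub>0 complex" where "cst c = sng 0 c"

text \<open>Embeddings of the coefficient field: the identity for numerical evaluation,
  \<open>cst\<close> for values in polynomials and Laurent polynomials.\<close>

definition scalars :: "(complex \<Rightarrow> 'b::comm_ring_1) \<Rightarrow> bool" where
  "scalars c \<longleftrightarrow> c 0 = 0 \<and> c 1 = 1 \<and> (\<forall>x y. c (x + y) = c x + c y) \<and> (\<forall>x y. c (x * y) = c x * c y)"

lemma pconst_eq_cst: "pconst = cst"
  by (simp add: fun_eq_iff pconst_def cst_def)

lemma scalars_cst [simp]: "scalars (cst :: complex \<Rightarrow> 'k::comm_monoid_add \<Rightarrow>\<^sub>0 complex)"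
  by (simp add: scalars_def cst_def single_add mult_single)

lemma scalars_id [simp]: "scalars (\<lambda>x. x)"
  by (simp add: scalars_def)

lemma cst_simps [simp]: "cst 0 = 0" "cst 1 = (1 :: 'k::comm_monoid_add \<Rightarrow>\<^sub>0 complex)"
  by (simp_all add: cst_def)

lemma cst_add: "cst (x + y) = cst x + cst y" by (simp add: cst_def single_add)
lemma cst_mult: "cst (x * y) = cst x * (cst y :: 'k::comm_monoid_add \<Rightarrow>\<^sub>0 complex)" by (simp add: cst_def mult_single)
lemma cst_uminus: "cst (- x) = - cst x" by (simp add: cst_def single_uminus)
lemma cst_of_nat: "cst (of_nat n) = (of_nat n :: 'k::comm_monoid_add \<Rightarrow>\<^sub>0 complex)" by (simp add: cst_def)
lemma cst_of_int: "cst (of_int n) = (of_int n :: 'k::comm_monoid_add \<Rightarrow>\<^sub>0 complex)" by (simp add: cst_def)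
lemma cst_times_single: "cst a * sng k c = (sng k (a * c) :: 'k::comm_monoid_add \<Rightarrow>\<^sub>0 complex)"
  by (simp add: cst_def mult_single)
lemma cst_inverse: "n > 0 \<Longrightarrow> cst (1 / of_nat n) * of_nat n = (1 :: 'k::comm_monoid_add \<Rightarrow>\<^sub>0 complex)"
  unfolding cst_of_nat[symmetric] cst_mult[symmetric] by simp

lemma lookup_cst_times: "lkp (cst a * f) k = a * lkp f (k :: 'k::comm_monoid_add)"
  by (rule additive_eqI[of "\<lambda>f. lkp (cst a * f) k" "\<lambda>f. a * lkp f k"])
    (simp_all add: cst_times_single lookup_single when_def distrib_left lookup_add)

text \<open>Linear extension of a function on monomials. Evaluation, partial derivatives, Euler
  operators, functionals on Laurent polynomials and projections are all instances.\<close>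

definition lin :: "(complex \<Rightarrow> 'b::comm_ring_1) \<Rightarrow> ('k \<Rightarrow> 'b) \<Rightarrow> ('k \<Rightarrow>\<^sub>0 complex) \<Rightarrow> 'b" where
  "lin c \<phi> f = (\<Sum>k\<in>Poly_Mapping.keys f. c (lkp f k) * \<phi> k)"

lemma lin_superset:
  assumes "scalars c" "finite A" "Poly_Mapping.keys f \<subseteq> A"
  shows "lin c \<phi> f = (\<Sum>k\<in>A. c (lkp f k) * \<phi> k)"
  unfolding lin_def using assms
  by (intro sum.mono_neutral_left) (auto simp: in_keys_iff scalars_def)

lemma lin_add: "scalars c \<Longrightarrow> lin c \<phi> (f + g) = lin c \<phi> f + lin c \<phi> g"
  using lin_superset[of c "Poly_Mapping.keys f \<union> Poly_Mapping.keys g"] Poly_Mapping.keys_add[of f g]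
  by (simp add: lookup_add scalars_def distrib_right sum.distrib)

lemma lin_single: "scalars c \<Longrightarrow> lin c \<phi> (sng k a) = c a * \<phi> k"
  using lin_superset[of c "{k}" "sng k a" \<phi>] by simp

lemma lin_0 [simp]: "lin c \<phi> 0 = 0" by (simp add: lin_def)

lemma lin_sum: "scalars c \<Longrightarrow> lin c \<phi> (\<Sum>x\<in>A. f x) = (\<Sum>x\<in>A. lin c \<phi> (f x))"
  by (induction A rule: infinite_finite_induct) (simp_all add: lin_add)

lemma lin_uminus: "scalars c \<Longrightarrow> lin c \<phi> (- f) = - lin c \<phi> f"
  using lin_add[of c \<phi> f "- f"] by (simp add: add_eq_0_iff)

lemma lin_diff: "scalars c \<Longrightarrow> lin c \<phi> (f - g) = lin c \<phi> f - lin c \<phi> g"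
  using lin_add[of c \<phi> f "- g"] by (simp add: lin_uminus)

lemma lin_mult:
  assumes "scalars c" "\<And>k l. \<phi> (k + l) = \<phi> k * \<phi> l"
  shows "lin c \<phi> (f * g) = lin c \<phi> f * lin c \<phi> (g :: 'k::comm_monoid_add \<Rightarrow>\<^sub>0 complex)"
proof (rule additive_eqI[of "\<lambda>f. lin c \<phi> (f * g)"])
  fix k a
  show "lin c \<phi> (sng k a * g) = lin c \<phi> (sng k a) * lin c \<phi> g"
    by (rule additive_eqI[of "\<lambda>g. lin c \<phi> (sng k a * g)"])
      (use assms in \<open>simp_all add: mult_single lin_single lin_add scalars_def algebra_simps\<close>)
qed (simp_all add: lin_add assms distrib_right)

lemma lin_cst_times:
  assumes "scalars c"
  shows "lin c \<phi> (cst a * f) = c a * lin c \<phi> (f :: 'k::comm_monoid_add \<Rightarrow>\<^sub>0 complex)"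
  by (rule additive_eqI[of "\<lambda>f. lin c \<phi> (cst a * f)"])
    (use assms in \<open>simp_all add: cst_times_single lin_single lin_add distrib_left scalars_def mult_ac\<close>)

lemma lin_of_nat_times:
  assumes "scalars c"
  shows "lin c \<phi> (of_nat a * f) = of_nat a * lin c \<phi> (f :: 'k::comm_monoid_add \<Rightarrow>\<^sub>0 complex)"
  by (induction a) (use assms in \<open>simp_all add: lin_add distrib_right\<close>)

lemma lin_one:
  assumes "scalars c" "\<phi> 0 = 1"
  shows "lin c \<phi> (1 :: 'k::comm_monoid_add \<Rightarrow>\<^sub>0 complex) = 1"
  using lin_single[OF assms(1), of \<phi> 0 1] assms by (simp add: scalars_def)

lemma lin_prod:
  assumes "scalars c" "\<And>k l. \<phi> (k + l) = \<phi> k * \<phi> l" "\<phi> 0 = 1"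
  shows "lin c \<phi> (\<Prod>x\<in>A. f x) = (\<Prod>x\<in>A. lin c \<phi> (f x :: 'k::comm_monoid_add \<Rightarrow>\<^sub>0 complex))"
  by (induction A rule: infinite_finite_induct) (simp_all add: lin_mult lin_one assms)

section \<open>Evaluation of monomials and polynomials in commutative rings\<close>

definition mev :: "(nat \<Rightarrow> 'b::comm_monoid_mult) \<Rightarrow> monomial \<Rightarrow> 'b" where
  "mev \<sigma> \<alpha> = (\<Prod>m\<in>Poly_Mapping.keys \<alpha>. \<sigma> m ^ lkp \<alpha> m)"

lemma mev_superset:
  assumes "finite A" "Poly_Mapping.keys \<alpha> \<subseteq> A"
  shows "mev \<sigma> \<alpha> = (\<Prod>m\<in>A. \<sigma> m ^ lkp \<alpha> m)"
  unfolding mev_def using assms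
  by (intro prod.mono_neutral_left) (auto simp: in_keys_iff)

lemma mev_add: "mev \<sigma> (\<alpha> + \<beta>) = mev \<sigma> \<alpha> * mev \<sigma> \<beta>"
proof -
  let ?A = "Poly_Mapping.keys \<alpha> \<union> Poly_Mapping.keys \<beta>"
  have "mev \<sigma> \<gamma> = (\<Prod>m\<in>?A. \<sigma> m ^ lkp \<gamma> m)" if "\<gamma> \<in> {\<alpha>, \<beta>, \<alpha> + \<beta>}" for \<gamma>
    using that Poly_Mapping.keys_add[of \<alpha> \<beta>] by (intro mev_superset) auto
  then show ?thesis by (simp add: lookup_add power_add prod.distrib)
qed

lemma mev_0 [simp]: "mev \<sigma> 0 = 1" by (simp add: mev_def)

lemma mev_single: "mev \<sigma> (sng m k) = \<sigma> m ^ k"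
  using mev_superset[of "{m}" "sng m k" \<sigma>] by simp

lemma psubst_lin: "psubst \<sigma> = lin cst (mev \<sigma>)"
  by (simp add: fun_eq_iff psubst_def lin_def mev_def pconst_eq_cst)

definition peval :: "(complex \<Rightarrow> 'b::comm_ring_1) \<Rightarrow> (nat \<Rightarrow> 'b) \<Rightarrow> ppoly \<Rightarrow> 'b" where
  "peval c \<sigma> = lin c (mev \<sigma>)"

lemma peval_hom:
  assumes "scalars c"
  shows "peval c \<sigma> (f + g) = peval c \<sigma> f + peval c \<sigma> g" "peval c \<sigma> (f * g) = peval c \<sigma> f * peval c \<sigma> g"
    "peval c \<sigma> (f - g) = peval c \<sigma> f - peval c \<sigma> g" "peval c \<sigma> 1 = 1" "peval c \<sigma> 0 = 0"
    "peval c \<sigma> (cst a) = c a" "peval c \<sigma> (pvar m) = \<sigma> m"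
    "peval c \<sigma> (\<Sum>x\<in>A. F x) = (\<Sum>x\<in>A. peval c \<sigma> (F x))"
    "peval c \<sigma> (\<Prod>x\<in>A. F x) = (\<Prod>x\<in>A. peval c \<sigma> (F x))"
    "peval c \<sigma> (sng \<alpha> a) = c a * mev \<sigma> \<alpha>" "peval c \<sigma> (- f) = - peval c \<sigma> f"
    "peval c \<sigma> (of_nat k) = of_nat k"
proof -
  show o: "peval c \<sigma> 1 = 1" unfolding peval_def by (rule lin_one) (simp_all add: assms)
  show "peval c \<sigma> (cst a) = c a" unfolding peval_def cst_def by (simp add: lin_single assms)
  show "peval c \<sigma> (pvar m) = \<sigma> m" unfolding peval_def pvar_def using assms
    by (simp add: lin_single mev_single scalars_def)
  show "peval c \<sigma> (of_nat k) = of_nat k"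
    by (induction k) (use o in \<open>simp_all add: peval_def lin_add assms\<close>)
qed (simp_all add: peval_def lin_add lin_mult lin_diff mev_add lin_sum lin_prod lin_single lin_uminus assms)

subsection \<open>Partial derivatives\<close>

lemma pderiv_var_lin: "pderiv_var m = lin cst (\<lambda>\<alpha>. sng (\<alpha> - sng m 1) (of_nat (lkp \<alpha> m)))"
  by (simp add: fun_eq_iff pderiv_var_def lin_def cst_times_single mult.commute)

lemma pderiv_var_add: "pderiv_var m (f + g) = pderiv_var m f + pderiv_var m g"
  by (simp add: pderiv_var_lin lin_add)

lemma pderiv_var_single: "pderiv_var m (sng \<alpha> a) = sng (\<alpha> - sng m 1) (of_nat (lkp \<alpha> m) * a)"
  by (simp add: pderiv_var_lin lin_single cst_times_single mult.commute)

lemma pderiv_var_0 [simp]: "pderiv_var m 0 = 0" by (simp add: pderiv_var_lin)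
lemma pderiv_var_cst [simp]: "pderiv_var m (cst a) = 0" by (simp add: cst_def pderiv_var_single)
lemma pderiv_var_1 [simp]: "pderiv_var m 1 = 0" using pderiv_var_cst[of m 1] by simp

lemma pderiv_var_cst_times: "pderiv_var m (cst a * f) = cst a * pderiv_var m f"
  by (simp add: pderiv_var_lin lin_cst_times)

lemma pderiv_var_sum: "pderiv_var m (\<Sum>x\<in>A. f x) = (\<Sum>x\<in>A. pderiv_var m (f x))"
  by (simp add: pderiv_var_lin lin_sum)

lemma pderiv_var_uminus: "pderiv_var m (- f) = - pderiv_var m f"
  by (simp add: pderiv_var_lin lin_uminus)

lemma pderiv_var_pvar: "pderiv_var m (pvar k) = (if m = k then 1 else 0)"
  by (simp add: pvar_def pderiv_var_single lookup_single)

lemma monomial_diff_add: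
  assumes "lkp \<alpha> m > 0"
  shows "\<alpha> - sng m 1 + \<beta> = \<alpha> + \<beta> - sng m (1::nat)" "\<beta> + (\<alpha> - sng m 1) = \<beta> + \<alpha> - sng m (1::nat)"
    "\<alpha> - sng m 1 + sng m 1 = \<alpha>"
  using assms by (auto intro!: poly_mapping_eqI simp: lookup_add lookup_minus lookup_single when_def)

lemma pderiv_var_mult: "pderiv_var m (f * g) = pderiv_var m f * g + f * pderiv_var m g"
proof (rule additive_eqI[of "\<lambda>f. pderiv_var m (f * g)"])
  fix \<alpha> a
  show "pderiv_var m (sng \<alpha> a * g) = pderiv_var m (sng \<alpha> a) * g + sng \<alpha> a * pderiv_var m g"
  proof (rule additive_eqI[of "\<lambda>g. pderiv_var m (sng \<alpha> a * g)"])
    fix \<beta> b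
    \<comment> \<open>The truncated subtraction commutes with adding \<beta> only if
      \<open>p_m\<close> occurs in \<alpha>; otherwise the coefficient is zero and so are both
      sides.\<close>
    have 1: "sng (\<alpha> - sng m 1 + \<beta>) (of_nat (lkp \<alpha> m) * a * b) = sng (\<alpha> + \<beta> - sng m 1) (of_nat (lkp \<alpha> m) * a * b)"
      by (cases "lkp \<alpha> m = 0") (use monomial_diff_add(1)[of \<alpha> m \<beta>] in auto)
    have 2: "sng (\<alpha> + (\<beta> - sng m 1)) (a * (of_nat (lkp \<beta> m) * b)) = sng (\<alpha> + \<beta> - sng m 1) (a * (of_nat (lkp \<beta> m) * b))"
      by (cases "lkp \<beta> m = 0") (use monomial_diff_add(2)[of \<beta> m \<alpha>] in auto)
    show "pderiv_var m (sng \<alpha> a * sng \<beta> b)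
        = pderiv_var m (sng \<alpha> a) * sng \<beta> b + sng \<alpha> a * pderiv_var m (sng \<beta> b)"
      unfolding pderiv_var_single mult_single 1 2 single_add[symmetric] lookup_add
      by (simp add: algebra_simps)
  qed (simp_all add: pderiv_var_add algebra_simps)
qed (simp_all add: pderiv_var_add algebra_simps)

lemma pderiv_var_prod:
  assumes "finite A"
  shows "pderiv_var m (\<Prod>x\<in>A. f x) = (\<Sum>x\<in>A. pderiv_var m (f x) * (\<Prod>y\<in>A - {x}. f y))"
  using assms
proof (induction A)
  case (insert x A)
  have "(\<Sum>u\<in>A. f x * (pderiv_var m (f u) * prod f (A - {u}))) = (\<Sum>u\<in>A. pderiv_var m (f u) * prod f (insert x A - {u}))"
  proof (rule sum.cong[OF refl])
    fix u assume "u \<in> A"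
    then have "insert x A - {u} = insert x (A - {u})" using insert by auto
    then show "f x * (pderiv_var m (f u) * prod f (A - {u})) = pderiv_var m (f u) * prod f (insert x A - {u})"
      using insert by (simp add: mult_ac)
  qed
  with insert show ?case by (simp add: pderiv_var_mult sum_distrib_left)
qed simp

lemma lookup_pderiv_var: "lkp (pderiv_var m f) \<alpha> = of_nat (Suc (lkp \<alpha> m)) * lkp f (\<alpha> + sng m 1)"
proof (rule additive_eqI[of "\<lambda>f. lkp (pderiv_var m f) \<alpha>"])
  fix \<beta> b
  have "\<beta> - sng m 1 = \<alpha> \<longleftrightarrow> \<beta> = \<alpha> + sng m 1" if "lkp \<beta> m > 0"
    using monomial_diff_add(3)[OF that] by auto
  moreover have "lkp (\<alpha> + sng m 1) m > 0" by (simp add: lookup_add)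
  ultimately show "lkp (pderiv_var m (sng \<beta> b)) \<alpha> = of_nat (Suc (lkp \<alpha> m)) * lkp (sng \<beta> b) (\<alpha> + sng m 1)"
    by (cases "lkp \<beta> m = 0") (auto simp: pderiv_var_single lookup_single when_def lookup_add)
qed (simp_all add: pderiv_var_add lookup_add algebra_simps)

subsection \<open>Weighted degree\<close>

definition wt :: "monomial \<Rightarrow> nat" where "wt \<alpha> = (\<Sum>m\<in>Poly_Mapping.keys \<alpha>. m * lkp \<alpha> m)"

lemma wt_superset:
  assumes "finite A" "Poly_Mapping.keys \<alpha> \<subseteq> A"
  shows "wt \<alpha> = (\<Sum>m\<in>A. m * lkp \<alpha> m)"
  unfolding wt_def using assms by (intro sum.mono_neutral_left) (auto simp: in_keys_iff)

lemma wt_add: "wt (\<alpha> + \<beta>) = wt \<alpha> + wt \<beta>"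
  using wt_superset[of "Poly_Mapping.keys \<alpha> \<union> Poly_Mapping.keys \<beta>"] Poly_Mapping.keys_add[of \<alpha> \<beta>]
  by (simp add: lookup_add distrib_left sum.distrib)

lemma wt_0 [simp]: "wt 0 = 0" by (simp add: wt_def)

lemma wt_single: "wt (sng m k) = m * k"
  using wt_superset[of "{m}" "sng m k"] by simp

text \<open>An ideal of the polynomial ring. A coefficient of weight at most \<open>K\<close>
  depends only on the class modulo it, so congruence modulo this ideal does the work of equality of
  power series.\<close>

definition high :: "nat \<Rightarrow> ppoly \<Rightarrow> bool" where
  "high K f \<longleftrightarrow> (\<forall>\<alpha>. wt \<alpha> \<le> K \<longrightarrow> lkp f \<alpha> = 0)"

lemma high_0 [simp]: "high K 0" by (simp add: high_def)
lemma high_add: "high K f \<Longrightarrow> high K g \<Longrightarrow> high K (f + g)" by (simp add: high_def lookup_add)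
lemma high_uminus: "high K f \<Longrightarrow> high K (- f)" by (simp add: high_def)
lemma high_diff: "high K f \<Longrightarrow> high K g \<Longrightarrow> high K (f - g)" by (simp add: high_def lookup_minus)

lemma high_mult_gen: 
  assumes "\<And>\<alpha> \<beta>. \<alpha> \<in> Poly_Mapping.keys f \<Longrightarrow> \<beta> \<in> Poly_Mapping.keys g \<Longrightarrow> K < wt \<alpha> + wt \<beta>"
  shows "high K (f * g)"
  unfolding high_def
proof (intro allI impI)
  fix \<gamma> assume \<gamma>: "wt \<gamma> \<le> K"
  show "lkp (f * g) \<gamma> = 0"
  proof (rule ccontr)
    assume "lkp (f * g) \<gamma> \<noteq> 0"
    then have "\<gamma> \<in> Poly_Mapping.keys (f * g)" by (simp add: in_keys_iff)
    then obtain \<alpha> \<beta> where "\<gamma> = \<alpha> + \<beta>" "\<alpha> \<in> Poly_Mapping.keys f" "\<beta> \<in> Poly_Mapping.keys g"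
      using keys_mult[of f g] by blast
    with assms \<gamma> show False by (force simp: wt_add)
  qed
qed

lemma high_mult: "high K f \<Longrightarrow> high K (f * g)" "high K f \<Longrightarrow> high K (g * f)"
proof -
  show "high K (f * g)" if "high K f" for f g
    using that by (intro high_mult_gen) (auto simp: high_def in_keys_iff, meson not_le_imp_less trans_less_add1)
  then show "high K f \<Longrightarrow> high K (g * f)" by (simp add: mult.commute)
qed

lemma high_sum: "(\<And>x. x \<in> A \<Longrightarrow> high K (f x)) \<Longrightarrow> high K (\<Sum>x\<in>A. f x)"
  by (induction A rule: infinite_finite_induct) (simp_all add: high_add)

lemma high_prod: "finite A \<Longrightarrow> x \<in> A \<Longrightarrow> high K (f x) \<Longrightarrow> high K (\<Prod>x\<in>A. f x)"
  by (simp add: prod.remove high_mult)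

definition cong_low :: "nat \<Rightarrow> ppoly \<Rightarrow> ppoly \<Rightarrow> bool" where
  "cong_low K f g \<longleftrightarrow> high K (f - g)"

lemma cong_low_refl [simp]: "cong_low K f f" by (simp add: cong_low_def)
lemma cong_low_sym: "cong_low K f g \<Longrightarrow> cong_low K g f"
  unfolding cong_low_def using high_uminus[of K "f - g"] by simp
lemma cong_low_lookup: "cong_low K f g \<Longrightarrow> wt \<alpha> \<le> K \<Longrightarrow> lkp f \<alpha> = lkp g \<alpha>"
  by (simp add: cong_low_def high_def lookup_minus)
lemma cong_low_add: "cong_low K f g \<Longrightarrow> cong_low K f' g' \<Longrightarrow> cong_low K (f + f') (g + g')"
  unfolding cong_low_def using high_add[of K "f - g" "f' - g'"] by (simp add: algebra_simps)
lemma cong_low_diff: "cong_low K f g \<Longrightarrow> cong_low K f' g' \<Longrightarrow> cong_low K (f - f') (g - g')"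
  unfolding cong_low_def using high_diff[of K "f - g" "f' - g'"] by (simp add: algebra_simps)
lemma cong_low_mult:
  assumes "cong_low K f g" "cong_low K f' g'"
  shows "cong_low K (f * f') (g * g')"
proof -
  have "f * f' - g * g' = (f - g) * f' + g * (f' - g')" by (simp add: algebra_simps)
  then show ?thesis using assms unfolding cong_low_def by (simp add: high_add high_mult)
qed
lemma cong_low_sum: "(\<And>x. x \<in> A \<Longrightarrow> cong_low K (f x) (g x)) \<Longrightarrow> cong_low K (\<Sum>x\<in>A. f x) (\<Sum>x\<in>A. g x)"
  by (induction A rule: infinite_finite_induct) (simp_all add: cong_low_add)
lemma cong_low_prod: "(\<And>x. x \<in> A \<Longrightarrow> cong_low K (f x) (g x)) \<Longrightarrow> cong_low K (\<Prod>x\<in>A. f x) (\<Prod>x\<in>A. g x)"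
  by (induction A rule: infinite_finite_induct) (simp_all add: cong_low_mult)

lemma cong_low_dt:
  assumes "\<And>i j. i < n \<Longrightarrow> j < n \<Longrightarrow> cong_low K (a i j) (b i j)"
  shows "cong_low K (dt n a) (dt n b)"
  unfolding dt_leibniz using assms permutes_in_image
  by (intro cong_low_sum cong_low_mult cong_low_prod cong_low_refl) (auto intro!: assms)

lemma high_dt:
  assumes "i < n" "\<And>j. j < n \<Longrightarrow> high K (a i j)"
  shows "high K (dt n a)"
  unfolding dt_leibniz
proof (intro high_sum high_mult(2))
  fix p assume "p \<in> {p. p permutes {0..<n}}"
  then have "p i < n" using assms(1) permutes_in_image[of p "{0..<n}" i] by auto
  then show "high K (\<Prod>i = 0..<n. a i (p i))"
    using assms by (intro high_prod[of _ i]) auto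
qed

subsection \<open>Laurent polynomials\<close>

type_synonym laurent = "(nat \<Rightarrow>\<^sub>0 int) \<Rightarrow>\<^sub>0 complex"

definition zp :: "nat \<Rightarrow> int \<Rightarrow> laurent" where "zp i k = sng (sng i k) 1"

lemma zp_add: "zp i (k + l) = zp i k * zp i l"
  by (simp add: zp_def mult_single single_add)
lemma zp_0 [simp]: "zp i 0 = 1" by (simp add: zp_def)
lemma zp_power: "zp i k ^ m = zp i (int m * k)"
  by (induction m) (simp_all add: zp_add[symmetric] algebra_simps)
lemma zp_inv: "zp i k * zp i (- k) = 1" by (simp add: zp_add[symmetric])

definition expo :: "nat \<Rightarrow> (nat \<Rightarrow> int) \<Rightarrow> nat \<Rightarrow>\<^sub>0 int" where
  "expo n e = (\<Sum>i<n. sng i (e i))"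

lemma lookup_expo: "lkp (expo n e) i = (if i < n then e i else 0)"
  by (simp add: expo_def lookup_sum lookup_single when_def sum.delta')

lemma prod_zp: "(\<Prod>i<n. zp i (e i)) = sng (expo n e) 1"
  by (induction n) (simp_all add: zp_def expo_def mult_single)

definition theta :: "nat \<Rightarrow> laurent \<Rightarrow> laurent" where
  "theta i = lin cst (\<lambda>e. sng e (of_int (lkp e i)))"

lemma theta_add: "theta i (f + g) = theta i f + theta i g" by (simp add: theta_def lin_add)
lemma theta_sum: "theta i (\<Sum>x\<in>A. f x) = (\<Sum>x\<in>A. theta i (f x))" by (simp add: theta_def lin_sum)
lemma theta_diff: "theta i (f - g) = theta i f - theta i g" by (simp add: theta_def lin_diff)
lemma theta_uminus: "theta i (- f) = - theta i f" by (simp add: theta_def lin_uminus)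
lemma theta_single: "theta i (sng e c) = sng e (of_int (lkp e i) * c)"
  by (simp add: theta_def lin_single cst_times_single mult.commute)
lemma theta_cst_times: "theta i (cst a * f) = cst a * theta i f" by (simp add: theta_def lin_cst_times)
lemma theta_1 [simp]: "theta i 1 = 0" using theta_single[of i 0 1] by simp
lemma theta_cst [simp]: "theta i (cst a) = 0" using theta_single[of i 0 a] by (simp add: cst_def)

lemma lookup_theta: "lkp (theta i f) e = of_int (lkp e i) * lkp f e"
  by (rule additive_eqI[of "\<lambda>f. lkp (theta i f) e"])
    (simp_all add: theta_single theta_add lookup_add lookup_single when_def distrib_left)

lemma theta_mult: "theta i (f * g) = theta i f * g + f * theta i g"
proof (rule additive_eqI[of "\<lambda>f. theta i (f * g)"])
  fix k a
  show "theta i (sng k a * g) = theta i (sng k a) * g + sng k a * theta i g"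
    by (rule additive_eqI[of "\<lambda>g. theta i (sng k a * g)"])
      (simp_all add: mult_single theta_single theta_add lookup_add single_add[symmetric] algebra_simps)
qed (simp_all add: theta_add algebra_simps)

lemma theta_zp: "theta i (zp j k) = (if i = j then of_int k * zp j k else 0)"
  by (simp add: zp_def theta_single lookup_single when_def cst_of_int[symmetric] cst_times_single)

text \<open>The functional \<open>z^e \<mapsto> \<Prod>_i G i (e_i)\<close>. With
  \<open>G i e = h (k i - e)\<close> it produces Jacobi-Trudi determinants, with indicator functions
  it extracts a coefficient, and with \<open>G i e = g (i + 1 - e)\<close> it gives the coefficient
  of \<open>z^\<rho>\<close> after multiplication by
  \<open>\<Prod>_i \<Sum>_d g d z_i^d\<close>.\<close>

definition lfun :: "nat \<Rightarrow> (nat \<Rightarrow> int \<Rightarrow> ppoly) \<Rightarrow> laurent \<Rightarrow> ppoly" where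
  "lfun n G = lin cst (\<lambda>e. \<Prod>i<n. G i (lkp e i))"

lemma lfun_linear:
  "lfun n G (f + g) = lfun n G f + lfun n G g" "lfun n G (f - g) = lfun n G f - lfun n G g"
  "lfun n G (- f) = - lfun n G f" "lfun n G (cst a * f) = cst a * lfun n G f"
  "lfun n G (\<Sum>x\<in>A. F x) = (\<Sum>x\<in>A. lfun n G (F x))" "lfun n G 0 = 0"
  "lfun n G (of_nat k * f) = of_nat k * lfun n G f"
  by (simp_all add: lfun_def lin_add lin_diff lin_uminus lin_cst_times lin_sum lin_of_nat_times)

lemma lfun_signof: "lfun n G (signof p * f) = signof p * lfun n G f"
  using signof_cases[of p, where 'a = int] by (auto simp: lfun_linear)

lemma lfun_prod_zp: "lfun n G (\<Prod>i<n. zp i (e i)) = (\<Prod>i<n. G i (e i))"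
  unfolding prod_zp lfun_def by (simp add: lin_single lookup_expo)

lemma lfun_prod_sum:
  assumes "finite S"
  shows "lfun n G (\<Prod>i<n. \<Sum>s\<in>S. cst (c i s) * zp i (e i s)) = (\<Prod>i<n. \<Sum>s\<in>S. cst (c i s) * G i (e i s))"
proof -
  have cp: "(\<Prod>i<n. cst (d i)) = (cst (\<Prod>i<n. d i) :: 'k::comm_monoid_add \<Rightarrow>\<^sub>0 complex)" for d
    by (induction n) (simp_all add: cst_mult)
  have "lfun n G (\<Prod>i<n. \<Sum>s\<in>S. cst (c i s) * zp i (e i s))
     = (\<Sum>g\<in>PiE {..<n} (\<lambda>_. S). lfun n G (\<Prod>i<n. cst (c i (g i)) * zp i (e i (g i))))"
    using assms by (simp add: prod_sum_PiE lfun_linear)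
  also have "\<dots> = (\<Sum>g\<in>PiE {..<n} (\<lambda>_. S). (\<Prod>i<n. cst (c i (g i)) * G i (e i (g i))))"
    by (simp add: prod.distrib cp lfun_linear lfun_prod_zp)
  also have "\<dots> = (\<Prod>i<n. \<Sum>s\<in>S. cst (c i s) * G i (e i s))"
    using assms by (simp add: prod_sum_PiE)
  finally show ?thesis .
qed

subsection \<open>Pfaffians and correlation sums\<close>

text \<open>The functional is multiplicative on products with one factor per variable. Hence it maps
  a determinant whose row \<open>i\<close> involves \<open>z_i\<close> alone to the determinant of
  the images.\<close>

lemma lfun_prod_uni:
  "lfun n G (\<Prod>i<n. lin cst (zp i) (u i)) = (\<Prod>i<n. lin cst (G i) (u i))"
proof -
  define S where "S = (\<Union>i<n. Poly_Mapping.keys (u i))"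
  have S: "finite S" by (simp add: S_def)
  have e: "lin cst \<phi> (u i) = (\<Sum>s\<in>S. cst (lkp (u i) s) * \<phi> s)" if "i < n" for i and \<phi> :: "int \<Rightarrow> 'k::comm_monoid_add \<Rightarrow>\<^sub>0 complex"
    by (rule lin_superset[OF scalars_cst S]) (use that S_def in blast)
  have "lfun n G (\<Prod>i<n. lin cst (zp i) (u i)) = lfun n G (\<Prod>i<n. \<Sum>s\<in>S. cst (lkp (u i) s) * zp i s)"
    by (intro arg_cong[where f = "lfun n G"] prod.cong refl) (simp add: e)
  also have "\<dots> = (\<Prod>i<n. \<Sum>s\<in>S. cst (lkp (u i) s) * G i s)"
    by (rule lfun_prod_sum[OF S])
  also have "\<dots> = (\<Prod>i<n. lin cst (G i) (u i))"
    by (intro prod.cong refl) (simp add: e)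
  finally show ?thesis .
qed

text \<open>Summed over all permutations without normalization: for antisymmetric \<open>B\<close>
  this is \<open>2^n * fact n\<close> times the usual pfaffian, and it makes sense in rings without
  division.\<close>

definition pfaff :: "nat \<Rightarrow> (nat \<Rightarrow> nat \<Rightarrow> 'a::comm_ring_1) \<Rightarrow> 'a" where
  "pfaff n B = (\<Sum>p | p permutes {0..<2 * n}. signof p * (\<Prod>i<n. B (p (2 * i)) (p (Suc (2 * i)))))"

text \<open>The pairs are antisymmetrized one at a time, \<open>Q m\<close> having the first
  \<open>m\<close> done. Precomposing a permutation with the transposition of the positions
  \<open>2 m\<close> and \<open>2 m + 1\<close> swaps the arguments of one factor and flips the
  sign, so each step doubles the sum.\<close>

lemma pfaff_antisymmetrize:
  "pfaff n (\<lambda>a b. A a b - A b a) = 2 ^ n * pfaff n A"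
proof -
  let ?P = "{p. p permutes {0..<2 * n}}"
  define Q where "Q m = (\<Sum>p\<in>?P. signof p * (\<Prod>i<n. if i < m then A (p (2 * i)) (p (Suc (2 * i))) - A (p (Suc (2 * i))) (p (2 * i))
    else A (p (2 * i)) (p (Suc (2 * i)))))" for m
  have step: "Q (Suc m) = 2 * Q m" if "m < n" for m
  proof -
    define R where "R p = (\<Prod>i\<in>{..<n} - {m}. if i < m then A (p (2 * i)) (p (Suc (2 * i))) - A (p (Suc (2 * i))) (p (2 * i))
      else A (p (2 * i)) (p (Suc (2 * i))))" for p
    let ?t = "Transposition.transpose (2 * m) (Suc (2 * m))"
    have t: "?t permutes {0..<2 * n}" using that by (intro permutes_swap_id) auto
    have R: "R (p \<circ> ?t) = R p" for p
    proof -
      have "?t (2 * i) = 2 * i" "?t (Suc (2 * i)) = Suc (2 * i)" if "i \<noteq> m" for i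
        using that by (simp_all add: Transposition.transpose_def)
      then show ?thesis unfolding R_def by (intro prod.cong refl) simp
    qed
    have 1: "Q m = (\<Sum>p\<in>?P. signof p * (A (p (2 * m)) (p (Suc (2 * m))) * R p))"
      unfolding Q_def R_def using that by (intro sum.cong refl) (simp add: prod.remove[of "{..<n}" m])
    have "Q (Suc m) = (\<Sum>p\<in>?P. signof p * ((A (p (2 * m)) (p (Suc (2 * m))) - A (p (Suc (2 * m))) (p (2 * m))) * R p))"
    proof -
      have "(\<Prod>i\<in>{..<n} - {m}. if i < Suc m then A (p (2 * i)) (p (Suc (2 * i))) - A (p (Suc (2 * i))) (p (2 * i))
        else A (p (2 * i)) (p (Suc (2 * i)))) = R p" for p
        unfolding R_def by (intro prod.cong refl) (auto simp: less_Suc_eq)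
      then show ?thesis
        unfolding Q_def using that by (simp add: prod.remove[of "{..<n}" m])
    qed
    also have "\<dots> = Q m - (\<Sum>p\<in>?P. signof p * (A (p (Suc (2 * m))) (p (2 * m)) * R p))"
      unfolding 1 by (simp add: algebra_simps sum_subtractf)
    also have "(\<Sum>p\<in>?P. signof p * (A (p (Suc (2 * m))) (p (2 * m)) * R p))
       = (\<Sum>p\<in>?P. signof (p \<circ> ?t) * (A ((p \<circ> ?t) (Suc (2 * m))) ((p \<circ> ?t) (2 * m)) * R (p \<circ> ?t)))"
      using sum.reindex_bij_betw[OF bij_betw_byWitness[of ?P "\<lambda>p. p \<circ> ?t" "\<lambda>p. p \<circ> ?t" ?P],
        of "\<lambda>p. signof p * (A (p (Suc (2 * m))) (p (2 * m)) * R p)"] t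
      by (auto simp: comp_assoc permutes_compose image_subset_iff)
    also have "\<dots> = (\<Sum>p\<in>?P. - (signof p * (A (p (2 * m)) (p (Suc (2 * m))) * R p)))"
    proof (rule sum.cong[OF refl])
      fix p assume "p \<in> ?P"
      then have "permutation p" by (auto intro: permutation_permutes[THEN iffD2])
      then have "sign (p \<circ> ?t) = - sign p"
        by (simp add: sign_compose permutation_swap_id sign_swap_id)
      then show "signof (p \<circ> ?t) * (A ((p \<circ> ?t) (Suc (2 * m))) ((p \<circ> ?t) (2 * m)) * R (p \<circ> ?t))
          = - (signof p * (A (p (2 * m)) (p (Suc (2 * m))) * R p))"
        by (simp add: R)
    qed
    finally show ?thesis unfolding 1 by (simp add: sum_negf)
  qed
  have "Q m = 2 ^ m * Q 0" if "m \<le> n" for m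
    using that by (induction m) (simp_all add: step mult.assoc)
  from this[of n] show ?thesis by (simp add: Q_def pfaff_def)
qed

lemma pfaff_sum:
  assumes "finite X"
  shows "pfaff n (\<lambda>a b. \<Sum>k\<in>X. U k a * W k b)
    = (\<Sum>k\<in>PiE {0..<n} (\<lambda>_. X). dt (2 * n) (interleave (\<lambda>i. U (k i)) (\<lambda>i. W (k i))))"
proof -
  have "pfaff n (\<lambda>a b. \<Sum>k\<in>X. U k a * W k b)
    = (\<Sum>p | p permutes {0..<2 * n}. \<Sum>k\<in>PiE {0..<n} (\<lambda>_. X). signof p * (\<Prod>i = 0..<n. U (k i) (p (2 * i)) * W (k i) (p (Suc (2 * i)))))"
    unfolding pfaff_def lessThan_atLeast0 using assms
    by (intro sum.cong refl) (simp add: prod_sum_PiE sum_distrib_left)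
  also have "\<dots> = (\<Sum>k\<in>PiE {0..<n} (\<lambda>_. X). \<Sum>p | p permutes {0..<2 * n}. signof p * (\<Prod>i = 0..<n. U (k i) (p (2 * i)) * W (k i) (p (Suc (2 * i)))))"
    by (rule sum.swap)
  also have "\<dots> = (\<Sum>k\<in>PiE {0..<n} (\<lambda>_. X). dt (2 * n) (interleave (\<lambda>i. U (k i)) (\<lambda>i. W (k i))))"
    unfolding dt_leibniz by (simp only: lessThan_atLeast0[symmetric] prod_double interleave_simps)
  finally show ?thesis .
qed

text \<open>A transposition of two indices exchanges two pairs of rows, which is an even permutation
  of the \<open>2 n\<close> rows.\<close>

lemma dt_interleave_permute:
  assumes "p permutes {0..<n}"
  shows "dt (2 * n) (interleave (u \<circ> p) (w \<circ> p)) = dt (2 * n) (interleave u w)"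
  using finite_atLeastLessThan[of 0 n] assms
proof (induction p arbitrary: u w rule: permutes_rev_induct)
  case (swap a b p)
  have step: "dt (2 * n) (interleave (u \<circ> Transposition.transpose a b) (w \<circ> Transposition.transpose a b)) = dt (2 * n) (interleave u w)"
    (is "dt _ ?v = _") for u w
  proof (cases "a = b")
    case False
    let ?s = "Transposition.transpose (2 * a) (2 * b)" and ?t = "Transposition.transpose (Suc (2 * a)) (Suc (2 * b))"
    have st: "?s permutes {0..<2 * n}" "?t permutes {0..<2 * n}"
      using swap by (auto intro!: permutes_swap_id)
    have "?v r = interleave u w (?t (?s r))" for r
    proof (cases "even r")
      case True
      then obtain i where "r = 2 * i" by blast
      then show ?thesis by (auto simp: Transposition.transpose_def; presburger)
    next
      case False
      then obtain i where "r = Suc (2 * i)" by (metis oddE Suc_eq_plus1)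
      then show ?thesis by (auto simp: Transposition.transpose_def; presburger)
    qed
    then have "?v = (\<lambda>r. interleave u w (?t (?s r)))" by (rule ext)
    then have "dt (2 * n) ?v = dt (2 * n) (\<lambda>r. interleave u w (?t (?s r)))" by (rule arg_cong)
    also have "\<dots> = signof ?s * (signof ?t * dt (2 * n) (interleave u w))"
      by (simp only: dt_permute_rows[OF st(1), of "\<lambda>r. interleave u w (?t r)"]
          dt_permute_rows[OF st(2), of "interleave u w"])
    also have "\<dots> = dt (2 * n) (interleave u w)" using False by (simp add: sign_swap_id)
    finally show ?thesis .
  qed (simp add: comp_def)
  show ?case using step[of "u \<circ> p" "w \<circ> p"] swap.IH[of u w]
    by (simp only: comp_assoc)
qed (simp add: comp_def)

text \<open>A minor summation formula of de Bruijn type. After antisymmetrization only the products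
  \<open>U k a * W k b\<close> are expanded; tuples with a repeated index give equal rows, and the
  determinant does not depend on the order of the pairs.\<close>

lemma pfaff_minor_summation:
  fixes U W :: "nat \<Rightarrow> nat \<Rightarrow> 'a::comm_ring_1"
  assumes X: "finite X"
  shows "pfaff n (\<lambda>a b. \<Sum>k\<in>X. U k a * W k b - W k a * U k b)
    = 2 ^ n * of_nat (fact n) * (\<Sum>A | A \<subseteq> X \<and> card A = n.
        dt (2 * n) (interleave (\<lambda>i. U (desc A i)) (\<lambda>i. W (desc A i))))"
proof -
  let ?F = "\<lambda>k. dt (2 * n) (interleave (\<lambda>i. U (k i)) (\<lambda>i. W (k i)))"
  have "pfaff n (\<lambda>a b. \<Sum>k\<in>X. U k a * W k b - W k a * U k b)
     = pfaff n (\<lambda>a b. (\<Sum>k\<in>X. U k a * W k b) - (\<Sum>k\<in>X. U k b * W k a))"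
    by (simp add: sum_subtractf mult.commute)
  also have "\<dots> = 2 ^ n * pfaff n (\<lambda>a b. \<Sum>k\<in>X. U k a * W k b)"
    by (rule pfaff_antisymmetrize)
  also have "pfaff n (\<lambda>a b. \<Sum>k\<in>X. U k a * W k b) = (\<Sum>k\<in>PiE {0..<n} (\<lambda>_. X). ?F k)"
    by (rule pfaff_sum[OF X])
  also have "\<dots> = of_nat (fact n) * (\<Sum>A | A \<subseteq> X \<and> card A = n. ?F (desc A))"
  proof (rule sum_PiE_symmetric[OF X])
    fix k :: "nat \<Rightarrow> nat" assume "\<not> inj_on k {0..<n}"
    then obtain i j where "i < n" "j < n" "i \<noteq> j" "k i = k j" by (auto simp: inj_on_def)
    then show "?F k = 0" by (intro dt_equal_rows[of "2 * i" _ "2 * j"]) auto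
  next
    fix k p :: "nat \<Rightarrow> nat" assume "p permutes {0..<n}"
    from dt_interleave_permute[OF this, of "\<lambda>i. U (k i)" "\<lambda>i. W (k i)"]
    show "?F (k \<circ> p) = ?F k" by (simp add: comp_def)
  qed
  finally show ?thesis by (simp add: mult_ac)
qed

section \<open>Autocorrelations and Toeplitz-plus-Hankel determinants\<close>

definition corr :: "(int \<Rightarrow> 'a::comm_ring_1) \<Rightarrow> nat \<Rightarrow> int \<Rightarrow> 'a" where
  "corr h K d = (\<Sum>l\<in>{0..int K}. h l * h (l + d))"

definition supported :: "(int \<Rightarrow> 'a::comm_ring_1) \<Rightarrow> nat \<Rightarrow> bool" where
  "supported h K \<longleftrightarrow> (\<forall>i. i < 0 \<or> i > int K \<longrightarrow> h i = 0)"

text \<open>For \<open>h\<close> supported on \<open>{0..K}\<close> the truncated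
  \<open>corr h K d\<close> equals the sum of \<open>h l * h (l + d)\<close> over all integers
  \<open>l\<close>, so any window that covers the support computes it.\<close>

lemma corr_shift:
  assumes "supported h K" "int a + c \<le> 0" "int K < int b + c"
  shows "(\<Sum>k\<in>{a..<b}. h (int k + c) * h (int k + c + d)) = corr h K d"
proof -
  have "(\<Sum>k\<in>{a..<b}. h (int k + c) * h (int k + c + d))
      = (\<Sum>l\<in>(\<lambda>k. int k + c) ` {a..<b}. h l * h (l + d))"
    by (subst sum.reindex) (auto simp: inj_on_def)
  also have "\<dots> = corr h K d"
    unfolding corr_def
  proof (rule sum.mono_neutral_right)
    show "{0..int K} \<subseteq> (\<lambda>k. int k + c) ` {a..<b}"
    proof
      fix l assume "l \<in> {0..int K}"
      then have "l = int (nat (l - c)) + c" "nat (l - c) \<in> {a..<b}" using assms(2,3) by auto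
      then show "l \<in> (\<lambda>k. int k + c) ` {a..<b}" by blast
    qed
  qed (use assms(1) in \<open>auto simp: supported_def\<close>)
  finally show ?thesis .
qed

lemma corr_even:
  assumes "supported h K" shows "corr h K (- d) = corr h K d"
proof -
  have "corr h K (- d) = (\<Sum>k\<in>{0..<K + nat \<bar>d\<bar> + nat \<bar>d\<bar> + 1}. h (int k + (- \<bar>d\<bar>)) * h (int k + (- \<bar>d\<bar>) + (- d)))"
    by (rule corr_shift[symmetric]) (use assms in auto)
  also have "\<dots> = (\<Sum>k\<in>{0..<K + nat \<bar>d\<bar> + nat \<bar>d\<bar> + 1}. h (int k + (- \<bar>d\<bar> - d)) * h (int k + (- \<bar>d\<bar> - d) + d))"
    by (simp add: mult.commute algebra_simps)
  also have "\<dots> = corr h K d"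
    by (rule corr_shift) (use assms in auto)
  finally show ?thesis .
qed

text \<open>The coefficient of \<open>\<Prod>_i z_i^(i+1)\<close> in the Weyl denominator times
  \<open>\<Prod>_i \<Sum>_d g d z_i^d\<close>.\<close>

definition toeplitz_hankel :: "nat \<Rightarrow> (int \<Rightarrow> 'a::comm_ring_1) \<Rightarrow> 'a" where
  "toeplitz_hankel n g = dt n (\<lambda>i j. g (int i - int j) - g (int i + int j + 2))"

definition delta :: "nat \<Rightarrow> laurent" where
  "delta n = dt n (\<lambda>i j. zp i (int (Suc j)) - zp i (- int (Suc j)))"

lemma delta_alt: "delta n = dt n (\<lambda>i j. zp i 1 ^ Suc j - zp i (-1) ^ Suc j)"
  unfolding delta_def zp_power by (simp add: algebra_simps)

text \<open>At the inverse variables the Weyl denominator is \<open>(-1)^n * delta n\<close>.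
  Pairing it with \<open>delta n\<close> term by term gives \<open>fact n\<close> equal
  determinants; each entry is a signed sum of four values of \<open>g\<close> that agree in pairs
  because \<open>g\<close> is even, whence \<open>2^n\<close>.\<close>

lemma lfun_delta_delta:
  assumes even: "\<And>d. g (- d) = g d"
  shows "lfun n (\<lambda>_. g) ((-1) ^ n * (delta n)\<^sup>2) = 2 ^ n * of_nat (fact n) * toeplitz_hankel n g"
proof -
  let ?P = "{p. p permutes {0..<n}}"
  define a where "a i j = zp i (int (Suc j)) - zp i (- int (Suc j))" for i j
  define b where "b i j = - a i j" for i j
  define u where "u j k = (sng (int (Suc j) + - int (Suc k)) 1 - sng (int (Suc j) + int (Suc k)) 1
     - sng (- int (Suc j) + - int (Suc k)) 1 + sng (- int (Suc j) + int (Suc k)) 1 :: int \<Rightarrow>\<^sub>0 complex)" for j k :: nat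
  define C where "C j k = g (int j - int k) - g (int j + int k + 2)" for j k :: nat
  have ab: "a i j * b i k = lin cst (zp i) (u j k)" for i j k
  proof -
    have "(P - N) * - (P' - N') = P * N' - P * P' - N * N' + N * P'" for P N P' N' :: laurent
      by (simp add: algebra_simps)
    then show ?thesis
      by (simp only: u_def lin_add lin_diff lin_single scalars_cst cst_simps zp_add mult_1 a_def b_def)
  qed
  have g0: "int (Suc j) + - int (Suc k) = int j - int k" "int (Suc j) + int (Suc k) = int j + int k + 2"
    "- int (Suc j) + - int (Suc k) = - (int j + int k + 2)" "- int (Suc j) + int (Suc k) = - (int j - int k)" for j k
    by simp_all
  have gu: "lin cst g (u j k) = 2 * C j k" for j k
    unfolding u_def g0 C_def by (simp only: lin_add lin_diff lin_single scalars_cst cst_simps mult_1 even) simp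
  have "(-1) ^ n * (delta n)\<^sup>2 = dt n a * dt n b"
  proof -
    have "dt n b = (-1) ^ n * dt n a" using dt_neg_rows[of n a] by (simp only: b_def[abs_def])
    moreover have "delta n = dt n a" by (simp only: delta_def a_def[abs_def])
    ultimately show ?thesis by (simp add: power2_eq_square)
  qed
  also have "\<dots> = (\<Sum>p\<in>?P. \<Sum>q\<in>?P. signof p * (signof q * (\<Prod>i<n. lin cst (zp i) (u (p i) (q i)))))"
    unfolding dt_leibniz sum_product ab[symmetric] by (simp add: prod.distrib mult_ac lessThan_atLeast0)
  finally have "lfun n (\<lambda>_. g) ((-1) ^ n * (delta n)\<^sup>2)
      = (\<Sum>p\<in>?P. \<Sum>q\<in>?P. signof p * (signof q * (\<Prod>i<n. 2 * C (p i) (q i))))"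
    by (simp only: lfun_linear lfun_signof lfun_prod_uni gu)
  also have "\<dots> = (\<Sum>p\<in>?P. signof p * dt n (\<lambda>i j. 2 * C (p i) j))"
    unfolding dt_leibniz by (simp add: sum_distrib_left lessThan_atLeast0)
  also have "\<dots> = (\<Sum>p\<in>?P. dt n (\<lambda>i j. 2 * C i j))"
    by (intro sum.cong refl) (simp add: dt_permute_rows[of _ n "\<lambda>i j. 2 * C i j"] mult.assoc[symmetric] signof_square)
  also have "\<dots> = of_nat (fact n) * dt n (\<lambda>i j. 2 * C i j)"
    by (simp add: card_permutations)
  also have "dt n (\<lambda>i j. 2 * C i j) = 2 ^ n * toeplitz_hankel n g"
    using dt_scale_rows[of n "\<lambda>_. 2" C] by (simp add: C_def[abs_def] toeplitz_hankel_def)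
  finally show ?thesis by (simp add: mult_ac)
qed

lemma lfun_vand:
  "lfun n (\<lambda>_. g) ((\<Prod>i<n. zp i 1 - zp i (-1)) * vand (2 * n) (interleave (\<lambda>i. zp i 1) (\<lambda>i. zp i (-1))))
    = pfaff n (\<lambda>a b. g (int a - int b + 1) - g (int a - int b - 1))"
proof -
  let ?P = "{p. p permutes {0..<2 * n}}"
  define u where "u a b = (sng (int a - int b + 1) 1 - sng (int a - int b - 1) 1 :: int \<Rightarrow>\<^sub>0 complex)" for a b :: nat
  have u: "(zp i 1 - zp i (-1)) * (zp i 1 ^ a * zp i (-1) ^ b) = lin cst (zp i) (u a b)" for i a b
    by (simp add: u_def lin_diff lin_single zp_power zp_add[symmetric] algebra_simps)
  have "(\<Prod>i<n. zp i 1 - zp i (-1)) * vand (2 * n) (interleave (\<lambda>i. zp i 1) (\<lambda>i. zp i (-1)))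
     = (\<Sum>p\<in>?P. signof p * ((\<Prod>i<n. zp i 1 - zp i (-1)) * (\<Prod>i<n. zp i 1 ^ p (2 * i) * zp i (-1) ^ p (Suc (2 * i)))))"
    unfolding dt_vandermonde[symmetric] dt_leibniz
    by (simp only: lessThan_atLeast0[symmetric] prod_double interleave_simps sum_distrib_left mult.left_commute)
  also have "\<dots> = (\<Sum>p\<in>?P. signof p * (\<Prod>i<n. lin cst (zp i) (u (p (2 * i)) (p (Suc (2 * i))))))"
    by (simp only: prod.distrib[symmetric] u)
  finally show ?thesis
    by (simp only: lfun_linear lfun_signof lfun_prod_uni pfaff_def) (simp add: u_def lin_diff lin_single)
qed

text \<open>Both sides are images of \<open>(-1)^n * (delta n)^2\<close> under the functional
  \<open>z^e \<mapsto> \<Prod>_i g (e_i)\<close>. As a product of two determinants it gives the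
  right hand side, through the Vandermonde product in \<open>2 n\<close> variables the left.\<close>

lemma pfaff_eq_toeplitz_hankel:
  assumes "\<And>d. g (- d) = g d"
  shows "pfaff n (\<lambda>a b. g (int a - int b + 1) - g (int a - int b - 1)) = 2 ^ n * of_nat (fact n) * (toeplitz_hankel n g :: ppoly)"
  unfolding lfun_vand[symmetric] lfun_delta_delta[of g n, OF assms, symmetric] delta_alt
  by (subst vand_interleave_symplectic) (simp_all add: zp_inv)

text \<open>Minor summation with \<open>U k c = h (k - c)\<close> and
  \<open>W k c = h (k + 1 - c)\<close>: the pfaffian then has the entries
  \<open>g (a - b + 1) - g (a - b - 1)\<close> with \<open>g = corr h K\<close>. The bound on
  \<open>M\<close> lets \<open>k\<close> run over every shifted copy of the support.\<close>

lemma double_sum_toeplitz_hankel: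
  fixes h :: "int \<Rightarrow> ppoly"
  assumes h: "supported h K" and M: "M \<ge> K + 2 * n + 2"
  shows "(\<Sum>A | A \<subseteq> {0..<M} \<and> card A = n. dt (2 * n) (interleave (\<lambda>i c. h (int (desc A i) - int c)) (\<lambda>i c. h (int (desc A i) + 1 - int c))))
     = toeplitz_hankel n (corr h K)" (is "?S = _")
proof -
  let ?U = "\<lambda>k c. h (int k - int c)" and ?W = "\<lambda>k c. h (int k + 1 - int c)"
  have "corr h K (int a - int b + 1) - corr h K (int a - int b - 1)
     = (\<Sum>k\<in>{0..<M}. ?U k a * ?W k b - ?W k a * ?U k b)" if "a < 2 * n" "b < 2 * n" for a b
  proof -
    have "corr h K (int a - int b + 1) = (\<Sum>k\<in>{0..<M}. h (int k + (- int a)) * h (int k + (- int a) + (int a - int b + 1)))"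
      by (rule corr_shift[symmetric]) (use h M that in auto)
    moreover have "corr h K (int a - int b - 1) = (\<Sum>k\<in>{0..<M}. h (int k + (- int b)) * h (int k + (- int b) + (int b - int a + 1)))"
      using corr_even[OF h, of "int b - int a + 1"]
      by (subst corr_shift[OF h]) (use M that in \<open>auto simp: algebra_simps\<close>)
    ultimately show ?thesis by (simp add: sum_subtractf algebra_simps)
  qed
  then have "pfaff n (\<lambda>a b. corr h K (int a - int b + 1) - corr h K (int a - int b - 1))
     = pfaff n (\<lambda>a b. \<Sum>k\<in>{0..<M}. ?U k a * ?W k b - ?W k a * ?U k b)"
    unfolding pfaff_def
  proof (intro sum.cong refl arg_cong2[of _ _ _ _ "(*)"] prod.cong)
    fix p i assume e: "\<And>a b. a < 2 * n \<Longrightarrow> b < 2 * n \<Longrightarrow> corr h K (int a - int b + 1) - corr h K (int a - int b - 1)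
      = (\<Sum>k\<in>{0..<M}. ?U k a * ?W k b - ?W k a * ?U k b)"
      and "p \<in> {p. p permutes {0..<2 * n}}" "i \<in> {..<n}"
    then have "p (2 * i) < 2 * n" "p (Suc (2 * i)) < 2 * n"
      using permutes_in_image[of p "{0..<2 * n}" "2 * i"] permutes_in_image[of p "{0..<2 * n}" "Suc (2 * i)"] by auto
    then show "corr h K (int (p (2 * i)) - int (p (Suc (2 * i))) + 1) - corr h K (int (p (2 * i)) - int (p (Suc (2 * i))) - 1)
      = (\<Sum>k\<in>{0..<M}. ?U k (p (2 * i)) * ?W k (p (Suc (2 * i))) - ?W k (p (2 * i)) * ?U k (p (Suc (2 * i))))"
      by (rule e)
  qed
  also have "\<dots> = 2 ^ n * of_nat (fact n) * ?S"
    by (rule pfaff_minor_summation) simp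
  finally have "2 ^ n * of_nat (fact n) * ?S = 2 ^ n * of_nat (fact n) * toeplitz_hankel n (corr h K)"
    by (simp add: pfaff_eq_toeplitz_hankel corr_even[OF h])
  moreover have "2 ^ n * of_nat (fact n) \<noteq> (0 :: ppoly)" by simp
  ultimately show ?thesis by (subst (asm) mult_left_cancel)
qed

text \<open>The Andreief identity with the same determinant twice. The four products in
  \<open>a k i * a k j\<close> correlate to \<open>g (i - j)\<close> twice and to
  \<open>- g (i + j + 2)\<close> twice, which is the origin of \<open>2^n\<close>.\<close>

lemma square_sum_toeplitz_hankel:
  fixes h :: "int \<Rightarrow> ppoly"
  assumes h: "supported h K" and M: "M \<ge> K + 2 * n + 2"
  shows "(\<Sum>A | A \<subseteq> {0..<M} \<and> card A = n. (dt n (\<lambda>i j. h (int (desc A i) - int n + int (Suc j)) - h (int (desc A i) - int n - int (Suc j))))\<^sup>2)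
     = 2 ^ n * toeplitz_hankel n (corr h K)" (is "?S = _")
proof -
  define a where "a k j = h (int k - int n + int (Suc j)) - h (int k - int n - int (Suc j))" for k j :: nat
  define F where "F k = dt n (\<lambda>i j. a (k i) j) * dt n (\<lambda>i j. a (k i) j)" for k :: "nat \<Rightarrow> nat"
  have sh: "(\<Sum>k\<in>{0..<M}. h (int k + c) * h (int k + c')) = corr h K d"
    if "c \<le> 0" "int K < int M + c" "d = c' - c" for c c' d
    using corr_shift[OF h, of 0 c M d] that by simp
  have C: "(\<Sum>k\<in>{0..<M}. a k i * a k j) = 2 * (corr h K (int i - int j) - corr h K (int i + int j + 2))"
    if "i < n" "j < n" for i j
  proof -
    have e1: "corr h K (int j - int i) = corr h K (int i - int j)"
      using corr_even[OF h, of "int i - int j"] by simp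
    have s1: "(\<Sum>k\<in>{0..<M}. h (int k + (int i + 1 - int n)) * h (int k + (int j + 1 - int n))) = corr h K (int j - int i)"
      by (rule sh) (use that M in auto)
    have s2: "(\<Sum>k\<in>{0..<M}. h (int k + (int i + 1 - int n)) * h (int k + (- int j - 1 - int n))) = corr h K (- (int i + int j + 2))"
      by (rule sh) (use that M in auto)
    have s3: "(\<Sum>k\<in>{0..<M}. h (int k + (- int i - 1 - int n)) * h (int k + (int j + 1 - int n))) = corr h K (int i + int j + 2)"
      by (rule sh) (use that M in auto)
    have s4: "(\<Sum>k\<in>{0..<M}. h (int k + (- int i - 1 - int n)) * h (int k + (- int j - 1 - int n))) = corr h K (int i - int j)"
      by (rule sh) (use that M in auto)
    have "(\<Sum>k\<in>{0..<M}. a k i * a k j)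
      = (\<Sum>k\<in>{0..<M}. h (int k + (int i + 1 - int n)) * h (int k + (int j + 1 - int n)))
      - (\<Sum>k\<in>{0..<M}. h (int k + (int i + 1 - int n)) * h (int k + (- int j - 1 - int n)))
      - (\<Sum>k\<in>{0..<M}. h (int k + (- int i - 1 - int n)) * h (int k + (int j + 1 - int n)))
      + (\<Sum>k\<in>{0..<M}. h (int k + (- int i - 1 - int n)) * h (int k + (- int j - 1 - int n)))"
      by (simp add: a_def sum_subtractf[symmetric] sum.distrib[symmetric] algebra_simps)
    also have "\<dots> = 2 * (corr h K (int i - int j) - corr h K (int i + int j + 2))"
      unfolding s1 s2 s3 s4 corr_even[OF h] e1 by simp
    finally show ?thesis .
  qed
  have "of_nat (fact n) * (\<Sum>A | A \<subseteq> {0..<M} \<and> card A = n. F (desc A)) = (\<Sum>k\<in>PiE {0..<n} (\<lambda>_. {0..<M}). F k)"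
  proof (rule sum_PiE_symmetric[symmetric])
    fix k :: "nat \<Rightarrow> nat" assume "\<not> inj_on k {0..<n}"
    then obtain i j where "i < n" "j < n" "i \<noteq> j" "k i = k j" by (auto simp: inj_on_def)
    then have "dt n (\<lambda>i j. a (k i) j) = 0" by (intro dt_equal_rows[of i _ j]) auto
    then show "F k = 0" by (simp add: F_def)
  next
    fix k p :: "nat \<Rightarrow> nat" assume "p permutes {0..<n}"
    from dt_permute_rows[OF this, of "\<lambda>i. a (k i)"]
    show "F (k \<circ> p) = F k" using signof_square[of p, where 'a = ppoly]
      by (simp add: F_def comp_def)
  qed simp
  also have "\<dots> = of_nat (fact n) * dt n (\<lambda>i j. \<Sum>k\<in>{0..<M}. a k i * a k j)"
    unfolding F_def by (rule sum_PiE_dt_dt) simp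
  also have "dt n (\<lambda>i j. \<Sum>k\<in>{0..<M}. a k i * a k j) = dt n (\<lambda>i j. 2 * (corr h K (int i - int j) - corr h K (int i + int j + 2)))"
    by (rule dt_cong) (rule C)
  also have "\<dots> = 2 ^ n * toeplitz_hankel n (corr h K)"
    by (simp only: dt_scale_rows[of n "\<lambda>_. 2"] toeplitz_hankel_def) simp
  finally have "(\<Sum>A | A \<subseteq> {0..<M} \<and> card A = n. F (desc A)) = 2 ^ n * toeplitz_hankel n (corr h K)"
    by (subst (asm) mult_left_cancel) simp_all
  then show ?thesis by (simp add: F_def a_def[abs_def] power2_eq_square)
qed

section \<open>Formal exponentials and logarithmic derivatives\<close>

definition gexp :: "(nat \<Rightarrow> 'a::comm_ring_1) \<Rightarrow> 'a fps \<Rightarrow> 'a fps" where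
  "gexp c A = Abs_fps (\<lambda>i. \<Sum>k\<le>i. c k * fps_nth (A ^ k) i)"

lemma fps_power_nth_0: "fps_nth A 0 = 0 \<Longrightarrow> i < k \<Longrightarrow> fps_nth (A ^ k) i = (0 :: 'a::comm_ring_1)"
  using startsby_zero_power_prefix[of A k] by blast

lemma gexp_nth:
  assumes "fps_nth A 0 = 0" "i \<le> N"
  shows "fps_nth (gexp c A) i = (\<Sum>k\<le>N. c k * fps_nth (A ^ k) i)"
  unfolding gexp_def using assms
  by (simp, intro sum.mono_neutral_left) (simp_all add: fps_power_nth_0 Ball_def not_le)

text \<open>The sequence \<open>c\<close> stands for \<open>1 / fact k\<close> in the coefficient
  ring, through its recursion. The cutoffs differ from one coefficient to the next; they are aligned
  by \<open>gexp_nth\<close>, since \<open>A ^ k\<close> has no terms below degree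
  \<open>k\<close>.\<close>

lemma gexp_deriv:
  assumes A: "fps_nth A 0 = 0" and c: "\<And>k. of_nat (Suc k) * c (Suc k) = c k"
  shows "fps_deriv (gexp c A) = fps_deriv A * gexp c A"
proof (rule fps_ext)
  fix i
  have "fps_nth (fps_deriv (gexp c A)) i = (\<Sum>k\<le>Suc i. c k * fps_nth (fps_deriv (A ^ k)) i)"
    by (simp only: fps_deriv_nth Suc_eq_plus1[symmetric] gexp_nth[OF A le_refl] sum_distrib_left mult.left_commute)
  also have "\<dots> = (\<Sum>k\<le>i. c (Suc k) * fps_nth (fps_deriv (A ^ Suc k)) i)"
    by (simp only: sum.atMost_Suc_shift) simp
  also have "\<dots> = (\<Sum>k\<le>i. c k * fps_nth (fps_deriv A * A ^ k) i)"
  proof (rule sum.cong[OF refl])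
    fix k
    have "fps_deriv (A ^ Suc k) = fps_const (of_nat (Suc k)) * (fps_deriv A * A ^ k)"
      by (simp only: fps_deriv_power diff_Suc_1 mult.assoc)
    then have "fps_nth (fps_deriv (A ^ Suc k)) i = of_nat (Suc k) * fps_nth (fps_deriv A * A ^ k) i"
      by (simp only: fps_mult_left_const_nth)
    then have "c (Suc k) * fps_nth (fps_deriv (A ^ Suc k)) i = (of_nat (Suc k) * c (Suc k)) * fps_nth (fps_deriv A * A ^ k) i"
      by (simp only: mult_ac)
    then show "c (Suc k) * fps_nth (fps_deriv (A ^ Suc k)) i = c k * fps_nth (fps_deriv A * A ^ k) i"
      by (simp only: c)
  qed
  also have "\<dots> = (\<Sum>k\<le>i. \<Sum>j = 0..i. fps_nth (fps_deriv A) j * (c k * fps_nth (A ^ k) (i - j)))"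
    by (simp only: fps_mult_nth sum_distrib_left mult.left_commute)
  also have "\<dots> = (\<Sum>j = 0..i. \<Sum>k\<le>i. fps_nth (fps_deriv A) j * (c k * fps_nth (A ^ k) (i - j)))"
    by (rule sum.swap)
  also have "\<dots> = (\<Sum>j = 0..i. fps_nth (fps_deriv A) j * fps_nth (gexp c A) (i - j))"
    by (intro sum.cong refl) (simp only: gexp_nth[OF A, of "i - _" i] diff_le_self sum_distrib_left)
  finally show "fps_nth (fps_deriv (gexp c A)) i = fps_nth (fps_deriv A * gexp c A) i"
    by (simp only: fps_mult_nth)
qed

text \<open>The differential equation determines each coefficient from the earlier ones, because
  \<open>of_nat (Suc k)\<close> can be cancelled. This reduces identities between exponentials and
  products to their logarithmic derivatives.\<close>

lemma fps_log_deriv_unique: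
  fixes A :: "'a::{idom, ring_char_0} fps"
  assumes "fps_deriv X = A * X" "fps_deriv Y = A * Y" "fps_nth X 0 = fps_nth Y 0"
  shows "X = Y"
proof (rule fps_ext)
  fix i show "fps_nth X i = fps_nth Y i"
  proof (induction i rule: less_induct)
    case (less i)
    show ?case
    proof (cases i)
      case (Suc k)
      have "fps_nth (fps_deriv X) k = fps_nth (fps_deriv Y) k"
        unfolding assms fps_mult_nth using less Suc by (intro sum.cong refl) simp
      then have "of_nat (Suc k) * fps_nth X (Suc k) = of_nat (Suc k) * fps_nth Y (Suc k)"
        by (simp only: fps_deriv_nth Suc_eq_plus1)
      then show ?thesis using Suc by (simp del: of_nat_Suc)
    qed (use assms in simp)
  qed
qed

subsection \<open>One-row Schur functions\<close>

lemma inverse_fact_cst: "of_nat (Suc k) * cst (1 / fact (Suc k)) = (cst (1 / fact k) :: 'k::comm_monoid_add \<Rightarrow>\<^sub>0 complex)"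
  unfolding cst_of_nat[symmetric] cst_mult[symmetric] by (simp del: of_nat_Suc)

lemma schur_row_eq: "schur_row (int i) = fps_nth (gexp (\<lambda>k. cst (1 / fact k)) power_sum_zseries) i"
  by (simp add: schur_row_def exp_zseries_def gexp_def pconst_eq_cst)

lemma schur_row_neg: "i < 0 \<Longrightarrow> schur_row i = 0" by (simp add: schur_row_def)

lemma schur_row_0 [simp]: "schur_row 0 = 1"
  using schur_row_eq[of 0] by (simp add: gexp_def)

lemma schur_row_newton_Suc: "of_nat (Suc i) * schur_row (int (Suc i)) = (\<Sum>j\<le>i. pvar (Suc j) * schur_row (int (i - j)))"
proof -
  let ?A = power_sum_zseries
  have A: "fps_nth (fps_deriv ?A) j = pvar (Suc j)" for j
  proof -
    have "fps_nth (fps_deriv ?A) j = (cst (1 / of_nat (Suc j)) * of_nat (Suc j)) * pvar (Suc j)"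
      by (simp add: power_sum_zseries_def pconst_eq_cst mult_ac del: of_nat_Suc)
    then show ?thesis by (simp only: cst_inverse zero_less_Suc mult_1)
  qed
  have "fps_nth (fps_deriv (gexp (\<lambda>k. cst (1 / fact k)) ?A)) i
      = fps_nth (fps_deriv ?A * gexp (\<lambda>k. cst (1 / fact k)) ?A) i"
    by (rule arg_cong[OF gexp_deriv]) (simp add: power_sum_zseries_def, rule inverse_fact_cst)
  then show ?thesis
    by (simp only: fps_mult_nth A schur_row_eq atLeast0AtMost) (simp only: fps_deriv_nth Suc_eq_plus1)
qed

text \<open>Newton's identity for all integers \<open>a \<le> N\<close>, with a number of terms
  independent of \<open>a\<close>: the surplus terms have negative index. In this form
  \<open>a\<close> can be shifted under the sum.\<close>

lemma schur_row_newton: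
  assumes "a \<le> int N"
  shows "of_int a * schur_row a = (\<Sum>j<N. pvar (Suc j) * schur_row (a - 1 - int j))"
proof (cases "a \<le> 0")
  case True
  then have "of_int a * schur_row a = 0" by (cases "a = 0") (simp_all add: schur_row_neg)
  moreover have "(\<Sum>j<N. pvar (Suc j) * schur_row (a - 1 - int j)) = 0"
    using True by (intro sum.neutral) (simp add: schur_row_neg)
  ultimately show ?thesis by simp
next
  case False
  then obtain i where i: "a = int (Suc i)" by (metis not_le zero_less_imp_eq_int gr0_implies_Suc)
  have "of_int a * schur_row a = (\<Sum>j\<le>i. pvar (Suc j) * schur_row (int (i - j)))"
    using schur_row_newton_Suc[of i] by (simp add: i)
  also have "\<dots> = (\<Sum>j\<le>i. pvar (Suc j) * schur_row (a - 1 - int j))"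
    by (intro sum.cong refl) (simp add: i of_nat_diff)
  also have "\<dots> = (\<Sum>j<N. pvar (Suc j) * schur_row (a - 1 - int j))"
    using assms by (intro sum.mono_neutral_left) (auto simp: i schur_row_neg)
  finally show ?thesis .
qed

lemma pderiv_var_of_int: "pderiv_var m (of_int a * f) = of_int a * pderiv_var m f"
  using pderiv_var_cst_times[of m "of_int a" f] by (simp add: cst_of_int)

text \<open>Induction along Newton's identity. Differentiating its right hand side yields the same
  identity for \<open>a - m\<close>, divided by \<open>m\<close>, plus the term in which
  \<open>p_m\<close> itself is differentiated; that term makes up the difference between
  \<open>a - m\<close> and \<open>a\<close>.\<close>

lemma pderiv_schur_row:
  assumes "m > 0"
  shows "pderiv_var m (schur_row a) = cst (1 / of_nat m) * schur_row (a - int m)"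
proof (induction "nat a" arbitrary: a rule: less_induct)
  case less
  consider "a < 0" | "a = 0" | "a > 0" by linarith
  then show ?case
  proof cases
    case 3
    define N where "N = nat a + m"
    have N: "a \<le> int N" "a - int m \<le> int N" "m \<le> N" by (auto simp: N_def)
    have IH: "pderiv_var m (schur_row (a - 1 - int j)) = cst (1 / of_nat m) * schur_row (a - int m - 1 - int j)" for j
      using less[of "a - 1 - int j"] 3 by (simp add: algebra_simps)
    have "of_int a * pderiv_var m (schur_row a) = (\<Sum>j<N. pderiv_var m (pvar (Suc j) * schur_row (a - 1 - int j)))"
      unfolding pderiv_var_of_int[symmetric] schur_row_newton[OF N(1)] by (simp add: pderiv_var_sum)
    also have "\<dots> = (\<Sum>j<N. (if j = m - 1 then schur_row (a - 1 - int j) else 0)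
        + cst (1 / of_nat m) * (pvar (Suc j) * schur_row (a - int m - 1 - int j)))"
      using assms by (intro sum.cong refl) (auto simp: pderiv_var_mult pderiv_var_pvar IH mult_ac)
    also have "\<dots> = schur_row (a - int m) + cst (1 / of_nat m) * (of_int (a - int m) * schur_row (a - int m))"
      unfolding schur_row_newton[OF N(2)] sum_distrib_left sum.distrib
      using assms N(3) by (simp add: sum.delta' of_nat_diff)
    also have "\<dots> = of_int a * (cst (1 / of_nat m) * schur_row (a - int m))"
    proof -
      have "cst (1 / of_nat m) * of_int (a - int m) = cst (1 / of_nat m) * of_int a - (1 :: ppoly)"
        using cst_inverse[of m, where 'k = monomial] assms by (simp add: algebra_simps)
      then have "schur_row (a - int m) + (cst (1 / of_nat m) * of_int (a - int m)) * schur_row (a - int m)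
        = schur_row (a - int m) + (cst (1 / of_nat m) * of_int a - 1) * schur_row (a - int m)"
        by (simp only:)
      then show ?thesis by (simp only: mult.assoc) (simp only: algebra_simps, simp)
    qed
    finally show ?thesis using 3 by simp
  qed (use assms in \<open>simp_all add: schur_row_neg\<close>)
qed

text \<open>Monomials may contain the index \<open>0\<close>, for which the factor
  \<open>1 / m\<close> of the general formula is meaningless; the rows do not involve
  \<open>p_0\<close>.\<close>

lemma pderiv_0_schur_row: "pderiv_var 0 (schur_row a) = 0"
proof (induction "nat a" arbitrary: a rule: less_induct)
  case less
  consider "a < 0" | "a = 0" | "a > 0" by linarith
  then show ?case
  proof cases
    case 3
    have "of_int a * pderiv_var 0 (schur_row a) = (\<Sum>j<nat a. pderiv_var 0 (pvar (Suc j) * schur_row (a - 1 - int j)))"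
      unfolding pderiv_var_of_int[symmetric] using 3 by (subst schur_row_newton[of a "nat a"]) (simp_all add: pderiv_var_sum)
    also have "\<dots> = 0"
      using 3 by (intro sum.neutral) (auto simp: pderiv_var_mult pderiv_var_pvar less)
    finally show ?thesis using 3 by simp
  qed (simp_all add: schur_row_neg)
qed

lemma keys_schur_row:
  assumes "\<alpha> \<in> Poly_Mapping.keys (schur_row a)"
  shows "int (wt \<alpha>) = a"
  using assms
proof (induction "nat a" arbitrary: a \<alpha> rule: less_induct)
  case less
  consider "a < 0" | "a = 0" | "a > 0" by linarith
  then show ?case
  proof cases
    case 3
    have "lkp (of_int a * schur_row a) \<alpha> = of_int a * lkp (schur_row a) \<alpha>"
      using lookup_cst_times[of "of_int a" "schur_row a" \<alpha>] by (simp add: cst_of_int)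
    with 3 less.prems have "\<alpha> \<in> Poly_Mapping.keys (of_int a * schur_row a)" by (simp add: in_keys_iff)
    then have "\<alpha> \<in> Poly_Mapping.keys (\<Sum>j<nat a. pvar (Suc j) * schur_row (a - 1 - int j))"
      using 3 by (subst (asm) schur_row_newton[of a "nat a"]) simp_all
    then obtain j where "j < nat a" "\<alpha> \<in> Poly_Mapping.keys (pvar (Suc j) * schur_row (a - 1 - int j))"
      using keys_sum[of "\<lambda>j. pvar (Suc j) * schur_row (a - 1 - int j)" "{..<nat a}"] by blast
    then obtain \<beta> where "\<alpha> = sng (Suc j) 1 + \<beta>" "\<beta> \<in> Poly_Mapping.keys (schur_row (a - 1 - int j))"
      using keys_mult[of "pvar (Suc j)" "schur_row (a - 1 - int j)"] by (auto simp: pvar_def split: if_splits)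
    with less.hyps[of "a - 1 - int j" \<beta>] 3 show ?thesis by (simp add: wt_add wt_single)
  qed (use less.prems in \<open>auto simp: schur_row_neg\<close>)
qed

lemma high_schur_row: "int K < a \<Longrightarrow> high K (schur_row a)"
  using keys_schur_row[of _ a] by (force simp: high_def in_keys_iff)

subsection \<open>Partitions padded with zeros\<close>

definition pt :: "nat list \<Rightarrow> nat \<Rightarrow> nat" where "pt l i = (if i < length l then l ! i else 0)"

lemma schur_eq_dt:
  assumes "length l \<le> n"
  shows "schur l = dt n (\<lambda>i j. schur_row (int (pt l i) - int i + int j))"
  using assms
proof (induction n rule: dec_induct)
  case base
  show ?case unfolding schur_def dt_def
    by (intro arg_cong[of _ _ Determinant.det] eq_matI) (auto simp: pt_def)
next
  case (step n)
  show ?case using step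
    by (subst dt_Suc_last_row) (auto simp: pt_def schur_row_neg)
qed

lemma lfun_dt: "lfun n G (dt n (\<lambda>i j. lin cst (zp i) (u i j))) = dt n (\<lambda>i j. lin cst (G i) (u i j))"
  unfolding dt_leibniz lessThan_atLeast0[symmetric] by (simp only: lfun_linear lfun_signof lfun_prod_uni)

subsection \<open>The exponential of Omega\<close>

definition psum :: "nat \<Rightarrow> int \<Rightarrow> laurent" where "psum n m = (\<Sum>i<n. zp i m)"

text \<open>With \<open>k i = \<lambda>_i - i - 1\<close>, the determinant of the powers
  \<open>z_i^(-j-1)\<close> is mapped to the Jacobi-Trudi determinant of \<lambda>.\<close>

definition shifted_rows :: "nat \<Rightarrow> (nat \<Rightarrow> int) \<Rightarrow> laurent \<Rightarrow> ppoly" where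
  "shifted_rows n k = lfun n (\<lambda>i e. schur_row (k i - e))"

lemma shifted_rows_linear:
  "shifted_rows n k (f + g) = shifted_rows n k f + shifted_rows n k g"
  "shifted_rows n k (cst a * f) = cst a * shifted_rows n k f"
  "shifted_rows n k (\<Sum>x\<in>A. F x) = (\<Sum>x\<in>A. shifted_rows n k (F x))"
  "shifted_rows n k 0 = 0"
  by (simp_all add: shifted_rows_def lfun_linear)

lemma shifted_rows_single: "shifted_rows n k (sng e c) = cst c * (\<Prod>i<n. schur_row (k i - lkp e i))"
  by (simp add: shifted_rows_def lfun_def lin_single)

text \<open>Differentiating a row \<open>h_a\<close> by \<open>p_m\<close> lowers \<open>a\<close>
  by \<open>m\<close>, as does multiplication of the monomial by \<open>z_i^m\<close>; the product
  rule sums over \<open>i\<close>.\<close>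

lemma pderiv_shifted_rows:
  assumes "m > 0"
  shows "pderiv_var m (shifted_rows n k f) = cst (1 / of_nat m) * shifted_rows n k (psum n (int m) * f)"
proof (rule additive_eqI[of "\<lambda>f. pderiv_var m (shifted_rows n k f)"])
  fix e c
  have "shifted_rows n k (zp i (int m) * sng e c)
      = cst c * (schur_row (k i - lkp e i - int m) * (\<Prod>j\<in>{..<n} - {i}. schur_row (k j - lkp e j)))"
    if "i < n" for i
  proof -
    have "(\<Prod>j<n. schur_row (k j - lkp (sng i (int m) + e) j))
      = schur_row (k i - lkp e i - int m) * (\<Prod>j\<in>{..<n} - {i}. schur_row (k j - lkp e j))"
      using that by (simp add: prod.remove[of _ i] lookup_add lookup_single when_def algebra_simps)
    then show ?thesis by (simp add: zp_def mult_single shifted_rows_single)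
  qed
  then show "pderiv_var m (shifted_rows n k (sng e c)) = cst (1 / of_nat m) * shifted_rows n k (psum n (int m) * sng e c)"
    using assms
    by (simp add: shifted_rows_single pderiv_var_cst_times pderiv_var_prod pderiv_schur_row psum_def
        sum_distrib_right shifted_rows_linear) (simp add: sum_distrib_left mult_ac)
qed (simp_all add: shifted_rows_linear pderiv_var_add distrib_left)

text \<open>The coefficient of \<open>t^m\<close> in the logarithm of
  \<open>\<Prod>_(i\<le>j) (1 - t z_i z_j)\<close>; the auxiliary variable \<open>t\<close> records
  half the degree in \<open>z\<close>.\<close>

definition qlog :: "nat \<Rightarrow> nat \<Rightarrow> laurent" where
  "qlog n m = (if m = 0 then 0 else - (cst (1 / of_nat m) * (\<Sum>j<n. \<Sum>i\<le>j. (zp i 1 * zp j 1) ^ m)))"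

lemma symmetric_square_sum:
  fixes a :: "nat \<Rightarrow> 'a::comm_ring_1"
  shows "(\<Sum>i<n. a i)\<^sup>2 + (\<Sum>i<n. (a i)\<^sup>2) = 2 * (\<Sum>j<n. \<Sum>i\<le>j. a i * a j)"
proof (induction n)
  case (Suc n)
  have "(\<Sum>i<Suc n. a i)\<^sup>2 + (\<Sum>i<Suc n. (a i)\<^sup>2) = ((\<Sum>i<n. a i)\<^sup>2 + (\<Sum>i<n. (a i)\<^sup>2)) + 2 * (\<Sum>i\<le>n. a i * a n)"
    by (simp add: power2_eq_square algebra_simps sum_distrib_left sum_distrib_right lessThan_Suc_atMost[symmetric])
  with Suc show ?case by (simp add: algebra_simps)
qed simp

text \<open>The operator \<open>- m/2 \<partial>_m^2 - \<partial>_(2m)\<close> becomes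
  multiplication by \<open>- (P_m^2 + P_(2m)) / (2 m)\<close> with power sums \<open>P_m\<close> in
  \<open>z\<close>, and half the bracket is the sum of \<open>(z_i z_j)^m\<close> over
  \<open>i \<le> j\<close>.\<close>

lemma qlog_eq:
  assumes "m > 0"
  shows "cst (- of_nat m / 2) * (cst (1 / of_nat m) * (cst (1 / of_nat m) * (psum n (int m))\<^sup>2))
    - cst (1 / of_nat (2 * m)) * psum n (int (2 * m)) = qlog n m"
proof -
  have "(psum n (int m))\<^sup>2 + psum n (int (2 * m)) = 2 * (\<Sum>j<n. \<Sum>i\<le>j. zp i (int m) * zp j (int m))"
    using symmetric_square_sum[of "\<lambda>i. zp i (int m)" n] by (simp add: psum_def zp_power)
  then have P: "psum n (int (2 * m)) = 2 * (\<Sum>j<n. \<Sum>i\<le>j. (zp i 1 * zp j 1) ^ m) - (psum n (int m))\<^sup>2"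
    by (simp add: power_mult_distrib zp_power algebra_simps)
  have c: "cst (- of_nat m / 2) * (cst (1 / of_nat m) * (cst (1 / of_nat m))) = (- cst (1 / of_nat (2 * m)) :: laurent)"
    using assms unfolding cst_mult[symmetric] cst_uminus[symmetric] by (simp add: field_simps)
  have d: "cst (1 / of_nat (2 * m)) * 2 = (cst (1 / of_nat m) :: laurent)"
    using assms cst_of_nat[of 2, where 'k = "nat \<Rightarrow>\<^sub>0 int"] cst_mult[of "1 / of_nat (2 * m)" 2, where 'k = "nat \<Rightarrow>\<^sub>0 int", symmetric]
    by simp
  have "cst (- of_nat m / 2) * (cst (1 / of_nat m) * (cst (1 / of_nat m) * (psum n (int m))\<^sup>2))
      = - cst (1 / of_nat (2 * m)) * (psum n (int m))\<^sup>2"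
    unfolding c[symmetric] by (simp only: mult.assoc)
  moreover have "cst (1 / of_nat (2 * m)) * psum n (int (2 * m))
      = (cst (1 / of_nat (2 * m)) * 2) * (\<Sum>j<n. \<Sum>i\<le>j. (zp i 1 * zp j 1) ^ m) - cst (1 / of_nat (2 * m)) * (psum n (int m))\<^sup>2"
    unfolding P right_diff_distrib by (simp only: mult.assoc)
  ultimately show ?thesis using assms unfolding d by (simp add: qlog_def)
qed

definition tdeg :: "nat \<Rightarrow> (nat \<Rightarrow>\<^sub>0 int) \<Rightarrow> int" where "tdeg n e = (\<Sum>i<n. lkp e i)"

definition tdeg_ge :: "nat \<Rightarrow> int \<Rightarrow> laurent \<Rightarrow> bool" where
  "tdeg_ge n d f \<longleftrightarrow> (\<forall>e\<in>Poly_Mapping.keys f. d \<le> tdeg n e)"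

lemma tdeg_ge_0 [simp]: "tdeg_ge n d 0" by (simp add: tdeg_ge_def)
lemma tdeg_ge_add: "tdeg_ge n d f \<Longrightarrow> tdeg_ge n d g \<Longrightarrow> tdeg_ge n d (f + g)"
  using Poly_Mapping.keys_add[of f g] by (auto simp: tdeg_ge_def)
lemma tdeg_ge_uminus: "tdeg_ge n d f \<Longrightarrow> tdeg_ge n d (- f)"
  by (simp add: tdeg_ge_def in_keys_iff)
lemma tdeg_ge_sum: "(\<And>x. x \<in> A \<Longrightarrow> tdeg_ge n d (f x)) \<Longrightarrow> tdeg_ge n d (\<Sum>x\<in>A. f x)"
  by (induction A rule: infinite_finite_induct) (simp_all add: tdeg_ge_add)
lemma tdeg_ge_mult: "tdeg_ge n d f \<Longrightarrow> tdeg_ge n d' g \<Longrightarrow> tdeg_ge n (d + d') (f * g)"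
  using keys_mult[of f g] by (force simp: tdeg_ge_def tdeg_def lookup_add sum.distrib intro: add_mono)
lemma tdeg_ge_mono: "tdeg_ge n d f \<Longrightarrow> d' \<le> d \<Longrightarrow> tdeg_ge n d' f"
  by (force simp: tdeg_ge_def)
lemma tdeg_ge_cst: "tdeg_ge n 0 (cst c)"
  by (simp add: tdeg_ge_def cst_def tdeg_def)
lemma tdeg_ge_zp: "i < n \<Longrightarrow> tdeg_ge n k (zp i k)"
  by (simp add: tdeg_ge_def zp_def tdeg_def lookup_single when_def sum.delta')

lemma tdeg_ge_qlog: "tdeg_ge n (2 * int m) (qlog n m)"
proof (cases "m = 0")
  case False
  have "tdeg_ge n (0 + (int m + int m)) (cst (1 / of_nat m) * (zp i (int m) * zp j (int m)))" if "j < n" "i \<le> j" for i j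
    using that by (intro tdeg_ge_mult tdeg_ge_cst tdeg_ge_zp) auto
  then have "tdeg_ge n (2 * int m) (- (\<Sum>j<n. \<Sum>i\<le>j. cst (1 / of_nat m) * (zp i (int m) * zp j (int m))))"
    by (intro tdeg_ge_uminus tdeg_ge_sum) auto
  with False show ?thesis by (simp add: qlog_def power_mult_distrib zp_power sum_distrib_left)
qed (simp add: qlog_def)

text \<open>If the total degree of a monomial exceeds the sum of the \<open>k i\<close>, some row
  index is negative. Since \<open>qlog n m\<close> raises the degree by \<open>2 m\<close>, this is
  the local nilpotency of \<Omega>.\<close>

lemma shifted_rows_eq_0:
  assumes "tdeg_ge n d f" "(\<Sum>i<n. k i) < d"
  shows "shifted_rows n k f = 0"
  unfolding shifted_rows_def lfun_def lin_def
proof (rule sum.neutral, rule ballI)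
  fix e assume "e \<in> Poly_Mapping.keys f"
  with assms have "(\<Sum>i<n. k i) < (\<Sum>i<n. lkp e i)" by (auto simp: tdeg_ge_def tdeg_def)
  then obtain i where "i < n" "k i < lkp e i" by (metis lessThan_iff linorder_not_less sum_mono)
  then have "(\<Prod>i<n. schur_row (k i - lkp e i)) = 0" by (auto intro!: prod_zero bexI[of _ i] simp: schur_row_neg)
  then show "cst (lkp f e) * (\<Prod>i<n. schur_row (k i - lkp e i)) = 0" by simp
qed

lemma Omega_shifted_rows:
  assumes f: "tdeg_ge n d f" and M: "(\<Sum>i<n. k i) \<le> 2 * int M + d"
  shows "Omega (-1) (shifted_rows n k f) = (\<Sum>m\<le>M. shifted_rows n k (qlog n m * f))"
proof -
  let ?g = "\<lambda>m. if m = 0 then 0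
     else pconst (- of_nat m / 2) * pderiv_var m (pderiv_var m (shifted_rows n k f))
          + pconst (-1) * pderiv_var (2 * m) (shifted_rows n k f)"
  have g: "?g m = shifted_rows n k (qlog n m * f)" for m
  proof (cases "m = 0")
    case True then show ?thesis by (simp add: qlog_def shifted_rows_def lfun_linear)
  next
    case False
    then have "?g m = shifted_rows n k ((cst (- of_nat m / 2) * (cst (1 / of_nat m) * (cst (1 / of_nat m) * (psum n (int m))\<^sup>2))
        - cst (1 / of_nat (2 * m)) * psum n (int (2 * m))) * f)"
      by (simp add: pderiv_shifted_rows pderiv_var_cst_times pconst_eq_cst left_diff_distrib mult.assoc
          power2_eq_square cst_uminus) (simp add: shifted_rows_def lfun_linear)
    also have "\<dots> = shifted_rows n k (qlog n m * f)" using False by (subst qlog_eq) simp_all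
    finally show ?thesis .
  qed
  have "shifted_rows n k (qlog n m * f) = 0" if "m > M" for m
    using that M by (intro shifted_rows_eq_0[OF tdeg_ge_mult[OF tdeg_ge_qlog f]]) auto
  then show ?thesis
    unfolding Omega_def g by (intro Sum_any.expand_superset) (auto simp: not_le[symmetric])
qed

text \<open>The sum of \<open>qlog n m\<close> over all \<open>m\<close> is not a Laurent
  polynomial; its powers are tracked as powers of a series in an auxiliary variable. The terms
  beyond \<open>M\<close> have so large a degree that \<open>shifted_rows n k\<close> kills
  them.\<close>

lemma Omega_funpow_shifted_rows:
  assumes "tdeg_ge n d f" and M: "(\<Sum>i<n. k i) \<le> 2 * int M + d"
  shows "(Omega (-1) ^^ r) (shifted_rows n k f) = (\<Sum>j\<le>M. shifted_rows n k (fps_nth (Abs_fps (qlog n) ^ r) j * f))"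
proof -
  let ?Q = "Abs_fps (qlog n)"
  have deg: "tdeg_ge n (2 * int j) (fps_nth (?Q ^ r) j)" for r j
  proof (induction r arbitrary: j)
    case 0 then show ?case using tdeg_ge_cst[of n 1] by (cases j) simp_all
  next
    case (Suc r)
    have "tdeg_ge n (2 * int j) (qlog n i * fps_nth (?Q ^ r) (j - i))" if "i \<le> j" for i
    proof -
      have "tdeg_ge n (2 * int i + 2 * int (j - i)) (qlog n i * fps_nth (?Q ^ r) (j - i))"
        by (intro tdeg_ge_mult tdeg_ge_qlog Suc)
      moreover have "2 * int i + 2 * int (j - i) = 2 * int j" using that by simp
      ultimately show ?thesis by simp
    qed
    then have "tdeg_ge n (2 * int j) (\<Sum>i = 0..j. qlog n i * fps_nth (?Q ^ r) (j - i))"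
      by (intro tdeg_ge_sum) auto
    then show ?case by (simp add: fps_mult_nth)
  qed
  show "(Omega (-1) ^^ r) (shifted_rows n k f) = (\<Sum>j\<le>M. shifted_rows n k (fps_nth (?Q ^ r) j * f))"
    using assms(1)
  proof (induction r arbitrary: f)
    case 0
    have "(\<Sum>j\<le>M. shifted_rows n k (fps_nth (?Q ^ 0) j * f)) = (\<Sum>j\<in>{0}. shifted_rows n k (fps_nth (?Q ^ 0) j * f))"
      by (rule sum.mono_neutral_right) (auto simp: shifted_rows_def lfun_linear)
    then show ?case by simp
  next
    case (Suc r)
    let ?F = "\<lambda>i j. shifted_rows n k (qlog n i * (fps_nth (?Q ^ r) j * f))"
    have z: "?F i j = 0" if "i + j > M" for i j
      using that M
      by (intro shifted_rows_eq_0[OF tdeg_ge_mult[OF tdeg_ge_qlog tdeg_ge_mult[OF deg Suc.prems]]]) auto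
    have deg': "tdeg_ge n d (fps_nth (?Q ^ r) j * f)" for j
      using tdeg_ge_mult[OF deg Suc.prems] by (rule tdeg_ge_mono) simp
    have add: "Omega (-1) (\<Sum>j\<in>J. shifted_rows n k (fps_nth (?Q ^ r) j * f)) = (\<Sum>j\<in>J. \<Sum>i\<le>M. ?F i j)" if "finite J" for J
    proof -
      have "Omega (-1) (shifted_rows n k (\<Sum>j\<in>J. fps_nth (?Q ^ r) j * f)) = (\<Sum>i\<le>M. shifted_rows n k (qlog n i * (\<Sum>j\<in>J. fps_nth (?Q ^ r) j * f)))"
        by (rule Omega_shifted_rows[OF tdeg_ge_sum M]) (rule deg')
      also have "\<dots> = (\<Sum>j\<in>J. \<Sum>i\<le>M. ?F i j)"
        by (simp add: sum_distrib_left shifted_rows_def lfun_linear) (rule sum.swap)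
      finally show ?thesis by (simp add: shifted_rows_def lfun_linear)
    qed
    have "(Omega (-1) ^^ Suc r) (shifted_rows n k f) = (\<Sum>j\<le>M. \<Sum>i\<le>M. ?F i j)"
      using Suc.IH[OF Suc.prems] by (simp add: add)
    also have "\<dots> = (\<Sum>i\<le>M. \<Sum>j\<le>M. ?F i j)" by (rule sum.swap)
    also have "\<dots> = (\<Sum>(i, j)\<in>{..M} \<times> {..M}. ?F i j)" by (rule sum.cartesian_product)
    \<comment> \<open>Outside the triangle the degree is too large, so the square can be cut down to
      the index set of a Cauchy product.\<close>
    also have "\<dots> = (\<Sum>(i, j)\<in>{(i, j). i + j \<le> M}. ?F i j)"
      by (rule sum.mono_neutral_right) (use z in force)+
    also have "\<dots> = (\<Sum>l\<le>M. \<Sum>i\<le>l. ?F i (l - i))" by (rule sum.triangle_reindex_eq)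
    also have "\<dots> = (\<Sum>l\<le>M. shifted_rows n k (fps_nth (?Q ^ Suc r) l * f))"
      by (simp add: fps_mult_nth sum_distrib_right shifted_rows_def lfun_linear atLeast0AtMost mult.assoc)
    finally show ?case .
  qed
qed

text \<open>Substitution of \<open>1\<close> for the auxiliary variable, expressed as the sum of the
  coefficients; the degree bound proved along with it shows that the sum is complete.\<close>

lemma prod_one_minus_X:
  fixes u :: "'b \<Rightarrow> 'a::comm_ring_1"
  assumes "finite S"
  defines "W \<equiv> \<Prod>s\<in>S. 1 - fps_X * fps_const (u s)"
  shows "(\<Sum>j\<le>card S. fps_nth W j) = (\<Prod>s\<in>S. 1 - u s) \<and> (\<forall>j>card S. fps_nth W j = 0)"
  unfolding W_def using assms(1)
proof (induction S)
  case (insert x S)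
  let ?V = "\<Prod>s\<in>S. 1 - fps_X * fps_const (u s)"
  have c: "fps_nth ((1 - fps_X * fps_const (u x)) * ?V) j = fps_nth ?V j - (if j = 0 then 0 else u x * fps_nth ?V (j - 1))" for j
    by (simp add: left_diff_distrib mult.assoc)
  have "(\<Sum>j\<le>Suc (card S). fps_nth ((1 - fps_X * fps_const (u x)) * ?V) j)
    = (\<Sum>j\<le>Suc (card S). fps_nth ?V j) - (\<Sum>j\<le>Suc (card S). if j = 0 then 0 else u x * fps_nth ?V (j - 1))"
    unfolding c by (rule sum_subtractf)
  also have "(\<Sum>j\<le>Suc (card S). if j = 0 then 0 else u x * fps_nth ?V (j - 1)) = u x * (\<Sum>j\<le>card S. fps_nth ?V j)"
    by (subst sum.atMost_Suc_shift) (simp add: sum_distrib_left)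
  finally have "(\<Sum>j\<le>Suc (card S). fps_nth ((1 - fps_X * fps_const (u x)) * ?V) j) = (1 - u x) * (\<Prod>s\<in>S. 1 - u s)"
    using insert by (simp add: left_diff_distrib)
  moreover have "\<forall>j>Suc (card S). fps_nth ((1 - fps_X * fps_const (u x)) * ?V) j = 0"
    unfolding c using insert by auto
  ultimately show ?case unfolding prod.insert[OF insert(1,2)] card_insert_disjoint[OF insert(1,2)] by blast
qed simp

lemma fps_nth_prod_0: "fps_nth (\<Prod>x\<in>A. f x) 0 = (\<Prod>x\<in>A. fps_nth (f x) 0 :: 'a::comm_ring_1)"
  by (induction A rule: infinite_finite_induct) simp_all

text \<open>Both sides have constant term one and logarithmic derivative
  \<open>- \<Sum> u / (1 - t u)\<close>, where \<open>u\<close> runs through the products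
  \<open>z_i z_j\<close> with \<open>i \<le> j\<close>; \<open>L u\<close> is one summand.\<close>

lemma gexp_qlog:
  "gexp (\<lambda>k. cst (1 / fact k)) (Abs_fps (qlog n)) = (\<Prod>j<n. \<Prod>i\<le>j. 1 - fps_X * fps_const (zp i 1 * zp j 1))"
  (is "_ = ?W")
proof (rule fps_log_deriv_unique)
  let ?Q = "Abs_fps (qlog n)"
  show "fps_deriv (gexp (\<lambda>k. cst (1 / fact k)) ?Q) = fps_deriv ?Q * gexp (\<lambda>k. cst (1 / fact k)) ?Q"
    by (rule gexp_deriv) (simp_all only: inverse_fact_cst, simp add: qlog_def)
  define L where "L u = Abs_fps (\<lambda>m. - (u ^ Suc m))" for u :: laurent
  have L: "fps_deriv (1 - fps_X * fps_const u) = L u * (1 - fps_X * fps_const u)" for u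
  proof (rule fps_ext)
    fix m
    have "L u * (1 - fps_X * fps_const u) = L u - fps_X * (L u * fps_const u)"
      by (simp add: algebra_simps)
    then show "fps_nth (fps_deriv (1 - fps_X * fps_const u)) m = fps_nth (L u * (1 - fps_X * fps_const u)) m"
      by (cases m) (simp_all add: L_def)
  qed
  have Lprod: "fps_deriv (\<Prod>s\<in>S. 1 - fps_X * fps_const (u s)) = (\<Sum>s\<in>S. L (u s)) * (\<Prod>s\<in>S. 1 - fps_X * fps_const (u s))"
    if "finite S" for S and u :: "'b \<Rightarrow> laurent"
    using that
  proof induction
    case (insert x F)
    have "a * (s * P) + (l * a) * P = (l + s) * (a * P)" for a s P l :: "laurent fps"
      by (simp add: algebra_simps)
    then show ?case
      unfolding prod.insert[OF insert(1,2)] sum.insert[OF insert(1,2)] fps_deriv_mult L insert(3) .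
  qed simp
  have Q: "fps_deriv ?Q = (\<Sum>j<n. \<Sum>i\<le>j. L (zp i 1 * zp j 1))"
  proof (rule fps_ext)
    fix m
    have "of_nat (Suc m) * qlog n (Suc m) = - ((of_nat (Suc m) * cst (1 / of_nat (Suc m))) * (\<Sum>j<n. \<Sum>i\<le>j. (zp i 1 * zp j 1) ^ Suc m))"
      by (simp add: qlog_def mult_ac del: of_nat_Suc)
    also have "of_nat (Suc m) * cst (1 / of_nat (Suc m)) = (1 :: laurent)"
      using cst_inverse[of "Suc m", where 'k = "nat \<Rightarrow>\<^sub>0 int"] by (simp add: mult.commute)
    finally show "fps_nth (fps_deriv ?Q) m = fps_nth (\<Sum>j<n. \<Sum>i\<le>j. L (zp i 1 * zp j 1)) m"
      by (simp add: L_def fps_sum_nth sum_negf del: of_nat_Suc)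
  qed
  let ?S = "Sigma {..<n} (\<lambda>j. {..j})"
  have "fps_deriv (\<Prod>s\<in>?S. 1 - fps_X * fps_const (zp (snd s) 1 * zp (fst s) 1))
     = (\<Sum>s\<in>?S. L (zp (snd s) 1 * zp (fst s) 1)) * (\<Prod>s\<in>?S. 1 - fps_X * fps_const (zp (snd s) 1 * zp (fst s) 1))"
    by (rule Lprod) simp
  then show "fps_deriv ?W = fps_deriv ?Q * ?W"
    by (simp add: Q sum.Sigma prod.Sigma case_prod_beta)
  show "fps_nth (gexp (\<lambda>k. cst (1 / fact k)) ?Q) 0 = fps_nth ?W 0"
    by (simp add: gexp_def fps_nth_prod_0)
qed

lemma exp_Omega_shifted_rows:
  "exp_Omega (-1) (shifted_rows n k f) = shifted_rows n k ((\<Prod>j<n. \<Prod>i\<le>j. 1 - zp i 1 * zp j 1) * f)"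
proof -
  let ?Q = "Abs_fps (qlog n)" and ?c = "\<lambda>k. cst (1 / fact k) :: laurent"
  let ?S = "Sigma {..<n} (\<lambda>j. {..j})"
  obtain d where d: "tdeg_ge n d f"
  proof
    show "tdeg_ge n (Min (insert 0 (tdeg n ` Poly_Mapping.keys f))) f" by (auto simp: tdeg_ge_def)
  qed
  obtain B where B: "(\<Sum>i<n. k i) - d \<le> int B" using nat_le_iff by blast
  \<comment> \<open>\<open>B\<close> takes care of the nilpotency of \<Omega>, and
    \<open>card ?S\<close> bounds the degree of the product in the auxiliary variable.\<close>
  define M where "M = B + card ?S"
  obtain C where C: "card ?S = C" by blast
  have M: "(\<Sum>i<n. k i) \<le> 2 * int M + d" using B unfolding M_def C by simp
  have M': "card ?S \<le> M" by (simp only: M_def)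
  have Q0: "fps_nth ?Q 0 = 0" by (simp add: qlog_def)
  note om = Omega_funpow_shifted_rows[OF d M]
  have "exp_Omega (-1) (shifted_rows n k f) = (\<Sum>r\<le>M. pconst (1 / fact r) * (Omega (-1) ^^ r) (shifted_rows n k f))"
    unfolding exp_Omega_def
  proof (rule Sum_any.expand_superset)
    have "(Omega (-1) ^^ r) (shifted_rows n k f) = 0" if "r > M" for r
      unfolding om using that by (intro sum.neutral) (auto simp: fps_power_nth_0[OF Q0] shifted_rows_def lfun_linear)
    then show "{r. pconst (1 / fact r) * (Omega (-1) ^^ r) (shifted_rows n k f) \<noteq> 0} \<subseteq> {..M}"
      by (auto simp: not_le[symmetric])
  qed simp
  also have "\<dots> = (\<Sum>r\<le>M. \<Sum>j\<le>M. shifted_rows n k (?c r * fps_nth (?Q ^ r) j * f))"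
    unfolding om by (simp add: pconst_eq_cst sum_distrib_left shifted_rows_def lfun_linear mult.assoc)
  also have "\<dots> = (\<Sum>j\<le>M. \<Sum>r\<le>M. shifted_rows n k (?c r * fps_nth (?Q ^ r) j * f))"
    by (rule sum.swap)
  also have "\<dots> = shifted_rows n k ((\<Sum>j\<le>M. fps_nth (gexp ?c ?Q) j) * f)"
    by (simp add: gexp_nth[OF Q0, of _ M] shifted_rows_def lfun_linear sum_distrib_right)
  also have "gexp ?c ?Q = (\<Prod>s\<in>?S. 1 - fps_X * fps_const (zp (snd s) 1 * zp (fst s) 1))"
    unfolding gexp_qlog by (simp add: prod.Sigma case_prod_beta)
  also have "(\<Sum>j\<le>M. fps_nth (\<Prod>s\<in>?S. 1 - fps_X * fps_const (zp (snd s) 1 * zp (fst s) 1)) j)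
     = (\<Sum>j\<le>card ?S. fps_nth (\<Prod>s\<in>?S. 1 - fps_X * fps_const (zp (snd s) 1 * zp (fst s) 1 :: laurent)) j)"
    using M' prod_one_minus_X[of ?S "\<lambda>s. zp (snd s) 1 * zp (fst s) 1"]
    by (intro sum.mono_neutral_right) auto
  also have "\<dots> = (\<Prod>s\<in>?S. 1 - zp (snd s) 1 * zp (fst s) 1)"
    using prod_one_minus_X[of ?S "\<lambda>s. zp (snd s) 1 * zp (fst s) 1"] by simp
  also have "\<dots> = (\<Prod>j<n. \<Prod>i\<le>j. 1 - zp i 1 * zp j 1)"
    by (simp add: prod.Sigma case_prod_beta)
  finally show ?thesis .
qed

text \<open>By \<open>dt_mult_prod_pairs\<close>, multiplication by
  \<open>\<Prod>_(i\<le>j) (1 - z_i z_j)\<close> turns the alternant of the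
  \<open>z_i^(-j-1)\<close> into that of the \<open>z_i^(-j-1) - z_i^(j+1)\<close>; the functional
  then acts entry by entry.\<close>

lemma orth_char_eq_dt:
  assumes "length l \<le> n"
  shows "orth_char l = dt n (\<lambda>i j. schur_row (int (pt l i) - int (Suc i) + int (Suc j))
      - schur_row (int (pt l i) - int (Suc i) - int (Suc j)))"
proof -
  define k where "k i = int (pt l i) - int (Suc i)" for i
  have ev1: "lin cst (\<lambda>e. schur_row (k i - e)) (sng (- int (Suc j)) 1) = schur_row (int (pt l i) - int i + int j)" for i j
    by (simp add: lin_single k_def algebra_simps)
  have "schur l = shifted_rows n k (dt n (\<lambda>i j. lin cst (zp i) (sng (- int (Suc j)) 1)))"
    unfolding shifted_rows_def lfun_dt ev1 by (rule schur_eq_dt[OF assms])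
  also have "(\<lambda>i j. lin cst (zp i) (sng (- int (Suc j)) 1)) = (\<lambda>i j. zp i (-1) ^ Suc j)"
    by (simp only: lin_single scalars_cst cst_simps mult_1 zp_power) simp
  finally have "orth_char l = shifted_rows n k (dt n (\<lambda>i j. zp i (-1) ^ Suc j) * (\<Prod>j<n. \<Prod>i\<le>j. 1 - zp i 1 * zp j 1))"
    by (simp only: orth_char_def exp_Omega_shifted_rows mult.commute)
  also have "dt n (\<lambda>i j. zp i (-1) ^ Suc j) * (\<Prod>j<n. \<Prod>i\<le>j. 1 - zp i 1 * zp j 1)
     = dt n (\<lambda>i j. zp i (-1) ^ Suc j - zp i 1 ^ Suc j)"
    by (rule dt_mult_prod_pairs) (rule zp_inv)
  also have "(\<lambda>i j. zp i (-1) ^ Suc j - zp i 1 ^ Suc j) = (\<lambda>i j. lin cst (zp i) (sng (- int (Suc j)) 1 - sng (int (Suc j)) 1))"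
    by (simp only: lin_single lin_diff scalars_cst cst_simps mult_1 zp_power) simp
  also have "shifted_rows n k (dt n \<dots>) = dt n (\<lambda>i j. schur_row (k i + int (Suc j)) - schur_row (k i - int (Suc j)))"
    unfolding shifted_rows_def lfun_dt by (simp add: lin_diff lin_single algebra_simps)
  finally show ?thesis by (simp only: k_def)
qed

lemma mev_pvar: "mev pvar \<alpha> = sng \<alpha> 1"
proof -
  have p: "pvar m ^ k = sng (sng m k) 1" for m k
    by (induction k) (simp_all add: pvar_def mult_single single_add[symmetric])
  have "(\<Prod>m\<in>A. sng (sng m (lkp \<alpha> m)) (1 :: complex)) = sng (\<Sum>m\<in>A. sng m (lkp \<alpha> m)) 1" if "finite A" for A
    using that by induction (simp_all add: mult_single)
  moreover have "(\<Sum>m\<in>Poly_Mapping.keys \<alpha>. sng m (lkp \<alpha> m)) = \<alpha>"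
    by (rule poly_mapping_eqI) (simp add: lookup_sum lookup_single when_def sum.delta' in_keys_iff)
  ultimately show ?thesis by (simp add: mev_def p)
qed

lemma ppoly_induct [case_names cst pvar add mult]:
  assumes c: "\<And>a. P (cst a)" and v: "\<And>m. P (pvar m)"
    and a: "\<And>f g. P f \<Longrightarrow> P g \<Longrightarrow> P (f + g)" and m: "\<And>f g. P f \<Longrightarrow> P g \<Longrightarrow> P (f * g)"
  shows "P f"
proof (induction f rule: poly_mapping_monomial_induct)
  case (single \<alpha> b)
  have 1: "P 1" using c[of 1] by simp
  have pw: "P (pvar i ^ k)" for i k by (induction k) (simp_all add: 1 m v)
  have "P (\<Prod>i\<in>A. pvar i ^ lkp \<alpha> i)" if "finite A" for A
    using that by induction (simp_all add: 1 m pw)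
  then have "P (mev pvar \<alpha>)" by (simp add: mev_def)
  then have "P (cst b * sng \<alpha> 1)" unfolding mev_pvar by (rule m[OF c])
  then show ?case by (simp add: cst_times_single)
qed (rule a)

subsection \<open>Partitions and finite sets\<close>

definition bounded_partitions :: "nat \<Rightarrow> nat \<Rightarrow> nat list set" where
  "bounded_partitions n N = {l. int_partition l \<and> length l \<le> n \<and> pt l 0 \<le> N}"

lemma first_part_eq_pt: "first_part l = pt l 0"
  by (cases l) (simp_all add: first_part_def pt_def)

lemma pt_antimono:
  assumes "int_partition l" "i \<le> j" shows "pt l j \<le> pt l i"
proof (cases "i = j \<or> length l \<le> j")
  case False
  with assms show ?thesis
    using sorted_wrt_nth_less[of "(\<ge>)" l i j] by (auto simp: int_partition_def pt_def)
qed (auto simp: pt_def)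

lemma pt_pos_iff: "int_partition l \<Longrightarrow> 0 < pt l i \<longleftrightarrow> i < length l"
  by (metis gr0I int_partition_def less_irrefl nth_mem pt_def)

lemma partition_eqI:
  assumes "int_partition l" "int_partition l'" "\<And>i. pt l i = pt l' i"
  shows "l = l'"
proof (rule nth_equalityI)
  show "length l = length l'"
    using pt_pos_iff[OF assms(1)] pt_pos_iff[OF assms(2)] assms(3) by (metis linorder_neqE_nat less_irrefl)
  then show "l ! i = l' ! i" if "i < length l" for i
    using that assms(3)[of i] by (simp add: pt_def)
qed

lemma partition_of_antimono:
  fixes v :: "nat \<Rightarrow> nat"
  assumes v: "\<And>i j. i \<le> j \<Longrightarrow> j < n \<Longrightarrow> v j \<le> v i"
  shows "\<exists>l. int_partition l \<and> length l \<le> n \<and> (\<forall>i<n. pt l i = v i)"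
proof -
  define c where "c = (LEAST c. c = n \<or> v c = 0)"
  have c: "c = n \<or> v c = 0" unfolding c_def by (rule LeastI[of _ n]) simp
  have cn: "c \<le> n" unfolding c_def by (rule Least_le) simp
  have pos: "v i \<noteq> 0" if "i < c" for i using not_less_Least[of i "\<lambda>c. c = n \<or> v c = 0"] that c_def by auto
  define l where "l = map v [0..<c]"
  have "int_partition l"
    unfolding int_partition_def
  proof
    show "sorted_wrt (\<ge>) l" unfolding l_def using cn by (auto simp: sorted_wrt_map sorted_wrt_iff_nth_less intro!: v)
    show "0 \<notin> set l" unfolding l_def using pos by (auto simp: image_iff)
  qed
  moreover have "pt l i = v i" if "i < n" for i
    using c v[of c i] that by (auto simp: pt_def l_def)
  moreover have "length l \<le> n" using cn by (simp add: l_def)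
  ultimately show ?thesis by blast
qed

text \<open>The shifted parts \<open>\<lambda>_i + s (n - 1 - i)\<close>. For \<open>s = 1\<close>
  they form arbitrary sets of \<open>n\<close> elements; for \<open>s = 2\<close>, used for doubled
  partitions, sets without consecutive elements.\<close>

definition parts_set :: "nat \<Rightarrow> nat \<Rightarrow> nat list \<Rightarrow> nat set" where
  "parts_set s n l = (\<lambda>i. pt l i + s * (n - 1 - i)) ` {0..<n}"

lemma desc_parts_set:
  assumes "int_partition l" "s > 0" "i < n"
  shows "desc (parts_set s n l) i = pt l i + s * (n - 1 - i)" "card (parts_set s n l) = n"
proof -
  have dec: "pt l j + s * (n - 1 - j) < pt l i + s * (n - 1 - i)" if "i < j" "j < n" for i j
    using that pt_antimono[OF assms(1), of i j] assms(2) by (intro add_le_less_mono) auto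
  then show "desc (parts_set s n l) i = pt l i + s * (n - 1 - i)"
    unfolding parts_set_def using assms(3) by (rule desc_unique)
  have "inj_on (\<lambda>i. pt l i + s * (n - 1 - i)) {0..<n}"
    by (rule inj_onI) (metis atLeastLessThan_iff dec linorder_neqE_nat order_less_irrefl)
  then show "card (parts_set s n l) = n" by (simp add: parts_set_def card_image)
qed

lemma parts_set_bij:
  assumes s: "s > 0" and n: "n > 0"
  shows "bij_betw (parts_set s n) (bounded_partitions n N)
     {A. A \<subseteq> {0..<N + s * (n - 1) + 1} \<and> card A = n \<and> (\<forall>i. Suc i < n \<longrightarrow> desc A (Suc i) + s \<le> desc A i)}"
  (is "bij_betw _ ?P ?A")
  unfolding bij_betw_def
proof
  show "inj_on (parts_set s n) ?P"
  proof (rule inj_onI)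
    fix l l' assume l: "l \<in> ?P" "l' \<in> ?P" "parts_set s n l = parts_set s n l'"
    then have ip: "int_partition l" "int_partition l'" "length l \<le> n" "length l' \<le> n" by (auto simp: bounded_partitions_def)
    have "pt l i = pt l' i" for i
    proof (cases "i < n")
      case True
      then show ?thesis using desc_parts_set(1)[OF ip(1) s True] desc_parts_set(1)[OF ip(2) s True] l(3) by simp
    qed (use ip in \<open>simp add: pt_def\<close>)
    with ip show "l = l'" by (intro partition_eqI)
  qed
  show "parts_set s n ` ?P = ?A"
  proof (rule subset_antisym; rule subsetI)
    fix A assume "A \<in> parts_set s n ` ?P"
    then obtain l where l: "int_partition l" "pt l 0 \<le> N" and A: "A = parts_set s n l" by (auto simp: bounded_partitions_def)
    have "desc A (Suc i) + s \<le> desc A i" if "Suc i < n" for i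
    proof -
      have "n - 1 - i = Suc (n - 1 - Suc i)" using that by simp
      then show ?thesis using that pt_antimono[OF l(1), of i "Suc i"] desc_parts_set(1)[OF l(1) s, of i n] desc_parts_set(1)[OF l(1) s, of "Suc i" n]
        by (simp add: A)
    qed
    moreover have "pt l i + s * (n - 1 - i) < N + s * (n - 1) + 1" for i
    proof -
      have "pt l i \<le> N" using pt_antimono[OF l(1), of 0 i] l(2) by simp
      moreover have "s * (n - 1 - i) \<le> s * (n - 1)" by (intro mult_left_mono) auto
      ultimately show ?thesis by linarith
    qed
    ultimately show "A \<in> ?A" using desc_parts_set(2)[OF l(1) s n] by (auto simp: A parts_set_def)
  next
    fix A assume A: "A \<in> ?A"
    then have fin: "finite A" and card: "card A = n" using finite_subset by auto
    have gap: "desc A j + s * (j - i) \<le> desc A i" if "i \<le> j" "j < n" for i j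
      using that
    proof (induction j rule: dec_induct)
      case (step j)
      then have "desc A (Suc j) + s \<le> desc A j" using A by auto
      moreover have "Suc j - i = Suc (j - i)" using step by simp
      ultimately show ?case using step by simp
    qed simp
    define v where "v i = desc A i - s * (n - 1 - i)" for i
    have v: "desc A i = v i + s * (n - 1 - i)" if "i < n" for i
    proof -
      have "i \<le> n - 1" "n - 1 < n" using that by auto
      from gap[OF this] show ?thesis by (simp add: v_def)
    qed
    have "v j \<le> v i" if "i \<le> j" "j < n" for i j
    proof -
      have "n - 1 - i = (n - 1 - j) + (j - i)" using that by simp
      then have "s * (n - 1 - i) = s * (n - 1 - j) + s * (j - i)" by (metis distrib_left)
      moreover have "i < n" using that by simp
      ultimately show ?thesis using gap[OF that] v[OF \<open>i < n\<close>] v[OF that(2)] by linarith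
    qed
    then have "\<exists>l. int_partition l \<and> length l \<le> n \<and> (\<forall>i<n. pt l i = v i)"
      by (rule partition_of_antimono)
    then obtain l where l: "int_partition l" "length l \<le> n" "\<And>i. i < n \<Longrightarrow> pt l i = v i"
      by blast
    have bij: "desc A ` {0..<n} = A" using desc_bij_betw[OF fin] card by (simp add: bij_betw_def)
    have "parts_set s n l = desc A ` {0..<n}"
      unfolding parts_set_def using v l(3) by (intro image_cong) auto
    then have "A = parts_set s n l" by (simp only: bij)
    moreover have "pt l 0 \<le> N"
    proof -
      have "desc A 0 \<in> A" using bij n by auto
      then have "desc A 0 < N + s * (n - 1) + 1" using A by auto
      then show ?thesis using v[OF n] l(3)[OF n] by simp
    qed
    ultimately show "A \<in> parts_set s n ` ?P" using l by (auto simp: bounded_partitions_def)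
  qed
qed

lemma finite_bounded_partitions: "n > 0 \<Longrightarrow> finite (bounded_partitions n N)"
  using bij_betw_finite[OF parts_set_bij[of 1 n N]] by (auto intro: finite_subset[of _ "Pow {0..<N + 1 * (n - 1) + 1}"])

lemma sum_bounded_partitions:
  assumes n: "n > 0"
  shows "(\<Sum>l\<in>bounded_partitions n N. F (parts_set 1 n l)) = (\<Sum>A | A \<subseteq> {0..<N + n} \<and> card A = n. F A)"
proof -
  have "desc A (Suc i) + 1 \<le> desc A i" if "A \<subseteq> {0..<N + n}" "card A = n" "Suc i < n" for A i
    using desc_mono[of A i "Suc i"] that finite_subset by fastforce
  then have "{A. A \<subseteq> {0..<N + 1 * (n - 1) + 1} \<and> card A = n \<and> (\<forall>i. Suc i < n \<longrightarrow> desc A (Suc i) + 1 \<le> desc A i)}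
     = {A. A \<subseteq> {0..<N + n} \<and> card A = n}" using n by auto
  then show ?thesis using sum.reindex_bij_betw[OF parts_set_bij[OF _ n, of 1 N], of F] by simp
qed

subsection \<open>Coefficientwise sums\<close>

text \<open>A first part beyond \<open>w + c\<close> pushes the whole term above weight
  \<open>w\<close>; what is left is a finite box of partitions.\<close>

lemma coeff_sum_bounded:
  assumes n: "n > 0"
    and high: "\<And>l. int_partition l \<Longrightarrow> length l \<le> n \<Longrightarrow> pt l 0 > w + c \<Longrightarrow> high w (f l)"
    and "wt \<alpha> \<le> w" "N \<ge> w + c"
  defines "X \<equiv> {l. int_partition l \<and> length l \<le> n}"
  shows "finite {l \<in> X. lkp (f l) \<alpha> \<noteq> 0}"
    and "coeff_sum f X \<alpha> = lkp (\<Sum>l\<in>bounded_partitions n N. f l) \<alpha>"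
proof -
  have sub: "{l \<in> X. lkp (f l) \<alpha> \<noteq> 0} \<subseteq> bounded_partitions n N"
    using high assms(3,4) by (force simp: X_def bounded_partitions_def high_def not_le[symmetric])
  then show "finite {l \<in> X. lkp (f l) \<alpha> \<noteq> 0}"
    using finite_bounded_partitions[OF n] finite_subset by blast
  have "(\<Sum>l\<in>{l \<in> X. lkp (f l) \<alpha> \<noteq> 0}. lkp (f l) \<alpha>) = (\<Sum>l\<in>bounded_partitions n N. lkp (f l) \<alpha>)"
    using finite_bounded_partitions[OF n] sub
    by (intro sum.mono_neutral_left) (auto simp: X_def bounded_partitions_def)
  then show "coeff_sum f X \<alpha> = lkp (\<Sum>l\<in>bounded_partitions n N. f l) \<alpha>"
    by (simp add: coeff_sum_def lookup_sum)
qed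

text \<open>Makes the sequence finitely supported, so that the finite correlation identities apply,
  and changes nothing up to weight \<open>K\<close>.\<close>

definition trunc_row :: "nat \<Rightarrow> int \<Rightarrow> ppoly" where
  "trunc_row K i = (if i \<le> int K then schur_row i else 0)"

lemma trunc_row_supported: "supported (trunc_row K) K"
  by (simp add: supported_def trunc_row_def schur_row_neg)

lemma trunc_row_cong: "cong_low K (schur_row i) (trunc_row K i)"
  by (simp add: trunc_row_def) (simp add: cong_low_def high_schur_row)

text \<open>Truncating at the weight of \<open>\<alpha>\<close> does not affect the coefficient at \<open>\<alpha>\<close>.\<close>

definition symp_coeff :: "nat \<Rightarrow> pseries" where
  "symp_coeff n \<alpha> = lkp (toeplitz_hankel n (corr (trunc_row (wt \<alpha>)) (wt \<alpha>))) \<alpha>"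

text \<open>The first row of the determinant has indices at least \<open>pt l 0 - 1 - n\<close>;
  hence the margin \<open>n + 1\<close>.\<close>

lemma orth_char_high:
  assumes "length l \<le> n" "n > 0" "pt l 0 > w + (n + 1)"
  shows "high w (orth_char l)"
  unfolding orth_char_eq_dt[OF assms(1)]
  by (rule high_dt[of 0]) (use assms in \<open>auto intro!: high_diff high_schur_row\<close>)

lemma orth_char_square_sum:
  assumes n: "n > 0"
  defines "X \<equiv> {l. int_partition l \<and> length l \<le> n}"
  shows "coeff_summable (\<lambda>l. (orth_char l)\<^sup>2) X"
    and "coeff_sum (\<lambda>l. (orth_char l)\<^sup>2) X \<alpha> = 2 ^ n * symp_coeff n \<alpha>"
proof -
  have high: "high w ((orth_char l)\<^sup>2)" if "length l \<le> n" "pt l 0 > w + (n + 1)" for l w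
    unfolding power2_eq_square using orth_char_high[OF that(1) n that(2)] by (rule high_mult)
  show "coeff_summable (\<lambda>l. (orth_char l)\<^sup>2) X"
    unfolding coeff_summable_def X_def
    using coeff_sum_bounded(1)[OF n, of _ "n + 1" "\<lambda>l. (orth_char l)\<^sup>2"] high by blast
  define K where "K = wt \<alpha>"
  \<comment> \<open>At least \<open>K + n + 1\<close>, so that the omitted partitions do not
    contribute, and with \<open>N + n = K + 2 * n + 2\<close> as the sum over subsets
    requires.\<close>
  define N where "N = K + n + 2"
  have "coeff_sum (\<lambda>l. (orth_char l)\<^sup>2) X \<alpha> = lkp (\<Sum>l\<in>bounded_partitions n N. (orth_char l)\<^sup>2) \<alpha>"
    unfolding X_def by (rule coeff_sum_bounded(2)[OF n, of K "n + 1"]) (use high in \<open>auto simp: K_def N_def\<close>)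
  also have "(\<Sum>l\<in>bounded_partitions n N. (orth_char l)\<^sup>2)
     = (\<Sum>l\<in>bounded_partitions n N. (dt n (\<lambda>i j. schur_row (int (desc (parts_set 1 n l) i) - int n + int (Suc j))
          - schur_row (int (desc (parts_set 1 n l) i) - int n - int (Suc j))))\<^sup>2)"
  proof (rule sum.cong[OF refl])
    fix l assume "l \<in> bounded_partitions n N"
    then have l: "int_partition l" "length l \<le> n" by (auto simp: bounded_partitions_def)
    have "orth_char l = dt n (\<lambda>i j. schur_row (int (desc (parts_set 1 n l) i) - int n + int (Suc j))
          - schur_row (int (desc (parts_set 1 n l) i) - int n - int (Suc j)))"
      unfolding orth_char_eq_dt[OF l(2)]
    proof (rule dt_cong)
      fix i j assume "i < n"
      then have "int (desc (parts_set 1 n l) i) - int n = int (pt l i) - int (Suc i)"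
        using desc_parts_set(1)[OF l(1), of 1 i n] by simp
      then show "schur_row (int (pt l i) - int (Suc i) + int (Suc j)) - schur_row (int (pt l i) - int (Suc i) - int (Suc j))
        = schur_row (int (desc (parts_set 1 n l) i) - int n + int (Suc j)) - schur_row (int (desc (parts_set 1 n l) i) - int n - int (Suc j))"
        by (simp only:)
    qed
    then show "(orth_char l)\<^sup>2 = (dt n (\<lambda>i j. schur_row (int (desc (parts_set 1 n l) i) - int n + int (Suc j))
          - schur_row (int (desc (parts_set 1 n l) i) - int n - int (Suc j))))\<^sup>2" by (simp only:)
  qed
  also have "\<dots> = (\<Sum>A | A \<subseteq> {0..<N + n} \<and> card A = n. (dt n (\<lambda>i j. schur_row (int (desc A i) - int n + int (Suc j))
          - schur_row (int (desc A i) - int n - int (Suc j))))\<^sup>2)"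
    by (rule sum_bounded_partitions[OF n])
  also have "lkp \<dots> \<alpha> = lkp (\<Sum>A | A \<subseteq> {0..<N + n} \<and> card A = n. (dt n (\<lambda>i j. trunc_row K (int (desc A i) - int n + int (Suc j))
          - trunc_row K (int (desc A i) - int n - int (Suc j))))\<^sup>2) \<alpha>"
    unfolding power2_eq_square
    by (rule cong_low_lookup[of K]) (auto intro!: cong_low_sum cong_low_mult cong_low_dt cong_low_diff trunc_row_cong simp: K_def)
  also have "(\<Sum>A | A \<subseteq> {0..<N + n} \<and> card A = n. (dt n (\<lambda>i j. trunc_row K (int (desc A i) - int n + int (Suc j))
          - trunc_row K (int (desc A i) - int n - int (Suc j))))\<^sup>2) = 2 ^ n * toeplitz_hankel n (corr (trunc_row K) K)"
    by (rule square_sum_toeplitz_hankel[OF trunc_row_supported]) (simp add: N_def)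
  also have "lkp (2 ^ n * toeplitz_hankel n (corr (trunc_row K) K)) \<alpha> = 2 ^ n * symp_coeff n \<alpha>"
    using lookup_cst_times[of "2 ^ n" "toeplitz_hankel n (corr (trunc_row K) K)" \<alpha>] cst_of_nat[of "2 ^ n", where 'k = monomial]
    by (simp add: symp_coeff_def K_def)
  finally show "coeff_sum (\<lambda>l. (orth_char l)\<^sup>2) X \<alpha> = 2 ^ n * symp_coeff n \<alpha>" .
qed

subsection \<open>Doubled partitions\<close>

definition flip :: "nat \<Rightarrow> nat \<Rightarrow> nat" where "flip n i = (if i < n then n - 1 - i else i)"

lemma flip_permutes: "flip n permutes {0..<n}"
  by (rule bij_imp_permutes, rule bij_betw_byWitness[of _ "flip n"]) (auto simp: flip_def)

lemma dt_flip_rows: "dt n (\<lambda>i j. a (n - 1 - i) j) = signof (flip n) * dt n a"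
proof -
  have "dt n (\<lambda>i j. a (n - 1 - i) j) = dt n (\<lambda>i j. a (flip n i) j)"
    by (rule dt_cong) (simp add: flip_def)
  then show ?thesis using dt_permute_rows[OF flip_permutes[of n], of a] by simp
qed

lemma dt_flip_cols: "dt n (\<lambda>i j. a i (n - 1 - j)) = signof (flip n) * dt n a"
  using dt_flip_rows[of n "\<lambda>i j. a j i"] dt_transpose[of n "\<lambda>i j. a i (n - 1 - j)"] dt_transpose[of n a] by simp

lemma dt_flip: "dt n (\<lambda>i j. a (n - 1 - i) (n - 1 - j)) = dt n a"
  using dt_flip_rows[of n "\<lambda>i j. a i (n - 1 - j)"] dt_flip_cols[of n a]
  by (simp add: mult.assoc[symmetric] signof_square)

lemma pt_double_parts: "pt (double_parts l) r = pt l (r div 2)"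
proof (induction l arbitrary: r)
  case Nil then show ?case by (simp add: double_parts_def pt_def)
next
  case (Cons x l)
  have d: "double_parts (x # l) = x # x # double_parts l" by (simp add: double_parts_def)
  have p: "pt (y # ys) (Suc i) = pt ys i" "pt (y # ys) 0 = y" for y ys i by (simp_all add: pt_def)
  show ?case
  proof (cases r)
    case (Suc r')
    show ?thesis
    proof (cases r')
      case 0 then show ?thesis by (simp add: Suc d p)
    next
      case (Suc r'') then show ?thesis using Cons[of r''] \<open>r = Suc r'\<close> by (simp add: d p)
    qed
  qed (simp add: d p)
qed

lemma length_double_parts: "length (double_parts l) = 2 * length l"
  by (induction l) (simp_all add: double_parts_def)

text \<open>Rows and columns are both reversed, which preserves the determinant. The doubled part
  \<open>\<lambda>_i\<close> then occupies two adjacent rows with leading indices \<open>a\<close>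
  and \<open>a + 1\<close>, where \<open>a = \<lambda>_i + 2 (n - 1 - i)\<close>; reordering the
  pairs does not change the sign.\<close>

lemma schur_double_parts:
  assumes "int_partition l" "length l \<le> n"
  defines "A \<equiv> parts_set 2 n l"
  shows "schur (double_parts l) = dt (2 * n) (interleave (\<lambda>i c. schur_row (int (desc A i) - int c)) (\<lambda>i c. schur_row (int (desc A i) + 1 - int c)))"
proof -
  let ?u = "\<lambda>i c. schur_row (int (desc A i) - int c)" and ?w = "\<lambda>i c. schur_row (int (desc A i) + 1 - int c)"
  have "schur (double_parts l) = dt (2 * n) (\<lambda>r c. schur_row (int (pt l (r div 2)) - int r + int c))"
    using assms(2) by (simp add: schur_eq_dt[of _ "2 * n"] length_double_parts pt_double_parts)
  also have "\<dots> = dt (2 * n) (\<lambda>r c. schur_row (int (pt l ((2 * n - 1 - r) div 2)) - int (2 * n - 1 - r) + int (2 * n - 1 - c)))"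
    by (rule dt_flip[symmetric])
  also have "\<dots> = dt (2 * n) (interleave (?u \<circ> flip n) (?w \<circ> flip n))"
  proof (rule dt_cong)
    fix r c assume rc: "r < 2 * n" "c < 2 * n"
    define i where "i = n - 1 - r div 2"
    have i: "i < n" "flip n (r div 2) = i" "(2 * n - 1 - r) div 2 = i" using rc by (auto simp: i_def flip_def)
    have d: "int (desc A i) = int (pt l i) + 2 * (int n - 1 - int i)"
      using desc_parts_set(1)[OF assms(1), of 2 i n] i(1) by (simp add: A_def of_nat_diff)
    have "int (desc A i) + int (r mod 2) - int c = int (pt l i) - int (2 * n - 1 - r) + int (2 * n - 1 - c)"
      unfolding d using rc i_def by (auto simp: of_nat_diff) presburger
    moreover have "interleave (?u \<circ> flip n) (?w \<circ> flip n) r c = schur_row (int (desc A i) + int (r mod 2) - int c)"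
      by (simp add: interleave_def mod_2_eq_odd i(2))
    ultimately show "schur_row (int (pt l ((2 * n - 1 - r) div 2)) - int (2 * n - 1 - r) + int (2 * n - 1 - c))
       = interleave (?u \<circ> flip n) (?w \<circ> flip n) r c"
      by (simp only: i(3))
  qed
  also have "\<dots> = dt (2 * n) (interleave ?u ?w)"
    by (rule dt_interleave_permute[OF flip_permutes])
  finally show ?thesis .
qed

lemma schur_double_sum:
  assumes n: "n > 0"
  defines "X \<equiv> {l. int_partition l \<and> length l \<le> n}"
  shows "coeff_summable (\<lambda>l. schur (double_parts l)) X"
    and "coeff_sum (\<lambda>l. schur (double_parts l)) X \<alpha> = symp_coeff n \<alpha>"
proof -
  have high: "high w (schur (double_parts l))" if "length l \<le> n" "pt l 0 > w + 0" for l w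
  proof -
    have "schur (double_parts l) = dt (2 * n) (\<lambda>r c. schur_row (int (pt l (r div 2)) - int r + int c))"
      using that by (simp add: schur_eq_dt[of _ "2 * n"] length_double_parts pt_double_parts)
    then show ?thesis using n that by (auto intro!: high_dt[of 0] high_schur_row)
  qed
  show "coeff_summable (\<lambda>l. schur (double_parts l)) X"
    unfolding coeff_summable_def X_def
    using coeff_sum_bounded(1)[OF n, of _ 0 "\<lambda>l. schur (double_parts l)"] high by blast
  define K where "K = wt \<alpha>"
  define N where "N = K + 2 * n + 2"
  define M where "M = N + 2 * (n - 1) + 1"
  let ?F = "\<lambda>h A. dt (2 * n) (interleave (\<lambda>i c. h (int (desc A i) - int c)) (\<lambda>i c. h (int (desc A i) + 1 - int c)))"
  let ?G = "{A. A \<subseteq> {0..<M} \<and> card A = n \<and> (\<forall>i. Suc i < n \<longrightarrow> desc A (Suc i) + 2 \<le> desc A i)}"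
  have "coeff_sum (\<lambda>l. schur (double_parts l)) X \<alpha> = lkp (\<Sum>l\<in>bounded_partitions n N. schur (double_parts l)) \<alpha>"
    unfolding X_def by (rule coeff_sum_bounded(2)[OF n, of K 0]) (use high in \<open>auto simp: K_def N_def\<close>)
  also have "(\<Sum>l\<in>bounded_partitions n N. schur (double_parts l)) = (\<Sum>l\<in>bounded_partitions n N. ?F schur_row (parts_set 2 n l))"
    by (intro sum.cong refl schur_double_parts) (auto simp: bounded_partitions_def)
  also have "\<dots> = (\<Sum>A\<in>?G. ?F schur_row A)"
    unfolding M_def by (rule sum.reindex_bij_betw[OF parts_set_bij]) (use n in auto)
  \<comment> \<open>A set with consecutive elements \<open>a\<close> and \<open>a + 1\<close>
    produces the row of leading index \<open>a + 1\<close> twice, once from each element. The gap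
    condition can thus be dropped.\<close>
  also have "\<dots> = (\<Sum>A | A \<subseteq> {0..<M} \<and> card A = n. ?F schur_row A)"
  proof (rule sum.mono_neutral_left)
    show "finite {A. A \<subseteq> {0..<M} \<and> card A = n}" by (rule finite_subset[of _ "Pow {0..<M}"]) auto
    show "\<forall>A\<in>{A. A \<subseteq> {0..<M} \<and> card A = n} - ?G. ?F schur_row A = 0"
    proof
      fix A assume A: "A \<in> {A. A \<subseteq> {0..<M} \<and> card A = n} - ?G"
      then obtain i where i: "Suc i < n" "desc A i < desc A (Suc i) + 2" by (auto simp: not_le)
      moreover have "desc A (Suc i) < desc A i"
        using A i by (intro desc_mono) (auto intro: finite_subset)
      ultimately have "desc A i = Suc (desc A (Suc i))" by simp
      then show "?F schur_row A = 0" using i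
        by (intro dt_equal_rows[of "2 * i" _ "Suc (2 * Suc i)"]) (simp_all only: interleave_simps, simp_all add: add.commute)
    qed
  qed auto
  also have "lkp \<dots> \<alpha> = lkp (\<Sum>A | A \<subseteq> {0..<M} \<and> card A = n. ?F (trunc_row K) A) \<alpha>"
    by (rule cong_low_lookup[of K])
      (auto intro!: cong_low_sum cong_low_dt trunc_row_cong simp: K_def interleave_def)
  also have "(\<Sum>A | A \<subseteq> {0..<M} \<and> card A = n. ?F (trunc_row K) A) = toeplitz_hankel n (corr (trunc_row K) K)"
    by (rule double_sum_toeplitz_hankel[OF trunc_row_supported]) (simp add: N_def M_def)
  finally show "coeff_sum (\<lambda>l. schur (double_parts l)) X \<alpha> = symp_coeff n \<alpha>"
    by (simp add: symp_coeff_def K_def)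
qed

subsection \<open>Conjugate partitions\<close>

definition conj_part :: "nat list \<Rightarrow> nat list" where
  "conj_part l = map (\<lambda>j. card {i. j < pt l i}) [0..<pt l 0]"

lemma finite_pt_gt: "finite {i. j < pt l i}"
  by (rule finite_subset[of _ "{..<length l}"]) (auto simp: pt_def split: if_splits)

lemma pt_gt_initial: "int_partition l \<Longrightarrow> i < card {i. j < pt l i} \<longleftrightarrow> j < pt l i"
proof -
  assume l: "int_partition l"
  have "{i. j < pt l i} = {..<card {i. j < pt l i}}"
  proof -
    obtain c where c: "\<And>i. j < pt l i \<longleftrightarrow> i < c"
    proof
      define c where "c = (LEAST c. pt l c \<le> j)"
      have ex: "pt l (length l) \<le> j" by (simp add: pt_def)
      fix i show "j < pt l i \<longleftrightarrow> i < c"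
        unfolding c_def using LeastI[of "\<lambda>c. pt l c \<le> j", OF ex] not_less_Least[of i "\<lambda>c. pt l c \<le> j"]
          pt_antimono[OF l, of "LEAST c. pt l c \<le> j" i] by (cases "i < (LEAST c. pt l c \<le> j)") auto
    qed
    then show ?thesis by (auto simp: lessThan_def)
  qed
  then show ?thesis by blast
qed

lemma pt_conj_part: "int_partition l \<Longrightarrow> pt (conj_part l) j = card {i. j < pt l i}"
proof (cases "j < pt l 0")
  case False
  assume "int_partition l"
  with False have "{i. j < pt l i} = {}" using pt_antimono[of l 0] by (auto simp: not_less) (meson leD le_trans zero_le)
  with False show ?thesis unfolding pt_def[of "conj_part l" j] by (simp add: conj_part_def)
next
  case True
  then show ?thesis unfolding pt_def[of "conj_part l" j] by (simp add: conj_part_def)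
qed

text \<open>Both conditions say that the box \<open>(i, j)\<close> belongs to the diagram of
  \<open>l\<close>; in this symmetric form conjugation is visibly an involution.\<close>

lemma less_pt_conj_part: "int_partition l \<Longrightarrow> i < pt (conj_part l) j \<longleftrightarrow> j < pt l i"
  by (simp add: pt_conj_part pt_gt_initial)

lemma conj_part_partition: "int_partition l \<Longrightarrow> int_partition (conj_part l)"
  unfolding int_partition_def[of "conj_part l"]
proof
  assume l: "int_partition l"
  show "sorted_wrt (\<ge>) (conj_part l)"
    unfolding conj_part_def sorted_wrt_map
    by (rule sorted_wrt_mono_rel[of _ "(<)"]) (auto intro!: card_mono finite_pt_gt)
  show "0 \<notin> set (conj_part l)"
    using finite_pt_gt by (auto simp: conj_part_def)
qed

lemma length_conj_part: "length (conj_part l) = pt l 0" by (simp add: conj_part_def)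

lemma conj_part_conj_part: "int_partition l \<Longrightarrow> conj_part (conj_part l) = l"
  using less_pt_conj_part[of l] less_pt_conj_part[of "conj_part l"] conj_part_partition
  by (intro partition_eqI) (auto, metis linorder_neqE_nat less_irrefl)

lemma pt_conj_part_0: "int_partition l \<Longrightarrow> pt (conj_part l) 0 = length l"
  using length_conj_part[of "conj_part l"] by (simp add: conj_part_conj_part)

lemma conj_part_bij:
  "bij_betw conj_part {l. int_partition l \<and> first_part l \<le> n} {l. int_partition l \<and> length l \<le> n}"
  by (rule bij_betw_byWitness[of _ conj_part])
    (auto simp: conj_part_conj_part conj_part_partition length_conj_part pt_conj_part_0 first_part_eq_pt)

subsection \<open>Complementary minors\<close>

lemma dt_unit_rows:
  assumes "\<And>i j. m \<le> i \<Longrightarrow> i < m + n \<Longrightarrow> j \<le> i \<Longrightarrow> a i j = (if i = j then 1 else 0)"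
  shows "dt (m + n) a = dt m a"
  using assms
proof (induction n)
  case (Suc n)
  then have "dt (Suc (m + n)) a = dt (m + n) a" by (intro dt_Suc_last_row) auto
  with Suc show ?case by simp
qed simp

lemma dt_unit_rows_first:
  assumes "\<And>i j. i < m \<Longrightarrow> j < m + n \<Longrightarrow> a i j = (if i = j then 1 else 0)"
  shows "dt (m + n) a = dt n (\<lambda>i j. a (m + i) (m + j))"
proof -
  let ?b = "\<lambda>i j. a (m + n - 1 - i) (m + n - 1 - j)"
  have "dt (m + n) a = dt (n + m) ?b" using dt_flip[of "m + n" a] by (simp add: add.commute)
  also have "\<dots> = dt n ?b" by (rule dt_unit_rows) (use assms in auto)
  also have "\<dots> = dt n (\<lambda>i j. ?b (n - 1 - i) (n - 1 - j))" by (rule dt_flip[symmetric])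
  also have "\<dots> = dt n (\<lambda>i j. a (m + i) (m + j))"
    by (rule dt_cong) (rule arg_cong2[of _ _ _ _ a], auto)
  finally show ?thesis .
qed

text \<open>Jacobi's theorem on complementary minors; the column permutation brings the chosen minor
  to the front. \<open>Z\<close> consists of \<open>m\<close> unit columns followed by columns of
  the inverse \<open>Y\<close> of \<open>X\<close>, so the product of \<open>X\<close> and
  \<open>Z\<close> is block triangular with the minor of \<open>X\<close> as determinant, while the
  determinant of \<open>Z\<close> is the complementary minor of \<open>Y\<close>.\<close>

lemma dt_complementary_minor:
  fixes H G :: "nat \<Rightarrow> nat \<Rightarrow> 'a::comm_ring_1"
  assumes inv: "\<And>c d. c < m + n \<Longrightarrow> d < m + n \<Longrightarrow> (\<Sum>k<m + n. H c k * G k d) = (if c = d then 1 else 0)"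
    and p: "p permutes {0..<m + n}" and H: "dt (m + n) H = 1"
  shows "dt m (\<lambda>r c. H r (p c)) = signof p * dt n (\<lambda>k c. G (p (m + k)) (m + c))"
proof -
  let ?N = "m + n"
  define X where "X r k = H r (p k)" for r k
  define Y where "Y k c = G (p k) c" for k c
  define Z where "Z k c = (if c < m then (if k = c then 1 else 0) else Y k c)" for k c
  have XY: "(\<Sum>k<?N. X r k * Y k c) = (if r = c then 1 else 0)" if "r < ?N" "c < ?N" for r c
  proof -
    have "(\<Sum>k<?N. X r k * Y k c) = (\<Sum>k\<in>{0..<?N}. H r (p k) * G (p k) c)"
      by (simp add: X_def Y_def lessThan_atLeast0)
    also have "\<dots> = (\<Sum>k\<in>{0..<?N}. H r k * G k c)"
      by (rule sum.reindex_bij_betw[OF permutes_imp_bij[OF p]])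
    finally show ?thesis using inv[OF that] by (simp add: lessThan_atLeast0)
  qed
  have XZ: "(\<Sum>k<?N. X r k * Z k c) = (if c < m then X r c else if r = c then 1 else 0)" if "r < ?N" "c < ?N" for r c
  proof (cases "c < m")
    case True
    then have "(\<Sum>k<?N. X r k * Z k c) = (\<Sum>k<?N. if k = c then X r k else 0)"
      by (intro sum.cong) (auto simp: Z_def)
    with True that show ?thesis by (simp add: sum.delta)
  next
    case False then show ?thesis using XY[OF that] by (simp add: Z_def)
  qed
  have "dt ?N X = signof p * dt ?N H"
    using dt_permute_rows[OF p, of "\<lambda>i j. H j i"] dt_transpose[of ?N X] dt_transpose[of ?N H] by (simp add: X_def)
  moreover have "dt ?N Z = dt n (\<lambda>k c. Y (m + k) (m + c))"
  proof -
    have "dt ?N Z = dt ?N (\<lambda>c k. Z k c)" by (rule dt_transpose[symmetric])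
    also have "\<dots> = dt n (\<lambda>c k. Z (m + k) (m + c))" by (rule dt_unit_rows_first) (auto simp: Z_def)
    also have "\<dots> = dt n (\<lambda>k c. Y (m + k) (m + c))" by (subst dt_transpose) (simp add: Z_def)
    finally show ?thesis .
  qed
  moreover have "dt ?N X * dt ?N Z = dt m X"
  proof -
    have "dt ?N X * dt ?N Z = dt ?N (\<lambda>r c. if c < m then X r c else if r = c then 1 else 0)"
      unfolding dt_mult[symmetric] by (rule dt_cong) (rule XZ)
    also have "\<dots> = dt ?N (\<lambda>c r. if c < m then X r c else if r = c then 1 else 0)" by (rule dt_transpose[symmetric])
    also have "\<dots> = dt m (\<lambda>c r. if c < m then X r c else if r = c then 1 else 0)" by (rule dt_unit_rows) auto
    also have "\<dots> = dt m (\<lambda>c r. X r c)" by (rule dt_cong) simp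
    also have "\<dots> = dt m X" by (rule dt_transpose)
    finally show ?thesis .
  qed
  moreover have "X = (\<lambda>r c. H r (p c))" by (simp add: fun_eq_iff X_def)
  ultimately show ?thesis using H by (simp add: Y_def)
qed

section \<open>Negated power sums and mutually inverse Toeplitz matrices\<close>

definition negp :: "ppoly \<Rightarrow> ppoly" where "negp = psubst (\<lambda>m. - pvar m)"

lemma negp_peval: "negp = peval cst (\<lambda>m. - pvar m)"
  by (simp add: negp_def psubst_lin peval_def)

lemmas negp_hom = peval_hom[OF scalars_cst, of "\<lambda>m. - pvar m", folded negp_peval]

lemma negp_negp: "negp (negp f) = f"
  by (induction f rule: ppoly_induct) (simp_all add: negp_hom)

lemma negp_signof: "negp (signof p) = signof p"
  using signof_cases[of p, where 'a = int] by (auto simp: negp_hom)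

lemma negp_dt: "negp (dt n a) = dt n (\<lambda>i j. negp (a i j))"
  unfolding dt_leibniz by (simp add: negp_hom negp_signof)

text \<open>The series of the \<open>h_i\<close> and of their images under \<open>negp\<close> are
  exponentials of opposite series, so their product has derivative zero. Up to the sign
  \<open>(-1)^i\<close>, \<open>negp\<close> maps \<open>h_i\<close> to the elementary symmetric
  function \<open>e_i\<close>.\<close>

lemma schur_row_negp_convolution:
  "(\<Sum>i = 0..d. schur_row (int i) * negp (schur_row (int (d - i)))) = (if d = 0 then 1 else 0)"
proof -
  define D where "D = Abs_fps (\<lambda>j. pvar (Suc j))"
  define E where "E = Abs_fps (\<lambda>i. schur_row (int i))"
  define F where "F = Abs_fps (\<lambda>i. negp (schur_row (int i)))"
  have E: "fps_deriv E = D * E"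
    by (rule fps_ext) (simp only: fps_deriv_nth fps_mult_nth Suc_eq_plus1[symmetric] E_def D_def fps_nth_Abs_fps schur_row_newton_Suc atLeast0AtMost)
  have F': "of_nat (Suc i) * negp (schur_row (int (Suc i))) = (\<Sum>j\<le>i. - pvar (Suc j) * negp (schur_row (int (i - j))))" for i
    using arg_cong[OF schur_row_newton_Suc[of i], of negp] by (simp only: negp_hom)
  have F: "fps_deriv F = - D * F"
    by (rule fps_ext) (simp only: fps_deriv_nth fps_mult_nth Suc_eq_plus1[symmetric] F_def D_def fps_nth_Abs_fps F' atLeast0AtMost fps_neg_nth)
  have "fps_deriv (E * F) = 0" by (simp add: E F algebra_simps)
  moreover have "fps_nth (E * F) 0 = 1" by (simp add: E_def F_def negp_hom)
  ultimately have "E * F = 1"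
    by (intro fps_log_deriv_unique[of "E * F" 0 1]) (simp_all only: mult_zero_left fps_deriv_1 fps_one_nth simp_thms if_True)
  then have "fps_nth (E * F) d = (if d = 0 then 1 else 0)" by simp
  then show ?thesis by (simp add: fps_mult_nth E_def F_def)
qed

lemma schur_row_negp_inverse:
  assumes "c < N" "d < N"
  shows "(\<Sum>k<N. schur_row (int k - int c) * negp (schur_row (int d - int k))) = (if c = d then 1 else 0)"
proof (cases "c \<le> d")
  case True
  have "(\<Sum>k<N. schur_row (int k - int c) * negp (schur_row (int d - int k)))
     = (\<Sum>k\<in>{c..d}. schur_row (int k - int c) * negp (schur_row (int d - int k)))"
    using assms by (intro sum.mono_neutral_right) (auto simp: schur_row_neg negp_hom not_le)
  also have "\<dots> = (\<Sum>i = 0..d - c. schur_row (int (i + c) - int c) * negp (schur_row (int d - int (i + c))))"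
    using True sum.shift_bounds_cl_nat_ivl[of "\<lambda>k. schur_row (int k - int c) * negp (schur_row (int d - int k))" 0 c "d - c"]
    by (simp del: of_nat_add)
  also have "\<dots> = (\<Sum>i = 0..d - c. schur_row (int i) * negp (schur_row (int (d - c - i))))"
    using True by (intro sum.cong refl arg_cong2[of _ _ _ _ "(*)"] arg_cong[of _ _ schur_row] arg_cong[of _ _ negp]) auto
  also have "\<dots> = (if d - c = 0 then 1 else 0)" by (rule schur_row_negp_convolution)
  finally show ?thesis using True by auto
next
  case False
  then have "schur_row (int k - int c) * negp (schur_row (int d - int k)) = 0" for k
    by (cases "k < c") (simp_all add: schur_row_neg negp_hom)
  with False show ?thesis by simp
qed

text \<open>The exponents \<open>\<lambda>\<^sub>i + m - i\<close> and \<open>m - 1 + j - \<lambda>'\<^sub>j\<close> partition an initial segment of the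
  natural numbers, so that Schur functions of conjugate partitions are complementary minors of
  mutually inverse Toeplitz matrices.\<close>

lemma schur_conj_part:
  assumes l: "int_partition l"
  shows "schur l = negp (schur (conj_part l)) \<or> schur l = - negp (schur (conj_part l))"
proof -
  define m n where "m = length l" and "n = pt l 0"
  define l' where "l' = conj_part l"
  have l': "int_partition l'" "length l' = n" "pt l' 0 = m"
    using l by (auto simp: l'_def n_def m_def conj_part_partition length_conj_part pt_conj_part_0)
  have box: "i < pt l' j \<longleftrightarrow> j < pt l i" for i j unfolding l'_def by (rule less_pt_conj_part[OF l])
  define p where "p c = (if c < m then pt l c + (m - 1 - c) else if c < m + n then c - pt l' (c - m) else c)" for c
  have b1: "pt l c \<le> n" for c using pt_antimono[OF l, of 0 c] by (simp add: n_def)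
  have b2: "pt l' c \<le> m" for c using pt_antimono[OF l'(1), of 0 c] by (simp add: l'(3))
  \<comment> \<open>The box \<open>(i, j)\<close> decides the order: if it lies in the diagram then
    \<open>p i > p (m + j)\<close>, otherwise \<open>p i < p (m + j)\<close>.\<close>
  have sep: "p i \<noteq> p (m + j)" if "i < m" "j < n" for i j
    using that box[of i j] b2[of j] by (cases "j < pt l i") (auto simp: p_def)
  have dec1: "p j < p i" if "i < j" "j < m" for i j
    using that pt_antimono[OF l, of i j] by (simp add: p_def)
  have dec2: "p (m + i) < p (m + j)" if "i < j" "j < n" for i j
    using that pt_antimono[OF l'(1), of i j] b2[of i] by (simp add: p_def)
  have inj: "inj_on p {0..<m + n}"
  proof (rule linorder_inj_onI)
    fix x y assume xy: "x < y" "x \<in> {0..<m + n}" "y \<in> {0..<m + n}"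
    show "p x \<noteq> p y"
    proof (cases "y < m")
      case True with dec1[of x y] xy show ?thesis by simp
    next
      case False
      then obtain j where j: "y = m + j" "j < n" using xy by (metis add_less_cancel_left atLeastLessThan_iff le_Suc_ex not_le)
      show ?thesis
      proof (cases "x < m")
        case True with sep[of x j] j show ?thesis by simp
      next
        case False
        then obtain i where "x = m + i" by (metis le_Suc_ex not_le)
        with dec2[of i j] j xy show ?thesis by simp
      qed
    qed
  qed auto
  have "p ` {0..<m + n} \<subseteq> {0..<m + n}"
  proof
    fix y assume "y \<in> p ` {0..<m + n}"
    then obtain x where "x < m + n" "y = p x" by auto
    with b1[of x] show "y \<in> {0..<m + n}" by (auto simp: p_def)
  qed
  then have "bij_betw p {0..<m + n} {0..<m + n}"
    using inj endo_inj_surj[of "{0..<m + n}" p] by (auto simp: bij_betw_def)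
  then have p: "p permutes {0..<m + n}" by (rule bij_imp_permutes) (auto simp: p_def)
  let ?H = "\<lambda>c k. schur_row (int k - int c)" and ?G = "\<lambda>k c. negp (schur_row (int c - int k))"
  have "dt (m + n) ?H = 1"
    by (subst dt_upper_triangular) (auto simp: schur_row_neg)
  then have minors: "dt m (\<lambda>r c. ?H r (p c)) = signof p * dt n (\<lambda>k c. ?G (p (m + k)) (m + c))"
    by (intro dt_complementary_minor p schur_row_negp_inverse)
  have "dt n (\<lambda>k c. ?G (p (m + k)) (m + c)) = dt n (\<lambda>k c. negp (schur_row (int (pt l' k) - int k + int c)))"
    by (rule dt_cong) (use b2 in \<open>auto intro!: arg_cong[of _ _ negp] arg_cong[of _ _ schur_row] simp: p_def of_nat_diff trans_le_add1\<close>)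
  also have "\<dots> = negp (schur l')"
    using schur_eq_dt[of l' n] l'(2) by (simp add: negp_dt)
  finally have 1: "dt m (\<lambda>r c. ?H r (p c)) = signof p * negp (schur l')" using minors by simp
  have "dt m (\<lambda>r c. ?H r (p c)) = dt m (\<lambda>c r. schur_row (int (p c) - int r))"
    by (rule dt_transpose[symmetric])
  also have "\<dots> = dt m (\<lambda>i j. schur_row (int (pt l i) - int i + int (m - 1 - j)))"
    by (rule dt_cong) (auto intro!: arg_cong[of _ _ schur_row] simp: p_def of_nat_diff)
  also have "\<dots> = signof (flip m) * dt m (\<lambda>i j. schur_row (int (pt l i) - int i + int j))"
    by (rule dt_flip_cols)
  also have "\<dots> = signof (flip m) * schur l" using schur_eq_dt[of l m] by (simp add: m_def)
  finally have "signof (flip m) * schur l = signof p * negp (schur l')" using 1 by simp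
  \<comment> \<open>The two signs are left as a disjunction, since the characters enter the sums
    through their squares.\<close>
  then show ?thesis
    using signof_cases[of p, where 'a = ppoly] signof_cases[of "flip m", where 'a = ppoly] unfolding l'_def by (metis mult_1 mult_minus1 minus_minus)
qed

subsection \<open>Symplectic characters\<close>

text \<open>The last assumption keeps the supports equal, also when they are infinite and both
  values of \<open>Sum_any\<close> are zero by default.\<close>

lemma Sum_any_additive:
  fixes N :: "'a::comm_monoid_add \<Rightarrow> 'b::comm_monoid_add"
  assumes "N 0 = 0" "\<And>x y. N (x + y) = N x + N y" "\<And>x. N x = 0 \<Longrightarrow> x = 0"
  shows "N (Sum_any G) = Sum_any (\<lambda>x. N (G x))"
proof -
  have "N (sum G A) = (\<Sum>x\<in>A. N (G x))" for A
    by (induction A rule: infinite_finite_induct) (simp_all add: assms)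
  moreover have "{x. N (G x) \<noteq> 0} = {x. G x \<noteq> 0}" using assms by auto
  ultimately show ?thesis by (simp add: Sum_any.expand_set)
qed

lemma pderiv_var_negp: "pderiv_var m (negp f) = - negp (pderiv_var m f)"
  by (induction f rule: ppoly_induct)
    (simp_all add: negp_hom pderiv_var_add pderiv_var_mult pderiv_var_uminus pderiv_var_pvar algebra_simps)

lemma negp_eq_0: "negp f = 0 \<Longrightarrow> f = 0"
  using negp_negp[of f] negp_hom(5) by simp

text \<open>Every partial derivative changes sign under \<open>p \<mapsto> - p\<close>. The second
  order part is unaffected and the first order part is reversed, which exchanges
  \<open>c = 1\<close> and \<open>c = -1\<close>.\<close>

lemma Omega_negp: "Omega (-1) (negp f) = negp (Omega 1 f)"
proof -
  have "negp (Omega 1 f) = Sum_any (\<lambda>m. negp (if m = 0 then 0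
     else pconst (- of_nat m / 2) * pderiv_var m (pderiv_var m f) + pconst 1 * pderiv_var (2 * m) f))"
    unfolding Omega_def by (rule Sum_any_additive) (simp_all add: negp_hom negp_eq_0)
  also have "\<dots> = Omega (-1) (negp f)"
    unfolding Omega_def
    by (intro arg_cong[of _ _ Sum_any] ext)
      (simp add: negp_hom pderiv_var_negp pderiv_var_uminus pconst_eq_cst cst_uminus)
  finally show ?thesis by simp
qed

lemma exp_Omega_negp: "exp_Omega (-1) (negp f) = negp (exp_Omega 1 f)"
proof -
  have "(Omega (-1) ^^ k) (negp f) = negp ((Omega 1 ^^ k) f)" for k
    by (induction k) (simp_all add: Omega_negp)
  then have "exp_Omega (-1) (negp f) = Sum_any (\<lambda>k. negp (pconst (1 / fact k) * (Omega 1 ^^ k) f))"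
    by (simp add: exp_Omega_def negp_hom pconst_eq_cst)
  also have "\<dots> = negp (exp_Omega 1 f)"
    unfolding exp_Omega_def by (rule Sum_any_additive[symmetric]) (simp_all add: negp_hom negp_eq_0)
  finally show ?thesis .
qed

lemma Omega_uminus: "Omega c (- f) = - Omega c f"
proof -
  have "- Omega c f = Sum_any (\<lambda>m. - (if m = 0 then 0
     else pconst (- of_nat m / 2) * pderiv_var m (pderiv_var m f) + pconst c * pderiv_var (2 * m) f))"
    unfolding Omega_def by (rule Sum_any_additive) simp_all
  also have "\<dots> = Omega c (- f)"
    unfolding Omega_def by (intro arg_cong[of _ _ Sum_any] ext) (simp add: pderiv_var_uminus)
  finally show ?thesis by simp
qed

lemma exp_Omega_uminus: "exp_Omega c (- f) = - exp_Omega c f"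
proof -
  have "(Omega c ^^ k) (- f) = - (Omega c ^^ k) f" for k
    by (induction k) (simp_all add: Omega_uminus)
  then have "exp_Omega c (- f) = Sum_any (\<lambda>k. - (pconst (1 / fact k) * (Omega c ^^ k) f))"
    by (simp add: exp_Omega_def)
  also have "\<dots> = - exp_Omega c f"
    unfolding exp_Omega_def by (rule Sum_any_additive[symmetric]) simp_all
  finally show ?thesis .
qed

lemma symp_char_negp_square:
  assumes "int_partition l"
  shows "(psubst (\<lambda>m. - pvar m) (symp_char l))\<^sup>2 = (orth_char (conj_part l))\<^sup>2"
proof -
  have "schur (conj_part l) = negp (schur l) \<or> schur (conj_part l) = - negp (schur l)"
    using schur_conj_part[OF conj_part_partition[OF assms]] by (simp add: conj_part_conj_part assms)
  then have "orth_char (conj_part l) = negp (symp_char l) \<or> orth_char (conj_part l) = - negp (symp_char l)"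
    unfolding orth_char_def symp_char_def exp_Omega_negp[symmetric] by (auto simp: exp_Omega_uminus)
  then show ?thesis by (auto simp: negp_def)
qed

lemma bij_betw_restrict_pred:
  assumes "bij_betw h X Y" "\<And>x. x \<in> X \<Longrightarrow> f x = g (h x)"
  shows "bij_betw h {x \<in> X. P (f x)} {y \<in> Y. P (g y)}"
  using assms by (auto simp: bij_betw_def inj_on_def)

lemma symp_char_square_sum:
  assumes n: "n > 0"
  defines "X \<equiv> {l. int_partition l \<and> first_part l \<le> n}"
  shows "coeff_summable (\<lambda>l. (psubst (\<lambda>m. - pvar m) (symp_char l))\<^sup>2) X"
    and "coeff_sum (\<lambda>l. (psubst (\<lambda>m. - pvar m) (symp_char l))\<^sup>2) X \<alpha> = 2 ^ n * symp_coeff n \<alpha>"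
proof -
  let ?f = "\<lambda>l. (psubst (\<lambda>m. - pvar m) (symp_char l))\<^sup>2" and ?Y = "{l. int_partition l \<and> length l \<le> n}"
  let ?A = "\<lambda>\<alpha>. {l \<in> X. lkp (?f l) \<alpha> \<noteq> 0}" and ?B = "\<lambda>\<alpha>. {l \<in> ?Y. lkp ((orth_char l)\<^sup>2) \<alpha> \<noteq> 0}"
  have f: "?f l = (orth_char (conj_part l))\<^sup>2" if "l \<in> X" for l
    using that by (intro symp_char_negp_square) (simp add: X_def)
  have bij: "bij_betw conj_part (?A \<alpha>) (?B \<alpha>)" for \<alpha>
    using bij_betw_restrict_pred[of conj_part X ?Y ?f "\<lambda>l. (orth_char l)\<^sup>2" "\<lambda>q. lkp q \<alpha> \<noteq> 0"]
      conj_part_bij[of n, folded X_def] f by blast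
  show "coeff_summable ?f X"
    unfolding coeff_summable_def
  proof
    fix \<alpha>
    have "finite (?B \<alpha>)" using orth_char_square_sum(1)[OF n] by (simp add: coeff_summable_def)
    then show "finite (?A \<alpha>)" using bij_betw_finite[OF bij] by blast
  qed
  have "coeff_sum ?f X \<alpha> = (\<Sum>l\<in>?A \<alpha>. lkp ((orth_char (conj_part l))\<^sup>2) \<alpha>)"
    unfolding coeff_sum_def by (intro sum.cong refl) (simp add: f)
  also have "\<dots> = (\<Sum>l\<in>?B \<alpha>. lkp ((orth_char l)\<^sup>2) \<alpha>)"
    by (rule sum.reindex_bij_betw[OF bij])
  also have "\<dots> = 2 ^ n * symp_coeff n \<alpha>"
    using orth_char_square_sum(2)[OF n, of \<alpha>] by (simp add: coeff_sum_def)
  finally show "coeff_sum ?f X \<alpha> = 2 ^ n * symp_coeff n \<alpha>" .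
qed

subsection \<open>Haar measure on the compact symplectic group\<close>

type_synonym 'n cmat = "complex^('n + 'n)^('n + 'n)"

abbreviation entry (infixl "$h" 90) where "entry x i \<equiv> Finite_Cartesian_Product.vec.vec_nth x i"

abbreviation mtr :: "'a^'m^'k \<Rightarrow> 'a^'k^'m" where "mtr \<equiv> Finite_Cartesian_Product.transpose"
abbreviation mone :: "'a::zero_neq_one^'k^'k" where "mone \<equiv> Finite_Cartesian_Product.mat 1"

definition adj :: "complex^'k^'k \<Rightarrow> complex^'k^'k" where "adj A = map_matrix cnj (mtr A)"

lemma adj_nth: "adj A $h i $h j = cnj (A $h j $h i)"
  by (simp add: adj_def map_matrix_def Finite_Cartesian_Product.transpose_def)

lemma mtr_nth: "mtr A $h i $h j = A $h j $h i"
  by (simp add: Finite_Cartesian_Product.transpose_def)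

lemma mone_nth: "mone $h i $h j = (if i = j then 1 else 0)"
  by (simp add: Finite_Cartesian_Product.mat_def)

lemma mult_nth: "(A ** B) $h i $h j = (\<Sum>k\<in>UNIV. A $h i $h k * B $h k $h j)"
  by (simp add: matrix_matrix_mult_def)

lemma adj_mult: "adj (A ** B) = adj B ** adj (A :: complex^'k::finite^'k)"
  by (simp add: Finite_Cartesian_Product.vec_eq_iff adj_nth mult_nth mult.commute)

lemma adj_linear: "adj (A + B) = adj A + adj B" "adj (A - B) = adj A - adj B" "adj (t *\<^sub>R A) = t *\<^sub>R adj A"
  "adj (- A) = - adj A" "adj mone = mone"
  by (simp_all add: Finite_Cartesian_Product.vec_eq_iff adj_nth mone_nth)

lemma mtr_linear: "mtr (A + B) = mtr A + mtr B" "mtr (A - B) = mtr A - mtr B" "mtr (t *\<^sub>R A) = t *\<^sub>R mtr A"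
  "mtr (- A) = - mtr (A :: complex^'k^'k)" "mtr (mone :: complex^'k^'k) = mone"
  by (simp_all add: Finite_Cartesian_Product.vec_eq_iff mtr_nth mone_nth)

lemma mult_scaleR: "(t *\<^sub>R A) ** B = t *\<^sub>R (A ** B)" "A ** (t *\<^sub>R B) = t *\<^sub>R (A ** (B :: complex^'k::finite^'k))"
  by (simp_all add: Finite_Cartesian_Product.vec_eq_iff mult_nth scaleR_sum_right)

lemma mult_uminus: "(- A) ** B = - (A ** B)" "A ** (- B) = - (A ** (B :: complex^'k::finite^'k))"
  by (simp_all add: Finite_Cartesian_Product.vec_eq_iff mult_nth sum_negf)

lemma mult_distribs:
  fixes A B C :: "complex^'k::finite^'k"
  shows "(A + B) ** C = A ** C + B ** C" "A ** (B + C) = A ** B + A ** C"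
    "(A - B) ** C = A ** C - B ** C" "A ** (B - C) = A ** B - A ** C"
  by (simp_all add: Finite_Cartesian_Product.vec_eq_iff mult_nth sum.distrib sum_subtractf algebra_simps)

lemma mtr_mult: "mtr (A ** B) = mtr B ** mtr (A :: complex^'k::finite^'k)"
  by (simp add: Finite_Cartesian_Product.vec_eq_iff mtr_nth mult_nth mult.commute)

abbreviation J :: "complex^('n::finite + 'n)^('n + 'n)" where "J \<equiv> symp_form"

definition partner :: "'n + 'n \<Rightarrow> 'n + 'n" where
  "partner i = (case i of Inl a \<Rightarrow> Inr a | Inr a \<Rightarrow> Inl a)"

definition side :: "'n + 'n \<Rightarrow> complex" where
  "side i = (case i of Inl a \<Rightarrow> 1 | Inr a \<Rightarrow> -1)"

lemma partner_simps [simp]: "partner (partner i) = i" "side (partner i) = - side i" "side i * side i = 1" "partner i \<noteq> i"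
  by (auto simp: partner_def side_def split: sum.splits)

lemma J_nth: "J $h i $h j = (if j = partner i then side i else 0)"
  by (auto simp: symp_form_def partner_def side_def split: sum.splits)

lemma mtr_J: "mtr J = - (J :: 'n::finite cmat)"
proof -
  have "J $h j $h i = - (J $h i $h j)" for i j :: "'n + 'n"
  proof (cases "j = partner i")
    case False
    then have "i \<noteq> partner j" by (metis partner_simps(1))
    with False show ?thesis by (simp add: J_nth)
  qed (simp add: J_nth)
  then show ?thesis unfolding Finite_Cartesian_Product.vec_eq_iff mtr_nth vector_uminus_component by blast
qed

lemma J_J: "J ** J = - (mone :: 'n::finite cmat)"
proof -
  have "(J ** J) $h i $h j = - (mone $h i $h j)" for i j :: "'n + 'n"
  proof -
    have "(J ** J) $h i $h j = (\<Sum>k\<in>UNIV. if k = partner i then side i * J $h k $h j else 0)"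
      unfolding mult_nth by (intro sum.cong) (auto simp: J_nth[of i])
    also have "\<dots> = side i * J $h partner i $h j" by (simp add: sum.delta')
    also have "\<dots> = - (mone $h i $h j)" by (auto simp: J_nth mone_nth)
    finally show ?thesis .
  qed
  then show ?thesis by (simp add: Finite_Cartesian_Product.vec_eq_iff)
qed

lemma compact_Sp_iff: "S \<in> compact_Sp \<longleftrightarrow> adj S ** S = mone \<and> mtr S ** J ** S = (J :: 'n::finite cmat)"
  by (simp add: compact_Sp_def adj_def)

lemma compact_Sp_mult: "U \<in> compact_Sp \<Longrightarrow> S \<in> compact_Sp \<Longrightarrow> U ** S \<in> (compact_Sp :: 'n::finite cmat set)"
proof -
  assume a: "U \<in> compact_Sp" "S \<in> (compact_Sp :: 'n cmat set)"
  have "adj (U ** S) ** (U ** S) = adj S ** (adj U ** U) ** S"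
    by (simp add: adj_mult matrix_mul_assoc)
  moreover have "mtr (U ** S) ** J ** (U ** S) = mtr S ** (mtr U ** J ** U) ** S"
    by (simp add: mtr_mult matrix_mul_assoc)
  ultimately show ?thesis using a by (simp add: compact_Sp_iff)
qed

lemma compact_Sp_entry_le:
  assumes "S \<in> (compact_Sp :: 'n::finite cmat set)"
  shows "norm (S $h i $h j) \<le> 1"
proof -
  have "(adj S ** S) $h j $h j = 1" using assms by (simp add: compact_Sp_iff mone_nth)
  then have "(\<Sum>k\<in>UNIV. cnj (S $h k $h j) * S $h k $h j) = 1" by (simp add: mult_nth adj_nth)
  moreover have "(\<Sum>k\<in>UNIV. cnj (S $h k $h j) * S $h k $h j) = of_real (\<Sum>k\<in>UNIV. (norm (S $h k $h j))\<^sup>2)"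
    by (simp only: of_real_sum complex_norm_square mult.commute)
  ultimately have "(\<Sum>k\<in>UNIV. (norm (S $h k $h j))\<^sup>2) = 1" using of_real_eq_1_iff by metis
  moreover have "(norm (S $h i $h j))\<^sup>2 \<le> (\<Sum>k\<in>UNIV. (norm (S $h k $h j))\<^sup>2)"
    by (rule member_le_sum) auto
  ultimately show ?thesis by (simp add: abs_square_le_1[of "norm (S $h i $h j)", simplified])
qed

definition lie :: "'n::finite cmat \<Rightarrow> bool" where
  "lie Y \<longleftrightarrow> adj Y = - Y \<and> mtr Y ** J + J ** Y = 0"

text \<open>Satisfied by the Cayley transform \<open>U = (1 + t Y / 2) (1 - t Y / 2)^(-1)\<close>,
  which replaces \<open>exp (t Y)\<close>: it stays in the group, and its exact remainder formula
  gives uniform second order estimates.\<close>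

definition cayley_at :: "'n::finite cmat \<Rightarrow> real \<Rightarrow> 'n cmat \<Rightarrow> bool" where
  "cayley_at Y t U \<longleftrightarrow> U \<in> compact_Sp \<and> U = mone + t *\<^sub>R Y + (t\<^sup>2 / 4) *\<^sub>R (Y ** Y ** (mone + U))"

text \<open>For skew-Hermitian \<open>Y\<close> the sum of the \<open>cnj (x i) (Y x) i\<close> is
  purely imaginary, whereas \<open>Y x = x\<close> makes it the squared norm of
  \<open>x\<close>.\<close>

lemma lie_invertible:
  assumes "adj Y = - (Y :: complex^'k::finite^'k)"
  obtains B where "B ** (mone - Y) = mone" "(mone - Y) ** B = mone"
proof -
  have "x = 0" if x: "(mone - Y) *v x = 0" for x
  proof -
    have Yx: "Y *v x = x" using x by (simp add: matrix_vector_mult_diff_rdistrib)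
    have c: "cnj (\<Sum>i\<in>UNIV. cnj (x $h i) * (Y *v x) $h i) = - (\<Sum>i\<in>UNIV. cnj (x $h i) * (Y *v x) $h i)"
    proof -
      have e: "cnj (Y $h i $h j) = - Y $h j $h i" for i j
        using assms by (metis adj_nth vector_uminus_component)
      have "cnj (\<Sum>i\<in>UNIV. cnj (x $h i) * (Y *v x) $h i) = (\<Sum>i\<in>UNIV. \<Sum>j\<in>UNIV. x $h i * (- Y $h j $h i * cnj (x $h j)))"
        by (simp add: matrix_vector_mult_def sum_distrib_left e)
      also have "\<dots> = (\<Sum>j\<in>UNIV. \<Sum>i\<in>UNIV. x $h i * (- Y $h j $h i * cnj (x $h j)))" by (rule sum.swap)
      also have "\<dots> = - (\<Sum>i\<in>UNIV. cnj (x $h i) * (Y *v x) $h i)"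
        by (simp add: matrix_vector_mult_def sum_distrib_left sum_negf mult_ac)
      finally show ?thesis .
    qed
    have n: "(\<Sum>i\<in>UNIV. cnj (x $h i) * x $h i) = of_real (\<Sum>i\<in>UNIV. (norm (x $h i))\<^sup>2)"
      by (simp only: of_real_sum complex_norm_square mult.commute)
    have "(\<Sum>i\<in>UNIV. (norm (x $h i))\<^sup>2) = 0"
      using c unfolding Yx n by (simp add: complex_eq_iff)
    then have "x $h i = 0" for i by (simp add: sum_nonneg_eq_0_iff)
    then show ?thesis by (simp add: Finite_Cartesian_Product.vec_eq_iff)
  qed
  then obtain B where "B ** (mone - Y) = mone" using matrix_left_invertible_ker by blast
  then show ?thesis using that matrix_left_right_inverse by blast
qed

text \<open>Taking adjoints, and moving a transpose across \<open>J\<close>, exchanges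
  \<open>1 + Z\<close> and \<open>1 - Z\<close>. As these commute,
  \<open>(1 + Z) (1 - Z)^(-1)\<close> satisfies both equations of the group.\<close>

lemma cayley_exists:
  assumes "lie (Y :: 'n::finite cmat)"
  obtains U where "cayley_at Y t U"
proof -
  define Z where "Z = (t / 2) *\<^sub>R Y"
  have adjZ: "adj Z = - Z" and JZ: "mtr Z ** J = - (J ** Z)"
    using assms by (simp_all add: lie_def Z_def adj_linear mtr_linear mult_scaleR eq_neg_iff_add_eq_0 scaleR_add_right[symmetric])
  obtain B where B: "B ** (mone - Z) = mone" "(mone - Z) ** B = mone" using lie_invertible[OF adjZ] by blast
  define U where "U = (mone + Z) ** B"
  have comm: "(mone - Z) ** (mone + Z) = (mone + Z) ** (mone - Z)" by (simp add: mult_distribs)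
  have "adj U ** U = adj B ** (mone - Z) ** (mone + Z) ** B"
    by (simp add: U_def adj_mult adj_linear adjZ matrix_mul_assoc)
  also have "\<dots> = adj B ** ((mone + Z) ** (mone - Z)) ** B"
    unfolding comm[symmetric] by (simp add: matrix_mul_assoc)
  also have "\<dots> = adj ((mone - Z) ** B) ** ((mone - Z) ** B)"
    by (simp add: adj_mult adj_linear adjZ matrix_mul_assoc)
  finally have 1: "adj U ** U = mone" by (simp add: B adj_linear)
  have J1: "mtr (mone + Z) ** J = J ** (mone - Z)" and J2: "mtr (mone - Z) ** J = J ** (mone + Z)"
    by (simp_all add: mtr_linear mult_distribs JZ)
  have "mtr U ** J ** U = mtr B ** (mtr (mone + Z) ** J) ** (mone + Z) ** B"
    by (simp add: U_def mtr_mult matrix_mul_assoc)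
  also have "\<dots> = mtr B ** J ** ((mone + Z) ** (mone - Z)) ** B"
    unfolding J1 comm[symmetric] by (simp add: matrix_mul_assoc)
  also have "\<dots> = mtr B ** (mtr (mone - Z) ** J) ** ((mone - Z) ** B)"
    unfolding J2 by (simp add: matrix_mul_assoc)
  also have "\<dots> = mtr B ** mtr (mone - Z) ** J"
    by (simp add: B matrix_mul_assoc)
  also have "mtr B ** mtr (mone - Z) = mtr ((mone - Z) ** B)" by (rule mtr_mult[symmetric])
  finally have 2: "mtr U ** J ** U = J" by (simp add: B mtr_linear)
  have UB: "mone + U = 2 *\<^sub>R B"
  proof -
    have "mone + U = (mone - Z) ** B + (mone + Z) ** B" by (simp only: B U_def)
    then have "mone + U = ((mone - Z) + (mone + Z)) ** B" by (simp only: mult_distribs(1))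
    also have "(mone - Z) + (mone + Z) = 2 *\<^sub>R mone" by (simp add: scaleR_2)
    finally show ?thesis by (simp add: mult_scaleR)
  qed
  have U1: "U - mone = Z ** (mone + U)"
  proof -
    have "U - mone = (mone + Z) ** B - (mone - Z) ** B" by (simp only: B U_def)
    then have "U - mone = ((mone + Z) - (mone - Z)) ** B" by (simp only: mult_distribs(3))
    also have "(mone + Z) - (mone - Z) = 2 *\<^sub>R Z" by (simp add: scaleR_2)
    finally show ?thesis by (simp add: UB mult_scaleR)
  qed
  have "Z ** (mone + U) = 2 *\<^sub>R Z + Z ** (U - mone)" by (simp add: mult_distribs scaleR_2)
  then have "U = mone + 2 *\<^sub>R Z + Z ** (Z ** (mone + U))" using U1 by (simp add: algebra_simps)
  then have "U = mone + t *\<^sub>R Y + (t\<^sup>2 / 4) *\<^sub>R (Y ** Y ** (mone + U))"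
    by (simp add: Z_def mult_scaleR matrix_mul_assoc power2_eq_square)
  with 1 2 that show ?thesis by (auto simp: cayley_at_def compact_Sp_iff)
qed

subsection \<open>Differentiation along left translations\<close>

definition good :: "('n::finite cmat \<Rightarrow> complex) \<Rightarrow> bool" where
  "good F \<longleftrightarrow> continuous_on UNIV F \<and> (\<exists>B. \<forall>S\<in>compact_Sp. norm (F S) \<le> B)"

lemma good_const: "good (\<lambda>_. c)" by (auto simp: good_def)

lemma good_add: "good F \<Longrightarrow> good G \<Longrightarrow> good (\<lambda>S. F S + G S)"
  unfolding good_def by (auto intro!: continuous_intros) (meson add_mono norm_triangle_le)

lemma good_mult: "good F \<Longrightarrow> good G \<Longrightarrow> good (\<lambda>S. F S * G S)"
proof -
  assume "good F" "good G"
  then obtain B C where b: "\<And>S. S \<in> compact_Sp \<Longrightarrow> norm (F S) \<le> B" "\<And>S. S \<in> compact_Sp \<Longrightarrow> norm (G S) \<le> C"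
    and c: "continuous_on UNIV F" "continuous_on UNIV G" unfolding good_def by blast
  have "norm (F S * G S) \<le> \<bar>B\<bar> * \<bar>C\<bar>" if "S \<in> compact_Sp" for S
    using b[OF that] by (auto simp: norm_mult intro!: mult_mono)
  with c show ?thesis unfolding good_def by (auto intro!: continuous_intros)
qed

lemma good_sum: "(\<And>x. x \<in> A \<Longrightarrow> good (F x)) \<Longrightarrow> good (\<lambda>S. \<Sum>x\<in>A. F x S)"
  by (induction A rule: infinite_finite_induct) (simp_all add: good_const good_add)

lemma good_entry: "good (\<lambda>S. S $h i $h j)"
  unfolding good_def using compact_Sp_entry_le by (auto intro!: continuous_intros exI[of _ 1])

text \<open>\<open>G\<close> is the derivative of \<open>F\<close> along the field
  \<open>S \<mapsto> Y S\<close>, with an error quadratic in \<open>t\<close> uniformly on the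
  group. Uniformity lets the expansion be integrated without a convergence theorem.\<close>

definition tder :: "'n::finite cmat \<Rightarrow> ('n cmat \<Rightarrow> complex) \<Rightarrow> ('n cmat \<Rightarrow> complex) \<Rightarrow> bool" where
  "tder Y F G \<longleftrightarrow> good F \<and> good G \<and> (\<exists>C\<ge>0. \<forall>t U S. 0 < t \<and> t \<le> 1 \<and> cayley_at Y t U \<and> S \<in> compact_Sp \<longrightarrow>
     norm (F (U ** S) - F S - of_real t * G S) \<le> C * t\<^sup>2)"

lemma tder_const: "tder Y (\<lambda>_. c) (\<lambda>_. 0)"
  by (auto simp: tder_def good_const)

lemma tder_add:
  assumes "tder Y F G" "tder Y F' G'"
  shows "tder Y (\<lambda>S. F S + F' S) (\<lambda>S. G S + G' S)"
proof -
  obtain C C' where C: "C \<ge> 0" "C' \<ge> 0"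
    "\<And>t U S. 0 < t \<Longrightarrow> t \<le> 1 \<Longrightarrow> cayley_at Y t U \<Longrightarrow> S \<in> compact_Sp \<Longrightarrow> norm (F (U ** S) - F S - of_real t * G S) \<le> C * t\<^sup>2"
    "\<And>t U S. 0 < t \<Longrightarrow> t \<le> 1 \<Longrightarrow> cayley_at Y t U \<Longrightarrow> S \<in> compact_Sp \<Longrightarrow> norm (F' (U ** S) - F' S - of_real t * G' S) \<le> C' * t\<^sup>2"
    using assms unfolding tder_def by metis
  have "norm (F (U ** S) + F' (U ** S) - (F S + F' S) - of_real t * (G S + G' S)) \<le> (C + C') * t\<^sup>2"
    if "0 < t" "t \<le> 1" "cayley_at Y t U" "S \<in> compact_Sp" for t U S
  proof -
    have "F (U ** S) + F' (U ** S) - (F S + F' S) - of_real t * (G S + G' S)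
       = (F (U ** S) - F S - of_real t * G S) + (F' (U ** S) - F' S - of_real t * G' S)" by (simp add: algebra_simps)
    then show ?thesis using norm_triangle_mono[OF C(3)[OF that] C(4)[OF that]] by (simp only: distrib_right)
  qed
  with C(1,2) assms show ?thesis unfolding tder_def by (auto intro!: good_add exI[of _ "C + C'"])
qed

lemma tder_mult:
  assumes "tder Y F G" "tder Y F' G'"
  shows "tder Y (\<lambda>S. F S * F' S) (\<lambda>S. G S * F' S + F S * G' S)"
proof -
  obtain C C' where C: "C \<ge> 0" "C' \<ge> 0"
    "\<And>t U S. 0 < t \<Longrightarrow> t \<le> 1 \<Longrightarrow> cayley_at Y t U \<Longrightarrow> S \<in> compact_Sp \<Longrightarrow> norm (F (U ** S) - F S - of_real t * G S) \<le> C * t\<^sup>2"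
    "\<And>t U S. 0 < t \<Longrightarrow> t \<le> 1 \<Longrightarrow> cayley_at Y t U \<Longrightarrow> S \<in> compact_Sp \<Longrightarrow> norm (F' (U ** S) - F' S - of_real t * G' S) \<le> C' * t\<^sup>2"
    using assms unfolding tder_def by metis
  have "\<exists>B\<ge>0. \<forall>S\<in>compact_Sp. norm (H S) \<le> B" if "good H" for H :: "'a cmat \<Rightarrow> complex"
    using that unfolding good_def by (meson abs_ge_zero abs_ge_self order_trans)
  then obtain BF BG BF' BG' where B: "BF \<ge> 0" "BG \<ge> 0" "BF' \<ge> 0" "BG' \<ge> 0"
    "\<And>S. S \<in> compact_Sp \<Longrightarrow> norm (F S) \<le> BF" "\<And>S. S \<in> compact_Sp \<Longrightarrow> norm (G S) \<le> BG"
    "\<And>S. S \<in> compact_Sp \<Longrightarrow> norm (F' S) \<le> BF'" "\<And>S. S \<in> compact_Sp \<Longrightarrow> norm (G' S) \<le> BG'"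
    using assms unfolding tder_def by metis
  define D where "D = C * BF' + BG * (BG' + C') + BF * C'"
  have "norm (F (U ** S) * F' (U ** S) - F S * F' S - of_real t * (G S * F' S + F S * G' S)) \<le> D * t\<^sup>2"
    if h: "0 < t" "t \<le> 1" "cayley_at Y t U" "S \<in> compact_Sp" for t U S
  proof -
    have US: "U ** S \<in> compact_Sp" using h compact_Sp_mult by (auto simp: cayley_at_def)
    let ?r = "F (U ** S) - F S - of_real t * G S" and ?r' = "F' (U ** S) - F' S - of_real t * G' S"
    have "norm (F' (U ** S) - F' S) = norm (?r' + of_real t * G' S)" by simp
    also have "\<dots> \<le> C' * t\<^sup>2 + t * BG'"
      using C(4)[OF h] B(8)[OF h(4)] h(1) by (intro norm_triangle_mono) (simp_all add: norm_mult)
    also have "C' * t\<^sup>2 \<le> C' * t" using h C(2) by (intro mult_left_mono) (simp_all add: power2_eq_square mult_left_le)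
    finally have d: "norm (F' (U ** S) - F' S) \<le> t * (BG' + C')" by (simp add: algebra_simps)
    have "F (U ** S) * F' (U ** S) - F S * F' S - of_real t * (G S * F' S + F S * G' S)
      = ?r * F' (U ** S) + of_real t * G S * (F' (U ** S) - F' S) + F S * ?r'" by (simp add: algebra_simps)
    also have "norm \<dots> \<le> C * t\<^sup>2 * BF' + t * BG * (t * (BG' + C')) + BF * (C' * t\<^sup>2)"
    proof (intro norm_triangle_mono)
      show "norm (?r * F' (U ** S)) \<le> C * t\<^sup>2 * BF'"
        unfolding norm_mult using C(3)[OF h] B(7)[OF US] C(1) by (intro mult_mono) auto
      show "norm (of_real t * G S * (F' (U ** S) - F' S)) \<le> t * BG * (t * (BG' + C'))"
        unfolding norm_mult using d B(6)[OF h(4)] h(1) B(2) by (intro mult_mono) auto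
      show "norm (F S * ?r') \<le> BF * (C' * t\<^sup>2)"
        unfolding norm_mult using C(4)[OF h] B(5)[OF h(4)] B(1) by (intro mult_mono) auto
    qed
    also have "\<dots> = D * t\<^sup>2" by (simp add: D_def power2_eq_square algebra_simps)
    finally show ?thesis .
  qed
  moreover have "D \<ge> 0" using C B by (simp add: D_def)
  moreover have "good F" "good G" "good F'" "good G'" using assms by (auto simp: tder_def)
  ultimately show ?thesis unfolding tder_def by (auto intro!: good_add good_mult exI[of _ D])
qed

lemma tder_entry: "tder Y (\<lambda>S. S $h i $h j) (\<lambda>S. (Y ** S) $h i $h j)"
proof -
  \<comment> \<open>The remainder carries the factor \<open>t^2 / 4\<close>, and the entries of
    \<open>S + U ** S\<close> are bounded by \<open>2\<close>.\<close>
  define C where "C = (\<Sum>a\<in>UNIV. norm ((Y ** Y) $h i $h a) * 2) / 4"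
  have "norm ((U ** S) $h i $h j - S $h i $h j - of_real t * (Y ** S) $h i $h j) \<le> C * t\<^sup>2"
    if "cayley_at Y t U" "S \<in> compact_Sp" for t U S
  proof -
    have U: "U = mone + t *\<^sub>R Y + (t\<^sup>2 / 4) *\<^sub>R (Y ** Y ** (mone + U))" "U \<in> compact_Sp" using that by (auto simp: cayley_at_def)
    have "U ** S = (mone + t *\<^sub>R Y + (t\<^sup>2 / 4) *\<^sub>R (Y ** Y ** (mone + U))) ** S" using U(1) by (rule arg_cong)
    also have "\<dots> = S + t *\<^sub>R (Y ** S) + (t\<^sup>2 / 4) *\<^sub>R (Y ** Y ** (S + U ** S))"
      by (simp only: mult_distribs mult_scaleR matrix_mul_assoc matrix_mul_lid matrix_mul_rid)
    finally have "(U ** S) $h i $h j = (S + t *\<^sub>R (Y ** S) + (t\<^sup>2 / 4) *\<^sub>R (Y ** Y ** (S + U ** S))) $h i $h j"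
      by (rule arg_cong)
    then have "(U ** S) $h i $h j - S $h i $h j - of_real t * (Y ** S) $h i $h j = (t\<^sup>2 / 4) *\<^sub>R (Y ** Y ** (S + U ** S)) $h i $h j"
      by (simp only: vector_add_component vector_scaleR_component) (simp add: scaleR_conv_of_real)
    also have "norm \<dots> = t\<^sup>2 / 4 * norm ((Y ** Y ** (S + U ** S)) $h i $h j)" by simp
    finally have n: "norm ((U ** S) $h i $h j - S $h i $h j - of_real t * (Y ** S) $h i $h j) = t\<^sup>2 / 4 * norm ((Y ** Y ** (S + U ** S)) $h i $h j)" .
    have "norm ((Y ** Y ** (S + U ** S)) $h i $h j) \<le> (\<Sum>a\<in>UNIV. norm ((Y ** Y) $h i $h a) * 2)"
      unfolding mult_nth[of "Y ** Y"]
    proof (rule order_trans[OF norm_sum sum_mono])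
      fix a
      have "norm ((S + U ** S) $h a $h j) \<le> 1 + 1"
        unfolding vector_add_component
        by (intro norm_triangle_mono compact_Sp_entry_le compact_Sp_mult U(2) that(2))
      then show "norm ((Y ** Y) $h i $h a * (S + U ** S) $h a $h j) \<le> norm ((Y ** Y) $h i $h a) * 2"
        unfolding norm_mult by (intro mult_left_mono) auto
    qed
    then have "t\<^sup>2 / 4 * norm ((Y ** Y ** (S + U ** S)) $h i $h j) \<le> t\<^sup>2 / 4 * (\<Sum>a\<in>UNIV. norm ((Y ** Y) $h i $h a) * 2)"
      by (rule mult_left_mono) simp
    then show ?thesis unfolding n C_def by (simp add: mult.commute)
  qed
  moreover have "C \<ge> 0" by (simp add: C_def sum_nonneg)
  moreover have "good (\<lambda>S. (Y ** S) $h i $h j)"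
    unfolding mult_nth by (intro good_sum good_mult good_const good_entry)
  ultimately show ?thesis unfolding tder_def by (auto intro!: good_entry exI[of _ C])
qed

context
  fixes M :: "('n::finite cmat) measure"
  assumes haar: "normalized_haar_Sp M"
begin

lemma haar_space: "space M = compact_Sp"
  using haar sets_eq_imp_space_eq[of M "restrict_space borel compact_Sp"] by (simp add: normalized_haar_Sp_def space_restrict_space)

lemma haar_finite: "finite_measure M"
  using haar by (intro finite_measureI) (simp add: normalized_haar_Sp_def)

lemma haar_total: "measure M (space M) = 1"
  using haar by (simp add: normalized_haar_Sp_def measure_def)

lemma good_measurable: "good F \<Longrightarrow> F \<in> borel_measurable M"
proof -
  assume "good F"
  then have "F \<in> borel_measurable borel" by (auto simp: good_def intro: borel_measurable_continuous_onI)
  then have "F \<in> borel_measurable (restrict_space borel compact_Sp)" by (rule measurable_restrict_space1)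
  moreover have "sets M = sets (restrict_space borel compact_Sp)" using haar by (simp add: normalized_haar_Sp_def)
  ultimately show ?thesis by (simp cong: measurable_cong_sets)
qed

lemma good_integrable: "good F \<Longrightarrow> integrable M F"
proof -
  assume F: "good F"
  then obtain B where "\<And>S. S \<in> compact_Sp \<Longrightarrow> norm (F S) \<le> B" by (auto simp: good_def)
  then show ?thesis
    using good_measurable[OF F] haar_finite
    by (intro finite_measure.integrable_const_bound[of M F B])
      (auto simp: haar_space intro!: AE_I2)
qed

lemma haar_translate:
  assumes "U \<in> compact_Sp" "good F"
  shows "(\<integral>S. F (U ** S) \<partial>M) = (\<integral>S. F S \<partial>M)" and "integrable M (\<lambda>S. F (U ** S))"
proof -
  have s: "sets M = sets (restrict_space borel compact_Sp)" using haar by (simp add: normalized_haar_Sp_def)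
  have c: "continuous_on UNIV (\<lambda>S. U ** S)"
    unfolding matrix_matrix_mult_def by (intro continuous_intros)
  have "(\<lambda>S. U ** S) \<in> measurable (restrict_space borel compact_Sp) (restrict_space borel compact_Sp)"
    using assms(1) compact_Sp_mult borel_measurable_continuous_onI[OF c]
    by (intro measurable_restrict_space3) auto
  then have m: "(\<lambda>S. U ** S) \<in> measurable M M"
    using s by (simp cong: measurable_cong_sets)
  have d: "distr M M (\<lambda>S. U ** S) = M" using haar assms(1) by (simp add: normalized_haar_Sp_def)
  have "(\<integral>S. F S \<partial>M) = (\<integral>S. F S \<partial>(distr M M (\<lambda>S. U ** S)))" by (simp add: d)
  also have "\<dots> = (\<integral>S. F (U ** S) \<partial>M)" by (rule integral_distr[OF m good_measurable[OF assms(2)]])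
  finally show "(\<integral>S. F (U ** S) \<partial>M) = (\<integral>S. F S \<partial>M)" by simp
  have "integrable (distr M M (\<lambda>S. U ** S)) F" using good_integrable[OF assms(2)] by (simp add: d)
  then show "integrable M (\<lambda>S. F (U ** S))"
    using integrable_distr_eq[OF m good_measurable[OF assms(2)]] by simp
qed

text \<open>The integral of \<open>F (U ** S) - F S\<close> vanishes by invariance, so the integral
  of \<open>G\<close> has norm at most \<open>C * t\<close> for all small
  \<open>t > 0\<close>.\<close>

lemma tder_integral:
  assumes "lie Y" "tder Y F G"
  shows "(\<integral>S. G S \<partial>M) = 0"
proof -
  interpret finite_measure M by (rule haar_finite)
  have gF: "good F" and gG: "good G" using assms(2) by (auto simp: tder_def)
  obtain C where C: "C \<ge> 0"
    "\<And>t U S. 0 < t \<Longrightarrow> t \<le> 1 \<Longrightarrow> cayley_at Y t U \<Longrightarrow> S \<in> compact_Sp \<Longrightarrow> norm (F (U ** S) - F S - of_real t * G S) \<le> C * t\<^sup>2"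
    using assms(2) unfolding tder_def by metis
  have "norm (\<integral>S. G S \<partial>M) \<le> C * t" if t: "0 < t" "t \<le> 1" for t
  proof -
    obtain U where U: "cayley_at Y t U" using cayley_exists[OF assms(1)] by blast
    then have US: "U \<in> compact_Sp" by (simp add: cayley_at_def)
    note i = good_integrable[OF gF] good_integrable[OF gG] haar_translate(2)[OF US gF]
    have "(\<integral>S. F (U ** S) - F S - of_real t * G S \<partial>M) = - (of_real t * (\<integral>S. G S \<partial>M))"
      using i by (simp add: haar_translate(1)[OF US gF])
    moreover have "norm (\<integral>S. F (U ** S) - F S - of_real t * G S \<partial>M) \<le> (\<integral>S. C * t\<^sup>2 \<partial>M)"
    proof (rule order_trans[OF integral_norm_bound integral_mono])
      show "integrable M (\<lambda>S. norm (F (U ** S) - F S - of_real t * G S))" using i by simp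
    qed (use C(2)[OF t U] haar_space in auto)
    ultimately have "t * norm (\<integral>S. G S \<partial>M) \<le> C * t\<^sup>2"
      using t by (simp add: norm_mult haar_total)
    then show ?thesis using t by (simp add: power2_eq_square)
  qed
  then have "eventually (\<lambda>t. norm (\<integral>S. G S \<partial>M) \<le> C * t) (at_right 0)"
    by (auto simp: eventually_at_right_field intro!: exI[of _ 1])
  moreover have "((\<lambda>t. C * t) \<longlongrightarrow> C * 0) (at_right 0)" by (intro tendsto_intros)
  ultimately have "norm (\<integral>S. G S \<partial>M) \<le> C * 0"
    by (intro tendsto_lowerbound[of "\<lambda>t. C * t" _ "at_right 0"]) auto
  then show ?thesis by simp
qed

end

text \<open>The generators used below lie in the complexified Lie algebra; derivatives along them
  are complex combinations of two derivatives along the compact group.\<close>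

definition cder :: "'n::finite cmat \<Rightarrow> 'n cmat \<Rightarrow> ('n cmat \<Rightarrow> complex) \<Rightarrow> ('n cmat \<Rightarrow> complex) \<Rightarrow> bool" where
  "cder A B F G \<longleftrightarrow> (\<exists>G1 G2. tder A F G1 \<and> tder B F G2 \<and> G = (\<lambda>S. G1 S + \<i> * G2 S))"

lemma cder_const: "cder A B (\<lambda>_. c) (\<lambda>_. 0)"
  unfolding cder_def using tder_const by (intro exI[of _ "\<lambda>_. 0"]) auto

lemma cder_add: "cder A B F G \<Longrightarrow> cder A B F' G' \<Longrightarrow> cder A B (\<lambda>S. F S + F' S) (\<lambda>S. G S + G' S)"
  unfolding cder_def
  by (elim exE conjE, rule exI, rule exI, intro conjI, rule tder_add, assumption, assumption, rule tder_add, assumption, assumption)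
    (auto simp: algebra_simps)

lemma cder_mult: "cder A B F G \<Longrightarrow> cder A B F' G' \<Longrightarrow> cder A B (\<lambda>S. F S * F' S) (\<lambda>S. G S * F' S + F S * G' S)"
  unfolding cder_def
  by (elim exE conjE, rule exI, rule exI, intro conjI, rule tder_mult, assumption, assumption, rule tder_mult, assumption, assumption)
    (auto simp: algebra_simps)

lemma cder_sum: "(\<And>x. x \<in> X \<Longrightarrow> cder A B (F x) (G x)) \<Longrightarrow> cder A B (\<lambda>S. \<Sum>x\<in>X. F x S) (\<lambda>S. \<Sum>x\<in>X. G x S)"
  by (induction X rule: infinite_finite_induct) (simp_all add: cder_const cder_add)

lemma cder_entry:
  assumes "\<And>a b. A $h a $h b + \<i> * B $h a $h b = X $h a $h b"
  shows "cder A B (\<lambda>S. S $h i $h j) (\<lambda>S. (X ** S) $h i $h j)"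
  unfolding cder_def
proof (intro exI conjI)
  show "(\<lambda>S. (X ** S) $h i $h j) = (\<lambda>S. (A ** S) $h i $h j + \<i> * (B ** S) $h i $h j)"
    by (simp add: fun_eq_iff mult_nth assms[symmetric] sum.distrib sum_distrib_left distrib_right mult.assoc)
qed (rule tder_entry)+

lemma cder_good: "cder A B F G \<Longrightarrow> good G"
  unfolding cder_def tder_def by (auto intro!: good_add good_mult good_const)

lemma cder_integral:
  assumes "normalized_haar_Sp M" "lie A" "lie B" "cder A B F G"
  shows "(\<integral>S. G S \<partial>M) = 0"
proof -
  obtain G1 G2 where G: "tder A F G1" "tder B F G2" "G = (\<lambda>S. G1 S + \<i> * G2 S)" using assms(4) by (auto simp: cder_def)
  then have "good G1" "good G2" by (auto simp: tder_def)
  then have "integrable M G1" "integrable M G2" using good_integrable[OF assms(1)] by auto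
  then show ?thesis
    using tder_integral[OF assms(1,2) G(1)] tder_integral[OF assms(1,3) G(2)] by (simp add: G(3))
qed

subsection \<open>Generators of the symplectic Lie algebra\<close>

definition unit_mat :: "'k \<Rightarrow> 'k \<Rightarrow> complex^'k::finite^'k" where
  "unit_mat i j = (\<chi> a b. if a = i \<and> b = j then 1 else 0)"

text \<open>Twice the projection of the matrix unit to the complex symplectic Lie algebra, the fixed
  space of the involution \<open>X \<mapsto> J X^T J\<close>. Summing over all index pairs replaces
  the choice of a basis.\<close>

definition sp_gen :: "'n + 'n \<Rightarrow> 'n + 'n \<Rightarrow> 'n::finite cmat" where
  "sp_gen i j = unit_mat i j + J ** unit_mat j i ** J"

definition cscale :: "complex \<Rightarrow> complex^'k::finite^'k \<Rightarrow> complex^'k^'k" where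
  "cscale c A = (\<chi> a b. c * A $h a $h b)"

lemma cscale_nth: "cscale c A $h a $h b = c * A $h a $h b" by (simp add: cscale_def)

lemma cscale_mult: "cscale c A ** B = cscale c (A ** B)" "A ** cscale c B = cscale c (A ** B)"
  by (simp_all add: Finite_Cartesian_Product.vec_eq_iff mult_nth cscale_nth sum_distrib_left mult_ac)

lemma unit_mat_nth: "unit_mat i j $h a $h b = (if a = i \<and> b = j then 1 else 0)"
  by (simp add: unit_mat_def)

lemma sp_gen_nth: "sp_gen i j $h a $h b = (if a = i \<and> b = j then 1 else 0) + J $h a $h j * J $h i $h b"
proof -
  have "(J ** unit_mat j i) $h a $h k = (if k = i then J $h a $h j else 0)" for k
  proof -
    have "(J ** unit_mat j i) $h a $h k = (\<Sum>l\<in>UNIV. if l = j then (if k = i then J $h a $h j else 0) else 0)"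
      unfolding mult_nth unit_mat_nth by (intro sum.cong) auto
    then show ?thesis by (simp add: sum.delta')
  qed
  then have "(J ** unit_mat j i ** J) $h a $h b = (\<Sum>k\<in>UNIV. if k = i then J $h a $h j * J $h i $h b else 0)"
    unfolding mult_nth[of "J ** unit_mat j i"] by (intro sum.cong) auto
  then show ?thesis by (simp add: sp_gen_def unit_mat_nth sum.delta')
qed

lemma mtr_sp_gen: "mtr (sp_gen i j) = sp_gen j i"
proof -
  have u: "mtr (unit_mat i j) = unit_mat j i" for i j :: "'a + 'a"
    by (auto simp: Finite_Cartesian_Product.vec_eq_iff mtr_nth unit_mat_nth)
  show ?thesis
    unfolding sp_gen_def by (simp add: mtr_linear mtr_mult u mtr_J mult_uminus matrix_mul_assoc)
qed

lemma sp_gen_J: "mtr (sp_gen i j) ** J + J ** sp_gen i j = 0"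
proof -
  have "mtr (sp_gen i j) ** J = unit_mat j i ** J + J ** unit_mat i j ** (J ** J)"
    unfolding mtr_sp_gen unfolding sp_gen_def by (simp only: mult_distribs matrix_mul_assoc)
  moreover have "J ** sp_gen i j = J ** unit_mat i j + (J ** J) ** (unit_mat j i ** J)"
    unfolding sp_gen_def by (simp only: mult_distribs matrix_mul_assoc)
  ultimately show ?thesis by (simp add: J_J mult_uminus)
qed

text \<open>The generator \<open>X\<close> is real, and its transpose \<open>Y\<close> is the
  generator with exchanged indices; \<open>A = (X - Y) / 2\<close> and
  \<open>B = - \<i> (X + Y) / 2\<close> are skew-Hermitian.\<close>

lemma sp_gen_decomposition:
  obtains A B where "lie A" "lie B" "\<And>a b. A $h a $h b + \<i> * B $h a $h b = sp_gen i j $h a $h b"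
proof -
  define X Y where "X = sp_gen i j" and "Y = sp_gen j i"
  have XY: "mtr X = Y" "mtr Y = X" by (simp_all add: X_def Y_def mtr_sp_gen)
  have JX: "Y ** J = - (J ** X)" "X ** J = - (J ** Y)"
    using sp_gen_J[of i j] sp_gen_J[of j i] by (simp_all add: X_def Y_def mtr_sp_gen eq_neg_iff_add_eq_0)
  have "cnj (sp_gen k l $h a $h b) = sp_gen k l $h a $h b" for k l a b
    by (auto simp: sp_gen_nth J_nth side_def split: sum.splits)
  then have adjXY: "adj X = Y" "adj Y = X"
    using XY by (auto simp: X_def Y_def Finite_Cartesian_Product.vec_eq_iff adj_nth mtr_nth)
  define A where "A = cscale (1 / 2) (X - Y)"
  define B where "B = cscale (- (\<i> / 2)) (X + Y)"
  have adjs: "adj (cscale c Z) = cscale (cnj c) (adj Z)" and mtrs: "mtr (cscale c Z) = cscale c (mtr Z)" for c and Z :: "'a cmat"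
    by (simp_all add: Finite_Cartesian_Product.vec_eq_iff adj_nth mtr_nth cscale_nth)
  have neg: "cscale c Z + cscale c Z' = cscale c (Z + Z')" "cscale c 0 = 0" for c and Z Z' :: "'a cmat"
    by (simp_all add: Finite_Cartesian_Product.vec_eq_iff cscale_nth distrib_left)
  have "adj A = - A" unfolding A_def adjs
    by (simp add: adj_linear adjXY Finite_Cartesian_Product.vec_eq_iff cscale_nth field_simps)
  moreover have "adj B = - B" unfolding B_def adjs
    by (simp add: adj_linear adjXY Finite_Cartesian_Product.vec_eq_iff cscale_nth algebra_simps)
  moreover have "mtr A ** J + J ** A = 0"
    unfolding A_def mtrs cscale_mult neg by (simp add: mtr_linear XY mult_distribs JX neg)
  moreover have "mtr B ** J + J ** B = 0"
    unfolding B_def mtrs cscale_mult neg by (simp add: mtr_linear XY mult_distribs JX neg)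
  ultimately have "lie A" "lie B" by (simp_all add: lie_def)
  moreover have "A $h a $h b + \<i> * B $h a $h b = sp_gen i j $h a $h b" for a b
  proof -
    have "A $h a $h b + \<i> * B $h a $h b = (1 / 2) * (X $h a $h b - Y $h a $h b) - (\<i> * \<i>) / 2 * (X $h a $h b + Y $h a $h b)"
      by (simp add: A_def B_def cscale_nth algebra_simps)
    then show ?thesis by (simp add: X_def algebra_simps)
  qed
  ultimately show ?thesis using that by blast
qed

subsection \<open>Derivatives of power traces\<close>

lemma matrix_power_0 [simp]: "matrix_power S 0 = mone" by (simp add: matrix_power_def)
lemma matrix_power_Suc: "matrix_power S (Suc m) = S ** matrix_power S m" by (simp add: matrix_power_def)

lemma matrix_power_add: "matrix_power S (a + b) = matrix_power S a ** matrix_power (S :: complex^'k::finite^'k) b"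
  by (induction a) (simp_all add: matrix_power_Suc matrix_mul_assoc)

lemma cder_matrix_power:
  assumes X: "\<And>a b. A $h a $h b + \<i> * B $h a $h b = X $h a $h b"
  shows "cder A B (\<lambda>S. matrix_power S m $h a $h b)
    (\<lambda>S. \<Sum>r<m. (matrix_power S r ** X ** matrix_power S (m - r)) $h a $h b)"
proof (induction m arbitrary: a)
  case 0 show ?case by (simp add: cder_const)
next
  case (Suc m)
  have "cder A B (\<lambda>S. \<Sum>c\<in>UNIV. S $h a $h c * matrix_power S m $h c $h b)
    (\<lambda>S. \<Sum>c\<in>UNIV. (X ** S) $h a $h c * matrix_power S m $h c $h b
       + S $h a $h c * (\<Sum>r<m. (matrix_power S r ** X ** matrix_power S (m - r)) $h c $h b))"
    by (intro cder_sum cder_mult cder_entry X Suc)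
  also have "(\<lambda>S. \<Sum>c\<in>UNIV. S $h a $h c * matrix_power S m $h c $h b) = (\<lambda>S. matrix_power S (Suc m) $h a $h b)"
    by (simp add: matrix_power_Suc mult_nth)
  also have "(\<lambda>S. \<Sum>c\<in>UNIV. (X ** S) $h a $h c * matrix_power S m $h c $h b
       + S $h a $h c * (\<Sum>r<m. (matrix_power S r ** X ** matrix_power S (m - r)) $h c $h b))
    = (\<lambda>S. \<Sum>r<Suc m. (matrix_power S r ** X ** matrix_power S (Suc m - r)) $h a $h b)"
  proof
    fix S
    have "(\<Sum>c\<in>UNIV. S $h a $h c * (\<Sum>r<m. (matrix_power S r ** X ** matrix_power S (m - r)) $h c $h b))
       = (\<Sum>r<m. (S ** (matrix_power S r ** X ** matrix_power S (m - r))) $h a $h b)"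
      unfolding mult_nth[of S] sum_distrib_left by (rule sum.swap)
    also have "\<dots> = (\<Sum>r<m. (matrix_power S (Suc r) ** X ** matrix_power S (Suc m - Suc r)) $h a $h b)"
      by (simp add: matrix_power_Suc matrix_mul_assoc)
    finally show "(\<Sum>c\<in>UNIV. (X ** S) $h a $h c * matrix_power S m $h c $h b
       + S $h a $h c * (\<Sum>r<m. (matrix_power S r ** X ** matrix_power S (m - r)) $h c $h b))
      = (\<Sum>r<Suc m. (matrix_power S r ** X ** matrix_power S (Suc m - r)) $h a $h b)"
      unfolding sum.lessThan_Suc_shift sum.distrib
      by (simp add: mult_nth[of "X ** S", symmetric] matrix_power_Suc matrix_mul_assoc)
  qed
  finally show ?case .
qed

definition tr_pow :: "complex^'k::finite^'k \<Rightarrow> nat \<Rightarrow> complex" where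
  "tr_pow S m = Determinants.trace (matrix_power S m)"

lemma cder_tr_pow:
  assumes X: "\<And>a b. A $h a $h b + \<i> * B $h a $h b = X $h a $h b"
  shows "cder A B (\<lambda>S. tr_pow S m) (\<lambda>S. of_nat m * Determinants.trace (X ** matrix_power S m))"
proof -
  have "cder A B (\<lambda>S. \<Sum>a\<in>UNIV. matrix_power S m $h a $h a)
    (\<lambda>S. \<Sum>a\<in>UNIV. \<Sum>r<m. (matrix_power S r ** X ** matrix_power S (m - r)) $h a $h a)"
    by (intro cder_sum cder_matrix_power X)
  also have "(\<lambda>S. \<Sum>a\<in>UNIV. \<Sum>r<m. (matrix_power S r ** X ** matrix_power S (m - r)) $h a $h a)
    = (\<lambda>S. of_nat m * Determinants.trace (X ** matrix_power S m))"
  proof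
    fix S
    have "(\<Sum>a\<in>UNIV. \<Sum>r<m. (matrix_power S r ** X ** matrix_power S (m - r)) $h a $h a)
      = (\<Sum>r<m. Determinants.trace (matrix_power S r ** (X ** matrix_power S (m - r))))"
      unfolding Determinants.trace_def matrix_mul_assoc by (rule sum.swap)
    also have "\<dots> = (\<Sum>r<m. Determinants.trace (X ** matrix_power S m))"
    proof (rule sum.cong[OF refl])
      fix r assume "r \<in> {..<m}"
      then have "matrix_power S (m - r) ** matrix_power S r = matrix_power S m"
        by (simp add: matrix_power_add[symmetric])
      then show "Determinants.trace (matrix_power S r ** (X ** matrix_power S (m - r))) = Determinants.trace (X ** matrix_power S m)"
        by (subst trace_mul_sym) (simp add: matrix_mul_assoc[symmetric])
    qed
    finally show "(\<Sum>a\<in>UNIV. \<Sum>r<m. (matrix_power S r ** X ** matrix_power S (m - r)) $h a $h a)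
      = of_nat m * Determinants.trace (X ** matrix_power S m)" by simp
  qed
  finally show ?thesis by (simp add: tr_pow_def Determinants.trace_def)
qed

definition ev_mat :: "complex^'k::finite^'k \<Rightarrow> ppoly \<Rightarrow> complex" where
  "ev_mat S = peval (\<lambda>x. x) (tr_pow S)"

lemmas ev_mat_hom = peval_hom[OF scalars_id, of "tr_pow S" for S, folded ev_mat_def]

lemma good_ev_mat: "good (\<lambda>S. ev_mat S q)"
proof (induction q rule: ppoly_induct)
  case (pvar m)
  have "good (\<lambda>S. matrix_power S m $h a $h b)" for a b
    by (induction m arbitrary: a) (simp_all add: good_const matrix_power_Suc mult_nth good_sum good_mult good_entry)
  then show ?case unfolding ev_mat_hom tr_pow_def Determinants.trace_def by (rule good_sum)
qed (simp_all add: ev_mat_hom good_const good_add good_mult)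

definition deriv_along :: "'n::finite cmat \<Rightarrow> ppoly \<Rightarrow> nat \<Rightarrow> 'n cmat \<Rightarrow> complex" where
  "deriv_along X q M S = (\<Sum>m\<le>M. ev_mat S (pderiv_var m q) * (of_nat m * Determinants.trace (X ** matrix_power S m)))"

lemma pderiv_var_bound: "\<exists>M0. \<forall>m>M0. pderiv_var m q = 0"
proof (induction q rule: ppoly_induct)
  case (pvar v) show ?case by (rule exI[of _ v]) (simp add: pderiv_var_pvar)
next
  case (add f g)
  then obtain a b where "\<forall>m>a. pderiv_var m f = 0" "\<forall>m>b. pderiv_var m g = 0" by blast
  then show ?case by (intro exI[of _ "max a b"]) (simp add: pderiv_var_add)
next
  case (mult f g)
  then obtain a b where "\<forall>m>a. pderiv_var m f = 0" "\<forall>m>b. pderiv_var m g = 0" by blast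
  then show ?case by (intro exI[of _ "max a b"]) (simp add: pderiv_var_mult)
qed simp

lemma deriv_along_bound:
  assumes "\<forall>m>M. pderiv_var m q = 0" "M \<le> M'"
  shows "deriv_along X q M' S = deriv_along X q M S"
  unfolding deriv_along_def using assms
  by (intro sum.mono_neutral_right) (auto simp: ev_mat_hom)

lemma cder_ev_mat:
  assumes X: "\<And>a b. A $h a $h b + \<i> * B $h a $h b = X $h a $h b" and M: "\<forall>m>M. pderiv_var m q = 0"
  shows "cder A B (\<lambda>S. ev_mat S q) (deriv_along X q M)"
proof -
  have "\<exists>M. cder A B (\<lambda>S. ev_mat S q) (deriv_along X q M) \<and> (\<forall>m>M. pderiv_var m q = 0)"
  proof (induction q rule: ppoly_induct)
    case (cst a)
    have "deriv_along X (cst a) 0 = (\<lambda>_. 0)" by (simp add: fun_eq_iff deriv_along_def)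
    then show ?case by (intro exI[of _ 0]) (simp add: ev_mat_hom cder_const)
  next
    case (pvar v)
    have "deriv_along X (pvar v) v = (\<lambda>S. of_nat v * Determinants.trace (X ** matrix_power S v))"
    proof
      fix S
      have "deriv_along X (pvar v) v S = (\<Sum>m\<le>v. if m = v then of_nat v * Determinants.trace (X ** matrix_power S v) else 0)"
        unfolding deriv_along_def by (intro sum.cong) (auto simp: pderiv_var_pvar ev_mat_hom)
      then show "deriv_along X (pvar v) v S = of_nat v * Determinants.trace (X ** matrix_power S v)" by simp
    qed
    then show ?case
      using cder_tr_pow[of A B X, OF X, of v] by (intro exI[of _ v]) (simp add: ev_mat_hom pderiv_var_pvar)
  next
    case (add f g)
    then obtain a b where ab: "cder A B (\<lambda>S. ev_mat S f) (deriv_along X f a)" "\<forall>m>a. pderiv_var m f = 0"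
      "cder A B (\<lambda>S. ev_mat S g) (deriv_along X g b)" "\<forall>m>b. pderiv_var m g = 0" by blast
    let ?M = "max a b"
    have "deriv_along X (f + g) ?M = (\<lambda>S. deriv_along X f a S + deriv_along X g b S)"
      unfolding deriv_along_bound[OF ab(2) max.cobounded1[of a b], symmetric] deriv_along_bound[OF ab(4) max.cobounded2[of b a], symmetric]
      by (simp add: fun_eq_iff deriv_along_def pderiv_var_add ev_mat_hom distrib_right sum.distrib)
    then show ?case using cder_add[OF ab(1,3)] ab(2,4)
      by (intro exI[of _ ?M]) (simp add: ev_mat_hom pderiv_var_add)
  next
    case (mult f g)
    then obtain a b where ab: "cder A B (\<lambda>S. ev_mat S f) (deriv_along X f a)" "\<forall>m>a. pderiv_var m f = 0"
      "cder A B (\<lambda>S. ev_mat S g) (deriv_along X g b)" "\<forall>m>b. pderiv_var m g = 0" by blast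
    let ?M = "max a b"
    have "deriv_along X (f * g) ?M = (\<lambda>S. deriv_along X f a S * ev_mat S g + ev_mat S f * deriv_along X g b S)"
      unfolding deriv_along_bound[OF ab(2) max.cobounded1[of a b], symmetric] deriv_along_bound[OF ab(4) max.cobounded2[of b a], symmetric]
      by (simp add: fun_eq_iff deriv_along_def pderiv_var_mult ev_mat_hom distrib_right distrib_left sum.distrib sum_distrib_left sum_distrib_right mult_ac)
    then show ?case using cder_mult[OF ab(1,3)] ab(2,4)
      by (intro exI[of _ ?M]) (simp add: ev_mat_hom pderiv_var_mult)
  qed
  then obtain M' where M': "cder A B (\<lambda>S. ev_mat S q) (deriv_along X q M')" "\<forall>m>M'. pderiv_var m q = 0" by blast
  have "deriv_along X q M' = deriv_along X q M"
    by (rule ext) (metis deriv_along_bound[OF M'(2) max.cobounded1[of M' M]] deriv_along_bound[OF M max.cobounded2[of M M']])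
  with M'(1) show ?thesis by simp
qed

subsection \<open>Completeness relations\<close>

lemma compact_Sp_power: "S \<in> compact_Sp \<Longrightarrow> matrix_power S m \<in> (compact_Sp :: 'n::finite cmat set)"
proof (induction m)
  case 0 show ?case by (simp add: compact_Sp_iff adj_linear mtr_linear)
qed (simp add: matrix_power_Suc compact_Sp_mult)

lemma compact_Sp_inverse:
  assumes "S \<in> (compact_Sp :: 'n::finite cmat set)"
  shows "S ** adj S = mone" "J ** mtr S ** J = - adj S"
proof -
  show i: "S ** adj S = mone" using assms matrix_left_right_inverse by (auto simp: compact_Sp_iff)
  have "mtr S ** J ** (S ** adj S) = J ** adj S" using assms by (simp add: compact_Sp_iff matrix_mul_assoc)
  then have "mtr S ** J = J ** adj S" by (simp add: i)
  then have "J ** (mtr S ** J) = (J ** J) ** adj S" by (simp add: matrix_mul_assoc)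
  then show "J ** mtr S ** J = - adj S" by (simp add: J_J mult_uminus matrix_mul_assoc)
qed

lemma trace_mtr: "Determinants.trace (mtr A) = Determinants.trace A"
  by (simp add: Determinants.trace_def mtr_nth)

lemma trace_uminus: "Determinants.trace (- A) = - Determinants.trace (A :: complex^'k::finite^'k)"
  by (simp add: Determinants.trace_def sum_negf)

lemma trace_adj:
  assumes "S \<in> (compact_Sp :: 'n::finite cmat set)"
  shows "Determinants.trace (adj S) = Determinants.trace S"
proof -
  have "Determinants.trace (adj S) = - Determinants.trace (J ** (mtr S ** J))"
    using compact_Sp_inverse(2)[OF assms] by (simp add: trace_uminus matrix_mul_assoc)
  also have "\<dots> = - Determinants.trace (mtr S ** (J ** J))" by (subst trace_mul_sym) (simp add: matrix_mul_assoc)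
  also have "\<dots> = Determinants.trace S" by (simp add: J_J mult_uminus trace_uminus trace_mtr)
  finally show ?thesis .
qed

text \<open>Inverse powers of a group element are adjoints and have the same traces as the positive
  powers, so that only the distance of the exponents matters.\<close>

lemma trace_power_adj:
  assumes "S \<in> (compact_Sp :: 'n::finite cmat set)"
  shows "Determinants.trace (matrix_power S r ** adj (matrix_power S s)) = tr_pow S (nat \<bar>int r - int s\<bar>)"
proof (cases "s \<le> r")
  case True
  then have "matrix_power S r = matrix_power S (r - s) ** matrix_power S s" by (simp add: matrix_power_add[symmetric])
  then have "matrix_power S r ** adj (matrix_power S s) = matrix_power S (r - s)"
    using compact_Sp_inverse(1)[OF compact_Sp_power[OF assms, of s]] by (simp add: matrix_mul_assoc[symmetric])
  moreover have "nat \<bar>int r - int s\<bar> = r - s" using True by simp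
  ultimately show ?thesis by (simp only: tr_pow_def)
next
  case False
  then have "matrix_power S s = matrix_power S (s - r) ** matrix_power S r" by (simp add: matrix_power_add[symmetric])
  then have "matrix_power S r ** adj (matrix_power S s) = matrix_power S r ** adj (matrix_power S r) ** adj (matrix_power S (s - r))"
    by (simp add: adj_mult matrix_mul_assoc)
  then have "matrix_power S r ** adj (matrix_power S s) = adj (matrix_power S (s - r))"
    using compact_Sp_inverse(1)[OF compact_Sp_power[OF assms, of r]] by simp
  moreover have "nat \<bar>int r - int s\<bar> = s - r" using False by simp
  ultimately show ?thesis by (simp only: tr_pow_def trace_adj[OF compact_Sp_power[OF assms]])
qed

lemma sum_entry_products: "(\<Sum>i\<in>UNIV. \<Sum>j\<in>UNIV. C $h i $h j * D $h i $h j) = Determinants.trace (C ** mtr (D :: complex^'k::finite^'k))"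
  by (simp add: Determinants.trace_def mult_nth mtr_nth)

text \<open>A completeness relation. The matrix units split the trace into that of \<open>P\<close>
  times that of \<open>Q\<close>; the terms with \<open>J\<close> transpose \<open>Q\<close>, and
  \<open>J Q^T J = - adj Q\<close> on the group turns them into the trace of
  \<open>P ** adj Q\<close>.\<close>

lemma sp_gen_sandwich:
  assumes "Q \<in> (compact_Sp :: 'n::finite cmat set)"
  shows "(\<Sum>i\<in>UNIV. \<Sum>j\<in>UNIV. (P ** sp_gen i j ** Q) $h i $h j)
    = Determinants.trace P * Determinants.trace Q + Determinants.trace (P ** adj Q)"
proof -
  have e: "(P ** sp_gen i j ** Q) $h i $h j = P $h i $h i * Q $h j $h j + (P ** J) $h i $h j * (J ** Q) $h i $h j" for i j
  proof -
    have "(P ** unit_mat i j ** Q) $h i $h j = P $h i $h i * Q $h j $h j"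
    proof -
      have "(P ** unit_mat i j) $h i $h k = (if k = j then P $h i $h i else 0)" for k
      proof -
        have "(P ** unit_mat i j) $h i $h k = (\<Sum>l\<in>UNIV. if l = i then (if k = j then P $h i $h i else 0) else 0)"
          unfolding mult_nth unit_mat_nth by (intro sum.cong) auto
        then show ?thesis by (simp add: sum.delta')
      qed
      then have "(P ** unit_mat i j ** Q) $h i $h j = (\<Sum>k\<in>UNIV. if k = j then P $h i $h i * Q $h j $h j else 0)"
        unfolding mult_nth[of "P ** unit_mat i j"] by (intro sum.cong) auto
      then show ?thesis by (simp add: sum.delta')
    qed
    moreover have "(P ** (J ** unit_mat j i ** J) ** Q) $h i $h j = (P ** J) $h i $h j * (J ** Q) $h i $h j"
    proof -
      have "(P ** J ** unit_mat j i) $h i $h k = (if k = i then (P ** J) $h i $h j else 0)" for k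
      proof -
        have "(P ** J ** unit_mat j i) $h i $h k = (\<Sum>l\<in>UNIV. if l = j then (if k = i then (P ** J) $h i $h j else 0) else 0)"
          unfolding mult_nth[of "P ** J"] unit_mat_nth by (intro sum.cong) auto
        then show ?thesis by (simp add: sum.delta')
      qed
      then have "(P ** J ** unit_mat j i ** (J ** Q)) $h i $h j = (\<Sum>k\<in>UNIV. if k = i then (P ** J) $h i $h j * (J ** Q) $h i $h j else 0)"
        unfolding mult_nth[of "P ** J ** unit_mat j i"] by (intro sum.cong) auto
      then show ?thesis by (simp add: sum.delta' matrix_mul_assoc)
    qed
    ultimately show ?thesis by (simp add: sp_gen_def mult_distribs)
  qed
  have "mtr (J ** Q) = - (mtr Q ** J)" by (simp add: mtr_mult mtr_J mult_uminus)
  then have "Determinants.trace (P ** J ** mtr (J ** Q)) = - Determinants.trace (P ** (J ** mtr Q ** J))"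
    by (simp add: mult_uminus trace_uminus matrix_mul_assoc)
  also have "\<dots> = Determinants.trace (P ** adj Q)"
    by (simp add: compact_Sp_inverse(2)[OF assms] mult_uminus trace_uminus)
  finally show ?thesis
    by (simp add: e sum.distrib sum_entry_products[of "P ** J" "J ** Q"] Determinants.trace_def[of P] Determinants.trace_def[of Q] sum_product)
qed

text \<open>The companion relation: the matrix units join \<open>P\<close> and \<open>Q\<close> into
  one trace, and the terms with \<open>J\<close> contribute the inverse of \<open>Q\<close> with the
  opposite sign.\<close>

lemma sp_gen_trace:
  assumes "Q \<in> (compact_Sp :: 'n::finite cmat set)"
  shows "(\<Sum>i\<in>UNIV. \<Sum>j\<in>UNIV. P $h i $h j * Determinants.trace (sp_gen i j ** Q))
    = Determinants.trace (P ** Q) - Determinants.trace (P ** adj Q)"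
proof -
  have e: "Determinants.trace (sp_gen i j ** Q) = (Q + mtr (J ** Q ** J)) $h j $h i" for i j
  proof -
    have "Determinants.trace (sp_gen i j ** Q) = (\<Sum>a\<in>UNIV. \<Sum>b\<in>UNIV. (if a = i then if b = j then Q $h j $h i else 0 else 0) + J $h i $h b * Q $h b $h a * J $h a $h j)"
      unfolding Determinants.trace_def mult_nth sp_gen_nth
      by (intro sum.cong) (auto simp: algebra_simps)
    also have "\<dots> = Q $h j $h i + (\<Sum>a\<in>UNIV. (\<Sum>b\<in>UNIV. J $h i $h b * Q $h b $h a) * J $h a $h j)"
    proof -
      have "(\<Sum>b\<in>UNIV. if a = i then if b = j then Q $h j $h i else 0 else 0) = (if a = i then Q $h j $h i else 0)" for a
        by (simp add: sum.delta')
      then show ?thesis by (simp add: sum.distrib sum.delta' sum_distrib_right)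
    qed
    finally show ?thesis by (simp add: mtr_nth mult_nth)
  qed
  have "mtr (mtr (J ** Q ** J)) = J ** Q ** J" by (simp add: Finite_Cartesian_Product.vec_eq_iff mtr_nth)
  have "(\<Sum>i\<in>UNIV. \<Sum>j\<in>UNIV. P $h i $h j * Determinants.trace (sp_gen i j ** Q)) = Determinants.trace (P ** (Q + mtr (J ** Q ** J)))"
    unfolding e Determinants.trace_def[of "P ** _"] mult_nth[of P] ..
  also have "mtr (J ** Q ** J) = J ** mtr Q ** J" by (simp add: mtr_mult mtr_J mult_uminus matrix_mul_assoc)
  also have "\<dots> = - adj Q" by (rule compact_Sp_inverse(2)[OF assms])
  finally show ?thesis by (simp add: mult_distribs mult_uminus Determinants.trace_def sum_subtractf)
qed

text \<open>The divergence of the field \<open>S^k\<close>: the completeness relation summed over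
  the positions \<open>r\<close> at which a generator is inserted. \<open>pvar 0\<close>, which
  occurs for instance at \<open>r = 0\<close>, stands for the trace of the identity;
  \<open>ev_mat\<close> and \<open>lpi\<close> both send it to \<open>2 n\<close>.\<close>

definition sd_source :: "nat \<Rightarrow> ppoly" where
  "sd_source k = (\<Sum>r<k. pvar r * pvar (k - r) + pvar (nat \<bar>int r - int (k - r)\<bar>))"

text \<open>Schwinger--Dyson equations: the integral of the divergence of the vector field
  \<open>q(S) S\<^sup>k\<close> on the group vanishes.\<close>

lemma schwinger_dyson:
  fixes M :: "('n::finite cmat) measure"
  assumes haar: "normalized_haar_Sp M" and N: "\<forall>m>N. pderiv_var m q = 0"
  shows "(\<integral>S. ev_mat S (sd_source k * q
     + (\<Sum>m\<le>N. of_nat m * (pvar (k + m) - pvar (nat \<bar>int k - int m\<bar>)) * pderiv_var m q)) \<partial>M) = 0"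
proof -
  \<comment> \<open>The derivative of the entry \<open>(i, j)\<close> of \<open>q(S) S^k\<close>
    along the generator with the same indices; summed over both indices it becomes a polynomial in
    the traces.\<close>
  define H where "H i j S = (\<Sum>r<k. (matrix_power S r ** sp_gen i j ** matrix_power S (k - r)) $h i $h j) * ev_mat S q
     + matrix_power S k $h i $h j * deriv_along (sp_gen i j) q N S" for i j and S :: "'n cmat"
  have H: "good (H i j) \<and> (\<integral>S. H i j S \<partial>M) = 0" for i j
  proof -
    obtain A B where AB: "lie A" "lie B" "\<And>a b. A $h a $h b + \<i> * B $h a $h b = sp_gen i j $h a $h b"
      using sp_gen_decomposition by blast
    have "cder A B (\<lambda>S. matrix_power S k $h i $h j * ev_mat S q) (H i j)"
      unfolding H_def by (intro cder_mult cder_matrix_power cder_ev_mat AB N)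
    then show ?thesis using cder_good cder_integral[OF haar AB(1,2)] by blast
  qed
  have "(\<Sum>i\<in>UNIV. \<Sum>j\<in>UNIV. H i j S) = ev_mat S (sd_source k * q
     + (\<Sum>m\<le>N. of_nat m * (pvar (k + m) - pvar (nat \<bar>int k - int m\<bar>)) * pderiv_var m q))"
    if S: "S \<in> compact_Sp" for S
  proof -
    have "(\<Sum>i\<in>UNIV. \<Sum>j\<in>UNIV. \<Sum>r<k. (matrix_power S r ** sp_gen i j ** matrix_power S (k - r)) $h i $h j)
       = (\<Sum>r<k. \<Sum>i\<in>UNIV. \<Sum>j\<in>UNIV. (matrix_power S r ** sp_gen i j ** matrix_power S (k - r)) $h i $h j)"
    proof -
      have "(\<Sum>i\<in>UNIV. \<Sum>j\<in>UNIV. \<Sum>r<k. (matrix_power S r ** sp_gen i j ** matrix_power S (k - r)) $h i $h j)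
        = (\<Sum>i\<in>UNIV. \<Sum>r<k. \<Sum>j\<in>UNIV. (matrix_power S r ** sp_gen i j ** matrix_power S (k - r)) $h i $h j)"
        by (intro sum.cong refl sum.swap)
      also have "\<dots> = (\<Sum>r<k. \<Sum>i\<in>UNIV. \<Sum>j\<in>UNIV. (matrix_power S r ** sp_gen i j ** matrix_power S (k - r)) $h i $h j)"
        by (rule sum.swap)
      finally show ?thesis .
    qed
    also have "\<dots> = ev_mat S (sd_source k)"
      by (simp add: sp_gen_sandwich compact_Sp_power S trace_power_adj sd_source_def ev_mat_hom tr_pow_def[symmetric])
    finally have 1: "(\<Sum>i\<in>UNIV. \<Sum>j\<in>UNIV. \<Sum>r<k. (matrix_power S r ** sp_gen i j ** matrix_power S (k - r)) $h i $h j) = ev_mat S (sd_source k)" .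
    have "(\<Sum>i\<in>UNIV. \<Sum>j\<in>UNIV. matrix_power S k $h i $h j * deriv_along (sp_gen i j) q N S)
       = (\<Sum>i\<in>UNIV. \<Sum>j\<in>UNIV. \<Sum>m\<le>N. (ev_mat S (pderiv_var m q) * of_nat m) * (matrix_power S k $h i $h j * Determinants.trace (sp_gen i j ** matrix_power S m)))"
      unfolding deriv_along_def sum_distrib_left by (simp only: mult_ac)
    also have "\<dots> = (\<Sum>i\<in>UNIV. \<Sum>m\<le>N. \<Sum>j\<in>UNIV. (ev_mat S (pderiv_var m q) * of_nat m) * (matrix_power S k $h i $h j * Determinants.trace (sp_gen i j ** matrix_power S m)))"
      by (intro sum.cong refl sum.swap)
    also have "\<dots> = (\<Sum>m\<le>N. \<Sum>i\<in>UNIV. \<Sum>j\<in>UNIV. (ev_mat S (pderiv_var m q) * of_nat m) * (matrix_power S k $h i $h j * Determinants.trace (sp_gen i j ** matrix_power S m)))"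
      by (rule sum.swap)
    also have "\<dots> = (\<Sum>m\<le>N. (ev_mat S (pderiv_var m q) * of_nat m) * (tr_pow S (k + m) - tr_pow S (nat \<bar>int k - int m\<bar>)))"
      unfolding sum_distrib_left[symmetric] sp_gen_trace[OF compact_Sp_power[OF S]] trace_power_adj[OF S]
      by (simp add: tr_pow_def matrix_power_add)
    also have "\<dots> = ev_mat S (\<Sum>m\<le>N. of_nat m * (pvar (k + m) - pvar (nat \<bar>int k - int m\<bar>)) * pderiv_var m q)"
      by (simp add: ev_mat_hom mult_ac)
    finally have 2: "(\<Sum>i\<in>UNIV. \<Sum>j\<in>UNIV. matrix_power S k $h i $h j * deriv_along (sp_gen i j) q N S)
       = ev_mat S (\<Sum>m\<le>N. of_nat m * (pvar (k + m) - pvar (nat \<bar>int k - int m\<bar>)) * pderiv_var m q)" .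
    show ?thesis
      unfolding H_def sum.distrib sum_distrib_right[symmetric] 1 2 by (simp add: ev_mat_hom)
  qed
  then have "(\<integral>S. ev_mat S (sd_source k * q
     + (\<Sum>m\<le>N. of_nat m * (pvar (k + m) - pvar (nat \<bar>int k - int m\<bar>)) * pderiv_var m q)) \<partial>M)
     = (\<integral>S. (\<Sum>i\<in>UNIV. \<Sum>j\<in>UNIV. H i j S) \<partial>M)"
    by (intro Bochner_Integration.integral_cong) (simp_all add: haar_space[OF haar])
  also have "\<dots> = (\<Sum>i\<in>UNIV. \<Sum>j\<in>UNIV. (\<integral>S. H i j S \<partial>M))"
    using good_integrable[OF haar] H by (subst Bochner_Integration.integral_sum) (auto intro!: Bochner_Integration.integrable_sum)
  finally show ?thesis using H by simp
qed

section \<open>Pfaffians under congruence\<close>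

lemma dt_delta: "dt n (\<lambda>i j. if i = j then 1 else 0) = 1"
  by (subst dt_lower_triangular) auto

lemma dt_select_rows:
  assumes "\<And>r. r < N \<Longrightarrow> c r < N"
  shows "dt N (\<lambda>r. s (c r)) = dt N (\<lambda>r k. if c r = k then 1 else 0) * dt N s"
  unfolding dt_mult[symmetric]
proof (rule dt_cong)
  fix r j assume "r < N"
  then have "(\<Sum>k<N. (if c r = k then 1 else 0) * s k j) = (\<Sum>k<N. if k = c r then s k j else 0)"
    by (intro sum.cong) auto
  then show "s (c r) j = (\<Sum>k<N. (if c r = k then 1 else 0) * s k j)"
    using assms[OF \<open>r < N\<close>] by simp
qed

text \<open>The pfaffian of \<open>s^T B s\<close>. In the expansion over tuples of row indices each
  tuple contributes a factor free of \<open>s\<close> times the determinant of \<open>s\<close>; the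
  sum of these factors is found by taking \<open>s\<close> to be the identity.\<close>

lemma pfaff_congruence:
  "pfaff n (\<lambda>a b. \<Sum>x<2 * n. \<Sum>y<2 * n. s x a * B x y * s y b) = dt (2 * n) s * pfaff n (B :: nat \<Rightarrow> nat \<Rightarrow> 'a::comm_ring_1)"
proof -
  let ?K = "{..<2 * n} \<times> {..<2 * n}"
  let ?c = "\<lambda>k. interleave (\<lambda>i. fst (k i)) (\<lambda>i. snd (k i))"
  have expand: "pfaff n (\<lambda>a b. \<Sum>x<2 * n. \<Sum>y<2 * n. s x a * B x y * s y b)
     = (\<Sum>k\<in>PiE {..<n} (\<lambda>_. ?K). (\<Prod>i<n. B (fst (k i)) (snd (k i))) * dt (2 * n) (\<lambda>r k'. if ?c k r = k' then 1 else 0)) * dt (2 * n) s"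
    for s :: "nat \<Rightarrow> nat \<Rightarrow> 'a"
  proof -
    have "pfaff n (\<lambda>a b. \<Sum>x<2 * n. \<Sum>y<2 * n. s x a * B x y * s y b)
      = (\<Sum>p | p permutes {0..<2 * n}. \<Sum>k\<in>PiE {..<n} (\<lambda>_. ?K). signof p *
          (\<Prod>i<n. B (fst (k i)) (snd (k i)) * (s (fst (k i)) (p (2 * i)) * s (snd (k i)) (p (Suc (2 * i))))))"
    proof -
      have "(\<Sum>x<2 * n. \<Sum>y<2 * n. s x a * B x y * s y b) = (\<Sum>q\<in>?K. B (fst q) (snd q) * (s (fst q) a * s (snd q) b))" for a b
        by (simp add: sum.cartesian_product case_prod_beta mult_ac)
      then show ?thesis
        unfolding pfaff_def by (intro sum.cong refl) (simp add: prod_sum_PiE sum_distrib_left)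
    qed
    also have "\<dots> = (\<Sum>k\<in>PiE {..<n} (\<lambda>_. ?K). \<Sum>p | p permutes {0..<2 * n}. signof p *
          (\<Prod>i<n. B (fst (k i)) (snd (k i)) * (s (fst (k i)) (p (2 * i)) * s (snd (k i)) (p (Suc (2 * i))))))"
      by (rule sum.swap)
    also have "\<dots> = (\<Sum>k\<in>PiE {..<n} (\<lambda>_. ?K). (\<Prod>i<n. B (fst (k i)) (snd (k i))) * dt (2 * n) (\<lambda>r. s (?c k r)))"
      unfolding dt_leibniz lessThan_atLeast0[symmetric] prod_double interleave_simps
      by (simp only: prod.distrib sum_distrib_left mult.left_commute)
    also have "\<dots> = (\<Sum>k\<in>PiE {..<n} (\<lambda>_. ?K). (\<Prod>i<n. B (fst (k i)) (snd (k i))) * (dt (2 * n) (\<lambda>r k'. if ?c k r = k' then 1 else 0) * dt (2 * n) s))"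
    proof (intro sum.cong refl arg_cong2[of _ _ _ _ "(*)"] dt_select_rows)
      fix k r assume k: "k \<in> PiE {..<n} (\<lambda>_. ?K)" and "r < 2 * n"
      then have "r div 2 \<in> {..<n}" by auto
      with k have "k (r div 2) \<in> ?K" by (rule PiE_mem)
      then show "?c k r < 2 * n" by (auto simp: interleave_def)
    qed
    finally show ?thesis by (simp add: sum_distrib_right mult.assoc)
  qed
  have "pfaff n (\<lambda>a b. \<Sum>x<2 * n. \<Sum>y<2 * n. (if x = a then 1 else 0) * B x y * (if y = b then 1 else 0)) = pfaff n B"
    unfolding pfaff_def
  proof (intro sum.cong refl arg_cong2[of _ _ _ _ "(*)"] prod.cong)
    fix p i assume "p \<in> {p. p permutes {0..<2 * n}}" "i \<in> {..<n}"
    then have "p (2 * i) < 2 * n" "p (Suc (2 * i)) < 2 * n"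
      using permutes_in_image[of p "{0..<2 * n}" "2 * i"] permutes_in_image[of p "{0..<2 * n}" "Suc (2 * i)"] by auto
    moreover have E: "(\<Sum>x<2 * n. \<Sum>y<2 * n. (if x = a then 1 else 0) * B x y * (if y = b then 1 else 0))
      = (\<Sum>x<2 * n. if x = a then \<Sum>y<2 * n. if y = b then B x y else 0 else 0)" for a b
    proof -
      have "(if x = a then 1 else 0) * B x y * (if y = b then 1 else 0) = (if x = a then if y = b then B x y else 0 else 0)" for x y
        by simp
      then show ?thesis by (simp only:) (intro sum.cong refl, simp)
    qed
    ultimately show "(\<Sum>x<2 * n. \<Sum>y<2 * n. (if x = p (2 * i) then 1 else 0) * B x y * (if y = p (Suc (2 * i)) then 1 else 0))
        = B (p (2 * i)) (p (Suc (2 * i)))" unfolding E by simp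
  qed
  with expand[of "\<lambda>x a. if x = a then 1 else 0"] expand[of s] show ?thesis
    by (simp add: dt_delta mult.commute)
qed

lemma pfaff_standard:
  "pfaff n (\<lambda>a b. \<Sum>k\<in>{0..<n}. (if a = 2 * k then 1 else 0) * (if b = Suc (2 * k) then 1 else 0)
     - (if a = Suc (2 * k) then 1 else 0) * (if b = 2 * k then 1 else 0)) = (2 ^ n * of_nat (fact n) :: complex)"
proof -
  let ?U = "\<lambda>k a. if a = 2 * k then 1 else 0 :: complex" and ?W = "\<lambda>k a. if a = Suc (2 * k) then 1 else 0 :: complex"
  have S: "{A. A \<subseteq> {0..<n} \<and> card A = n} = {{0..<n}}"
    using card_subset_eq[of "{0..<n}"] by auto
  have d: "desc {0..<n} i = flip n i" if "i < n" for i
    using desc_unique[of n "flip n" i] that permutes_image[OF flip_permutes[of n]] by (simp add: flip_def)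
  have "dt (2 * n) (interleave (\<lambda>i. ?U (desc {0..<n} i)) (\<lambda>i. ?W (desc {0..<n} i)))
      = dt (2 * n) (interleave (?U \<circ> flip n) (?W \<circ> flip n))"
    by (rule dt_cong) (auto simp: interleave_def d)
  also have "\<dots> = dt (2 * n) (interleave ?U ?W)" by (rule dt_interleave_permute[OF flip_permutes])
  also have "\<dots> = dt (2 * n) (\<lambda>i j. if i = j then 1 else 0)"
    by (rule dt_cong) (auto simp: interleave_def; presburger)
  also have "\<dots> = 1" by (rule dt_delta)
  finally show ?thesis
    using pfaff_minor_summation[of "{0..<n}" n ?U ?W] by (simp add: S)
qed

subsection \<open>Enumerated matrices\<close>

text \<open>A determinant along an enumeration of the index type, in the form to which the pfaffian
  congruence and the triangularization apply.\<close>

definition enum_det :: "(nat \<Rightarrow> 'k) \<Rightarrow> complex^'k::finite^'k \<Rightarrow> complex" where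
  "enum_det e A = dt (CARD('k)) (\<lambda>a b. A $h e a $h e b)"

lemma sum_enum:
  fixes e :: "nat \<Rightarrow> 'k::finite"
  assumes "bij_betw e {0..<CARD('k)} UNIV"
  shows "(\<Sum>k\<in>UNIV. f k) = (\<Sum>k<CARD('k). f (e k))"
  using sum.reindex_bij_betw[OF assms, of f] by (simp add: lessThan_atLeast0)

lemma enum_det_mult:
  fixes A B :: "complex^'k::finite^'k"
  assumes e: "bij_betw e {0..<CARD('k)} UNIV"
  shows "enum_det e (A ** B) = enum_det e A * enum_det e B"
  unfolding enum_det_def mult_nth sum_enum[OF e] by (rule dt_mult)

lemma enum_det_mtr: "enum_det e (mtr A) = enum_det e A"
  unfolding enum_det_def mtr_nth by (rule dt_transpose)

lemma enum_det_mone: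
  fixes e :: "nat \<Rightarrow> 'k::finite"
  assumes "bij_betw e {0..<CARD('k)} UNIV"
  shows "enum_det e mone = 1"
proof -
  have "enum_det e mone = dt (CARD('k)) (\<lambda>i j. if i = j then 1 else 0)"
    unfolding enum_det_def mone_nth
    by (rule dt_cong) (use assms in \<open>auto simp: bij_betw_def inj_on_eq_iff\<close>)
  then show ?thesis by (simp add: dt_delta)
qed

lemma enum_det_cscale: "enum_det e (cscale c (A :: complex^'k::finite^'k)) = c ^ CARD('k) * enum_det e A"
  unfolding enum_det_def cscale_nth by (simp add: dt_scale_rows)

lemma triangularization:
  fixes S :: "complex^'k::finite^'k" and e :: "nat \<Rightarrow> 'k"
  assumes e: "bij_betw e {0..<CARD('k)} UNIV"
  obtains P Q T where "P ** Q = mone" "Q ** P = mone" "S = P ** T ** Q"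
    "\<And>i j. j < i \<Longrightarrow> i < CARD('k) \<Longrightarrow> T $h e i $h e j = 0"
proof -
  let ?N = "CARD('k)"
  define idx where "idx = the_inv_into {0..<?N} e"
  have idx: "idx (e i) = i" if "i < ?N" for i
    unfolding idx_def using e that by (intro the_inv_into_f_f) (auto simp: bij_betw_def)
  have idx2: "idx a < ?N" "e (idx a) = a" for a
    using e bij_betw_the_inv_into[OF e] f_the_inv_into_f_bij_betw[OF e, of a]
    by (auto simp: idx_def bij_betw_def)
  define F where "F B = (\<chi> a b. B $$ (idx a, idx b))" for B :: "complex Matrix.mat"
  define A where "A = Matrix.mat ?N ?N (\<lambda>(i, j). S $h e i $h e j)"
  have A: "A \<in> carrier_mat ?N ?N" by (simp add: A_def)
  obtain as where "char_poly A = (\<Prod>a\<leftarrow>as. [:- a, 1:])" using char_poly_factorized[OF A] by blast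
  from schur_decomposition_exists[OF A this] obtain B where B: "B \<in> carrier_mat ?N ?N" "upper_triangular B" "similar_mat A B" by blast
  then obtain m P Q where "{A, B, P, Q} \<subseteq> carrier_mat m m" and PQ: "P * Q = 1\<^sub>m m" "Q * P = 1\<^sub>m m" "A = P * B * Q"
    using similar_matD[OF B(3)] by blast
  moreover from this A have "m = ?N" by auto
  ultimately have c: "P \<in> carrier_mat ?N ?N" "Q \<in> carrier_mat ?N ?N" and m: "m = ?N" by auto
  have F_mult: "F (X * Y) = F X ** F Y" if "X \<in> carrier_mat ?N ?N" "Y \<in> carrier_mat ?N ?N" for X Y
  proof -
    have "(X * Y) $$ (idx a, idx b) = (\<Sum>k<?N. X $$ (idx a, k) * Y $$ (k, idx b))" for a b
      using that idx2(1)[of a] idx2(1)[of b] by (simp add: times_mat_def scalar_prod_def lessThan_atLeast0)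
    then show ?thesis
      by (simp add: Finite_Cartesian_Product.vec_eq_iff F_def mult_nth sum_enum[OF e] idx)
  qed
  have F_one: "F (1\<^sub>m ?N) = mone"
  proof -
    have "idx a = idx b \<longleftrightarrow> a = b" for a b using idx2(2) by metis
    then show ?thesis using idx2(1) by (simp add: Finite_Cartesian_Product.vec_eq_iff F_def mone_nth)
  qed
  have "F A = S" using idx2 by (simp add: Finite_Cartesian_Product.vec_eq_iff F_def A_def)
  then have "S = F P ** F B ** F Q" using PQ(3) c B(1) by (metis F_mult mult_carrier_mat)
  moreover have "F P ** F Q = mone" "F Q ** F P = mone" using PQ(1,2) c F_one by (simp_all add: F_mult[symmetric] m)
  moreover have "F B $h e i $h e j = 0" if "j < i" "i < ?N" for i j
    using that B(1,2) by (simp add: F_def idx upper_triangularD)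
  ultimately show ?thesis using that by blast
qed

lemma eigenvalue_list:
  fixes S :: "complex^'k::finite^'k" and e :: "nat \<Rightarrow> 'k"
  assumes e: "bij_betw e {0..<CARD('k)} UNIV"
  obtains w where "\<And>m. tr_pow S m = (\<Sum>i<CARD('k). w i ^ m)"
    "\<And>x. enum_det e (cscale x mone - S) = (\<Prod>i<CARD('k). x - w i)"
proof -
  let ?N = "CARD('k)"
  obtain P Q T where PQ: "P ** Q = mone" "Q ** P = mone" "S = P ** T ** Q"
    and T: "\<And>i j. j < i \<Longrightarrow> i < ?N \<Longrightarrow> T $h e i $h e j = 0" using triangularization[OF e] by blast
  have pow: "matrix_power S m = P ** matrix_power T m ** Q" for m
  proof (induction m)
    case (Suc m)
    have "matrix_power S (Suc m) = S ** (P ** matrix_power T m ** Q)"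
      by (simp only: matrix_power_Suc Suc)
    also have "\<dots> = P ** T ** (Q ** P) ** matrix_power T m ** Q"
      by (subst PQ(3)) (simp only: matrix_mul_assoc)
    finally show ?case by (simp add: PQ(2) matrix_power_Suc matrix_mul_assoc)
  qed (simp add: PQ)
  have tri: "(\<forall>i j. j < i \<longrightarrow> i < ?N \<longrightarrow> matrix_power T m $h e i $h e j = 0) \<and> (\<forall>i<?N. matrix_power T m $h e i $h e i = (T $h e i $h e i) ^ m)" for m
  proof (induction m)
    case 0
    have "e i = e j \<longleftrightarrow> i = j" if "i < ?N" "j < ?N" for i j using e that by (auto simp: bij_betw_def inj_on_eq_iff)
    then show ?case by (auto simp: mone_nth)
  next
    case (Suc m)
    have ent: "matrix_power T (Suc m) $h e i $h e j = (\<Sum>k<?N. if i \<le> k \<and> k \<le> j then T $h e i $h e k * matrix_power T m $h e k $h e j else 0)"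
      if "i < ?N" "j < ?N" for i j
      unfolding matrix_power_Suc mult_nth sum_enum[OF e]
      using Suc T that by (intro sum.cong refl) (auto simp: not_le)
    have "(\<Sum>k<?N. if i \<le> k \<and> k \<le> i then T $h e i $h e k * matrix_power T m $h e k $h e i else 0)
       = (\<Sum>k<?N. if k = i then T $h e i $h e i * matrix_power T m $h e i $h e i else 0)" for i
      by (intro sum.cong) auto
    with ent Suc show ?case by (auto intro!: sum.neutral)
  qed
  have "tr_pow S m = (\<Sum>i<?N. (T $h e i $h e i) ^ m)" for m
  proof -
    have "tr_pow S m = Determinants.trace (P ** (matrix_power T m ** Q))"
      by (simp only: tr_pow_def pow matrix_mul_assoc)
    also have "\<dots> = Determinants.trace (matrix_power T m)"
      by (subst trace_mul_sym) (simp add: matrix_mul_assoc[symmetric] PQ)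
    also have "\<dots> = (\<Sum>i<?N. (T $h e i $h e i) ^ m)"
      using tri by (simp add: Determinants.trace_def sum_enum[OF e])
    finally show ?thesis .
  qed
  moreover have "enum_det e (cscale x mone - S) = (\<Prod>i<?N. x - T $h e i $h e i)" for x
  proof -
    have "cscale x mone - S = P ** (cscale x mone - T) ** Q"
      by (simp add: mult_distribs cscale_mult PQ)
    then have "enum_det e (cscale x mone - S) = enum_det e (cscale x mone - T) * enum_det e (P ** Q)"
      by (simp add: enum_det_mult[OF e])
    also have "\<dots> = enum_det e (cscale x mone - T)" by (simp add: PQ enum_det_mone[OF e])
    also have "\<dots> = (\<Prod>i<?N. (cscale x mone - T) $h e i $h e i)"
      unfolding enum_det_def
    proof (rule dt_upper_triangular)
      fix i j assume "j < i" "i < ?N"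
      moreover from this have "e i \<noteq> e j" using e by (auto simp: bij_betw_def inj_on_eq_iff)
      ultimately show "(cscale x mone - T) $h e i $h e j = 0" using T by (simp add: cscale_nth mone_nth)
    qed
    finally show ?thesis by (simp add: cscale_nth mone_nth)
  qed
  ultimately show ?thesis by (rule that)
qed

subsection \<open>Eigenvalues of compact symplectic matrices\<close>

text \<open>Partners become neighbours, at positions \<open>2 i\<close> and \<open>2 i + 1\<close>,
  so that \<open>J\<close> takes the block form whose pfaffian is known.\<close>

lemma symplectic_enum:
  obtains e :: "nat \<Rightarrow> 'n::finite + 'n" where "bij_betw e {0..<CARD('n + 'n)} UNIV"
    "\<And>r. r < 2 * CARD('n) \<Longrightarrow> partner (e r) = e (if even r then Suc r else r - 1)" "\<And>r. side (e r) = (if even r then 1 else -1)"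
proof -
  obtain b :: "nat \<Rightarrow> 'n" where b: "bij_betw b {0..<CARD('n)} UNIV"
    using ex_bij_betw_nat_finite[of "UNIV :: 'n set"] by auto
  define e :: "nat \<Rightarrow> 'n + 'n" where "e = interleave (\<lambda>i. Inl (b i)) (\<lambda>i. Inr (b i))"
  have "inj_on e {0..<2 * CARD('n)}"
  proof (rule inj_onI)
    fix r s assume rs: "r \<in> {0..<2 * CARD('n)}" "s \<in> {0..<2 * CARD('n)}" "e r = e s"
    then have "(even r \<longleftrightarrow> even s) \<and> b (r div 2) = b (s div 2)" by (auto simp: e_def interleave_def split: if_splits)
    moreover from this have "r div 2 = s div 2" using b rs(1,2) by (auto simp: bij_betw_def inj_on_eq_iff)
    ultimately show "r = s" by (metis even_iff_mod_2_eq_zero div_mult_mod_eq odd_iff_mod_2_eq_one)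
  qed
  moreover from this have "e ` {0..<2 * CARD('n)} = UNIV"
    by (intro card_subset_eq) (simp_all add: card_image card_UNIV_sum)
  ultimately have "bij_betw e {0..<CARD('n + 'n)} UNIV"
    by (simp add: bij_betw_def card_UNIV_sum mult_2)
  moreover have "partner (e r) = e (if even r then Suc r else r - 1)" for r
    by (cases "even r") (auto simp: e_def interleave_def partner_def elim!: oddE evenE)
  moreover have "side (e r) = (if even r then 1 else -1)" for r
    by (simp add: e_def interleave_def side_def)
  ultimately show ?thesis using that by blast
qed

text \<open>Determinants of \<open>S^T J S = J\<close> only leave the values \<open>1\<close> and
  \<open>-1\<close>; the pfaffian congruence fixes the sign. This rules out an odd multiplicity of
  the eigenvalue \<open>-1\<close>.\<close>

lemma compact_Sp_det:
  fixes S :: "'n::finite cmat"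
  assumes S: "S \<in> compact_Sp" and e: "bij_betw e {0..<CARD('n + 'n)} UNIV"
    and p: "\<And>r. r < 2 * CARD('n) \<Longrightarrow> partner (e r) = e (if even r then Suc r else r - 1)" and s: "\<And>r. side (e r) = (if even r then 1 else -1)"
  shows "enum_det e S = 1"
proof -
  let ?n = "CARD('n)"
  have N: "CARD('n + 'n) = 2 * ?n" by (simp add: card_UNIV_sum mult_2)
  have inj: "e a = e b \<longleftrightarrow> a = b" if "a < 2 * ?n" "b < 2 * ?n" for a b
    using e that by (auto simp: bij_betw_def N inj_on_eq_iff)
  define B where "B a b = J $h e a $h e b" for a b
  have B: "B a b = (\<Sum>k\<in>{0..<?n}. (if a = 2 * k then 1 else 0) * (if b = Suc (2 * k) then 1 else 0)
     - (if a = Suc (2 * k) then 1 else 0) * (if b = 2 * k then 1 else 0))" if ab: "a < 2 * ?n" "b < 2 * ?n" for a b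
  proof (cases "even a")
    case True
    then obtain i where i: "a = 2 * i" by blast
    then have "Suc a < 2 * ?n" using ab by presburger
    then have "B a b = (if b = Suc a then 1 else 0)"
      using ab True by (auto simp: B_def J_nth p s inj)
    moreover have "(\<Sum>k\<in>{0..<?n}. (if a = 2 * k then 1 else 0) * (if b = Suc (2 * k) then 1 else 0)
     - (if a = Suc (2 * k) then 1 else 0) * (if b = 2 * k then 1 else 0)) = (\<Sum>k\<in>{0..<?n}. if k = i then (if b = Suc a then 1 else 0) else (0 :: complex))"
      using i by (intro sum.cong refl) (auto; presburger)
    ultimately show ?thesis using i ab by simp
  next
    case False
    then obtain i where i: "a = Suc (2 * i)" by (metis oddE Suc_eq_plus1)
    then have "B a b = (if b = 2 * i then -1 else 0)"
      using ab False by (auto simp: B_def J_nth p s inj)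
    moreover have "(\<Sum>k\<in>{0..<?n}. (if a = 2 * k then 1 else 0) * (if b = Suc (2 * k) then 1 else 0)
     - (if a = Suc (2 * k) then 1 else 0) * (if b = 2 * k then 1 else 0)) = (\<Sum>k\<in>{0..<?n}. if k = i then (if b = 2 * i then -1 else 0) else (0 :: complex))"
      using i by (intro sum.cong refl) (auto; presburger)
    ultimately show ?thesis using i ab by simp
  qed
  have cong: "pfaff ?n F = pfaff ?n G" if "\<And>a b. a < 2 * ?n \<Longrightarrow> b < 2 * ?n \<Longrightarrow> F a b = G a b" for F G :: "nat \<Rightarrow> nat \<Rightarrow> complex"
    unfolding pfaff_def
  proof (intro sum.cong refl arg_cong2[of _ _ _ _ "(*)"] prod.cong)
    fix p i assume "p \<in> {p. p permutes {0..<2 * ?n}}" "i \<in> {..<?n}"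
    then show "F (p (2 * i)) (p (Suc (2 * i))) = G (p (2 * i)) (p (Suc (2 * i)))"
      using permutes_in_image[of p "{0..<2 * ?n}" "2 * i"] permutes_in_image[of p "{0..<2 * ?n}" "Suc (2 * i)"]
      by (intro that) auto
  qed
  have pB: "pfaff ?n B = 2 ^ ?n * of_nat (fact ?n)"
    unfolding pfaff_standard[symmetric] by (rule cong) (rule B)
  have "(\<Sum>x<2 * ?n. \<Sum>y<2 * ?n. S $h e x $h e a * B x y * S $h e y $h e b) = B a b" for a b
  proof -
    have "B a b = (mtr S ** (J ** S)) $h e a $h e b" using S by (simp add: B_def compact_Sp_iff matrix_mul_assoc)
    also have "\<dots> = (\<Sum>x<2 * ?n. \<Sum>y<2 * ?n. S $h e x $h e a * B x y * S $h e y $h e b)"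
      by (simp only: mult_nth sum_enum[OF e] N mtr_nth B_def sum_distrib_left mult.assoc)
    finally show ?thesis by simp
  qed
  then have "pfaff ?n B = dt (2 * ?n) (\<lambda>x a. S $h e x $h e a) * pfaff ?n B"
    using pfaff_congruence[of ?n "\<lambda>x a. S $h e x $h e a" B] by simp
  then have "dt (2 * ?n) (\<lambda>x a. S $h e x $h e a) = 1" unfolding pB by simp
  then show ?thesis by (simp only: enum_det_def N)
qed

lemma order_prod_linear: "Polynomial.order a (\<Prod>w\<in>#W. [:- w, 1:]) = count W (a :: complex)"
proof (induction W)
  case (add w W)
  have "(\<Prod>w\<in>#W. [:- w, 1:]) \<noteq> (0 :: complex poly)" by (auto simp: prod_mset_zero_iff)
  then have "Polynomial.order a ([:- w, 1:] * (\<Prod>w\<in>#W. [:- w, 1:])) = Polynomial.order a [:- w, 1:] + count W a"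
    using add order_mult[of "[:- w, 1:]" "\<Prod>w\<in>#W. [:- w, 1:]" a] by (simp only: mult_eq_0_iff) simp
  moreover have "Polynomial.order a [:- w, 1:] = (if w = a then 1 else 0)"
    using order_power_n_n[of a 1] order_0I[of "[:- w, 1:]" a] by auto
  ultimately show ?case by simp
qed (simp add: order_0I)

text \<open>Away from \<open>1\<close> and \<open>-1\<close> an element differs from its inverse,
  and the two are removed together. What remains has product \<open>(-1)^b\<close> with
  \<open>b\<close> the multiplicity of \<open>-1\<close>, so \<open>b\<close> is even, and by the
  parity of the size so is the multiplicity of \<open>1\<close>.\<close>

lemma pair_inverses:
  fixes W :: "complex multiset"
  assumes "image_mset inverse W = W" "0 \<notin># W" "prod_mset W = 1" "even (size W)"
  shows "\<exists>Z. W = Z + image_mset inverse Z"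
  using assms
proof (induction "size W" arbitrary: W rule: less_induct)
  case less
  show ?case
  proof (cases "\<exists>w\<in>#W. w \<noteq> 1 \<and> w \<noteq> -1")
    case True
    then obtain w where w: "w \<in># W" "w \<noteq> 1" "w \<noteq> -1" by blast
    then have w0: "w \<noteq> 0" using less.prems by auto
    have ne: "inverse w \<noteq> w"
    proof
      assume "inverse w = w"
      then have "w * w = 1" using w0 by (metis right_inverse)
      with w show False by (simp add: square_eq_1_iff)
    qed
    have "inverse w \<in># image_mset inverse W" using w(1) by auto
    then have "inverse w \<in># W" using less.prems(1) by simp
    then obtain V where V: "W = add_mset w (add_mset (inverse w) V)"
      using w(1) ne by (metis in_diff_count insert_DiffM insert_noteq_member)
    have "\<exists>Z. V = Z + image_mset inverse Z"
    proof (rule less.hyps)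
      show "image_mset inverse V = V" using less.prems(1) unfolding V by (simp add: add_mset_commute)
      show "prod_mset V = 1" using less.prems(3) w0 by (simp add: V mult.assoc[symmetric])
    qed (use less.prems w0 in \<open>auto simp: V\<close>)
    then obtain Z where "V = Z + image_mset inverse Z" by blast
    then show ?thesis by (intro exI[of _ "add_mset w Z"]) (simp add: V)
  next
    case False
    define a b where "a = count W 1" and "b = count W (-1)"
    have W: "W = replicate_mset a 1 + replicate_mset b (-1)"
    proof (rule multiset_eqI)
      fix x show "count W x = count (replicate_mset a 1 + replicate_mset b (-1)) x"
        using False by (auto simp: a_def b_def count_eq_zero_iff)
    qed
    have "prod_mset W = (-1) ^ b" unfolding W by simp
    then have "even b" using less.prems(3) by (metis neg_one_odd_power one_neq_neg_one)
    moreover have "even (a + b)" using less.prems(4) unfolding W by simp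
    ultimately obtain a' b' where ab: "a = a' + a'" "b = b' + b'" by (metis evenE even_add mult_2)
    show ?thesis unfolding W ab
      by (intro exI[of _ "replicate_mset a' 1 + replicate_mset b' (-1)"])
        (simp add: multiset_eq_iff)
  qed
qed

text \<open>The inverse of \<open>S\<close> is \<open>- J S^T J\<close>, so \<open>S\<close> and its
  inverse have the same characteristic polynomial. Hence the multiset of eigenvalues is closed under
  inversion, and determinant one lets it be split into pairs.\<close>

lemma compact_Sp_eigenvalues:
  fixes S :: "'n::finite cmat"
  assumes S: "S \<in> compact_Sp"
  obtains z where "\<And>i. z i \<noteq> 0" "\<And>m. tr_pow S m = (\<Sum>i<CARD('n). z i ^ m + inverse (z i) ^ m)"
proof -
  let ?N = "CARD('n + 'n)"
  have N: "?N = 2 * CARD('n)" by (simp add: card_UNIV_sum mult_2)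
  obtain e :: "nat \<Rightarrow> 'n + 'n" where e: "bij_betw e {0..<?N} UNIV"
    and p: "\<And>r. r < 2 * CARD('n) \<Longrightarrow> partner (e r) = e (if even r then Suc r else r - 1)" and s: "\<And>r. side (e r) = (if even r then 1 else -1)"
    using symplectic_enum by blast
  have detS: "enum_det e S = 1" by (rule compact_Sp_det[OF S e p s])
  have adjS: "S ** adj S = mone" "J ** mtr S ** J = - adj S" using compact_Sp_inverse[OF S] .
  obtain w where w: "\<And>m. tr_pow S m = (\<Sum>i<?N. w i ^ m)" "\<And>x. enum_det e (cscale x mone - S) = (\<Prod>i<?N. x - w i)"
    using eigenvalue_list[OF e] by blast
  have prod_w: "(\<Prod>i<?N. w i) = 1"
  proof -
    have "cscale 0 mone - S = cscale (-1) S" by (simp add: Finite_Cartesian_Product.vec_eq_iff cscale_nth)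
    then have "(\<Prod>i<?N. - w i) = (-1) ^ ?N" using w(2)[of 0] by (simp add: enum_det_cscale detS)
    moreover have "(\<Prod>i<?N. - w i) = (-1) ^ ?N * (\<Prod>i<?N. w i)"
      using prod.distrib[of "\<lambda>_. -1" w "{..<?N}"] by simp
    ultimately show ?thesis by (simp add: N)
  qed
  then have w0: "w i \<noteq> 0" if "i < ?N" for i using that by (auto simp: prod_zero_iff dest!: arg_cong[of _ 1 "\<lambda>x. x = 0"])
  have refl: "(\<Prod>i<?N. x - w i) = (\<Prod>i<?N. x - inverse (w i))" if x: "x \<noteq> 0" for x
  proof -
    have detJ: "enum_det e J * enum_det e J = 1"
    proof -
      have "enum_det e J * enum_det e (- J) = enum_det e mone"
        unfolding enum_det_mult[OF e, symmetric] by (simp add: mult_uminus J_J)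
      moreover have "- J = cscale (-1) J" for J :: "'n cmat" by (simp add: Finite_Cartesian_Product.vec_eq_iff cscale_nth)
      ultimately show ?thesis by (simp add: enum_det_mone[OF e] enum_det_cscale N)
    qed
    have "J ** (cscale x mone - mtr S) ** J = cscale x (J ** J) - J ** mtr S ** J"
      by (simp add: mult_distribs cscale_mult)
    also have "\<dots> = adj S - cscale x mone"
      by (simp add: adjS J_J Finite_Cartesian_Product.vec_eq_iff cscale_nth)
    finally have "enum_det e (adj S - cscale x mone) = enum_det e (J ** (cscale x mone - mtr S) ** J)" by simp
    also have "\<dots> = enum_det e (cscale x mone - mtr S) * (enum_det e J * enum_det e J)"
      by (simp only: enum_det_mult[OF e] mult_ac)
    also have "cscale x mone - mtr S = mtr (cscale x mone - S)"
      by (auto simp: Finite_Cartesian_Product.vec_eq_iff mtr_nth cscale_nth mone_nth)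
    finally have 1: "enum_det e (adj S - cscale x mone) = enum_det e (cscale x mone - S)"
      by (simp add: detJ enum_det_mtr)
    have "S ** (adj S - cscale x mone) = cscale x (cscale (1 / x) mone - S)"
      using x by (simp add: mult_distribs adjS cscale_mult) (simp add: Finite_Cartesian_Product.vec_eq_iff cscale_nth right_diff_distrib)
    then have "enum_det e (adj S - cscale x mone) = x ^ ?N * enum_det e (cscale (1 / x) mone - S)"
      using enum_det_mult[OF e, of S "adj S - cscale x mone"] by (simp add: detS enum_det_cscale)
    then have "(\<Prod>i<?N. x - w i) = x ^ ?N * (\<Prod>i<?N. 1 / x - w i)" using 1 by (simp add: w(2))
    also have "\<dots> = (\<Prod>i<?N. x * (1 / x - w i))" by (simp add: prod.distrib)
    also have "\<dots> = (\<Prod>i<?N. (- w i) * (x - inverse (w i)))"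
      using x w0 by (intro prod.cong) (auto simp: field_simps)
    also have "\<dots> = (\<Prod>i<?N. - w i) * (\<Prod>i<?N. x - inverse (w i))" by (rule prod.distrib)
    also have "(\<Prod>i<?N. - w i) = (-1) ^ ?N * (\<Prod>i<?N. w i)"
      using prod.distrib[of "\<lambda>_. -1" w "{..<?N}"] by simp
    finally show ?thesis unfolding prod_w by (simp add: N)
  qed
  define W where "W = image_mset w (mset_set {..<?N})"
  let ?p = "\<Prod>v\<in>#W. [:- v, 1:]" and ?q = "\<Prod>v\<in>#image_mset inverse W. [:- v, 1:]"
  have pv: "poly ?p x = (\<Prod>i<?N. x - w i)" "poly ?q x = (\<Prod>i<?N. x - inverse (w i))" for x
    by (simp_all add: W_def image_mset.compositionality comp_def prod_unfold_prod_mset[symmetric] poly_prod)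
  have "?p = ?q"
  proof (rule ccontr)
    assume "?p \<noteq> ?q"
    then have "finite {x. poly (?p - ?q) x = 0}" by (intro poly_roots_finite) simp
    moreover have "UNIV - {0} \<subseteq> {x. poly (?p - ?q) x = 0}" using refl by (auto simp: pv)
    ultimately have "finite (UNIV - {0 :: complex})" using finite_subset by blast
    then show False using infinite_UNIV_char_0[where 'a = complex] by simp
  qed
  then have "W = image_mset inverse W" using order_prod_linear by (metis multiset_eqI)
  moreover have "0 \<notin># W" using w0 by (auto simp: W_def)
  moreover have "prod_mset W = 1" using prod_w by (simp add: W_def prod_unfold_prod_mset)
  moreover have "even (size W)" by (simp add: W_def N)
  ultimately obtain Z where Z: "W = Z + image_mset inverse Z" using pair_inverses[of W] by metis
  have szZ: "size Z = CARD('n)" using arg_cong[OF Z, of size] by (simp add: W_def N)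
  obtain zs where zs: "mset zs = Z" using ex_mset by blast
  define z where "z i = (if i < CARD('n) then zs ! i else 1)" for i
  have len: "length zs = CARD('n)" using zs szZ by (metis size_mset)
  have "z i \<noteq> 0" for i
  proof (cases "i < CARD('n)")
    case True
    then have "zs ! i \<in> set zs" using len by simp
    then have "zs ! i \<in># Z" by (simp only: zs[symmetric] set_mset_mset)
    then have "zs ! i \<in># W" by (subst Z) simp
    with \<open>0 \<notin># W\<close> have "zs ! i \<noteq> 0" by metis
    with True show ?thesis by (simp add: z_def)
  qed (simp add: z_def)
  moreover have "tr_pow S m = (\<Sum>i<CARD('n). z i ^ m + inverse (z i) ^ m)" for m
  proof -
    have "tr_pow S m = (\<Sum>v\<in>#W. v ^ m)"
      by (simp add: w(1) W_def image_mset.compositionality comp_def sum_unfold_sum_mset)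
    also have "\<dots> = (\<Sum>v\<in>#mset zs. v ^ m + inverse v ^ m)"
      unfolding Z zs by (simp add: image_mset.compositionality comp_def sum_mset.distrib)
    also have "\<dots> = (\<Sum>v\<leftarrow>zs. v ^ m + inverse v ^ m)" by (simp only: mset_map[symmetric] sum_mset_sum_list)
    also have "\<dots> = (\<Sum>i<CARD('n). z i ^ m + inverse (z i) ^ m)"
      by (simp add: sum_list_sum_nth len z_def lessThan_atLeast0)
    finally show ?thesis .
  qed
  ultimately show ?thesis using that by blast
qed

section \<open>Derivations and vector fields on Laurent polynomials\<close>

lemma chain_rule:
  fixes D :: "'b::comm_ring_1 \<Rightarrow> 'b"
  assumes c: "scalars c" and add: "\<And>x y. D (x + y) = D x + D y"
    and mult: "\<And>x y. D (x * y) = D x * y + x * D y" and const: "\<And>a. D (c a) = 0"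
    and N: "\<forall>m>N. pderiv_var m q = 0"
  shows "D (peval c \<sigma> q) = (\<Sum>m\<le>N. peval c \<sigma> (pderiv_var m q) * D (\<sigma> m))"
proof -
  let ?R = "\<lambda>q N. \<Sum>m\<le>N. peval c \<sigma> (pderiv_var m q) * D (\<sigma> m)"
  have bound: "?R q N' = ?R q N" if "\<forall>m>N. pderiv_var m q = 0" "N \<le> N'" for q N N'
    using that by (intro sum.mono_neutral_right) (auto simp: peval_hom[OF c])
  have "\<exists>N. D (peval c \<sigma> q) = ?R q N \<and> (\<forall>m>N. pderiv_var m q = 0)"
  proof (induction q rule: ppoly_induct)
    case (cst a) show ?case by (intro exI[of _ 0]) (simp add: peval_hom[OF c] const)
  next
    case (pvar v)
    have "?R (pvar v) v = (\<Sum>m\<le>v. if m = v then D (\<sigma> v) else 0)"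
      by (intro sum.cong) (auto simp: pderiv_var_pvar peval_hom[OF c])
    then show ?case by (intro exI[of _ v]) (simp add: peval_hom[OF c] pderiv_var_pvar)
  next
    case (add f g)
    then obtain a b where ab: "D (peval c \<sigma> f) = ?R f a" "\<forall>m>a. pderiv_var m f = 0"
      "D (peval c \<sigma> g) = ?R g b" "\<forall>m>b. pderiv_var m g = 0" by blast
    have "D (peval c \<sigma> (f + g)) = ?R f (max a b) + ?R g (max a b)"
      using ab bound[OF ab(2), of "max a b"] bound[OF ab(4), of "max a b"] by (simp add: peval_hom[OF c] assms(2))
    then show ?case using ab(2,4)
      by (intro exI[of _ "max a b"]) (simp add: pderiv_var_add peval_hom[OF c] distrib_right sum.distrib)
  next
    case (mult f g)
    then obtain a b where ab: "D (peval c \<sigma> f) = ?R f a" "\<forall>m>a. pderiv_var m f = 0"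
      "D (peval c \<sigma> g) = ?R g b" "\<forall>m>b. pderiv_var m g = 0" by blast
    have "D (peval c \<sigma> (f * g)) = ?R f (max a b) * peval c \<sigma> g + peval c \<sigma> f * ?R g (max a b)"
      using ab bound[OF ab(2), of "max a b"] bound[OF ab(4), of "max a b"] by (simp add: peval_hom[OF c] assms(3))
    also have "\<dots> = ?R (f * g) (max a b)"
      unfolding sum_distrib_left sum_distrib_right sum.distrib[symmetric]
      by (intro sum.cong refl) (simp add: pderiv_var_mult peval_hom[OF c] algebra_simps)
    finally show ?case using ab(2,4)
      by (intro exI[of _ "max a b"]) (simp add: pderiv_var_mult)
  qed
  then obtain N' where N': "D (peval c \<sigma> q) = ?R q N'" "\<forall>m>N'. pderiv_var m q = 0" by blast
  then show ?thesis
    using bound[OF N'(2), of "max N' N"] bound[OF N, of "max N' N"] by simp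
qed

lemma pderiv_var_commute: "pderiv_var m (pderiv_var k q) = pderiv_var k (pderiv_var m q)"
  by (cases "m = k", simp, rule poly_mapping_eqI)
    (simp add: lookup_pderiv_var lookup_add lookup_single add_ac mult_ac)

definition pz :: "nat \<Rightarrow> int \<Rightarrow> laurent" where "pz n k = (\<Sum>i<n. zp i k + zp i (- k))"

lemma pz_even: "pz n (- k) = pz n k" by (simp add: pz_def add.commute)
lemma pz_abs: "pz n \<bar>k\<bar> = pz n k" using pz_even[of n k] by (simp add: abs_if)

definition lpi :: "nat \<Rightarrow> ppoly \<Rightarrow> laurent" where "lpi n = peval cst (\<lambda>m. pz n (int m))"

lemmas lpi_hom = peval_hom[OF scalars_cst, of "\<lambda>m. pz n (int m)" for n, folded lpi_def]

lemma theta_of_nat: "theta i (of_nat k) = 0"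
  using theta_cst[of i "of_nat k"] by (simp add: cst_of_nat)

lemma theta_signof_times: "theta i (signof p * f) = signof p * theta i f"
  using signof_cases[of p, where 'a = int] by (auto simp: theta_uminus)

lemma theta_pz: "i < n \<Longrightarrow> theta i (pz n (int m)) = of_nat m * (zp i (int m) - zp i (- int m))"
  by (simp add: pz_def theta_sum theta_add theta_zp if_distrib[of "\<lambda>x. x + _"] sum.delta algebra_simps sum.distrib)

text \<open>Maps \<open>pz n m\<close> to \<open>m (pz n (k + m) - pz n (k - m))\<close>, in
  parallel to the field \<open>S^k\<close> of the Schwinger-Dyson equations, of which it is the form
  in eigenvalue coordinates.\<close>

definition vf :: "nat \<Rightarrow> int \<Rightarrow> laurent \<Rightarrow> laurent" where
  "vf n k f = (\<Sum>i<n. (zp i k - zp i (- k)) * theta i f)"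

lemma vf_linear: "vf n k (f + g) = vf n k f + vf n k g" "vf n k (f - g) = vf n k f - vf n k g"
  "vf n k 1 = 0" "vf n k (cst a) = 0"
  by (simp_all add: vf_def theta_add theta_diff algebra_simps sum.distrib sum_subtractf)

lemma vf_mult: "vf n k (f * g) = vf n k f * g + f * vf n k g"
  unfolding vf_def theta_mult sum_distrib_left sum_distrib_right sum.distrib[symmetric]
  by (intro sum.cong refl) (simp add: algebra_simps)

lemma vf_prod_log:
  assumes "finite S" "\<And>s. s \<in> S \<Longrightarrow> vf n k (x s) = x s * q s"
  shows "vf n k (\<Prod>s\<in>S. x s) = (\<Prod>s\<in>S. x s) * (\<Sum>s\<in>S. q s)"
  using assms by (induction S) (simp_all add: vf_linear vf_mult algebra_simps)

lemma vf_zp: "i < n \<Longrightarrow> vf n k (zp i s) = of_int s * (zp i (s + k) - zp i (s - k))"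
proof -
  assume "i < n"
  then have "vf n k (zp i s) = (\<Sum>j<n. if j = i then (zp i k - zp i (- k)) * (of_int s * zp i s) else 0)"
    unfolding vf_def by (intro sum.cong) (auto simp: theta_zp)
  also have "\<dots> = of_int s * (zp i (k + s) - zp i (- k + s))"
    using \<open>i < n\<close> unfolding zp_add by (simp add: right_diff_distrib left_diff_distrib mult_ac)
  also have "k + s = s + k" by simp
  also have "- k + s = s - k" by simp
  finally show ?thesis .
qed

subsection \<open>The logarithmic derivative of the Weyl denominator\<close>

text \<open>Powers of the \<open>2 n\<close> eigenvalues in the order
  \<open>z_0, 1/z_0, z_1, 1/z_1, ...\<close>.\<close>

definition wp :: "nat \<Rightarrow> int \<Rightarrow> laurent" where
  "wp r e = zp (r div 2) (if even r then e else - e)"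

lemma wp_add: "wp r (d + e) = wp r d * wp r e"
  by (simp add: wp_def zp_add[symmetric] add.commute)

lemma wp_0 [simp]: "wp r 0 = 1" by (simp add: wp_def)

lemma sum_wp: "(\<Sum>r<2 * n. wp r e) = pz n e"
  by (simp add: sum_double wp_def pz_def)

lemma vf_wp: "r < 2 * n \<Longrightarrow> vf n k (wp r 1) = wp r (k + 1) - wp r (1 - k)"
  by (auto simp: wp_def vf_zp algebra_simps)

text \<open>The quotient of \<open>vf n k (x_b - x_a)\<close> by \<open>x_b - x_a\<close> for
  \<open>x_r = wp r 1\<close>. The field sends each \<open>x\<close> to
  \<open>x^(k+1) - x^(1-k)\<close>, and the two sums are the quotients of these two powers.\<close>

definition wquot :: "nat \<Rightarrow> nat \<Rightarrow> nat \<Rightarrow> laurent" where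
  "wquot k a b = (\<Sum>r\<le>k. wp a (int r) * wp b (int k - int r))
     + (\<Sum>r<k - 1. wp a (- int (Suc r)) * wp b (int (Suc r) - int k))"

lemma vf_wp_diff:
  assumes k: "k > 0" and ab: "a < 2 * n" "b < 2 * n"
  shows "vf n (int k) (wp b 1 - wp a 1) = (wp b 1 - wp a 1) * wquot k a b"
proof -
  define u where "u r = wp a (int r) * wp b (int k + 1 - int r)" for r
  define t where "t r = wp a (- int r) * wp b (int r + 1 - int k)" for r
  have 1: "(wp b 1 - wp a 1) * (wp a (int r) * wp b (int k - int r)) = u r - u (Suc r)" for r
  proof -
    have "u r = wp a (int r) * (wp b 1 * wp b (int k - int r))"
      unfolding u_def wp_add[symmetric] by (simp add: algebra_simps)
    moreover have "u (Suc r) = wp a 1 * wp a (int r) * wp b (int k - int r)"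
      unfolding u_def wp_add[symmetric] by (simp add: algebra_simps)
    ultimately show ?thesis by (simp add: algebra_simps)
  qed
  have 2: "(wp b 1 - wp a 1) * (wp a (- int (Suc r)) * wp b (int (Suc r) - int k)) = t (Suc r) - t r" for r
  proof -
    have "t (Suc r) = wp a (- int (Suc r)) * (wp b 1 * wp b (int (Suc r) - int k))"
      unfolding t_def wp_add[symmetric] by (simp add: algebra_simps)
    moreover have "t r = wp a 1 * wp a (- int (Suc r)) * wp b (int (Suc r) - int k)"
      unfolding t_def wp_add[symmetric] by (simp add: algebra_simps)
    ultimately show ?thesis by (simp add: algebra_simps)
  qed
  have "(wp b 1 - wp a 1) * wquot k a b = (\<Sum>r\<le>k. u r - u (Suc r)) + (\<Sum>r<k - 1. t (Suc r) - t r)"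
    unfolding wquot_def distrib_left sum_distrib_left 1 2 ..
  also have "\<dots> = (u 0 - u (Suc k)) + (t (k - 1) - t 0)"
    unfolding sum_telescope sum_lessThan_telescope ..
  also have "\<dots> = wp b (int k + 1) - wp a (int k + 1) + (wp a (1 - int k) - wp b (1 - int k))"
    using k by (simp add: u_def t_def of_nat_diff algebra_simps)
  finally show ?thesis using ab by (simp add: vf_linear vf_wp)
qed

lemma sum_symmetric_square:
  fixes f :: "nat \<Rightarrow> nat \<Rightarrow> 'a::comm_ring_1"
  assumes "\<And>a b. f a b = f b a"
  shows "(\<Sum>b<N. \<Sum>a<N. f a b) = 2 * (\<Sum>b<N. \<Sum>a<b. f a b) + (\<Sum>a<N. f a a)"
proof (induction N)
  case (Suc N)
  have "(\<Sum>b<N. f N b) = (\<Sum>a<N. f a N)" using assms by (intro sum.cong) auto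
  with Suc show ?case by (simp add: sum.distrib algebra_simps)
qed simp

lemma wquot_symmetric: "wquot k a b = wquot k b a"
proof -
  have "(\<Sum>r\<le>k. wp a (int r) * wp b (int k - int r)) = (\<Sum>r\<le>k. wp a (int (k - r)) * wp b (int k - int (k - r)))"
    by (rule sum.reindex_bij_witness[of _ "\<lambda>r. k - r" "\<lambda>r. k - r"]) auto
  also have "\<dots> = (\<Sum>r\<le>k. wp b (int r) * wp a (int k - int r))"
    by (intro sum.cong refl) (simp add: of_nat_diff mult.commute)
  finally have 1: "(\<Sum>r\<le>k. wp a (int r) * wp b (int k - int r)) = (\<Sum>r\<le>k. wp b (int r) * wp a (int k - int r))" .
  have "(\<Sum>r<k - 1. wp a (- int (Suc r)) * wp b (int (Suc r) - int k))
      = (\<Sum>r<k - 1. wp a (- int (Suc (k - 1 - Suc r))) * wp b (int (Suc (k - 1 - Suc r)) - int k))"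
    by (rule sum.nat_diff_reindex[symmetric])
  also have "\<dots> = (\<Sum>r<k - 1. wp b (- int (Suc r)) * wp a (int (Suc r) - int k))"
  proof (intro sum.cong refl)
    fix r assume "r \<in> {..<k - 1}"
    then have "int (Suc (k - 1 - Suc r)) = int k - int (Suc r)" by (simp add: of_nat_diff)
    then show "wp a (- int (Suc (k - 1 - Suc r))) * wp b (int (Suc (k - 1 - Suc r)) - int k)
      = wp b (- int (Suc r)) * wp a (int (Suc r) - int k)" by (simp only: minus_diff_eq diff_diff_eq2) (simp add: algebra_simps)
  qed
  finally show ?thesis using 1 by (simp add: wquot_def)
qed

text \<open>By symmetry the sum over \<open>a < b\<close> is half of the full double sum minus the
  diagonal, and the full sum factorizes into power sums.\<close>

lemma sum_wquot:
  assumes "k > 0"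
  shows "(\<Sum>b<2 * n. \<Sum>a<b. wquot k a b) = (\<Sum>r<k. pz n (int r) * pz n (int (k - r))) - of_nat k * pz n (int k)"
proof -
  let ?B = "\<Sum>r<k. pz n (int r) * pz n (int (k - r))"
  obtain k' where k': "k = Suc k'" using assms gr0_implies_Suc by blast
  have "(\<Sum>b<2 * n. \<Sum>a<2 * n. wquot k a b)
     = (\<Sum>r\<le>k. \<Sum>b<2 * n. \<Sum>a<2 * n. wp a (int r) * wp b (int k - int r))
       + (\<Sum>r<k - 1. \<Sum>b<2 * n. \<Sum>a<2 * n. wp a (- int (Suc r)) * wp b (int (Suc r) - int k))"
  proof -
    have sw: "(\<Sum>b<2 * n. \<Sum>a<2 * n. \<Sum>r\<in>R. F r a b) = (\<Sum>r\<in>R. \<Sum>b<2 * n. \<Sum>a<2 * n. F r a b)" for R :: "nat set" and F :: "nat \<Rightarrow> nat \<Rightarrow> nat \<Rightarrow> laurent"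
    proof -
      have "(\<Sum>b<2 * n. \<Sum>a<2 * n. \<Sum>r\<in>R. F r a b) = (\<Sum>b<2 * n. \<Sum>r\<in>R. \<Sum>a<2 * n. F r a b)"
        by (intro sum.cong refl sum.swap)
      also have "\<dots> = (\<Sum>r\<in>R. \<Sum>b<2 * n. \<Sum>a<2 * n. F r a b)" by (rule sum.swap)
      finally show ?thesis .
    qed
    show ?thesis unfolding wquot_def sum.distrib sw ..
  qed
  also have "\<dots> = (\<Sum>r\<le>k. pz n (int r) * pz n (int k - int r)) + (\<Sum>r<k - 1. pz n (- int (Suc r)) * pz n (int (Suc r) - int k))"
    by (simp only: sum_wp sum_distrib_left[symmetric] sum_distrib_right[symmetric])
  also have "(\<Sum>r\<le>k. pz n (int r) * pz n (int k - int r)) = ?B + pz n (int k) * pz n 0"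
  proof -
    have "(\<Sum>r<k. pz n (int r) * pz n (int k - int r)) = ?B" by (intro sum.cong refl) (simp add: of_nat_diff)
    then show ?thesis by (simp add: lessThan_Suc_atMost[symmetric])
  qed
  also have "(\<Sum>r<k - 1. pz n (- int (Suc r)) * pz n (int (Suc r) - int k)) = ?B - pz n 0 * pz n (int k)"
  proof -
    have "(\<Sum>r<k - 1. pz n (- int (Suc r)) * pz n (int (Suc r) - int k)) = (\<Sum>r<k'. pz n (int (Suc r)) * pz n (int (k - Suc r)))"
    proof (intro sum.cong)
      fix r assume "r \<in> {..<k'}"
      then have "int (Suc r) - int k = - int (k - Suc r)" by (simp add: k' of_nat_diff)
      then show "pz n (- int (Suc r)) * pz n (int (Suc r) - int k) = pz n (int (Suc r)) * pz n (int (k - Suc r))"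
        by (simp only: pz_even)
    qed (simp add: k')
    moreover have "?B = pz n 0 * pz n (int k) + (\<Sum>r<k'. pz n (int (Suc r)) * pz n (int (k - Suc r)))"
      unfolding k' sum.lessThan_Suc_shift by simp
    ultimately show ?thesis by simp
  qed
  finally have 1: "(\<Sum>b<2 * n. \<Sum>a<2 * n. wquot k a b) = 2 * ?B" by (simp add: algebra_simps)
  have "wquot k a a = of_nat (Suc k) * wp a (int k) + of_nat (k - 1) * wp a (- int k)" for a
  proof -
    have "(\<Sum>r\<le>k. wp a (int r) * wp a (int k - int r)) = (\<Sum>r\<le>k. wp a (int k))"
      unfolding wp_add[symmetric] by simp
    moreover have "(\<Sum>r<k - 1. wp a (- int (Suc r)) * wp a (int (Suc r) - int k)) = (\<Sum>r<k - 1. wp a (- int k))"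
      unfolding wp_add[symmetric] by simp
    ultimately show ?thesis by (simp add: wquot_def)
  qed
  then have "(\<Sum>a<2 * n. wquot k a a) = of_nat (Suc k) * pz n (int k) + of_nat (k - 1) * pz n (int k)"
    by (simp only: sum.distrib sum_distrib_left[symmetric] sum_wp pz_even)
  also have "\<dots> = 2 * (of_nat k * pz n (int k))" by (simp add: k' algebra_simps)
  finally have 2: "(\<Sum>a<2 * n. wquot k a a) = 2 * (of_nat k * pz n (int k))" .
  have 3: "2 * (\<Sum>b<2 * n. \<Sum>a<b. wquot k a b) = 2 * (?B - of_nat k * pz n (int k))"
    using sum_symmetric_square[of "wquot k" "2 * n", OF wquot_symmetric] unfolding 1 2 by (simp add: algebra_simps)
  have "(2 :: laurent) \<noteq> 0" by simp
  from mult_left_cancel[THEN iffD1, OF this 3] show ?thesis .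
qed

definition zquot :: "nat \<Rightarrow> nat \<Rightarrow> laurent" where
  "zquot k i = (\<Sum>r<k. zp i (int k - 2 * int r) + zp i (int k - 2 * int (Suc r)))"

lemma vf_z_minus_inverse:
  assumes "i < n"
  shows "vf n (int k) (zp i 1 - zp i (-1)) = (zp i 1 - zp i (-1)) * zquot k i"
proof -
  let ?v = "\<lambda>r. zp i (int k - 2 * int r)"
  have a: "(zp i 1 - zp i (-1)) * zp i (int k - 1 - 2 * int r) = ?v r - ?v (Suc r)" for r
    unfolding left_diff_distrib zp_add[symmetric] by (simp add: algebra_simps)
  have b: "(zp i 1 + zp i (-1)) * zp i (int k - 1 - 2 * int r) = ?v r + ?v (Suc r)" for r
    unfolding distrib_right zp_add[symmetric] by (simp add: algebra_simps)
  have "(zp i 1 - zp i (-1)) * (\<Sum>r<k. zp i (int k - 1 - 2 * int r)) = ?v 0 - ?v k"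
    unfolding sum_distrib_left a by (rule sum_lessThan_telescope')
  then have s: "(zp i 1 - zp i (-1)) * (\<Sum>r<k. zp i (int k - 1 - 2 * int r)) = zp i (int k) - zp i (- int k)" by simp
  have "(zp i 1 - zp i (-1)) * zquot k i = (zp i 1 - zp i (-1)) * ((zp i 1 + zp i (-1)) * (\<Sum>r<k. zp i (int k - 1 - 2 * int r)))"
    unfolding sum_distrib_left b zquot_def ..
  also have "\<dots> = (zp i (int k) - zp i (- int k)) * (zp i 1 + zp i (-1))"
    unfolding s[symmetric] by (simp only: mult_ac)
  also have "\<dots> = vf n (int k) (zp i 1 - zp i (-1))"
  proof -
    have "vf n (int k) (zp i 1 - zp i (-1)) = (zp i (1 + int k) - zp i (1 - int k)) + (zp i (-1 + int k) - zp i (-1 - int k))"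
      using assms by (simp only: vf_linear vf_zp) simp
    also have "\<dots> = (zp i (int k) - zp i (- int k)) * (zp i 1 + zp i (-1))"
      unfolding left_diff_distrib distrib_left zp_add[symmetric] by (simp add: add.commute)
    finally show ?thesis by simp
  qed
  finally show ?thesis by simp
qed

lemma sum_zquot: "(\<Sum>i<n. zquot k i) = (\<Sum>r<k. pz n (2 * int r - int k))"
proof -
  have "zquot k i = (\<Sum>r<k. zp i (2 * int r - int k) + zp i (- (2 * int r - int k)))" for i
  proof -
    have "(\<Sum>r<k. zp i (int k - 2 * int (Suc r))) = (\<Sum>r<k. zp i (int k - 2 * int (Suc (k - Suc r))))"
      by (rule sum.nat_diff_reindex[symmetric])
    also have "\<dots> = (\<Sum>r<k. zp i (2 * int r - int k))"
      by (intro sum.cong refl arg_cong[of _ _ "zp i"]) (auto simp: of_nat_diff Suc_diff_Suc)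
    finally show ?thesis by (simp add: zquot_def sum.distrib)
  qed
  then show ?thesis unfolding pz_def by (simp only:) (rule sum.swap)
qed

text \<open>The coefficient of \<open>z\<^sup>\<rho> = \<Prod>\<^sub>i z\<^sub>i\<^sup>i\<^sup>+\<^sup>1\<close>, as a constant polynomial in order to be an instance of \<^const>\<open>lfun\<close>.\<close>

definition weyl_point :: "nat \<Rightarrow> laurent \<Rightarrow> ppoly" where
  "weyl_point n = lfun n (\<lambda>i e. if e = int (Suc i) then 1 else 0)"

lemma weyl_point_delta: "weyl_point n (delta n) = 1"
proof -
  have "delta n = dt n (\<lambda>i j. lin cst (zp i) (sng (int (Suc j)) 1 - sng (- int (Suc j)) 1))"
    by (simp only: delta_def lin_diff lin_single scalars_cst cst_simps mult_1)
  then have "weyl_point n (delta n) = dt n (\<lambda>i j. if i = j then 1 else 0)"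
    unfolding weyl_point_def by (simp only: lfun_dt) (rule dt_cong, auto simp: lin_diff lin_single)
  then show ?thesis by (simp add: dt_delta)
qed

lemma delta_nonzero: "delta n \<noteq> 0"
  using weyl_point_delta[of n] by (auto simp: weyl_point_def lfun_linear)

text \<open>Logarithmic differentiation of the square of \<open>delta n\<close>, which is up to sign
  a product of differences of eigenvalues and of the \<open>z_i - 1/z_i\<close>; one factor
  \<open>delta n\<close> is then cancelled.\<close>

lemma vf_delta:
  assumes k: "k > 0"
  shows "2 * vf n (int k) (delta n) = (lpi n (sd_source k) - of_nat k * pz n (int k)) * delta n"
proof -
  let ?P = "\<Prod>i<n. zp i 1 - zp i (-1)" and ?V = "vand (2 * n) (interleave (\<lambda>i. zp i 1) (\<lambda>i. zp i (-1)))"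
  let ?s = "(-1) ^ n :: laurent"
  define L where "L = (\<Sum>i<n. zquot k i) + (\<Sum>b<2 * n. \<Sum>a<b. wquot k a b)"
  have R: "?P * ?V = ?s * (delta n)\<^sup>2"
    unfolding delta_alt by (rule vand_interleave_symplectic) (rule zp_inv)
  have w: "interleave (\<lambda>i. zp i 1) (\<lambda>i. zp i (-1)) = (\<lambda>r. wp r 1)"
    by (auto simp: fun_eq_iff interleave_def wp_def)
  have V: "vf n (int k) ?V = ?V * (\<Sum>b<2 * n. \<Sum>a<b. wquot k a b)"
    unfolding w vand_def by (intro vf_prod_log vf_wp_diff k) auto
  have P: "vf n (int k) ?P = ?P * (\<Sum>i<n. zquot k i)"
    by (intro vf_prod_log vf_z_minus_inverse) auto
  have s: "?s * ?s = 1" by (simp add: power_mult_distrib[symmetric])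
  have cs: "?s = cst ((-1) ^ n)" by (induction n) (simp_all add: cst_mult cst_uminus)
  have "vf n (int k) (?P * ?V) = ?P * ?V * L"
    unfolding vf_mult V P L_def by (simp only: algebra_simps)
  then have "?s * (2 * delta n * vf n (int k) (delta n)) = ?s * (delta n)\<^sup>2 * L"
    unfolding R by (simp add: vf_mult power2_eq_square vf_linear(4)[of n "int k" "(-1) ^ n", folded cs] algebra_simps)
  then have "(?s * ?s) * (2 * delta n * vf n (int k) (delta n)) = (?s * ?s) * ((delta n)\<^sup>2 * L)"
    by (simp only: mult.assoc)
  then have "delta n * (2 * vf n (int k) (delta n)) = delta n * (L * delta n)"
    unfolding s by (simp add: power2_eq_square mult_ac)
  then have *: "2 * vf n (int k) (delta n) = L * delta n" 
    by (rule mult_left_cancel[THEN iffD1, OF delta_nonzero])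
  have "lpi n (sd_source k) = (\<Sum>r<k. pz n (int r) * pz n (int (k - r)) + pz n (2 * int r - int k))"
    unfolding sd_source_def by (simp add: lpi_hom pz_abs)
  also have "\<dots> = L + of_nat k * pz n (int k)"
    by (simp add: L_def sum_wquot[OF k] sum_zquot sum.distrib)
  finally show ?thesis using * by simp
qed

subsection \<open>Laplacian\<close>

definition lap :: "nat \<Rightarrow> laurent \<Rightarrow> laurent" where "lap n f = (\<Sum>i<n. theta i (theta i f))"

definition sqn :: "nat \<Rightarrow> (nat \<Rightarrow>\<^sub>0 int) \<Rightarrow> int" where "sqn n e = (\<Sum>i<n. (lkp e i)\<^sup>2)"

lemma lookup_lap: "lkp (lap n f) e = of_int (sqn n e) * lkp f e"
  by (simp add: lap_def sqn_def lookup_sum lookup_theta sum_distrib_right power2_eq_square mult.assoc)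

lemma lap_linear: "lap n (f + g) = lap n f + lap n g" "lap n (cst c * f) = cst c * lap n f"
  "lap n (\<Sum>x\<in>A. F x) = (\<Sum>x\<in>A. lap n (F x))" "lap n (signof p * f) = signof p * lap n f"
  by (simp_all add: lap_def theta_add theta_cst_times theta_sum theta_signof_times sum.distrib sum_distrib_left sum.swap[of _ A])

definition alt :: "nat \<Rightarrow> (nat \<Rightarrow> int) \<Rightarrow> laurent" where
  "alt n l = dt n (\<lambda>i j. zp i (l j) - zp i (- l j))"

lemma theta_prod_separate:
  assumes "finite A" "i \<in> A" "\<And>j. j \<in> A \<Longrightarrow> j \<noteq> i \<Longrightarrow> theta i (f j) = 0"
  shows "theta i (\<Prod>j\<in>A. f j) = theta i (f i) * (\<Prod>j\<in>A - {i}. f j)"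
proof -
  have "theta i (\<Prod>j\<in>B. f j) = 0" if "finite B" "\<And>j. j \<in> B \<Longrightarrow> theta i (f j) = 0" for B
    using that by (induction B) (simp_all add: theta_mult)
  then have "theta i (\<Prod>j\<in>A - {i}. f j) = 0" using assms by auto
  then show ?thesis using assms(1,2) by (simp add: prod.remove[of A i] theta_mult)
qed

text \<open>Each term of the Leibniz expansion is a product of one-variable eigenvectors of the
  squared Euler operators, and every permutation leads to the same set of eigenvalues.\<close>

lemma lap_alt: "lap n (alt n l) = of_int (\<Sum>j<n. (l j)\<^sup>2) * alt n l"
proof -
  have "lap n (\<Prod>i = 0..<n. zp i (l (p i)) - zp i (- l (p i))) = of_int (\<Sum>j<n. (l j)\<^sup>2) * (\<Prod>i = 0..<n. zp i (l (p i)) - zp i (- l (p i)))"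
    if p: "p permutes {0..<n}" for p
  proof -
    define f where "f i = zp i (l (p i)) - zp i (- l (p i))" for i
    have o: "theta i (f j) = 0" if "j \<noteq> i" for i j using that by (simp add: f_def theta_diff theta_zp)
    have o2: "theta i (theta i (f i)) = of_int ((l (p i))\<^sup>2) * f i" for i
    proof -
      have "theta i (of_int a * g) = of_int a * theta i g" for a g
        using theta_cst_times[of i "of_int a" g] by (simp add: cst_of_int)
      then have "theta i (theta i (zp i a)) = of_int (a\<^sup>2) * zp i a" for a
        by (simp add: theta_zp power2_eq_square mult.assoc)
      then show ?thesis by (simp add: f_def theta_diff right_diff_distrib)
    qed
    have "theta i (theta i (\<Prod>j\<in>{0..<n}. f j)) = of_int ((l (p i))\<^sup>2) * (\<Prod>j\<in>{0..<n}. f j)" if "i < n" for i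
    proof -
      have "theta i (\<Prod>j\<in>{0..<n} - {i}. f j) = 0"
      proof -
        have "theta i (\<Prod>j\<in>B. f j) = 0" if "finite B" "i \<notin> B" for B
          using that by (induction B) (auto simp: theta_mult o)
        then show ?thesis by auto
      qed
      moreover have "theta i (\<Prod>j\<in>{0..<n}. f j) = theta i (f i) * (\<Prod>j\<in>{0..<n} - {i}. f j)"
        using that by (intro theta_prod_separate) (auto simp: o)
      ultimately show ?thesis using that by (simp add: theta_mult o2 prod.remove[of "{0..<n}" i] mult.assoc)
    qed
    then have "lap n (\<Prod>j\<in>{0..<n}. f j) = of_int (\<Sum>i<n. (l (p i))\<^sup>2) * (\<Prod>j\<in>{0..<n}. f j)"
      by (simp add: lap_def sum_distrib_right)
    also have "(\<Sum>i<n. (l (p i))\<^sup>2) = (\<Sum>j<n. (l j)\<^sup>2)"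
      using sum.permute[OF p, of "\<lambda>j. (l j)\<^sup>2"] by (simp add: comp_def lessThan_atLeast0)
    finally show ?thesis unfolding f_def .
  qed
  then show ?thesis
    unfolding alt_def dt_leibniz by (simp add: lap_linear sum_distrib_left mult.left_commute)
qed

lemma delta_eq_alt: "delta n = alt n (\<lambda>j. int (Suc j))" by (simp add: delta_def alt_def)

definition weyl_norm :: "nat \<Rightarrow> int" where "weyl_norm n = (\<Sum>j<n. (int (Suc j))\<^sup>2)"

text \<open>The Schwinger-Dyson expressions with \<open>k = m\<close> and
  \<open>\<partial>_m q\<close> in place of \<open>q\<close>, weighted by \<open>m\<close> and
  summed. In eigenvalue coordinates it is, up to normalization, the radial part of the Laplace
  operator of the group.\<close>

definition casimir :: "nat \<Rightarrow> ppoly \<Rightarrow> ppoly" where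
  "casimir N q = (\<Sum>m\<le>N. of_nat m * (sd_source m * pderiv_var m q
     + (\<Sum>m'\<le>N. of_nat m' * (pvar (m + m') - pvar (nat \<bar>int m - int m'\<bar>)) * pderiv_var m' (pderiv_var m q))))"

lemma theta_lpi:
  assumes "\<forall>m>N. pderiv_var m q = 0" "i < n"
  shows "theta i (lpi n q) = (\<Sum>m\<le>N. lpi n (pderiv_var m q) * (of_nat m * (zp i (int m) - zp i (- int m))))"
  unfolding lpi_def
  by (subst chain_rule[OF scalars_cst theta_add theta_mult theta_cst assms(1)])
    (simp add: theta_pz assms(2))

text \<open>The Laplacian of \<open>f \<Delta>\<close> has three parts. Differentiating
  \<open>f\<close> twice gives the second order terms and extra terms
  \<open>m^2 p_m \<partial>_m f\<close>; the mixed part, evaluated by \<open>vf_delta\<close>,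
  cancels the extra terms; the last part is \<open>weyl_norm n\<close>, since \<open>delta n\<close>
  is an eigenvector.\<close>

lemma lpi_casimir:
  assumes N: "\<forall>m>N. pderiv_var m q = 0"
  shows "lpi n (casimir N q) * delta n = lap n (lpi n q * delta n) - of_int (weyl_norm n) * (lpi n q * delta n)"
proof -
  define d where "d m = lpi n (pderiv_var m q)" for m
  define s where "s i m = zp i (int m) - zp i (- int m)" for i m
  define c where "c i m = zp i (int m) + zp i (- int m)" for i m
  have N2: "\<forall>m'>N. pderiv_var m' (pderiv_var m q) = 0" for m
    using N by (simp add: pderiv_var_commute[of _ m])
  have th: "theta i (lpi n q) = (\<Sum>m\<le>N. d m * (of_nat m * s i m))" if "i < n" for i
    using theta_lpi[OF N that] by (simp add: d_def s_def)
  have ths: "theta i (s i m) = of_nat m * c i m" for i m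
    by (simp add: s_def c_def theta_diff theta_zp algebra_simps)
  have vfd: "vf n (int m) (d m) = lpi n (\<Sum>m'\<le>N. of_nat m' * (pvar (m + m') - pvar (nat \<bar>int m - int m'\<bar>)) * pderiv_var m' (pderiv_var m q))" for m
  proof -
    have ss: "(\<Sum>i<n. s i m * s i m') = pz n (int m + int m') - pz n (int m - int m')" for m'
    proof -
      have "s i m * s i m' = (zp i (int m + int m') + zp i (- (int m + int m'))) - (zp i (int m - int m') + zp i (- (int m - int m')))" for i
      proof -
        have "- (int m + int m') = - int m + - int m'" "int m - int m' = int m + - int m'" "- (int m - int m') = - int m + int m'" by auto
        then show ?thesis by (simp only: s_def zp_add) (simp add: algebra_simps)
      qed
      then show ?thesis by (simp add: pz_def sum_subtractf)
    qed
    have "vf n (int m) (d m) = (\<Sum>i<n. \<Sum>m'\<le>N. lpi n (pderiv_var m' (pderiv_var m q)) * of_nat m' * (s i m * s i m'))"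
      unfolding vf_def d_def by (intro sum.cong refl) (simp add: theta_lpi[OF N2] sum_distrib_left s_def mult_ac)
    also have "\<dots> = (\<Sum>m'\<le>N. lpi n (pderiv_var m' (pderiv_var m q)) * of_nat m' * (\<Sum>i<n. s i m * s i m'))"
      unfolding sum_distrib_left by (rule sum.swap)
    finally show ?thesis unfolding ss by (simp add: lpi_hom pz_abs mult_ac)
  qed
  have lap_q: "(\<Sum>i<n. theta i (theta i (lpi n q))) = (\<Sum>m\<le>N. of_nat m * (vf n (int m) (d m) + of_nat m * pz n (int m) * d m))"
  proof -
    have "(\<Sum>i<n. theta i (theta i (lpi n q))) = (\<Sum>i<n. \<Sum>m\<le>N. of_nat m * (s i m * theta i (d m)) + of_nat m * (of_nat m * (c i m * d m)))"
    proof (rule sum.cong[OF refl])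
      fix i assume "i \<in> {..<n}"
      then show "theta i (theta i (lpi n q)) = (\<Sum>m\<le>N. of_nat m * (s i m * theta i (d m)) + of_nat m * (of_nat m * (c i m * d m)))"
        by (simp add: th theta_sum theta_mult theta_of_nat ths algebra_simps)
    qed
    also have "\<dots> = (\<Sum>m\<le>N. \<Sum>i<n. of_nat m * (s i m * theta i (d m)) + of_nat m * (of_nat m * (c i m * d m)))"
      by (rule sum.swap)
    also have "\<dots> = (\<Sum>m\<le>N. of_nat m * (vf n (int m) (d m) + of_nat m * pz n (int m) * d m))"
      by (simp add: sum.distrib vf_def pz_def s_def c_def sum_distrib_left sum_distrib_right distrib_left mult_ac)
    finally show ?thesis .
  qed
  have cross: "2 * (\<Sum>i<n. theta i (lpi n q) * theta i (delta n)) = (\<Sum>m\<le>N. of_nat m * (d m * (lpi n (sd_source m) - of_nat m * pz n (int m)))) * delta n"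
  proof -
    have "(\<Sum>i<n. theta i (lpi n q) * theta i (delta n)) = (\<Sum>i<n. \<Sum>m\<le>N. of_nat m * (d m * (s i m * theta i (delta n))))"
      by (intro sum.cong refl) (simp add: th sum_distrib_right mult.assoc mult.left_commute)
    also have "\<dots> = (\<Sum>m\<le>N. \<Sum>i<n. of_nat m * (d m * (s i m * theta i (delta n))))" by (rule sum.swap)
    also have "\<dots> = (\<Sum>m\<le>N. of_nat m * (d m * vf n (int m) (delta n)))"
      by (simp add: vf_def s_def sum_distrib_left)
    finally have "2 * (\<Sum>i<n. theta i (lpi n q) * theta i (delta n)) = (\<Sum>m\<le>N. of_nat m * (d m * (2 * vf n (int m) (delta n))))"
      by (simp add: sum_distrib_left mult_ac)
    also have "\<dots> = (\<Sum>m\<le>N. of_nat m * (d m * ((lpi n (sd_source m) - of_nat m * pz n (int m)) * delta n)))"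
    proof (rule sum.cong[OF refl])
      fix m show "of_nat m * (d m * (2 * vf n (int m) (delta n))) = of_nat m * (d m * ((lpi n (sd_source m) - of_nat m * pz n (int m)) * delta n))"
        by (cases "m = 0") (simp_all only: vf_delta neq0_conv of_nat_0 mult_zero_left)
    qed
    finally show ?thesis by (simp add: sum_distrib_right mult.assoc)
  qed
  have "lap n (lpi n q * delta n) = (\<Sum>i<n. theta i (theta i (lpi n q))) * delta n
     + 2 * (\<Sum>i<n. theta i (lpi n q) * theta i (delta n)) + lpi n q * lap n (delta n)"
    by (simp add: lap_def theta_mult theta_add sum.distrib sum_distrib_left sum_distrib_right algebra_simps)
  also have "lap n (delta n) = of_int (weyl_norm n) * delta n"
    unfolding delta_eq_alt lap_alt weyl_norm_def ..
  finally have "lap n (lpi n q * delta n) - of_int (weyl_norm n) * (lpi n q * delta n)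
     = ((\<Sum>m\<le>N. of_nat m * (vf n (int m) (d m) + of_nat m * pz n (int m) * d m))
       + (\<Sum>m\<le>N. of_nat m * (d m * (lpi n (sd_source m) - of_nat m * pz n (int m))))) * delta n"
    unfolding lap_q cross by (simp add: algebra_simps)
  also have "\<dots> = (\<Sum>m\<le>N. of_nat m * (lpi n (sd_source m) * d m + vf n (int m) (d m))) * delta n"
    unfolding sum.distrib[symmetric] by (intro arg_cong2[where f = "(*)"] sum.cong refl) (simp add: algebra_simps)
  also have "(\<Sum>m\<le>N. of_nat m * (lpi n (sd_source m) * d m + vf n (int m) (d m))) = lpi n (casimir N q)"
    unfolding vfd casimir_def by (simp add: lpi_hom d_def)
  finally show ?thesis by simp
qed

lemma integral_casimir:
  fixes M :: "('n::finite cmat) measure"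
  assumes haar: "normalized_haar_Sp M" and N: "\<forall>m>N. pderiv_var m q = 0"
  shows "(\<integral>S. ev_mat S (casimir N q) \<partial>M) = 0"
proof -
  have N2: "\<forall>m'>N. pderiv_var m' (pderiv_var m q) = 0" for m
    using N by (simp add: pderiv_var_commute[of _ m])
  let ?e = "\<lambda>m. sd_source m * pderiv_var m q
     + (\<Sum>m'\<le>N. of_nat m' * (pvar (m + m') - pvar (nat \<bar>int m - int m'\<bar>)) * pderiv_var m' (pderiv_var m q))"
  have "(\<integral>S. ev_mat S (casimir N q) \<partial>M) = (\<integral>S. (\<Sum>m\<le>N. of_nat m * ev_mat S (?e m)) \<partial>M)"
    unfolding casimir_def by (simp only: ev_mat_hom)
  also have "\<dots> = (\<Sum>m\<le>N. of_nat m * (\<integral>S. ev_mat S (?e m) \<partial>M))"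
    using good_integrable[OF haar good_ev_mat] by (subst Bochner_Integration.integral_sum) auto
  also have "\<dots> = 0" by (intro sum.neutral ballI) (simp only: schwinger_dyson[OF haar N2] mult_zero_right)
  finally show ?thesis .
qed

subsection \<open>Alternating Laurent polynomials\<close>

inductive_set altspan :: "nat \<Rightarrow> laurent set" for n where
  base: "alt n l \<in> altspan n"
| add: "f \<in> altspan n \<Longrightarrow> g \<in> altspan n \<Longrightarrow> f + g \<in> altspan n"
| scale: "f \<in> altspan n \<Longrightarrow> cst c * f \<in> altspan n"

lemma altspan_0: "0 \<in> altspan n" using altspan.scale[OF altspan.base, of 0 n] by simp

lemma altspan_sum: "(\<And>x. x \<in> A \<Longrightarrow> f x \<in> altspan n) \<Longrightarrow> (\<Sum>x\<in>A. f x) \<in> altspan n"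
  by (induction A rule: infinite_finite_induct) (simp_all add: altspan_0 altspan.add)

lemma dt_replace_column:
  assumes "j < n"
  shows "dt n (\<lambda>i j'. if j' = j then y i else a i j')
    = (\<Sum>p | p permutes {0..<n}. signof p * (y (inv_into UNIV p j) * (\<Prod>i\<in>{0..<n} - {inv_into UNIV p j}. a i (p i))))"
  unfolding dt_leibniz
proof (rule sum.cong[OF refl])
  fix p assume "p \<in> {p. p permutes {0..<n}}"
  then have p: "p permutes {0..<n}" by simp
  then have i0: "inv_into UNIV p j \<in> {0..<n}" "p (inv_into UNIV p j) = j"
    using assms permutes_in_image[OF permutes_inv[OF p], of j] by (auto simp: permutes_inverses)
  have ne: "p i \<noteq> j" if "i \<noteq> inv_into UNIV p j" for i using that p by (auto simp: permutes_inverses)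
  have "(\<Prod>i = 0..<n. if p i = j then y i else a i (p i)) = y (inv_into UNIV p j) * (\<Prod>i\<in>{0..<n} - {inv_into UNIV p j}. if p i = j then y i else a i (p i))"
    using i0 by (simp add: prod.remove[of "{0..<n}" "inv_into UNIV p j"])
  also have "(\<Prod>i\<in>{0..<n} - {inv_into UNIV p j}. if p i = j then y i else a i (p i)) = (\<Prod>i\<in>{0..<n} - {inv_into UNIV p j}. a i (p i))"
    by (intro prod.cong refl) (simp add: ne)
  finally show "signof p * (\<Prod>i = 0..<n. if p i = j then y i else a i (p i)) = signof p * (y (inv_into UNIV p j) * (\<Prod>i\<in>{0..<n} - {inv_into UNIV p j}. a i (p i)))"
    by simp
qed

text \<open>In the determinant with column \<open>j\<close> scaled, each Leibniz term acquires the
  \<open>y\<close> of the row matched with \<open>j\<close>; summing over \<open>j\<close> runs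
  through all rows once.\<close>

lemma sum_times_dt:
  "(\<Sum>i<n. y i) * dt n a = (\<Sum>j<n. dt n (\<lambda>i j'. if j' = j then y i * a i j else a i j'))"
proof -
  let ?P = "{p. p permutes {0..<n}}"
  have "(\<Sum>j<n. dt n (\<lambda>i j'. if j' = j then y i * a i j else a i j'))
    = (\<Sum>j<n. \<Sum>p\<in>?P. signof p * (y (inv_into UNIV p j) * a (inv_into UNIV p j) j * (\<Prod>i\<in>{0..<n} - {inv_into UNIV p j}. a i (p i))))"
    by (intro sum.cong refl dt_replace_column) simp
  also have "\<dots> = (\<Sum>p\<in>?P. \<Sum>j<n. signof p * (y (inv_into UNIV p j) * a (inv_into UNIV p j) j * (\<Prod>i\<in>{0..<n} - {inv_into UNIV p j}. a i (p i))))"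
    by (rule sum.swap)
  also have "\<dots> = (\<Sum>p\<in>?P. (\<Sum>i<n. y i) * (signof p * (\<Prod>i = 0..<n. a i (p i))))"
  proof (rule sum.cong[OF refl])
    fix p assume "p \<in> ?P"
    then have p: "p permutes {0..<n}" by simp
    have "(\<Sum>j<n. signof p * (y (inv_into UNIV p j) * a (inv_into UNIV p j) j * (\<Prod>i\<in>{0..<n} - {inv_into UNIV p j}. a i (p i))))
      = (\<Sum>j\<in>{0..<n}. y (inv_into UNIV p j) * (signof p * (\<Prod>i = 0..<n. a i (p i))))"
      unfolding lessThan_atLeast0
    proof (rule sum.cong[OF refl])
      fix j assume "j \<in> {0..<n}"
      then have "inv_into UNIV p j \<in> {0..<n}" "p (inv_into UNIV p j) = j"
        using permutes_in_image[OF permutes_inv[OF p], of j] p by (auto simp: permutes_inverses)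
      then show "signof p * (y (inv_into UNIV p j) * a (inv_into UNIV p j) j * (\<Prod>i\<in>{0..<n} - {inv_into UNIV p j}. a i (p i)))
        = y (inv_into UNIV p j) * (signof p * (\<Prod>i = 0..<n. a i (p i)))"
        by (simp add: prod.remove[of "{0..<n}" "inv_into UNIV p j"] mult_ac)
    qed
    also have "\<dots> = (\<Sum>j\<in>{0..<n}. y (inv_into UNIV p j)) * (signof p * (\<Prod>i = 0..<n. a i (p i)))"
      by (simp add: sum_distrib_right)
    also have "(\<Sum>j\<in>{0..<n}. y (inv_into UNIV p j)) = (\<Sum>i<n. y i)"
      using sum.permute[OF permutes_inv[OF p], of y] by (simp add: comp_def lessThan_atLeast0)
    finally show "(\<Sum>j<n. signof p * (y (inv_into UNIV p j) * a (inv_into UNIV p j) j * (\<Prod>i\<in>{0..<n} - {inv_into UNIV p j}. a i (p i))))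
      = (\<Sum>i<n. y i) * (signof p * (\<Prod>i = 0..<n. a i (p i)))" .
  qed
  finally show ?thesis by (simp add: dt_leibniz sum_distrib_left)
qed

lemma pz_times_alt: "pz n m * alt n l = (\<Sum>j<n. alt n (l(j := l j + m)) + alt n (l(j := l j - m)))"
proof -
  have "pz n m * alt n l = (\<Sum>j<n. dt n (\<lambda>i j'. if j' = j then (zp i m + zp i (- m)) * (zp i (l j) - zp i (- l j)) else zp i (l j') - zp i (- l j')))"
    unfolding pz_def alt_def by (rule sum_times_dt)
  also have "\<dots> = (\<Sum>j<n. alt n (l(j := l j + m)) + alt n (l(j := l j - m)))"
  proof (rule sum.cong[OF refl])
    fix j assume j: "j \<in> {..<n}"
    have e: "(zp i m + zp i (- m)) * (zp i (l j) - zp i (- l j))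
      = (zp i (l j + m) - zp i (- (l j + m))) + (zp i (l j - m) - zp i (- (l j - m)))" for i
    proof -
      have "- (l j + m) = - l j + - m" "l j - m = l j + - m" "- (l j - m) = - l j + m" by auto
      then show ?thesis by (simp only: zp_add) (simp add: algebra_simps)
    qed
    have a: "alt n (l(j := x)) = dt n (\<lambda>i j'. if j' = j then zp i x - zp i (- x) else zp i (l j') - zp i (- l j'))" for x
      unfolding alt_def by (rule dt_cong) auto
    show "dt n (\<lambda>i j'. if j' = j then (zp i m + zp i (- m)) * (zp i (l j) - zp i (- l j)) else zp i (l j') - zp i (- l j'))
      = alt n (l(j := l j + m)) + alt n (l(j := l j - m))"
      unfolding a e using j by (simp add: dt_replace_column distrib_left distrib_right sum.distrib)
  qed
  finally show ?thesis .
qed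

lemma pz_times_altspan: "f \<in> altspan n \<Longrightarrow> pz n m * f \<in> altspan n"
proof (induction rule: altspan.induct)
  case (base l) show ?case unfolding pz_times_alt by (intro altspan_sum altspan.add altspan.base)
next
  case (scale f c) then show ?case using altspan.scale[of "pz n m * f" n c] by (simp add: mult.left_commute)
qed (simp add: distrib_left altspan.add)

lemma lpi_times_altspan: "f \<in> altspan n \<Longrightarrow> lpi n q * f \<in> altspan n"
proof (induction q arbitrary: f rule: ppoly_induct)
  case (mult p q) then show ?case by (simp add: lpi_hom mult.assoc)
qed (simp_all add: lpi_hom altspan.scale altspan.add pz_times_altspan distrib_right)

text \<open>The largest of \<open>n\<close> distinct positive integers is at least \<open>n\<close>;
  removing it and comparing with \<open>n^2\<close> gives the induction.\<close>

lemma sum_squares_minimal: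
  fixes A :: "nat set"
  assumes "finite A" "0 \<notin> A" "card A = n" "(\<Sum>a\<in>A. a\<^sup>2) \<le> (\<Sum>j<n. (Suc j)\<^sup>2)"
  shows "A = {1..n}"
  using assms
proof (induction n arbitrary: A)
  case (Suc n)
  have ne: "A \<noteq> {}" using Suc.prems by auto
  define M where "M = Max A"
  have M: "M \<in> A" "\<And>a. a \<in> A \<Longrightarrow> a \<le> M" using Suc.prems(1) ne by (auto simp: M_def)
  have "A \<subseteq> {1..M}" using M(2) Suc.prems(2) by (metis atLeastAtMost_iff less_one not_le subsetI)
  then have Mn: "Suc n \<le> M" using Suc.prems(3) card_mono[of "{1..M}" A] by simp
  have sA: "(\<Sum>a\<in>A. a\<^sup>2) = M\<^sup>2 + (\<Sum>a\<in>A - {M}. a\<^sup>2)" using Suc.prems(1) M(1) by (simp add: sum.remove)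
  have sq: "(Suc n)\<^sup>2 \<le> M\<^sup>2" using Mn by (rule power_mono) simp
  have A': "A - {M} = {1..n}"
  proof (rule Suc.IH)
    have "M\<^sup>2 + (\<Sum>a\<in>A - {M}. a\<^sup>2) \<le> (\<Sum>j<n. (Suc j)\<^sup>2) + (Suc n)\<^sup>2" using Suc.prems(4) unfolding sA by simp
    with sq show "(\<Sum>a\<in>A - {M}. a\<^sup>2) \<le> (\<Sum>j<n. (Suc j)\<^sup>2)" by linarith
  qed (use Suc.prems M in auto)
  have "(\<Sum>a\<in>{1..n}. a\<^sup>2) = (\<Sum>j<n. (Suc j)\<^sup>2)"
    by (simp add: sum.atLeast1_atMost_eq)
  then have "M\<^sup>2 \<le> (Suc n)\<^sup>2" using Suc.prems(4) unfolding sA A' by simp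
  then have "M = Suc n" using Mn by (metis le_antisym power2_nat_le_eq_le)
  moreover have "A = insert M {1..n}" using A' M(1) by auto
  ultimately show ?case by auto
qed simp

text \<open>A zero exponent or two exponents of equal absolute value make the alternant vanish.
  Otherwise the absolute values are distinct positive integers with the least possible sum of
  squares, hence a permutation of \<open>1, ..., n\<close>; it and the signs come out as a
  scalar.\<close>

lemma alt_minimal:
  assumes l: "(\<Sum>j<n. (l j)\<^sup>2) = weyl_norm n"
  shows "\<exists>c. alt n l = cst c * delta n"
proof -
  define b where "b j = nat \<bar>l j\<bar>" for j
  have "alt n l = dt n (\<lambda>i j. cst (of_int (sgn (l j))) * (zp i (int (b j)) - zp i (- int (b j))))"
    unfolding alt_def by (rule dt_cong) (auto simp: b_def sgn_if cst_uminus)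
  then have alt: "alt n l = (\<Prod>j<n. cst (of_int (sgn (l j)))) * alt n (\<lambda>j. int (b j))"
    unfolding alt_def by (simp only: dt_scale_cols)
  have cprod: "(\<Prod>j<m. cst (x j)) = (cst (\<Prod>j<m. x j) :: laurent)" for m :: nat and x
    by (induction m) (simp_all add: cst_mult)
  show ?thesis
  proof (cases "\<exists>j<n. l j = 0")
    case True
    then have "(\<Prod>j<n. cst (of_int (sgn (l j)))) = (0 :: laurent)" by (intro prod_zero) force+
    then show ?thesis using alt by (intro exI[of _ 0]) simp
  next
    case False
    show ?thesis
    proof (cases "inj_on b {0..<n}")
      case True
      let ?A = "b ` {0..<n}"
      have "(\<Sum>j<n. (b j)\<^sup>2) = (\<Sum>j<n. (Suc j)\<^sup>2)"
      proof -
        have "int (\<Sum>j<n. (b j)\<^sup>2) = (\<Sum>j<n. (l j)\<^sup>2)" by (simp add: b_def)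
        also have "\<dots> = int (\<Sum>j<n. (Suc j)\<^sup>2)" using l by (simp add: weyl_norm_def)
        finally show ?thesis by linarith
      qed
      then have "(\<Sum>a\<in>?A. a\<^sup>2) = (\<Sum>j<n. (Suc j)\<^sup>2)"
        using True by (simp add: sum.reindex lessThan_atLeast0)
      then have A: "?A = {1..n}"
        using \<open>\<not> (\<exists>j<n. l j = 0)\<close> card_image[OF True] by (intro sum_squares_minimal) (auto simp: b_def)
      define p where "p j = (if j < n then b j - 1 else j)" for j
      have b: "b j = Suc (p j) \<and> p j < n" if "j < n" for j
      proof -
        have "b j \<in> {1..n}" using that A by auto
        then show ?thesis using that by (auto simp: p_def)
      qed
      have "inj_on p {0..<n}" using True b by (metis (mono_tags, lifting) atLeastLessThan_iff inj_onD inj_onI)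
      moreover have "p ` {0..<n} \<subseteq> {0..<n}" using b by auto
      ultimately have "bij_betw p {0..<n} {0..<n}" using endo_inj_surj[of "{0..<n}" p] by (auto simp: bij_betw_def)
      then have p: "p permutes {0..<n}" by (rule bij_imp_permutes) (auto simp: p_def)
      let ?D = "\<lambda>i j. zp i (int (Suc j)) - zp i (- int (Suc j))"
      have "alt n (\<lambda>j. int (b j)) = dt n (\<lambda>i j. ?D i (p j))"
        unfolding alt_def by (rule dt_cong) (simp add: b)
      also have "\<dots> = dt n (\<lambda>j i. ?D i (p j))" by (rule dt_transpose[symmetric])
      also have "\<dots> = signof p * dt n (\<lambda>j i. ?D i j)" by (rule dt_permute_rows[OF p])
      also have "dt n (\<lambda>j i. ?D i j) = delta n" unfolding delta_def by (rule dt_transpose)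
      also have "signof p = (cst (of_int (sign p)) :: laurent)" by (simp add: cst_of_int)
      finally show ?thesis unfolding alt cprod 
        by (intro exI[of _ "(\<Prod>j<n. of_int (sgn (l j))) * of_int (sign p)"]) (simp only: cst_mult mult.assoc)
    next
      case False
      then obtain i j where "i < n" "j < n" "i \<noteq> j" "b i = b j" by (auto simp: inj_on_def)
      then have "dt n (\<lambda>j i. zp i (int (b j)) - zp i (- int (b j))) = 0" by (intro dt_equal_rows[of i _ j]) auto
      then have "alt n (\<lambda>j. int (b j)) = 0" unfolding alt_def by (subst dt_transpose[symmetric])
      then show ?thesis using alt by (intro exI[of _ 0]) simp
    qed
  qed
qed

definition proj :: "nat \<Rightarrow> laurent \<Rightarrow> laurent" where
  "proj n = lin cst (\<lambda>e. if sqn n e = weyl_norm n then sng e 1 else 0)"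

lemma proj_linear: "proj n (f + g) = proj n f + proj n g" "proj n (cst c * f) = cst c * proj n f"
  by (simp_all add: proj_def lin_add lin_cst_times)

lemma lookup_proj: "lkp (proj n f) e = (if sqn n e = weyl_norm n then lkp f e else 0)"
  by (rule additive_eqI[of "\<lambda>f. lkp (proj n f) e"])
    (auto simp: proj_def lin_single lin_add cst_times_single lookup_single lookup_add when_def)

lemma proj_altspan:
  assumes "f \<in> altspan n"
  shows "\<exists>c. proj n f = cst c * delta n"
  using assms
proof induction
  case (base l)
  have sq: "sqn n e = (\<Sum>j<n. (l j)\<^sup>2)" if "lkp (alt n l) e \<noteq> 0" for e
  proof -
    have "lkp (of_int (\<Sum>j<n. (l j)\<^sup>2) * alt n l) e = of_int (\<Sum>j<n. (l j)\<^sup>2) * lkp (alt n l) e"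
      using lookup_cst_times[of "of_int (\<Sum>j<n. (l j)\<^sup>2)" "alt n l" e] by (simp only: cst_of_int)
    then have "of_int (sqn n e) * lkp (alt n l) e = of_int (\<Sum>j<n. (l j)\<^sup>2) * lkp (alt n l) e"
      using lookup_lap[of n "alt n l" e] by (simp only: lap_alt)
    with that show ?thesis by (metis mult_right_cancel of_int_eq_iff)
  qed
  show ?case
  proof (cases "(\<Sum>j<n. (l j)\<^sup>2) = weyl_norm n")
    case True
    then have "proj n (alt n l) = alt n l" using sq by (intro poly_mapping_eqI) (auto simp: lookup_proj)
    then show ?thesis using alt_minimal[OF True] by simp
  next
    case False
    then have "proj n (alt n l) = 0" using sq by (intro poly_mapping_eqI) (force simp: lookup_proj)
    then show ?thesis by (intro exI[of _ 0]) simp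
  qed
next
  case (add f g)
  then obtain a b where "proj n f = cst a * delta n" "proj n g = cst b * delta n" by blast
  then show ?case by (intro exI[of _ "a + b"]) (simp add: proj_linear cst_add distrib_right)
next
  case (scale f c)
  then obtain a where "proj n f = cst a * delta n" by blast
  then show ?case by (intro exI[of _ "c * a"]) (simp add: proj_linear cst_mult mult.assoc)
qed

lemma weyl_point_proj: "weyl_point n (proj n f) = weyl_point n f"
proof (rule additive_eqI[of "\<lambda>f. weyl_point n (proj n f)"])
  fix e c
  show "weyl_point n (proj n (sng e c)) = weyl_point n (sng e c)"
  proof (cases "sqn n e = weyl_norm n")
    case False
    then obtain i where "i < n" "lkp e i \<noteq> int (Suc i)"
      unfolding sqn_def weyl_norm_def by (metis (no_types, lifting) lessThan_iff sum.cong)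
    then have "(\<Prod>i<n. if lkp e i = int (Suc i) then 1 else (0 :: ppoly)) = 0" by (intro prod_zero) auto
    with False show ?thesis by (simp add: weyl_point_def proj_def lfun_def lin_single)
  qed (simp add: proj_def lin_single cst_times_single)
qed (simp_all add: weyl_point_def lfun_linear proj_linear)

subsection \<open>Integration of trace polynomials\<close>

definition ev_torus :: "nat \<Rightarrow> (nat \<Rightarrow> complex) \<Rightarrow> laurent \<Rightarrow> complex" where
  "ev_torus n z = lin (\<lambda>x. x) (\<lambda>e. \<Prod>i<n. z i powi lkp e i)"

text \<open>Evaluation at the eigenvalues of \<open>S\<close> factors \<open>ev_mat\<close> through
  \<open>lpi\<close>, which transfers identities between Laurent polynomials to the group.\<close>

lemma ev_mat_eq_const:
  fixes S :: "'n::finite cmat"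
  assumes S: "S \<in> compact_Sp" and q: "lpi CARD('n) q = cst c"
  shows "ev_mat S q = c"
proof -
  let ?n = "CARD('n)"
  obtain z where z: "\<And>i. z i \<noteq> 0" "\<And>m. tr_pow S m = (\<Sum>i<?n. z i ^ m + inverse (z i) ^ m)"
    using compact_Sp_eigenvalues[OF S] by blast
  have mult: "ev_torus ?n z (f * g) = ev_torus ?n z f * ev_torus ?n z g" for f g
    unfolding ev_torus_def by (rule lin_mult) (simp_all add: lookup_add power_int_add z prod.distrib)
  have zp: "ev_torus ?n z (zp i k) = z i powi k" if "i < ?n" for i k
  proof -
    have "(\<Prod>j<?n. z j powi lkp (sng i k) j) = (\<Prod>j<?n. if j = i then z i powi k else 1)"
      by (intro prod.cong) (auto simp: lookup_single when_def)
    then show ?thesis using that by (simp add: ev_torus_def zp_def lin_single prod.delta)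
  qed
  have c: "ev_torus ?n z (cst a) = a" for a by (simp add: ev_torus_def cst_def lin_single)
  have pz: "ev_torus ?n z (pz ?n (int m)) = tr_pow S m" for m
  proof -
    have "ev_torus ?n z (pz ?n (int m)) = (\<Sum>i<?n. ev_torus ?n z (zp i (int m)) + ev_torus ?n z (zp i (- int m)))"
      by (simp add: pz_def ev_torus_def lin_sum lin_add)
    then show ?thesis by (simp add: zp z(2) power_int_minus power_inverse)
  qed
  have "ev_mat S q = ev_torus ?n z (lpi ?n q)" for q
    by (induction q rule: ppoly_induct)
      (simp_all add: ev_mat_hom lpi_hom c pz mult, simp add: ev_torus_def lin_add)
  then show ?thesis by (simp add: q c)
qed

lemma integral_ev_mat:
  fixes M :: "('n::finite cmat) measure"
  assumes haar: "normalized_haar_Sp M"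
  shows "(\<integral>S. ev_mat S q \<partial>M) = lkp (weyl_point CARD('n) (lpi CARD('n) q * delta CARD('n))) 0"
proof -
  let ?n = "CARD('n)"
  define F where "F = lpi ?n q * delta ?n"
  \<comment> \<open>The eigenvalue of \<open>lap\<close> minus \<open>weyl_norm\<close> on the
    monomial \<open>z^e\<close>; finitely many values occur on the support of
    \<open>F\<close>.\<close>
  define \<kappa> where "\<kappa> e = (of_int (sqn ?n e - weyl_norm ?n) :: complex)" for e
  define V where "V = \<kappa> ` Poly_Mapping.keys F - {0}"
  have "\<exists>q'. (\<integral>S. ev_mat S q' \<partial>M) = (\<integral>S. ev_mat S q \<partial>M) \<and> (\<forall>e. lkp (lpi ?n q' * delta ?n) e = (\<Prod>v\<in>W. 1 - \<kappa> e / v) * lkp F e)"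
    if "finite W" for W
    using that
  proof (induction W)
    case empty show ?case by (intro exI[of _ q]) (simp add: F_def)
  next
    case (insert v W)
    then obtain q' where q': "(\<integral>S. ev_mat S q' \<partial>M) = (\<integral>S. ev_mat S q \<partial>M)"
      "\<And>e. lkp (lpi ?n q' * delta ?n) e = (\<Prod>v\<in>W. 1 - \<kappa> e / v) * lkp F e" by blast
    obtain N where N: "\<forall>m>N. pderiv_var m q' = 0" using pderiv_var_bound by blast
    \<comment> \<open>The subtraction leaves the integral unchanged and multiplies the coefficient
      at \<open>e\<close> by \<open>1 - \<kappa> e / v\<close>, which is zero where
      \<open>\<kappa> e = v\<close> and one where \<open>\<kappa> e = 0\<close>.\<close>
    let ?q = "q' - cst (1 / v) * casimir N q'"
    have int: "integrable M (\<lambda>S. ev_mat S p)" for p by (rule good_integrable[OF haar good_ev_mat])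
    have "(\<integral>S. ev_mat S ?q \<partial>M) = (\<integral>S. ev_mat S q' \<partial>M) - 1 / v * (\<integral>S. ev_mat S (casimir N q') \<partial>M)"
      unfolding ev_mat_hom using int by simp
    then have 1: "(\<integral>S. ev_mat S ?q \<partial>M) = (\<integral>S. ev_mat S q \<partial>M)"
      by (simp add: q'(1) integral_casimir[OF haar N])
    have "lpi ?n ?q * delta ?n = lpi ?n q' * delta ?n - cst (1 / v) * (lpi ?n (casimir N q') * delta ?n)"
      by (simp add: lpi_hom algebra_simps)
    also have "\<dots> = lpi ?n q' * delta ?n - cst (1 / v) * (lap ?n (lpi ?n q' * delta ?n) - cst (of_int (weyl_norm ?n)) * (lpi ?n q' * delta ?n))"
      unfolding lpi_casimir[OF N] cst_of_int ..
    finally have "lkp (lpi ?n ?q * delta ?n) e = lkp (lpi ?n q' * delta ?n - cst (1 / v) * (lap ?n (lpi ?n q' * delta ?n) - cst (of_int (weyl_norm ?n)) * (lpi ?n q' * delta ?n))) e" for e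
      by (rule arg_cong)
    then have "lkp (lpi ?n ?q * delta ?n) e = (1 - \<kappa> e / v) * lkp (lpi ?n q' * delta ?n) e" for e
      unfolding lookup_minus lookup_cst_times lookup_lap \<kappa>_def by (simp add: diff_divide_distrib left_diff_distrib)
    then have "\<forall>e. lkp (lpi ?n ?q * delta ?n) e = (\<Prod>v\<in>insert v W. 1 - \<kappa> e / v) * lkp F e"
      using insert by (simp add: q'(2) mult.assoc)
    with 1 show ?case by blast
  qed
  moreover have "finite V" by (simp add: V_def)
  ultimately obtain q' where q': "(\<integral>S. ev_mat S q' \<partial>M) = (\<integral>S. ev_mat S q \<partial>M)"
    "\<And>e. lkp (lpi ?n q' * delta ?n) e = (\<Prod>v\<in>V. 1 - \<kappa> e / v) * lkp F e" by blast
  have "lpi ?n q' * delta ?n = proj ?n F"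
  proof (rule poly_mapping_eqI)
    fix e
    show "lkp (lpi ?n q' * delta ?n) e = lkp (proj ?n F) e"
    proof (cases "lkp F e = 0 \<or> \<kappa> e = 0")
      case True
      then show ?thesis unfolding q'(2) lookup_proj by (auto simp: \<kappa>_def)
    next
      case False
      then have "\<kappa> e \<in> V" by (auto simp: V_def in_keys_iff)
      then have "(\<Prod>v\<in>V. 1 - \<kappa> e / v) = 0" using False \<open>finite V\<close> by (intro prod_zero) auto
      with False show ?thesis unfolding q'(2) lookup_proj by (auto simp: \<kappa>_def)
    qed
  qed
  moreover have "F \<in> altspan ?n"
    unfolding F_def delta_eq_alt by (intro lpi_times_altspan altspan.base)
  ultimately obtain c where c: "lpi ?n q' * delta ?n = cst c * delta ?n" "proj ?n F = cst c * delta ?n"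
    using proj_altspan by metis
  \<comment> \<open>Laurent polynomials form a domain, so \<open>delta\<close> cancels and the
    modified integrand is constant on the group.\<close>
  then have "lpi ?n q' = cst c" using delta_nonzero by (metis mult_right_cancel)
  then have "ev_mat S q' = c" if "S \<in> compact_Sp" for S :: "'n cmat" using ev_mat_eq_const[OF that] by blast
  then have "(\<integral>S. ev_mat S q' \<partial>M) = (\<integral>S. c \<partial>M)"
    by (intro Bochner_Integration.integral_cong) (simp_all add: haar_space[OF haar])
  also have "\<dots> = c" by (simp add: haar_total[OF haar])
  finally have "(\<integral>S. ev_mat S q \<partial>M) = c" using q'(1) by simp
  moreover have "weyl_point ?n F = cst c"
  proof -
    have "weyl_point ?n F = weyl_point ?n (cst c * delta ?n)" using weyl_point_proj[of ?n F] c(2) by simp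
    also have "\<dots> = cst c * weyl_point ?n (delta ?n)" unfolding weyl_point_def lfun_linear ..
    finally show ?thesis by (simp add: weyl_point_delta)
  qed
  ultimately show ?thesis by (simp add: F_def[symmetric] cst_def)
qed

subsection \<open>The generating function of the integrals\<close>

lemma monomial_induct [case_names zero step]:
  assumes "P 0" and step: "\<And>\<beta> m. P \<beta> \<Longrightarrow> P (\<beta> + sng m 1)"
  shows "P (\<alpha> :: monomial)"
proof -
  have "\<forall>\<beta>. P \<beta> \<longrightarrow> P (\<beta> + \<alpha>)"
  proof (induction \<alpha> rule: poly_mapping_monomial_induct)
    case (single k c)
    show ?case
    proof (induction c)
      case (Suc c)
      have "\<beta> + sng k (Suc c) = \<beta> + sng k c + sng k 1" for \<beta> :: monomial
        by (simp add: add.assoc single_add[symmetric])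
      with Suc step show ?case by metis
    qed simp
  next
    case (add f g)
    then show ?case by (metis add.assoc)
  qed
  with assms(1) show ?thesis by (metis add_0)
qed

lemma cong_low_trans: "cong_low K f g \<Longrightarrow> cong_low K g h \<Longrightarrow> cong_low K f h"
  unfolding cong_low_def using high_add[of K "f - g" "g - h"] by simp

lemma cong_low_lfun:
  assumes "\<And>i e. i < n \<Longrightarrow> cong_low K (G i e) (G' i e)"
  shows "cong_low K (lfun n G f) (lfun n G' f)"
  unfolding lfun_def lin_def by (intro cong_low_sum cong_low_mult cong_low_prod cong_low_refl assms) simp

lemma high_trunc_row: "int L < a \<Longrightarrow> high L (trunc_row K a)"
  by (simp add: trunc_row_def high_schur_row)

text \<open>A derivative by \<open>p_m\<close> lowers weights by \<open>m\<close>, so the truncation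
  at \<open>K\<close> is respected up to weight \<open>K - m\<close>.\<close>

lemma pderiv_trunc_row:
  assumes "m > 0" "m \<le> K"
  shows "cong_low (K - m) (pderiv_var m (trunc_row K a)) (cst (1 / of_nat m) * trunc_row K (a - int m))"
proof (cases "a \<le> int K")
  case True
  then show ?thesis using assms by (simp add: trunc_row_def pderiv_schur_row)
next
  case False
  then have "high (K - m) (trunc_row K (a - int m))"
    using assms by (intro high_trunc_row) auto
  then have "high (K - m) (- (cst (1 / of_nat m) * trunc_row K (a - int m)))"
    by (intro high_uminus high_mult)
  with False show ?thesis by (simp add: cong_low_def trunc_row_def)
qed

definition inverse_index :: "nat \<Rightarrow> complex" where
  "inverse_index m = (if m = 0 then 0 else 1 / of_nat m)"

text \<open>On the series \<open>H(z) H(1/z)\<close> the derivative by \<open>p_m\<close> is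
  multiplication by \<open>(z^m + z^(-m)) / m\<close>, which shifts the coefficient index both ways.
  Truncation leaves boundary terms with \<open>l > K - m\<close>, all of weight above
  \<open>K - m\<close>.\<close>

lemma pderiv_corr:
  assumes "m \<le> K"
  shows "cong_low (K - m) (pderiv_var m (corr (trunc_row K) K d))
    (cst (inverse_index m) * (corr (trunc_row K) K (d - int m) + corr (trunc_row K) K (d + int m)))"
proof (cases "m = 0")
  case True
  then show ?thesis
    by (simp add: corr_def pderiv_var_sum pderiv_var_mult trunc_row_def pderiv_0_schur_row inverse_index_def)
next
  case False
  let ?h = "trunc_row K" and ?c = "cst (1 / of_nat m) :: ppoly"
  have "pderiv_var m (corr ?h K d) = (\<Sum>l\<in>{0..int K}. pderiv_var m (?h l) * ?h (l + d) + ?h l * pderiv_var m (?h (l + d)))"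
    by (simp add: corr_def pderiv_var_sum pderiv_var_mult)
  also have "cong_low (K - m) \<dots> (\<Sum>l\<in>{0..int K}. (?c * ?h (l - int m)) * ?h (l + d) + ?h l * (?c * ?h (l + d - int m)))"
    using False assms by (intro cong_low_sum cong_low_add cong_low_mult pderiv_trunc_row cong_low_refl) auto
  also have "(\<Sum>l\<in>{0..int K}. (?c * ?h (l - int m)) * ?h (l + d) + ?h l * (?c * ?h (l + d - int m)))
    = ?c * ((\<Sum>l\<in>{0..int K}. ?h (l - int m) * ?h (l + d)) + corr ?h K (d - int m))"
    by (simp add: corr_def sum_distrib_left sum.distrib distrib_left mult.assoc mult.left_commute add_diff_eq)
  finally have 1: "cong_low (K - m) (pderiv_var m (corr ?h K d))
    (?c * ((\<Sum>l\<in>{0..int K}. ?h (l - int m) * ?h (l + d)) + corr ?h K (d - int m)))" .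
  have "(\<Sum>l\<in>{0..int K}. ?h (l - int m) * ?h (l + d)) = (\<Sum>l\<in>{int m..int K}. ?h (l - int m) * ?h (l + d))"
    by (rule sum.mono_neutral_right) (auto simp: trunc_row_def schur_row_neg)
  also have "\<dots> = (\<Sum>l\<in>{0..int K - int m}. ?h l * ?h (l + (d + int m)))"
    by (rule sum.reindex_bij_witness[of _ "\<lambda>l. l + int m" "\<lambda>l. l - int m"]) (auto simp: algebra_simps)
  finally have 2: "(\<Sum>l\<in>{0..int K}. ?h (l - int m) * ?h (l + d)) = (\<Sum>l\<in>{0..int K - int m}. ?h l * ?h (l + (d + int m)))" .
  have "corr ?h K (d + int m) - (\<Sum>l\<in>{0..int K - int m}. ?h l * ?h (l + (d + int m)))
      = (\<Sum>l\<in>{0..int K} - {0..int K - int m}. ?h l * ?h (l + (d + int m)))"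
    unfolding corr_def by (rule sum_diff[symmetric]) auto
  also have "high (K - m) \<dots>"
  proof (intro high_sum high_mult(1) high_trunc_row)
    fix l assume "l \<in> {0..int K} - {0..int K - int m}"
    then show "int (K - m) < l" using of_nat_diff[OF assms, where 'a = int] by auto
  qed
  finally have 3: "cong_low (K - m) (\<Sum>l\<in>{0..int K - int m}. ?h l * ?h (l + (d + int m))) (corr ?h K (d + int m))"
    unfolding cong_low_def[symmetric] by (rule cong_low_sym)
  have "cong_low (K - m) (?c * ((\<Sum>l\<in>{0..int K}. ?h (l - int m) * ?h (l + d)) + corr ?h K (d - int m)))
    (?c * (corr ?h K (d + int m) + corr ?h K (d - int m)))"
    unfolding 2 by (intro cong_low_mult cong_low_add 3 cong_low_refl)
  from cong_low_trans[OF 1 this] show ?thesis using False by (simp add: inverse_index_def add.commute)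
qed

lemma pderiv_lfun:
  assumes g: "\<And>d. cong_low L (pderiv_var m (g d)) (cst c * (g (d - int m) + g (d + int m)))"
  shows "cong_low L (pderiv_var m (lfun n (\<lambda>i e. g (int (Suc i) - e)) f))
    (cst c * lfun n (\<lambda>i e. g (int (Suc i) - e)) (pz n (int m) * f))"
proof (induction f rule: poly_mapping_monomial_induct)
  case (single k a)
  let ?G = "\<lambda>i e. g (int (Suc i) - e)"
  have s: "lfun n ?G (sng e a) = cst a * (\<Prod>i<n. ?G i (lkp e i))" for e
    by (simp add: lfun_def lin_single)
  have z: "lfun n ?G (zp x s * sng k a) = cst a * (?G x (lkp k x + s) * (\<Prod>i\<in>{..<n} - {x}. ?G i (lkp k i)))" if "x < n" for x s
  proof -
    have "(\<Prod>i\<in>{..<n} - {x}. ?G i (lkp (sng x s + k) i)) = (\<Prod>i\<in>{..<n} - {x}. ?G i (lkp k i))"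
      by (intro prod.cong refl) (simp add: lookup_add lookup_single)
    then show ?thesis
      unfolding zp_def mult_single mult_1 s prod.remove[of "{..<n}" x, OF finite_lessThan lessThan_iff[THEN iffD2, OF that]]
      by (simp add: lookup_add add.commute)
  qed
  have 1: "pderiv_var m (lfun n ?G (sng k a)) = (\<Sum>x<n. cst a * (pderiv_var m (?G x (lkp k x)) * (\<Prod>i\<in>{..<n} - {x}. ?G i (lkp k i))))"
    unfolding s pderiv_var_cst_times pderiv_var_prod[OF finite_lessThan] sum_distrib_left ..
  have 2: "cong_low L (\<Sum>x<n. cst a * (pderiv_var m (?G x (lkp k x)) * (\<Prod>i\<in>{..<n} - {x}. ?G i (lkp k i))))
      (\<Sum>x<n. cst a * ((cst c * (g (int (Suc x) - lkp k x - int m) + g (int (Suc x) - lkp k x + int m)))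
      * (\<Prod>i\<in>{..<n} - {x}. ?G i (lkp k i))))"
    by (intro cong_low_sum cong_low_mult g cong_low_refl)
  have 3: "(\<Sum>x<n. cst a * ((cst c * (g (int (Suc x) - lkp k x - int m) + g (int (Suc x) - lkp k x + int m)))
      * (\<Prod>i\<in>{..<n} - {x}. ?G i (lkp k i)))) = cst c * lfun n ?G (pz n (int m) * sng k a)"
  proof -
    have "lfun n ?G (pz n (int m) * sng k a) = (\<Sum>x<n. lfun n ?G (zp x (int m) * sng k a) + lfun n ?G (zp x (- int m) * sng k a))"
      by (simp only: pz_def sum_distrib_right distrib_right lfun_linear)
    also have "\<dots> = (\<Sum>x<n. cst a * ((g (int (Suc x) - lkp k x - int m) + g (int (Suc x) - lkp k x + int m)) * (\<Prod>i\<in>{..<n} - {x}. ?G i (lkp k i))))"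
    proof (intro sum.cong refl)
      fix x assume "x \<in> {..<n}"
      then have x: "x < n" by simp
      show "lfun n ?G (zp x (int m) * sng k a) + lfun n ?G (zp x (- int m) * sng k a)
        = cst a * ((g (int (Suc x) - lkp k x - int m) + g (int (Suc x) - lkp k x + int m)) * (\<Prod>i\<in>{..<n} - {x}. ?G i (lkp k i)))"
        unfolding z[OF x] by (simp add: algebra_simps)
    qed
    finally show ?thesis by (simp add: sum_distrib_left mult.left_commute mult.assoc)
  qed
  show ?case using 2 unfolding 1 3 .
next
  case (add f f')
  then show ?case by (simp add: lfun_linear pderiv_var_add distrib_left cong_low_add)
qed

lemma corr_trunc_row_low: "cong_low 0 (corr (trunc_row K) K d) (if d = 0 then 1 else 0)"
proof -
  have hi: "high 0 (trunc_row K a)" if "a \<noteq> 0" for a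
    using that by (cases "a < 0") (auto simp: trunc_row_def schur_row_neg high_schur_row)
  have 0: "trunc_row K 0 = 1" by (simp add: trunc_row_def)
  have "corr (trunc_row K) K d = trunc_row K d + (\<Sum>l\<in>{0..int K} - {0}. trunc_row K l * trunc_row K (l + d))"
    by (simp add: corr_def sum.remove[of "{0..int K}" 0] 0)
  moreover have "high 0 (\<Sum>l\<in>{0..int K} - {0}. trunc_row K l * trunc_row K (l + d))"
    by (intro high_sum high_mult(1) hi) auto
  ultimately show ?thesis using hi[of d] 0 by (auto simp: cong_low_def high_add)
qed

lemma exp_linear_superset:
  assumes "finite A" "Poly_Mapping.keys \<alpha> \<subseteq> A"
  shows "exp_linear a \<alpha> = (\<Prod>m\<in>A. a m ^ lkp \<alpha> m / fact (lkp \<alpha> m))"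
  unfolding exp_linear_def using assms by (intro prod.mono_neutral_left) (auto simp: in_keys_iff)

lemma exp_linear_step:
  "of_nat (Suc (lkp \<beta> m)) * exp_linear a (\<beta> + sng m 1) = a m * exp_linear a \<beta>"
proof -
  let ?A = "insert m (Poly_Mapping.keys \<beta>)" and ?f = "\<lambda>\<alpha> i. a i ^ lkp \<alpha> i / fact (lkp \<alpha> i)"
  have 1: "exp_linear a \<alpha> = ?f \<alpha> m * (\<Prod>i\<in>?A - {m}. ?f \<alpha> i)" if "Poly_Mapping.keys \<alpha> \<subseteq> ?A" for \<alpha>
    using exp_linear_superset[OF _ that] by (simp add: prod.remove[of ?A m])
  have "Poly_Mapping.keys (\<beta> + sng m 1) \<subseteq> ?A" by (auto simp: in_keys_iff lookup_add lookup_single when_def split: if_splits)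
  from 1[OF this] have "exp_linear a (\<beta> + sng m 1) = ?f (\<beta> + sng m 1) m * (\<Prod>i\<in>?A - {m}. ?f (\<beta> + sng m 1) i)" .
  also have "(\<Prod>i\<in>?A - {m}. ?f (\<beta> + sng m 1) i) = (\<Prod>i\<in>?A - {m}. ?f \<beta> i)"
    by (intro prod.cong refl) (auto simp: lookup_add lookup_single)
  also have "?f (\<beta> + sng m 1) m = a m * ?f \<beta> m / of_nat (Suc (lkp \<beta> m))"
    by (simp add: lookup_add field_simps)
  finally have "of_nat (Suc (lkp \<beta> m)) * exp_linear a (\<beta> + sng m 1) = a m * (?f \<beta> m * (\<Prod>i\<in>?A - {m}. ?f \<beta> i))"
    by (simp del: of_nat_Suc)
  then show ?thesis by (simp only: 1[OF subset_insertI])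
qed

text \<open>The polynomial whose value at the power traces is the coefficient of the integrand at
  \<alpha>; the index \<alpha> of a coefficient in \<open>p\<close> serves as a monomial in the
  traces.\<close>

definition exp_term :: "monomial \<Rightarrow> ppoly" where "exp_term \<alpha> = sng \<alpha> (exp_linear inverse_index \<alpha>)"

lemma ev_mat_exp_term:
  "ev_mat S (exp_term \<alpha>) = exp_linear (\<lambda>m. if m = 0 then 0 else Determinants.trace (matrix_power S m) / of_nat m) \<alpha>"
  unfolding exp_term_def ev_mat_hom exp_linear_def mev_def prod.distrib[symmetric]
  by (intro prod.cong refl) (auto simp: inverse_index_def tr_pow_def power_divide in_keys_iff)

lemma lpi_exp_term_step:
  "of_nat (Suc (lkp \<beta> m)) * lpi n (exp_term (\<beta> + sng m 1)) = cst (inverse_index m) * (lpi n (exp_term \<beta>) * pz n (int m))"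
  unfolding exp_term_def lpi_hom mev_add mev_single cst_of_nat[symmetric] mult.assoc[symmetric]
    cst_mult[symmetric] exp_linear_step by simp

text \<open>Both sides obey the same recursion in \<alpha>: differentiation by \<open>p_m\<close> on
  the right and the next factor of the exponential on the left both multiply \<open>f\<close> by
  \<open>pz n m\<close>, which is why \<open>f\<close> is arbitrary. At \<open>\<alpha> = 0\<close>
  the functional reduces to the coefficient of \<open>z^\<rho>\<close>. The precision lost to a
  derivative is covered by the smaller weight of \<beta>.\<close>

lemma weyl_point_exp_term:
  assumes "wt \<alpha> \<le> K"
  shows "lkp (weyl_point n (lpi n (exp_term \<alpha>) * f)) 0
    = lkp (lfun n (\<lambda>i e. corr (trunc_row K) K (int (Suc i) - e)) f) \<alpha>"
  using assms
proof (induction \<alpha> arbitrary: f rule: monomial_induct)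
  case zero
  have "exp_term 0 = 1" by (simp add: exp_term_def exp_linear_def)
  moreover have "cong_low 0 (lfun n (\<lambda>i e. corr (trunc_row K) K (int (Suc i) - e)) f) (weyl_point n f)"
    unfolding weyl_point_def
  proof (rule cong_low_lfun)
    show "cong_low 0 (corr (trunc_row K) K (int (Suc i) - e)) (if e = int (Suc i) then 1 else 0)" for i e
      using corr_trunc_row_low[of K "int (Suc i) - e"] by (auto simp del: of_nat_Suc)
  qed
  ultimately show ?case using cong_low_lookup[of 0 _ _ 0] by (simp add: lpi_hom)
next
  case (step \<beta> m)
  let ?L = "lfun n (\<lambda>i e. corr (trunc_row K) K (int (Suc i) - e))" and ?k = "of_nat (Suc (lkp \<beta> m)) :: complex"
  have mK: "m \<le> K" "wt \<beta> \<le> K - m" "wt \<beta> \<le> K" using step.prems by (auto simp: wt_add wt_single)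
  have "?k * lkp (?L f) (\<beta> + sng m 1) = lkp (pderiv_var m (?L f)) \<beta>" by (rule lookup_pderiv_var[symmetric])
  also have "\<dots> = lkp (cst (inverse_index m) * ?L (pz n (int m) * f)) \<beta>"
    by (rule cong_low_lookup[OF pderiv_lfun[OF pderiv_corr[OF mK(1)]] mK(2)])
  also have "\<dots> = inverse_index m * lkp (weyl_point n (lpi n (exp_term \<beta>) * (pz n (int m) * f))) 0"
    by (simp add: lookup_cst_times step.IH[OF mK(3)])
  also have "\<dots> = lkp (weyl_point n ((of_nat (Suc (lkp \<beta> m)) * lpi n (exp_term (\<beta> + sng m 1))) * f)) 0"
    unfolding lpi_exp_term_step by (simp add: mult.assoc weyl_point_def lfun_linear lookup_cst_times)
  also have "\<dots> = ?k * lkp (weyl_point n (lpi n (exp_term (\<beta> + sng m 1)) * f)) 0"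
    unfolding cst_of_nat[symmetric] by (simp only: mult.assoc weyl_point_def lfun_linear lookup_cst_times)
  finally show ?case by (simp del: of_nat_Suc)
qed

lemma I_Sp_eq_symp_coeff:
  fixes M :: "('n::finite cmat) measure"
  assumes "normalized_haar_Sp M"
  shows "I_Sp M \<alpha> = symp_coeff CARD('n) \<alpha>"
proof -
  let ?n = "CARD('n)" and ?g = "corr (trunc_row (wt \<alpha>)) (wt \<alpha>)"
  have "I_Sp M \<alpha> = (\<integral>S. ev_mat S (exp_term \<alpha>) \<partial>M)" by (simp add: I_Sp_def ev_mat_exp_term)
  also have "\<dots> = lkp (lfun ?n (\<lambda>i e. ?g (int (Suc i) - e)) (delta ?n)) \<alpha>"
    unfolding integral_ev_mat[OF assms] by (rule weyl_point_exp_term) simp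
  also have "delta ?n = dt ?n (\<lambda>i j. lin cst (zp i) (sng (int (Suc j)) 1 - sng (- int (Suc j)) 1))"
    by (simp only: delta_def lin_diff lin_single scalars_cst cst_simps mult_1)
  also have "lfun ?n (\<lambda>i e. ?g (int (Suc i) - e)) \<dots> = toeplitz_hankel ?n ?g"
    unfolding lfun_dt toeplitz_hankel_def by (rule dt_cong) (simp add: lin_diff lin_single add_ac)
  finally show ?thesis by (simp add: symp_coeff_def)
qed

theorem proposition1:
  fixes M :: "(complex^('n::finite + 'n)^('n + 'n)) measure"
  assumes "normalized_haar_Sp M"
  shows "coeff_summable (\<lambda>l. schur (double_parts l)) {l. int_partition l \<and> length l \<le> CARD('n)}
       \<and> coeff_summable (\<lambda>l. (orth_char l)\<^sup>2) {l. int_partition l \<and> length l \<le> CARD('n)}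
       \<and> coeff_summable (\<lambda>l. (psubst (\<lambda>m. - pvar m) (symp_char l))\<^sup>2) {l. int_partition l \<and> first_part l \<le> CARD('n)}
       \<and> I_Sp M = coeff_sum (\<lambda>l. schur (double_parts l)) {l. int_partition l \<and> length l \<le> CARD('n)}
       \<and> I_Sp M = (\<lambda>\<alpha>. (1 / 2 ^ CARD('n)) *
           coeff_sum (\<lambda>l. (orth_char l)\<^sup>2) {l. int_partition l \<and> length l \<le> CARD('n)} \<alpha>)
       \<and> I_Sp M = (\<lambda>\<alpha>. (1 / 2 ^ CARD('n)) *
           coeff_sum (\<lambda>l. (psubst (\<lambda>m. - pvar m) (symp_char l))\<^sup>2) {l. int_partition l \<and> first_part l \<le> CARD('n)} \<alpha>)"
proof -
  have I: "I_Sp M \<alpha> = symp_coeff CARD('n) \<alpha>" for \<alpha> by (rule I_Sp_eq_symp_coeff[OF assms])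
  have n: "CARD('n) > 0" by simp
  show ?thesis
    using schur_double_sum[OF n] orth_char_square_sum[OF n] symp_char_square_sum[OF n]
    by (simp add: fun_eq_iff I)
qed

end
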